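(* The scaled discrete bilinear forms $a_h$ satisfy, for all $v_h,w_h\in V_h$, both $$|a(v_h,w_h)-a_h(v_h,w_h)|\lesssim h\,\|\nabla k\|_\infty\|\nabla v_h\|_0\|\nabla w_h\|_0 \tag{A2}$$ and $$|a(v_h,w_h)-a_h(v_h,w_h)|\lesssim h^2\|Hk\|_\infty\|\nabla v_h\|_0\|\nabla w_h\|_0+h\|\nabla k\|_\infty\|\nabla v_h\|_{0;S_h}\|\nabla w_h\|_{0;S_h}. \tag{A3}$$
   Context: Setting. $\Omega\subset\mathbb{R}^d$, $d\in\{2,3\}$, is a bounded polygonal/polyhedral domain; $\|\cdot\|_0$ is the norm of $L^2(\Omega)$. $\mathcal{T}_H$ ($H>0$ fixed) is a (possibly unstructured) conforming simplicial triangulation of $\Omega$, the macro triangulation, with elements $T$. The meshes $\mathcal{T}_h$, $h\in\{H/2,H/4,\dots\}$, are obtained from $\mathcal{T}_H$ by successive uniform refinement: $\mathcal{T}_{h/2}$ arises from $\mathcal{T}_h$ by decomposing each simplex into $2^d$ sub-simplices. For $d=2$ this is done by joining edge midpoints. For $d=3$ Bey's rule is used: an ordered tetrahedron $[x_1,x_2,x_3,x_4]$ with midpoints $x_{ij}=\frac12(x_i+x_j)$ is split into the ordered tetrahedra $[x_1,x_{12},x_{13},x_{14}]$, $[x_{12},x_2,x_{23},x_{24}]$, $[x_{13},x_{23},x_3,x_{34}]$, $[x_{14},x_{24},x_{34},x_4]$, $[x_{12},x_{13},x_{14},x_{24}]$, $[x_{12},x_{13},x_{23},x_{24}]$, $[x_{13},x_{14},x_{24},x_{34}]$,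 $[x_{13},x_{23},x_{24},x_{34}]$. $V_h\subset H^1(\Omega)$ is the space of continuous piecewise linear functions on $\mathcal{T}_h$ (no boundary conditions imposed), with nodal basis functions $\phi_i$ associated with the mesh nodes $x_i$. The coefficient $k$ is scalar and uniformly positive on $\Omega$, with $k|_T\in W^{2,\infty}(T)$ for each $T\in\mathcal{T}_H$ (jumps across macro-element boundaries are allowed; $k|_T$ is extended continuously to $\overline T$). The exact bilinear form is $a(v,w)=\int_\Omega k\,\nabla v\cdot\nabla w\,dx$. For $v_h=\sum_i\nu_i\phi_i$, $w_h=\sum_j\chi_j\phi_j$ in $V_h$, the scaled discrete bilinear form is $$a_h(v_h,w_h)=\frac14\sum_{T\in\mathcal{T}_H}\sum_{i,j}\big(k|_T(x_i)+k|_T(x_j)\big)(\nu_i-\nu_j)(\chi_j-\chi_i)\int_T\nabla\phi_i\cdot\nabla\phi_j\,dx,$$ the inner sum being over all pairs of mesh nodes (only nodes in $\overline T$ contribute). Notation. $Hk$ is the Hessian of $k$ ($Hk$ and $\nabla k$ are taken element-wise on the macro elements); $\|\cdot\|_\infty=\sup_{T\in\mathcal{T}_H}\|\cdot\|_{L^\infty(T)}$ is the broken $L^\infty$-norm. $S_h=\bigcup_{T\in\mathcal{T}_H}S_h(T)$ with $S_h(T)=\{t\in\mathcal{T}_h:\partial t\cap\partial T\neq\emptyset\}$, and $\|\cdot\|_{0;S_h}$ is the $L^2$-norm restricted to (the union of the elements in) $S_h$. $A\lesssim B$ means $A\le CB$ with a constant $C<\infty$ independent of the mesh size $h$ and of $v_h,w_h$;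 $C$ may depend on $\Omega$, on the macro triangulation, and on the global contrast $\sup_\Omega k/\inf_\Omega k$. *)

theory Defs
  imports "HOL-Analysis.Analysis" "HOL-Probability.Essential_Supremum"
begin

section \<open>Weak derivatives, Lebesgue norms and the Sobolev space of order 2 and exponent infinity\<close>

primrec Ck :: "nat \<Rightarrow> (real^'d \<Rightarrow> real) \<Rightarrow> bool" where
  "Ck 0 f \<longleftrightarrow> continuous_on UNIV f"
| "Ck (Suc m) f \<longleftrightarrow>
     f differentiable_on UNIV \<and> (\<forall>i. Ck m (\<lambda>x. frechet_derivative f (at x) (axis i 1)))"

definition test_function :: "(real^'d) set \<Rightarrow> (real^'d \<Rightarrow> real) \<Rightarrow> bool" where
  "test_function U \<psi> \<longleftrightarrow>
     (\<forall>m. Ck m \<psi>) \<and> compact (closure {x. \<psi> x \<noteq> 0}) \<and> closure {x. \<psi> x \<noteq> 0} \<subseteq> U"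

definition locally_integrable_on :: "(real^'d \<Rightarrow> real) \<Rightarrow> (real^'d) set \<Rightarrow> bool" where
  "locally_integrable_on f U \<longleftrightarrow> (\<forall>K. compact K \<and> K \<subseteq> U \<longrightarrow> set_integrable lebesgue K f)"

definition has_weak_partial ::
    "(real^'d) set \<Rightarrow> 'd \<Rightarrow> (real^'d \<Rightarrow> real) \<Rightarrow> (real^'d \<Rightarrow> real) \<Rightarrow> bool" where
  "has_weak_partial U i u g \<longleftrightarrow>
     locally_integrable_on u U \<and> locally_integrable_on g U \<and>
     (\<forall>\<psi>. test_function U \<psi> \<longrightarrow>
        (LINT x:U|lebesgue. u x * frechet_derivative \<psi> (at x) (axis i 1))
          = - (LINT x:U|lebesgue. g x * \<psi> x))"

text \<open>For open \<open>U\<close> the weak derivatives are determined almost everywhere on \<open>U\<close>; every use below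
  depends only on the class modulo null sets.\<close>

definition weak_partial :: "(real^'d) set \<Rightarrow> 'd \<Rightarrow> (real^'d \<Rightarrow> real) \<Rightarrow> (real^'d \<Rightarrow> real)" where
  "weak_partial U i u = (SOME g. has_weak_partial U i u g)"

definition weak_grad :: "(real^'d) set \<Rightarrow> (real^'d \<Rightarrow> real) \<Rightarrow> (real^'d \<Rightarrow> real^'d)" where
  "weak_grad U u x = (\<chi> i. weak_partial U i u x)"

definition weak_hess :: "(real^'d) set \<Rightarrow> (real^'d \<Rightarrow> real) \<Rightarrow> (real^'d \<Rightarrow> real^'d^'d)" where
  "weak_hess U u x = (\<chi> i j. weak_partial U i (weak_partial U j u) x)"

definition in_Linf :: "(real^'d) set \<Rightarrow> (real^'d \<Rightarrow> 'b::euclidean_space) \<Rightarrow> bool" where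
  "in_Linf U f \<longleftrightarrow>
     f \<in> borel_measurable (lebesgue_on U) \<and>
     esssup (lebesgue_on U) (\<lambda>x. ereal (norm (f x))) < \<infinity>"

definition Linf_norm :: "(real^'d) set \<Rightarrow> (real^'d \<Rightarrow> 'b::euclidean_space) \<Rightarrow> real" where
  "Linf_norm U f = real_of_ereal (esssup (lebesgue_on U) (\<lambda>x. ereal (norm (f x))))"

definition L2_norm_on :: "(real^'d) set \<Rightarrow> (real^'d \<Rightarrow> 'b::euclidean_space) \<Rightarrow> real" where
  "L2_norm_on U f = sqrt (LINT x:U|lebesgue. (norm (f x))\<^sup>2)"

definition in_W2inf :: "(real^'d) set \<Rightarrow> (real^'d \<Rightarrow> real) \<Rightarrow> bool" where
  "in_W2inf U u \<longleftrightarrow>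
     in_Linf U u \<and>
     (\<forall>i. \<exists>g. has_weak_partial U i u g \<and> in_Linf U g \<and>
        (\<forall>j. \<exists>g'. has_weak_partial U j g g' \<and> in_Linf U g'))"


section \<open>Polyhedral domains, macro triangulations and uniform refinement\<close>

text \<open>Requiring the domain to be the interior of a finite union of polytopes excludes slits and other
  removed sets of empty interior, so that the domain is recovered from its closure.\<close>

definition polyhedral_domain :: "(real^'d) set \<Rightarrow> bool" where
  "polyhedral_domain \<Omega> \<longleftrightarrow>
     \<Omega> \<noteq> {} \<and> open \<Omega> \<and> connected \<Omega> \<and> bounded \<Omega> \<and>
     (\<exists>F. finite F \<and> (\<forall>P\<in>F. polytope P) \<and> \<Omega> = interior (\<Union>F))"

definition conforming_triangulation :: "(real^'d) set set \<Rightarrow> (real^'d) set \<Rightarrow> bool" where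
  "conforming_triangulation \<T> \<Omega> \<longleftrightarrow>
     triangulation \<T> \<and> (\<forall>T\<in>\<T>. int CARD('d) simplex T) \<and> \<Union>\<T> = closure \<Omega>"

definition vertex_ordering :: "(real^'d) set \<Rightarrow> (real^'d) list \<Rightarrow> bool" where
  "vertex_ordering T xs \<longleftrightarrow> distinct xs \<and> set xs = {x. x extreme_point_of T}"

text \<open>Lists of three points are triangles, lists of four points are ordered tetrahedra (Bey's rule).
  For triangles the resulting subdivision does not depend on the order.\<close>

fun refine :: "(real^'d) list \<Rightarrow> (real^'d) list list" where
  "refine [x1, x2, x3] =
     (let x12 = midpoint x1 x2; x13 = midpoint x1 x3; x23 = midpoint x2 x3
      in [[x1, x12, x13], [x12, x2, x23], [x13, x23, x3], [x12, x13, x23]])"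
| "refine [x1, x2, x3, x4] =
     (let x12 = midpoint x1 x2; x13 = midpoint x1 x3; x14 = midpoint x1 x4;
          x23 = midpoint x2 x3; x24 = midpoint x2 x4; x34 = midpoint x3 x4
      in [[x1, x12, x13, x14], [x12, x2, x23, x24], [x13, x23, x3, x34], [x14, x24, x34, x4],
          [x12, x13, x14, x24], [x12, x13, x23, x24], [x13, x14, x24, x34], [x13, x23, x24, x34]])"
| "refine _ = []"

definition refined_mesh ::
    "(real^'d) set set \<Rightarrow> ((real^'d) set \<Rightarrow> (real^'d) list) \<Rightarrow> nat \<Rightarrow> (real^'d) list set" where
  "refined_mesh \<T> vord n = ((\<lambda>M. \<Union>xs\<in>M. set (refine xs)) ^^ n) (vord ` \<T>)"

definition elements :: "(real^'d) list set \<Rightarrow> (real^'d) set set" where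
  "elements M = (\<lambda>xs. convex hull (set xs)) ` M"

definition nodes :: "(real^'d) list set \<Rightarrow> (real^'d) set" where
  "nodes M = (\<Union>xs\<in>M. set xs)"

definition boundary_layer :: "(real^'d) set set \<Rightarrow> (real^'d) list set \<Rightarrow> (real^'d) set" where
  "boundary_layer \<T> M =
     \<Union> (\<Union>T\<in>\<T>. {t \<in> elements M. frontier t \<inter> frontier T \<noteq> {}})"


section \<open>The finite element space and the bilinear forms\<close>

text \<open>Functions on the closed domain are represented by total functions; their values elsewhere
  are irrelevant.\<close>

definition fe_space :: "(real^'d) set \<Rightarrow> (real^'d) list set \<Rightarrow> (real^'d \<Rightarrow> real) set" where
  "fe_space \<Omega> M =
     {v. continuous_on (closure \<Omega>) v \<and> (\<forall>t\<in>elements M. \<exists>g c. \<forall>x\<in>t. v x = g \<bullet> x + c)}"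

definition nodal_basis :: "(real^'d) set \<Rightarrow> (real^'d) list set \<Rightarrow> real^'d \<Rightarrow> (real^'d \<Rightarrow> real)" where
  "nodal_basis \<Omega> M p =
     (SOME \<phi>. \<phi> \<in> fe_space \<Omega> M \<and> (\<forall>q\<in>nodes M. \<phi> q = (if q = p then 1 else 0)))"

definition ess_sup :: "(real^'d) set \<Rightarrow> (real^'d \<Rightarrow> real) \<Rightarrow> real" where
  "ess_sup U f = real_of_ereal (esssup (lebesgue_on U) (\<lambda>x. ereal (f x)))"

definition ess_inf :: "(real^'d) set \<Rightarrow> (real^'d \<Rightarrow> real) \<Rightarrow> real" where
  "ess_inf U f = - ess_sup U (\<lambda>x. - f x)"

definition contrast :: "(real^'d) set \<Rightarrow> (real^'d \<Rightarrow> real) \<Rightarrow> real" where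
  "contrast \<Omega> k = ess_sup \<Omega> k / ess_inf \<Omega> k"

definition admissible_coefficient ::
    "(real^'d) set \<Rightarrow> (real^'d) set set \<Rightarrow> (real^'d \<Rightarrow> real) \<Rightarrow> bool" where
  "admissible_coefficient \<Omega> \<T> k \<longleftrightarrow>
     (\<exists>c>0. AE x in lebesgue_on \<Omega>. c \<le> k x) \<and> (\<forall>T\<in>\<T>. in_W2inf (interior T) k)"

text \<open>The continuous representative of \<open>k\<close> on the closed macro element \<open>T\<close>.\<close>

definition cont_ext :: "(real^'d \<Rightarrow> real) \<Rightarrow> (real^'d) set \<Rightarrow> (real^'d \<Rightarrow> real)" where
  "cont_ext k T = (SOME g. continuous_on T g \<and> (AE x in lebesgue_on (interior T). g x = k x))"

definition broken_grad_norm :: "(real^'d) set set \<Rightarrow> (real^'d \<Rightarrow> real) \<Rightarrow> real" where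
  "broken_grad_norm \<T> k = (SUP T\<in>\<T>. Linf_norm (interior T) (weak_grad (interior T) k))"

definition broken_hess_norm :: "(real^'d) set set \<Rightarrow> (real^'d \<Rightarrow> real) \<Rightarrow> real" where
  "broken_hess_norm \<T> k = (SUP T\<in>\<T>. Linf_norm (interior T) (weak_hess (interior T) k))"

definition bilin_a ::
    "(real^'d) set \<Rightarrow> (real^'d \<Rightarrow> real) \<Rightarrow> (real^'d \<Rightarrow> real) \<Rightarrow> (real^'d \<Rightarrow> real) \<Rightarrow> real" where
  "bilin_a \<Omega> k v w = (LINT x:\<Omega>|lebesgue. k x * (weak_grad \<Omega> v x \<bullet> weak_grad \<Omega> w x))"

text \<open>The coefficients of \<open>v\<close> and \<open>w\<close> in the nodal basis are their nodal values. For a node outside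
  \<open>T\<close> the number \<open>cont_ext k T i\<close> is meaningless, but it is multiplied by a vanishing integral.\<close>

definition bilin_ah ::
    "(real^'d) set \<Rightarrow> (real^'d) set set \<Rightarrow> (real^'d) list set \<Rightarrow> (real^'d \<Rightarrow> real) \<Rightarrow>
     (real^'d \<Rightarrow> real) \<Rightarrow> (real^'d \<Rightarrow> real) \<Rightarrow> real" where
  "bilin_ah \<Omega> \<T> M k v w =
     1/4 * (\<Sum>T\<in>\<T>. \<Sum>i\<in>nodes M. \<Sum>j\<in>nodes M.
       (cont_ext k T i + cont_ext k T j) * (v i - v j) * (w j - w i) *
       (LINT x:T|lebesgue.
          weak_grad \<Omega> (nodal_basis \<Omega> M i) x \<bullet> weak_grad \<Omega> (nodal_basis \<Omega> M j) x))"

end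

theory Submission
  imports Defs "HOL-Computational_Algebra.Polynomial"
begin

text \<open>On every macro element the ordered simplices produced by Bey's rule form the
  Freudenthal--Kuhn triangulation of a lattice: in the basis of consecutive edge vectors of the macro
  simplex each descendant is a lattice path visiting the (scaled) basis vectors in some order. This
  yields finitely many shapes, an explicit nodal basis, and invariance of the mesh of a macro element
  under point reflection at the midpoint of every edge that does not lie on its boundary.

  Writing \<open>a\<close> and \<open>a\<^sub>h\<close> as sums over cells and edges, the difference consists of terms
  \<open>(v\<^sub>i - v\<^sub>j) (w\<^sub>j - w\<^sub>i) (\<nabla>\<phi>\<^sub>i \<bullet> \<nabla>\<phi>\<^sub>j) (\<integral>\<^sub>t k - |t| (k\<^sub>i + k\<^sub>j) / 2)\<close>. The Lipschitz bound of \<open>k\<close> gives order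
  \<open>h\<close> for each of them. For interior edges the terms of a cell and of its reflection are added, so that
  only second differences of \<open>k\<close> remain, which are of order \<open>h\<^sup>2\<close>; the edges on a macro boundary only
  involve cells of the boundary layer.\<close>

section \<open>Test functions and the fundamental lemma\<close>

text \<open>Two obstacles shape the proof. First, \<open>k\<close> is only weakly differentiable, so
  there is no Taylor expansion to start from; all that is used of it are bounds on first and second
  differences, obtained from the definition of the weak derivative by moving a test function instead
  of \<open>k\<close>. Macro elements are convex, so the segments involved stay inside. Secondly,
  the nodal basis is a choice by \<open>SOME\<close>, and the vertex orders of neighbouring macro
  elements are unrelated, so the refinements must be shown to match on common faces. Such a face has
  at most three vertices, and there the refinement is symmetric in the vertices; this is one place
  where the dimension enters. Powers of the mesh size balance: nodal differences scale like h and
  basis gradients like 1/h, so an edge term is bounded by the energy of its cell times the error of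
  replacing the mean of \<open>k\<close> by an average of two nodal values. An edge counts as
  interior if its midpoint is interior to the macro element. Otherwise the midpoint is a boundary
  point of both the cell and the macro element, which puts the cell into
  \<open>boundary_layer\<close>.\<close>

lemma Ck_Suc_D: "Ck (Suc m) f \<Longrightarrow> Ck m f"
proof (induction m arbitrary: f)
  case 0
  then show ?case by (simp add: differentiable_imp_continuous_on)
next
  case (Suc m)
  then show ?case by auto
qed

lemma Ck_has_derivative:
  assumes "Ck (Suc m) f"
  shows "(f has_derivative frechet_derivative f (at x)) (at x)"
  using assms by (auto simp: frechet_derivative_works differentiable_on_def)

text \<open>\<open>frechet_derivative\<close> is a choice, but derivatives are unique, so any
  explicitly computed derivative may be used to climb one order.\<close>

lemma Ck_SucI:
  assumes "\<And>x. (f has_derivative f' x) (at x)" "\<And>i. Ck m (\<lambda>x. f' x (axis i 1))"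
  shows "Ck (Suc m) f"
proof -
  have "frechet_derivative f (at x) = f' x" for x
    using assms(1) frechet_derivative_at by metis
  then show ?thesis
    using assms by (auto simp: differentiable_on_def differentiable_def)
qed

lemma Ck_const: "Ck m (\<lambda>x. c)"
proof (induction m arbitrary: c)
  case (Suc m)
  show ?case by (rule Ck_SucI[where f'="\<lambda>x h. 0"]) (use Suc in auto)
qed auto

lemma Ck_add:
  "Ck m f \<Longrightarrow> Ck m g \<Longrightarrow> Ck m (\<lambda>x. f x + g x)"
proof (induction m arbitrary: f g)
  case (Suc m)
  show ?case
    by (rule Ck_SucI[OF has_derivative_add[OF Ck_has_derivative[OF Suc.prems(1)] Ck_has_derivative[OF Suc.prems(2)]]])
       (use Suc in auto)
qed (auto intro: continuous_intros)

lemma Ck_mult: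
  "Ck m f \<Longrightarrow> Ck m g \<Longrightarrow> Ck m (\<lambda>x. f x * g x)"
proof (induction m arbitrary: f g)
  case (Suc m)
  show ?case
    by (rule Ck_SucI[OF has_derivative_mult[OF Ck_has_derivative[OF Suc.prems(1)] Ck_has_derivative[OF Suc.prems(2)]]])
       (use Suc Ck_Suc_D[OF Suc.prems(1)] Ck_Suc_D[OF Suc.prems(2)] in \<open>auto intro!: Ck_add\<close>)
qed (auto intro: continuous_intros)

lemma Ck_diff: "Ck m f \<Longrightarrow> Ck m g \<Longrightarrow> Ck m (\<lambda>x. f x - g x)"
  using Ck_add[of m f "\<lambda>x. (-1) * g x"] Ck_mult[OF Ck_const[of m "-1"], of g] by simp

lemma Ck_power: "Ck m f \<Longrightarrow> Ck m (\<lambda>x. f x ^ r)"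
  by (induction r) (auto intro: Ck_const Ck_mult)

lemma Ck_prod: "(\<And>i. i \<in> I \<Longrightarrow> Ck m (f i)) \<Longrightarrow> Ck m (\<lambda>x. \<Prod>i\<in>I. f i x)"
  by (induction I rule: infinite_finite_induct) (auto intro: Ck_const Ck_mult)

lemma Ck_sum: "(\<And>i. i \<in> I \<Longrightarrow> Ck m (f i)) \<Longrightarrow> Ck m (\<lambda>x. \<Sum>i\<in>I. f i x)"
  by (induction I rule: infinite_finite_induct) (auto intro: Ck_const Ck_add)

lemma Ck_translate: "Ck m f \<Longrightarrow> Ck m (\<lambda>x. f (x - a))"
proof (induction m arbitrary: f)
  case 0
  then show ?case by (auto intro!: continuous_on_compose2[of UNIV f] continuous_intros)
next
  case (Suc m)
  show ?case
  proof (rule Ck_SucI)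
    show "((\<lambda>x. f (x - a)) has_derivative frechet_derivative f (at (x - a))) (at x)" for x
    proof -
      have "((\<lambda>x. x - a) has_derivative (\<lambda>h. h)) (at x)"
        by (auto intro!: derivative_eq_intros)
      from has_derivative_compose[OF this Ck_has_derivative[OF Suc.prems]] show ?thesis .
    qed
  qed (use Suc in auto)
qed

lemma Ck_component: "Ck m (\<lambda>x. x $ i)"
proof (cases m)
  case (Suc n)
  show ?thesis unfolding Suc
    by (rule Ck_SucI[where f'="\<lambda>x h. h $ i"])
       (auto intro!: bounded_linear.has_derivative[OF bounded_linear_vec_nth] Ck_const derivative_eq_intros)
qed (auto intro: continuous_intros)

text \<open>The derivatives of \<open>exp (-1/t)\<close> are of the form \<open>p (1/t) * exp (-1/t)\<close> with a polynomial \<open>p\<close>.\<close>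

definition expoly :: "real poly \<Rightarrow> real \<Rightarrow> real" where
  "expoly p t = (if t > 0 then poly p (1/t) * exp (- (1/t)) else 0)"

text \<open>Substituting s = 1/t turns this into the limit of \<open>poly p s\<close> / exp s at
  infinity, where the exponential beats every monomial.\<close>

lemma tendsto_expoly_0: "((\<lambda>t::real. poly p (1/t) * exp (- (1/t))) \<longlongrightarrow> 0) (at_right 0)"
proof -
  have "((\<lambda>s. \<Sum>i\<le>degree p. coeff p i * (s ^ i / exp s)) \<longlongrightarrow> (\<Sum>i\<le>degree p. coeff p i * 0)) at_top"
    by (intro tendsto_sum tendsto_mult_left tendsto_power_div_exp_0)
  then have "((\<lambda>s::real. poly p s * exp (- s)) \<longlongrightarrow> 0) at_top"
    by (simp add: poly_altdef sum_distrib_right exp_minus divide_inverse mult.assoc)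
  then show ?thesis
    using filterlim_compose[OF _ filterlim_inverse_at_top_right, of "\<lambda>s. poly p s * exp (- s)"]
    by (simp add: divide_inverse)
qed

text \<open>With s = 1/t the derivative is s^2 (p - p')(s) exp (-s); the factor
  \<open>[:0,0,1:]\<close> is s^2. The family is thus closed under differentiation, also at t =
  0.\<close>

lemma expoly_derivative:
  "(expoly p has_real_derivative expoly ([:0,0,1:] * (p - pderiv p)) t) (at t)"
proof (cases "t = 0")
  case False
  show ?thesis
  proof (cases "t > 0")
    case True
    have "((\<lambda>t. poly p (1/t) * exp (- (1/t))) has_real_derivative
        poly (pderiv p) (1/t) * (- (1/t^2)) * exp (-(1/t)) + poly p (1/t) * (exp (-(1/t)) * (1/t^2))) (at t)"
      using True by (auto intro!: derivative_eq_intros simp: power2_eq_square)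
    also have "poly (pderiv p) (1/t) * (- (1/t^2)) * exp (-(1/t)) + poly p (1/t) * (exp (-(1/t)) * (1/t^2))
       = expoly ([:0,0,1:] * (p - pderiv p)) t"
      using True by (simp add: expoly_def algebra_simps power2_eq_square)
    finally show ?thesis
      by (rule has_field_derivative_transform_within_open[where S="{0<..}"])
         (use True in \<open>auto simp: expoly_def\<close>)
  next
    case neg: False
    have "((\<lambda>t. 0) has_real_derivative expoly ([:0,0,1:] * (p - pderiv p)) t) (at t)"
      using neg by (simp add: expoly_def)
    then show ?thesis
      by (rule has_field_derivative_transform_within_open[where S="{..<0}"])
         (use neg False in \<open>auto simp: expoly_def\<close>)
  qed
next
  case True
  have "((\<lambda>h. (expoly p (0 + h) - expoly p 0) / h) \<longlongrightarrow> 0) (at 0)"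
  proof (rule filterlim_split_at_real)
    show "((\<lambda>h. (expoly p (0 + h) - expoly p 0) / h) \<longlongrightarrow> 0) (at_left 0)"
      by (rule tendsto_eventually) (auto simp: eventually_at_filter expoly_def)
    \<comment> \<open>Dividing by h multiplies the polynomial by s = 1/h, so the quotient is again
      of the type treated in \<open>tendsto_expoly_0\<close>.\<close>
    have "((\<lambda>t. poly ([:0,1:]*p) (1/t) * exp (- (1/t))) \<longlongrightarrow> 0) (at_right 0)"
      by (rule tendsto_expoly_0)
    then show "((\<lambda>h. (expoly p (0 + h) - expoly p 0) / h) \<longlongrightarrow> 0) (at_right 0)"
      by (rule Lim_transform_eventually) (auto simp: eventually_at_filter expoly_def)
  qed
  then show ?thesis using True by (simp add: DERIV_def expoly_def)
qed

text \<open>The induction keeps \<open>p\<close> arbitrary because each differentiation changes it,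
  while the inner function is assumed smooth of every order.\<close>

lemma Ck_expoly:
  "(\<And>m. Ck m f) \<Longrightarrow> Ck m (\<lambda>x. expoly p (f x))"
proof (induction m arbitrary: p)
  case 0
  have "continuous_on UNIV (expoly p)"
    using DERIV_isCont[OF expoly_derivative] by (auto simp: continuous_on_eq_continuous_at)
  with 0[of 0] show ?case
    by (auto intro: continuous_on_compose2[of UNIV "expoly p"])
next
  case (Suc m)
  let ?q = "[:0,0,1:] * (p - pderiv p)"
  show ?case
  proof (rule Ck_SucI)
    show "((\<lambda>x. expoly p (f x)) has_derivative (\<lambda>h. expoly ?q (f x) * frechet_derivative f (at x) h)) (at x)" for x
      using has_derivative_compose[OF Ck_has_derivative[OF Suc.prems] expoly_derivative[unfolded has_field_derivative_def]]
      by simp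
    show "Ck m (\<lambda>x. expoly ?q (f x) * frechet_derivative f (at x) (axis i 1))" for i
      using Suc.prems[of "Suc m"] by (intro Ck_mult Suc.IH Suc.prems) auto
  qed
qed

text \<open>The classical bump exp (-1 / (r^2 - |x - c|^2)) on the ball; \<open>1\<close> is the
  constant polynomial. Using the squared norm keeps the inner function polynomial, hence smooth at
  the centre too.\<close>

definition bump :: "real^'d \<Rightarrow> real \<Rightarrow> real^'d \<Rightarrow> real" where
  "bump c r x = expoly 1 (r\<^sup>2 - (norm (x - c))\<^sup>2)"

lemma Ck_bump: "Ck m (bump c r)"
proof -
  have "Ck m (\<lambda>x. r\<^sup>2 - (\<Sum>i\<in>UNIV. (x $ i - c $ i) * (x $ i - c $ i)))" for m
    by (intro Ck_diff Ck_const Ck_sum Ck_mult Ck_component)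
  then have "Ck m (\<lambda>x. r\<^sup>2 - (norm (x - c))\<^sup>2)" for m
    by (simp add: norm_vec_def L2_set_def sum_nonneg power2_eq_square)
  then show ?thesis unfolding bump_def[abs_def] by (rule Ck_expoly)
qed

lemma bump_bounds: "0 \<le> bump c r x" "bump c r x \<le> 1"
  by (auto simp: bump_def expoly_def)

lemma bump_pos_iff: "r > 0 \<Longrightarrow> bump c r x > 0 \<longleftrightarrow> x \<in> ball c r"
proof -
  assume "r > 0"
  then have "(norm (x - c))\<^sup>2 < r\<^sup>2 \<longleftrightarrow> norm (x - c) < r"
    using power_less_imp_less_base[of "norm (x - c)" 2 r] power_strict_mono[of "norm (x - c)" r 2] by auto
  then show ?thesis
    by (simp add: bump_def expoly_def dist_norm norm_minus_commute)
qed

text \<open>Finitely many bumps cover \<open>K\<close>, so the product \<open>P\<close> of their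
  complements is at most some q < 1 on \<open>K\<close> and equals 1 where all bumps vanish. Then 1
  - P^n is close to 1 on \<open>K\<close> and vanishes off \<open>V\<close>. Reaching 1 up to
  \<epsilon> is enough for the limit argument that follows.\<close>

lemma smooth_urysohn:
  fixes K V :: "(real^'d) set"
  assumes "compact K" "open V" "K \<subseteq> V" "0 < (\<epsilon>::real)"
  obtains \<psi> :: "real^'d \<Rightarrow> real" where "\<And>m. Ck m \<psi>" "\<And>x. 0 \<le> \<psi> x" "\<And>x. \<psi> x \<le> 1"
    "\<And>x. x \<in> K \<Longrightarrow> 1 - \<epsilon> \<le> \<psi> x" "\<And>x. \<psi> x \<noteq> 0 \<Longrightarrow> x \<in> V"
proof (cases "K = {}")
  case True
  show ?thesis
    by (rule that[OF Ck_const[of _ 0]]) (simp_all add: True)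
next
  case False
  have "\<forall>x\<in>K. \<exists>r. r > 0 \<and> ball x r \<subseteq> V"
    using openE[OF \<open>open V\<close>] \<open>K \<subseteq> V\<close> by blast
  from bchoice[OF this] obtain r where r: "\<And>x. x \<in> K \<Longrightarrow> r x > 0 \<and> ball x (r x) \<subseteq> V" by blast
  obtain X where X: "X \<subseteq> K" "finite X" "K \<subseteq> (\<Union>c\<in>X. ball c (r c))"
  proof (rule compactE_image[OF \<open>compact K\<close>, of K "\<lambda>c. ball c (r c)"])
    show "K \<subseteq> (\<Union>c\<in>K. ball c (r c))" using r by force
  qed auto
  define P where "P x = (\<Prod>c\<in>X. 1 - bump c (r c) x)" for x
  have P_Ck: "Ck m P" for m
    unfolding P_def[abs_def] by (intro Ck_prod Ck_diff Ck_const Ck_bump)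
  have P01: "0 \<le> P x" "P x \<le> 1" for x
    unfolding P_def using bump_bounds by (auto intro!: prod_nonneg prod_le_1)
  have "P x < 1" if xK: "x \<in> K" for x
  proof -
    obtain c where c: "c \<in> X" "x \<in> ball c (r c)" using X xK by auto
    have "P x = (1 - bump c (r c) x) * (\<Prod>c\<in>X-{c}. 1 - bump c (r c) x)"
      unfolding P_def using c X by (simp add: prod.remove)
    also have "\<dots> \<le> (1 - bump c (r c) x) * 1"
      using bump_bounds by (intro mult_left_mono prod_le_1) auto
    also have "\<dots> < 1" using bump_pos_iff[of "r c" c x] r c X by auto
    finally show ?thesis .
  qed
  moreover have "continuous_on K P"
    using P_Ck[of 0] continuous_on_subset by fastforce
  ultimately obtain q where q: "\<And>x. x \<in> K \<Longrightarrow> P x \<le> q" "q < 1"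
    using continuous_attains_sup[OF \<open>compact K\<close> False] by metis
  have "0 \<le> q" using q P01 False by (meson ex_in_conv order_trans)
  then obtain n where n: "q ^ n < \<epsilon>"
    using real_arch_pow_inv[OF assms(4) q(2)] by auto
  show ?thesis
  proof (rule that[of "\<lambda>x. 1 - P x ^ n"])
    show "Ck m (\<lambda>x. 1 - P x ^ n)" for m
      by (intro Ck_diff Ck_const Ck_power P_Ck)
    show "0 \<le> 1 - P x ^ n" "1 - P x ^ n \<le> 1" for x
      using P01 by (auto intro: power_le_one)
    show "1 - \<epsilon> \<le> 1 - P x ^ n" if "x \<in> K" for x
      using power_mono[OF q(1)[OF that] P01(1), of n] n by simp
    show "x \<in> V" if "1 - P x ^ n \<noteq> 0" for x
    proof -
      have "P x \<noteq> 1" using that by auto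
      then obtain c where "c \<in> X" "bump c (r c) x \<noteq> 0"
        unfolding P_def using prod.neutral by force
      then show ?thesis
        using bump_pos_iff[of "r c" c x] bump_bounds(1)[of c "r c" x] r X by fastforce
    qed
  qed
qed

section \<open>The sign of a function from its test integrals\<close>

lemma test_functionI:
  assumes "\<And>m. Ck m \<psi>" "compact K" "K \<subseteq> U" "\<And>x. \<psi> x \<noteq> 0 \<Longrightarrow> x \<in> K"
  shows "test_function U \<psi>"
proof -
  have "closure {x. \<psi> x \<noteq> 0} \<subseteq> K"
    using assms(4) compact_imp_closed[OF assms(2)] by (intro closure_minimal) auto
  moreover from this have "compact (closure {x. \<psi> x \<noteq> 0})"
    using assms(2) by (meson bounded_subset closed_closure compact_eq_bounded_closed)
  ultimately show ?thesis using assms by (auto simp: test_function_def)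
qed

text \<open>If \<open>f\<close> were negative on a set of positive measure, inner regularity would
  give a compact \<open>C\<close> of positive measure there, and test functions tending to its
  indicator would make the integral of \<open>f\<close> over \<open>C\<close> nonnegative. The
  one-sided form yields equalities and two-sided bounds by applying it to both signs of a
  difference.\<close>

lemma nonneg_AE_of_test_integrals:
  fixes U :: "(real^'d) set"
  assumes U: "open U" and f: "locally_integrable_on f U"
    and pos: "\<And>\<psi>. test_function U \<psi> \<Longrightarrow> (\<And>x. 0 \<le> \<psi> x) \<Longrightarrow> 0 \<le> (LINT x:U|lebesgue. f x * \<psi> x)"
  shows "AE x in lebesgue. x \<in> U \<longrightarrow> 0 \<le> f x"
proof -
  have K: "AE x in lebesgue. x \<in> K \<longrightarrow> 0 \<le> f x" if K: "compact K" "K \<subseteq> U" for K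
  proof (rule ccontr)
    assume neg: "\<not> ?thesis"
    have fK: "(\<lambda>x. indicator K x * f x) \<in> borel_measurable lebesgue"
      using f K by (auto simp: locally_integrable_on_def set_integrable_def dest!: borel_measurable_integrable)
    \<comment> \<open>\<open>f\<close> is known to be measurable only after multiplication by the
      indicator of a compact set, so \<open>A\<close> is written with that product.\<close>
    define A where "A = {x \<in> space lebesgue. indicator K x * f x < 0}"
    have A: "A \<in> sets lebesgue" unfolding A_def using fK by measurable
    have A': "A = {x \<in> K. f x < 0}" by (auto simp: A_def indicator_def split: if_splits)
    have "emeasure lebesgue A \<noteq> 0"
    proof
      assume "emeasure lebesgue A = 0"
      then have "A \<in> null_sets lebesgue" using A by (simp only: null_sets_def mem_Collect_eq)
      then have "AE x in lebesgue. x \<notin> A" by (rule AE_not_in)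
      then have "AE x in lebesgue. x \<in> K \<longrightarrow> 0 \<le> f x"
        by eventually_elim (auto simp: A' not_less)
      then show False using neg by simp
    qed
    moreover have lA: "A \<in> lmeasurable"
      using A by (intro fmeasurableI2[OF lmeasurable_compact[OF K(1)]]) (auto simp: A')
    ultimately have e: "measure lebesgue A > 0"
      using emeasure_eq_measure2[OF lA] by (simp add: zero_less_measure_iff del: emeasure_completion)
    obtain C where C: "closed C" "C \<subseteq> A" "A - C \<in> lmeasurable" "emeasure lebesgue (A - C) < ennreal (measure lebesgue A)"
      using sets_lebesgue_inner_closed[OF A e] .
    have CK: "C \<subseteq> K" "C \<subseteq> U" using C A' K by auto
    have "compact C" using C CK K compact_Int_closed[of K C] by (simp add: inf.absorb2)
    have Cs: "C \<in> sets lebesgue" using \<open>compact C\<close> by (simp add: lmeasurable_compact fmeasurableD)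
    have C0: "emeasure lebesgue C \<noteq> 0"
    proof
      assume "emeasure lebesgue C = 0"
      then have "emeasure lebesgue (A - C) = emeasure lebesgue A"
        using A Cs by (intro emeasure_Diff_null_set) (auto simp: null_sets_def)
      then show False using C(4) emeasure_eq_measure2[OF lA] by simp
    qed
    obtain \<delta> where d: "\<delta> > 0" "(\<Union>x\<in>C. ball x \<delta>) \<subseteq> U"
      using compact_subset_open_imp_ball_epsilon_subset[OF \<open>compact C\<close> U CK(2)] by blast
    define K' where "K' = {x + y |x y. x \<in> C \<and> y \<in> cball 0 (\<delta>/2)}"
    have K': "compact K'" unfolding K'_def using \<open>compact C\<close> by (intro compact_sums) auto
    have K'U: "K' \<subseteq> U"
    proof
      fix z assume "z \<in> K'"
      then obtain x y where "z = x + y" "x \<in> C" "norm y \<le> \<delta>/2" by (auto simp: K'_def)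
      then have "z \<in> ball x \<delta>" using d by (auto simp: dist_norm)
      then show "z \<in> U" using d(2) \<open>x \<in> C\<close> by blast
    qed
    \<comment> \<open>Shrinking neighbourhoods of \<open>C\<close>, all inside the one compact
      \<open>K'\<close>. The test functions converge to the indicator of \<open>C\<close> because
      \<open>C\<close> is closed, and |f| on \<open>K'\<close> is the majorant.\<close>
    define V where "V n = (\<Union>x\<in>C. ball x (\<delta>/2/real (Suc n)))" for n
    have VK: "V n \<subseteq> K'" for n
    proof
      fix z assume "z \<in> V n"
      then obtain x where x: "x \<in> C" "dist x z < \<delta>/2/real (Suc n)" by (auto simp: V_def)
      have "\<delta>/2/real (Suc n) \<le> \<delta>/2" using d by (simp add: field_simps)
      then have "dist x z \<le> \<delta>/2" using x by linarith
      then have "norm (z - x) \<le> \<delta>/2" by (simp add: dist_norm norm_minus_commute)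
      then show "z \<in> K'" unfolding K'_def using x by (intro CollectI exI[of _ x] exI[of _ "z - x"]) auto
    qed
    have "\<exists>\<psi>. (\<forall>m. Ck m \<psi>) \<and> (\<forall>x. 0 \<le> \<psi> x \<and> \<psi> x \<le> 1 \<and> (x \<in> C \<longrightarrow> 1 - 1/real (Suc n) \<le> \<psi> x) \<and> (\<psi> x \<noteq> 0 \<longrightarrow> x \<in> V n))" for n
    proof -
      have "open (V n)" "C \<subseteq> V n" using d by (auto simp: V_def)
      from smooth_urysohn[OF \<open>compact C\<close> this, of "1/real (Suc n)"] show ?thesis by (metis of_nat_0_less_iff zero_less_Suc zero_less_divide_1_iff)
    qed
    then obtain \<psi> where psi: "\<And>n m. Ck m (\<psi> n)" "\<And>n x. 0 \<le> \<psi> n x" "\<And>n x. \<psi> n x \<le> 1"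
      "\<And>n x. x \<in> C \<Longrightarrow> 1 - 1/real (Suc n) \<le> \<psi> n x" "\<And>n x. \<psi> n x \<noteq> 0 \<Longrightarrow> x \<in> V n"
      by metis
    have test: "test_function U (\<psi> n)" for n
      using psi VK by (intro test_functionI[OF _ K' K'U]) blast+
    have fK': "integrable lebesgue (\<lambda>x. indicator K' x * f x)"
      using f K' K'U by (auto simp: locally_integrable_on_def set_integrable_def)
    have psim: "\<psi> n \<in> borel_measurable lebesgue" for n
    proof -
      have "\<psi> n \<in> borel_measurable borel"
        using psi(1)[of 0 n] by (intro borel_measurable_continuous_onI) simp
      then show ?thesis by (simp add: measurable_completion)
    qed
    have lim: "(\<lambda>n. \<psi> n x) \<longlonglongrightarrow> indicator C x" for x
    proof (cases "x \<in> C")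
      case True
      have "(\<lambda>n. \<psi> n x) \<longlonglongrightarrow> 1"
      proof (rule tendsto_sandwich)
        show "\<forall>\<^sub>F n in sequentially. 1 - 1/real (Suc n) \<le> \<psi> n x" using psi True by auto
        show "\<forall>\<^sub>F n in sequentially. \<psi> n x \<le> 1" using psi by auto
        show "(\<lambda>n. 1 - 1/real (Suc n)) \<longlonglongrightarrow> 1"
          using tendsto_diff[OF tendsto_const LIMSEQ_inverse_real_of_nat, of 1] by (simp add: inverse_eq_divide)
      qed auto
      then show ?thesis using True by simp
    next
      case False
      then obtain e where e: "e > 0" "ball x e \<subseteq> - C" using C(1) by (metis Compl_iff openE open_Compl)
      have "\<forall>\<^sub>F n in sequentially. \<psi> n x = 0"
      proof -
        obtain n0 where n0: "\<delta>/2/real (Suc n0) < e"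
        proof -
          have "e / (\<delta>/2) > 0" using e d by simp
          then obtain n where "1 / real (Suc n) < e / (\<delta>/2)" using nat_approx_posE by blast
          then show ?thesis using that[of n] e d by (simp add: field_simps)
        qed
        have "\<psi> n x = 0" if "n \<ge> n0" for n
        proof (rule ccontr)
          assume "\<psi> n x \<noteq> 0"
          then have "x \<in> V n" by (rule psi(5))
          then obtain c where c: "c \<in> C" "dist c x < \<delta>/2/real (Suc n)" by (auto simp: V_def)
          have "\<delta>/2/real (Suc n) \<le> \<delta>/2/real (Suc n0)" using that d by (intro divide_left_mono) auto
          then have "dist c x < e" using c n0 by linarith
          then have "c \<in> ball x e" by (simp add: dist_commute)
          then show False using e c by auto
        qed
        then show ?thesis by (auto simp: eventually_sequentially)
      qed
      then show ?thesis using False by (auto intro: tendsto_eventually)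
    qed
    have "(\<lambda>n. \<integral>x. indicator K' x * f x * \<psi> n x \<partial>lebesgue) \<longlonglongrightarrow> (\<integral>x. indicator K' x * f x * indicator C x \<partial>lebesgue)"
    proof (rule integral_dominated_convergence[where w="\<lambda>x. norm (indicator K' x * f x)"])
      show "(\<lambda>x. indicator K' x * f x * indicator C x) \<in> borel_measurable lebesgue"
        using fK' Cs by auto
      show "(\<lambda>x. indicator K' x * f x * \<psi> n x) \<in> borel_measurable lebesgue" for n
        using fK' psim by auto
      show "AE x in lebesgue. (\<lambda>n. indicator K' x * f x * \<psi> n x) \<longlonglongrightarrow> indicator K' x * f x * indicator C x"
        by (intro AE_I2 tendsto_mult tendsto_const lim)
      show "AE x in lebesgue. norm (indicator K' x * f x * \<psi> n x) \<le> norm (indicator K' x * f x)" for n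
        using psi by (intro AE_I2) (auto simp: abs_mult intro!: mult_left_le)
    qed (use fK' in auto)
    moreover have "0 \<le> (\<integral>x. indicator K' x * f x * \<psi> n x \<partial>lebesgue)" for n
    proof -
      have "(\<integral>x. indicator K' x * f x * \<psi> n x \<partial>lebesgue) = (LINT x:U|lebesgue. f x * \<psi> n x)"
        unfolding set_lebesgue_integral_def
        by (rule Bochner_Integration.integral_cong) (use psi(5)[of n] VK[of n] K'U in \<open>auto simp: indicator_def\<close>)
      then show ?thesis using pos[OF test psi(2)] by simp
    qed
    ultimately have "0 \<le> (\<integral>x. indicator K' x * f x * indicator C x \<partial>lebesgue)"
      by (intro LIMSEQ_le_const) auto
    moreover have eqC: "indicator K' x * f x * indicator C x = - (indicator C x * \<bar>f x\<bar>)" for x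
      using C(2) A' d by (force simp: indicator_def K'_def intro: exI[of _ x] exI[of _ 0])
    moreover have "integrable lebesgue (\<lambda>x. indicator K' x * f x * indicator C x)"
      using fK' Cs by (intro integrable_real_mult_indicator) auto
    ultimately have "integrable lebesgue (\<lambda>x. indicator C x * \<bar>f x\<bar>)" "(\<integral>x. indicator C x * \<bar>f x\<bar> \<partial>lebesgue) \<le> 0"
      by auto
    then have "(\<integral>x. indicator C x * \<bar>f x\<bar> \<partial>lebesgue) = 0"
      by (intro antisym integral_nonneg_AE) auto
    then have "AE x in lebesgue. indicator C x * \<bar>f x\<bar> = 0"
      using \<open>integrable lebesgue (\<lambda>x. indicator C x * \<bar>f x\<bar>)\<close>
      by (subst (asm) integral_nonneg_eq_0_iff_AE) auto
    moreover have "indicator C x * \<bar>f x\<bar> \<noteq> 0" if "x \<in> C" for x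
      using that C(2) A' by auto
    ultimately have "AE x in lebesgue. x \<notin> C" by auto
    then show False using C0 Cs by (simp add: AE_iff_null_sets[symmetric] null_sets_def)
  qed
  \<comment> \<open>Exhausting \<open>U\<close> by countably many compact boxes combines the null
    sets of the pieces.\<close>
  obtain D where D: "countable D" "D \<subseteq> Pow U" "\<And>X. X \<in> D \<Longrightarrow> \<exists>a b. X = cbox a b" "\<Union>D = U"
    using open_countable_Union_open_cbox[OF U] by metis
  have "AE x in lebesgue. \<forall>X\<in>D. x \<in> X \<longrightarrow> 0 \<le> f x"
    using D by (subst AE_ball_countable) (fastforce intro!: K compact_cbox)+
  then show ?thesis by eventually_elim (use D(4) in auto)
qed

section \<open>Calculus of weak derivatives\<close>

text \<open>Translations (c = 1) serve the differences of \<open>k\<close>, point reflections (c =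
  -1) the reflected cells. Their Jacobian has modulus one, so the density in the affine change of
  variables is constantly 1.\<close>

lemma lebesgue_distr_pm_one:
  fixes t :: "'a::euclidean_space"
  assumes "c = 1 \<or> c = (-1::real)"
  shows "(\<lambda>x. t + c *\<^sub>R x) \<in> lebesgue \<rightarrow>\<^sub>M lebesgue"
    and "distr lebesgue lebesgue (\<lambda>x. t + c *\<^sub>R x) = lebesgue"
proof -
  have eq: "(\<lambda>x. t + c *\<^sub>R x) = (\<lambda>x. t + (\<Sum>j\<in>Basis. (c * (x \<bullet> j)) *\<^sub>R j))"
    by (simp add: scaleR_scaleR[symmetric] scaleR_sum_right[symmetric] euclidean_representation
        del: scaleR_scaleR)
  have c: "c \<noteq> 0" "\<bar>c\<bar> = 1" using assms by auto
  show "(\<lambda>x. t + c *\<^sub>R x) \<in> lebesgue \<rightarrow>\<^sub>M lebesgue"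
    unfolding eq using lebesgue_affine_measurable[of "\<lambda>_. c" t] c by simp
  have "lebesgue = density (distr lebesgue lebesgue (\<lambda>x. t + c *\<^sub>R x)) (\<lambda>_. 1)"
    unfolding eq using lebesgue_affine_euclidean[of "\<lambda>_. c" t] c by simp
  then show "distr lebesgue lebesgue (\<lambda>x. t + c *\<^sub>R x) = lebesgue"
    by (simp add: density_1)
qed

lemma AE_lebesgue_pm_one:
  fixes t :: "'a::euclidean_space"
  assumes "c = 1 \<or> c = (-1::real)" "AE x in lebesgue. P x"
  shows "AE x in lebesgue. P (t + c *\<^sub>R x)"
proof -
  have "AE x in distr lebesgue lebesgue (\<lambda>x. t + c *\<^sub>R x). P x"
    unfolding lebesgue_distr_pm_one(2)[OF assms(1)] by (rule assms(2))
  then show ?thesis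
    using AE_distrD[OF lebesgue_distr_pm_one(1)[OF assms(1)]] by blast
qed

lemma integrable_lebesgue_pm_one:
  fixes f :: "'a::euclidean_space \<Rightarrow> real" and t :: 'a
  assumes "c = 1 \<or> c = (-1::real)" "integrable lebesgue f"
  shows "integrable lebesgue (\<lambda>x. f (t + c *\<^sub>R x))"
  using integrable_distr[OF lebesgue_distr_pm_one(1)[OF assms(1)], of t f] lebesgue_distr_pm_one(2)[OF assms(1), of t] assms(2)
  by simp

lemma integral_lebesgue_pm_one:
  fixes f :: "'a::euclidean_space \<Rightarrow> real" and t :: 'a
  assumes "c = 1 \<or> c = (-1::real)" "integrable lebesgue f"
  shows "(\<integral>x. f (t + c *\<^sub>R x) \<partial>lebesgue) = (\<integral>x. f x \<partial>lebesgue)"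
  using integral_distr[OF lebesgue_distr_pm_one(1)[OF assms(1)], of f t] lebesgue_distr_pm_one(2)[OF assms(1), of t]
    borel_measurable_integrable[OF assms(2)]
  by simp

section \<open>Integrability against test functions and uniqueness of weak derivatives\<close>

lemma locally_integrable_on_mono:
  "locally_integrable_on f U \<Longrightarrow> V \<subseteq> U \<Longrightarrow> locally_integrable_on f V"
  by (auto simp: locally_integrable_on_def)

lemma integrable_mult_compact_support:
  fixes f \<phi> :: "real^'d \<Rightarrow> real"
  assumes "locally_integrable_on f U" "compact K" "K \<subseteq> U" "continuous_on UNIV \<phi>" "\<And>x. \<phi> x \<noteq> 0 \<Longrightarrow> x \<in> K"
  shows "set_integrable lebesgue U (\<lambda>x. f x * \<phi> x)"
proof -
  have fK: "integrable lebesgue (\<lambda>x. indicator K x * f x)"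
    using assms by (auto simp: locally_integrable_on_def set_integrable_def)
  have "compact (\<phi> ` K)" using assms by (intro compact_continuous_image) (auto intro: continuous_on_subset)
  then obtain B where "\<And>x. x \<in> K \<Longrightarrow> \<bar>\<phi> x\<bar> \<le> B"
    using compact_imp_bounded by (fastforce simp: bounded_iff)
  then have B: "\<bar>\<phi> x\<bar> \<le> \<bar>B\<bar>" for x
    using assms(5)[of x] by (cases "\<phi> x = 0") fastforce+
  have "\<phi> \<in> borel_measurable borel"
    using assms(4) by (rule borel_measurable_continuous_onI)
  then have phi: "\<phi> \<in> borel_measurable lebesgue" by (simp add: measurable_completion)
  have "integrable lebesgue (\<lambda>x. indicator K x * f x * \<phi> x)"
  proof (rule Bochner_Integration.integrable_bound)
    show "integrable lebesgue (\<lambda>x. \<bar>B\<bar> * (indicator K x * f x))" using fK by simp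
    show "(\<lambda>x. indicator K x * f x * \<phi> x) \<in> borel_measurable lebesgue"
      by (rule borel_measurable_times[OF borel_measurable_integrable[OF fK] phi])
    show "AE x in lebesgue. norm (indicator K x * f x * \<phi> x) \<le> norm (\<bar>B\<bar> * (indicator K x * f x))"
      by (intro AE_I2) (use B in \<open>auto simp: abs_mult mult.commute intro!: mult_right_mono mult_left_mono\<close>)
  qed
  also have "(\<lambda>x. indicator K x * f x * \<phi> x) = (\<lambda>x. indicator U x *\<^sub>R (f x * \<phi> x))"
    using assms by (force simp: indicator_def)
  finally show ?thesis by (simp add: set_integrable_def)
qed

lemma test_functionD:
  assumes "test_function U \<psi>"
  shows "\<exists>K. (\<forall>m. Ck m \<psi>) \<and> compact K \<and> K \<subseteq> U \<and> (\<forall>x. \<psi> x \<noteq> 0 \<longrightarrow> x \<in> K) \<and> continuous_on UNIV \<psi>"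
proof (intro exI conjI)
  show "\<forall>m. Ck m \<psi>" "compact (closure {x. \<psi> x \<noteq> 0})" "closure {x. \<psi> x \<noteq> 0} \<subseteq> U"
    using assms by (auto simp: test_function_def)
  then show "continuous_on UNIV \<psi>" using Ck.simps(1) by blast
  show "\<forall>x. \<psi> x \<noteq> 0 \<longrightarrow> x \<in> closure {x. \<psi> x \<noteq> 0}"
    by (auto intro: subsetD[OF closure_subset])
qed

lemma test_function_has_derivative:
  "test_function U \<psi> \<Longrightarrow> (\<psi> has_derivative frechet_derivative \<psi> (at x)) (at x)"
  by (rule Ck_has_derivative[of 0]) (simp only: test_function_def)

lemma set_integrable_mult_test:
  "locally_integrable_on f U \<Longrightarrow> test_function U \<psi> \<Longrightarrow> set_integrable lebesgue U (\<lambda>x. f x * \<psi> x)"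
  by (drule test_functionD) (auto intro: integrable_mult_compact_support)

lemma test_function_partial:
  assumes "test_function U \<psi>"
  shows "test_function U (\<lambda>x. frechet_derivative \<psi> (at x) (axis i 1))"
proof -
  obtain K where K: "\<And>m. Ck m \<psi>" "compact K" "K \<subseteq> U" "\<And>x. \<psi> x \<noteq> 0 \<Longrightarrow> x \<in> K" "continuous_on UNIV \<psi>"
    using test_functionD[OF assms] by auto
  show ?thesis
  proof (rule test_functionI[OF _ K(2,3)])
    show "Ck m (\<lambda>x. frechet_derivative \<psi> (at x) (axis i 1))" for m
      using K(1)[of "Suc m"] by simp
    show "x \<in> K" if "frechet_derivative \<psi> (at x) (axis i 1) \<noteq> 0" for x
    proof (rule ccontr)
      assume "x \<notin> K"
      have "((\<lambda>x. 0) has_derivative (\<lambda>h. 0)) (at x)" by simp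
      then have "(\<psi> has_derivative (\<lambda>h. 0)) (at x)"
        by (rule has_derivative_transform_within_open[where s="-K"])
           (use \<open>x \<notin> K\<close> K in \<open>auto intro: open_Compl compact_imp_closed\<close>)
      then show False using that frechet_derivative_at by metis
    qed
  qed
qed

lemma locally_integrable_on_diff:
  "locally_integrable_on f U \<Longrightarrow> locally_integrable_on g U \<Longrightarrow> locally_integrable_on (\<lambda>x. f x - g x) U"
  by (auto simp: locally_integrable_on_def)

lemma locally_integrable_on_cmult:
  "locally_integrable_on f U \<Longrightarrow> locally_integrable_on (\<lambda>x. c * f x) U"
  by (auto simp: locally_integrable_on_def)

lemma locally_integrable_on_const: "locally_integrable_on (\<lambda>x. c) U"
  by (auto simp: locally_integrable_on_def intro: absolutely_integrable_on_const lmeasurable_compact)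

text \<open>Both candidates have the same integral against each test function, so
  \<open>nonneg_AE_of_test_integrals\<close> applies to their difference in both directions.\<close>

lemma has_weak_partial_unique:
  assumes U: "open U" and g: "has_weak_partial U i u g" "has_weak_partial U i u g'"
  shows "AE x in lebesgue. x \<in> U \<longrightarrow> g x = g' x"
proof -
  have le: "AE x in lebesgue. x \<in> U \<longrightarrow> 0 \<le> g x - g' x"
    if g: "has_weak_partial U i u g" "has_weak_partial U i u g'" for g g'
  proof (rule nonneg_AE_of_test_integrals[OF U])
    have li: "locally_integrable_on g U" "locally_integrable_on g' U"
      using g by (auto simp: has_weak_partial_def)
    then show "locally_integrable_on (\<lambda>x. g x - g' x) U"
      by (rule locally_integrable_on_diff)
    fix \<psi> :: "real^'a \<Rightarrow> real" assume t: "test_function U \<psi>"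
    have "(LINT x:U|lebesgue. (g x - g' x) * \<psi> x) = (LINT x:U|lebesgue. g x * \<psi> x) - (LINT x:U|lebesgue. g' x * \<psi> x)"
      using set_integral_diff(2)[OF set_integrable_mult_test[OF li(1) t] set_integrable_mult_test[OF li(2) t]]
      by (simp add: algebra_simps)
    also have "\<dots> = 0"
    proof -
      have "(LINT x:U|lebesgue. u x * frechet_derivative \<psi> (at x) (axis i 1)) = - (LINT x:U|lebesgue. h x * \<psi> x)"
        if "has_weak_partial U i u h" for h
        using that t unfolding has_weak_partial_def by blast
      from this[OF g(1)] this[OF g(2)] show ?thesis by simp
    qed
    finally show "0 \<le> (LINT x:U|lebesgue. (g x - g' x) * \<psi> x)" by simp
  qed
  show ?thesis using le[OF g] le[OF g(2,1)] by eventually_elim auto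
qed

lemma has_weak_partial_weak_partial:
  "has_weak_partial U i u g \<Longrightarrow> has_weak_partial U i u (weak_partial U i u)"
  unfolding weak_partial_def by (rule someI[of "has_weak_partial U i u"])

text \<open>Each partial derivative is continuous with compact support, hence bounded. The constant
  supplies the majorant whenever a difference quotient of \<psi> is passed to the limit under an
  integral.\<close>

lemma test_function_lipschitz:
  fixes \<psi> :: "real^'d \<Rightarrow> real"
  assumes "test_function U \<psi>"
  obtains L where "L \<ge> 0" "\<And>x y. \<bar>\<psi> x - \<psi> y\<bar> \<le> L * norm (x - y)"
proof -
  have "\<exists>B. \<forall>x. \<bar>frechet_derivative \<psi> (at x) (axis i 1)\<bar> \<le> B" for i
  proof -
    let ?f = "\<lambda>x. frechet_derivative \<psi> (at x) (axis i 1)"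
    obtain K where K: "\<And>m. Ck m ?f" "compact K" "K \<subseteq> U" "\<And>x. ?f x \<noteq> 0 \<Longrightarrow> x \<in> K" "continuous_on UNIV ?f"
      using test_functionD[OF test_function_partial[OF assms, of i]] by auto
    have "compact (?f ` K)" using K by (intro compact_continuous_image) (auto intro: continuous_on_subset)
    then obtain B where B: "\<And>x. x \<in> K \<Longrightarrow> \<bar>?f x\<bar> \<le> B"
      using compact_imp_bounded by (fastforce simp: bounded_iff)
    show ?thesis
      by (rule exI[of _ "\<bar>B\<bar>"])
        (metis B K(4) abs_ge_self abs_ge_zero abs_zero order_trans)
  qed
  then have "\<exists>B. \<forall>i x. \<bar>frechet_derivative \<psi> (at x) (axis i 1)\<bar> \<le> B i" by (intro choice allI)
  then obtain B where B: "\<And>i x. \<bar>frechet_derivative \<psi> (at x) (axis i 1)\<bar> \<le> B i" by blast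
  have Bpos: "0 \<le> B i" for i by (rule order_trans[OF abs_ge_zero B])
  have der: "(\<psi> has_derivative frechet_derivative \<psi> (at x)) (at x)" for x
    by (rule test_function_has_derivative[OF assms])
  have "norm (\<psi> x - \<psi> y) \<le> (\<Sum>i\<in>UNIV. B i) * norm (x - y)" for x y
  proof (rule differentiable_bound[of UNIV])
    fix z
    show "onorm (frechet_derivative \<psi> (at z)) \<le> (\<Sum>i\<in>UNIV. B i)"
    proof (rule onorm_bound)
      show "0 \<le> (\<Sum>i\<in>UNIV. B i)" using Bpos by (simp add: sum_nonneg)
      fix h :: "real^'d"
      have "frechet_derivative \<psi> (at z) h = (\<Sum>i\<in>UNIV. h $ i * frechet_derivative \<psi> (at z) (axis i 1))"
      proof -
        have lin: "linear (frechet_derivative \<psi> (at z))"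
          using der has_derivative_linear by blast
        have "h = (\<Sum>i\<in>UNIV. h $ i *\<^sub>R axis i 1)"
          using basis_expansion[of h] by (simp add: scalar_mult_eq_scaleR)
        then have "frechet_derivative \<psi> (at z) h = frechet_derivative \<psi> (at z) (\<Sum>i\<in>UNIV. h $ i *\<^sub>R axis i 1)"
          by simp
        then show ?thesis by (simp add: linear_sum[OF lin] linear_scale[OF lin])
      qed
      also have "norm \<dots> \<le> (\<Sum>i\<in>UNIV. norm h * B i)"
        by (rule sum_norm_le) (use B in \<open>auto simp: abs_mult intro!: mult_mono component_le_norm_cart\<close>)
      finally show "norm (frechet_derivative \<psi> (at z) h) \<le> (\<Sum>i\<in>UNIV. B i) * norm h"
        by (simp add: sum_distrib_left mult.commute)
    qed
  qed (use der in auto)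
  then show ?thesis using that[of "\<Sum>i\<in>UNIV. B i"] Bpos by (simp add: sum_nonneg)
qed

section \<open>Differentiating integrals against translated test functions\<close>

lemma test_function_translate:
  assumes "test_function U \<psi>" "\<And>x. \<psi> x \<noteq> 0 \<Longrightarrow> x \<in> K" "compact K" "\<And>x. x \<in> K \<Longrightarrow> x + a \<in> V"
  shows "test_function V (\<lambda>x. \<psi> (x - a))"
proof (rule test_functionI[of _ "(\<lambda>x. x + a) ` K"])
  show "Ck m (\<lambda>x. \<psi> (x - a))" for m
    using assms(1) by (intro Ck_translate) (auto simp: test_function_def)
  show "compact ((\<lambda>x. x + a) ` K)"
    using assms(3) by (intro compact_continuous_image continuous_intros)
  show "x \<in> (\<lambda>x. x + a) ` K" if "\<psi> (x - a) \<noteq> 0" for x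
    using assms(2)[OF that] by (intro image_eqI[of _ _ "x - a"]) auto
qed (use assms in auto)

lemma frechet_derivative_translate:
  assumes "test_function U \<psi>"
  shows "frechet_derivative (\<lambda>x. \<psi> (x - a)) (at x) = frechet_derivative \<psi> (at (x - a))"
proof -
  have "((\<lambda>x. x - a) has_derivative (\<lambda>h. h)) (at x)" by (auto intro!: derivative_eq_intros)
  moreover have "(\<psi> has_derivative frechet_derivative \<psi> (at (x - a))) (at (x - a))"
    by (rule test_function_has_derivative[OF assms])
  ultimately have "((\<lambda>x. \<psi> (x - a)) has_derivative frechet_derivative \<psi> (at (x - a))) (at x)"
    by (rule has_derivative_compose)
  then show ?thesis by (simp add: frechet_derivative_at[symmetric])
qed

text \<open>The translation sits on \<psi>, so differentiating in \<open>s\<close> hits only the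
  smooth factor. The result contains -k times partial derivatives of \<psi>, and the definition of
  the weak derivative turns these into \<open>g i\<close> times \<psi>.\<close>

lemma weak_directional_derivative_integral:
  fixes k :: "real^'d \<Rightarrow> real"
  assumes U: "open U" and g: "\<And>i. has_weak_partial U i k (g i)"
    and t: "test_function V \<psi>" and K: "compact K" "\<And>x. \<psi> x \<noteq> 0 \<Longrightarrow> x \<in> K"
    and KU: "\<And>x. x \<in> K \<Longrightarrow> x + s *\<^sub>R a \<in> U"
  shows "((\<lambda>s. LINT x:U|lebesgue. k x * \<psi> (x - s *\<^sub>R a)) has_real_derivative
     (\<Sum>i\<in>UNIV. a $ i * (LINT x:U|lebesgue. g i x * \<psi> (x - s *\<^sub>R a)))) (at s)"
proof -
  have k: "locally_integrable_on k U" using g by (auto simp: has_weak_partial_def)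
  have ts: "test_function U (\<lambda>x. \<psi> (x - s *\<^sub>R a))"
    by (rule test_function_translate[OF t K(2,1) KU])
  define K0 where "K0 = (\<lambda>x. x + s *\<^sub>R a) ` K"
  have K0: "compact K0" "K0 \<subseteq> U"
    unfolding K0_def using KU K(1) by (auto intro!: compact_continuous_image continuous_intros)
  obtain e where e: "e > 0" "(\<Union>x\<in>K0. ball x e) \<subseteq> U"
    using compact_subset_open_imp_ball_epsilon_subset[OF K0(1) U K0(2)] by blast
  \<comment> \<open>Parameters within \<delta> of \<open>s\<close> move the support by at most e/2,
    so all supports lie in the compact \<open>K'\<close> inside \<open>U\<close>. The added 1 covers
    a = 0.\<close>
  define \<delta> where "\<delta> = e / (2 * (norm a + 1))"
  have \<delta>: "\<delta> > 0" using e by (simp add: \<delta>_def add_nonneg_pos)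
  define K' where "K' = {x + y |x y. x \<in> K0 \<and> y \<in> cball 0 (e/2)}"
  have K': "compact K'" unfolding K'_def using K0 by (intro compact_sums) auto
  have K'U: "K' \<subseteq> U"
  proof
    fix z assume "z \<in> K'"
    then obtain x y where z: "z = x + y" "x \<in> K0" "norm y \<le> e/2" by (auto simp: K'_def)
    then have "z \<in> ball x e" using e by (auto simp: dist_norm)
    then show "z \<in> U" using e(2) \<open>x \<in> K0\<close> by blast
  qed
  have supp: "x \<in> K'" if "\<psi> (x - (s + r) *\<^sub>R a) \<noteq> 0" "\<bar>r\<bar> \<le> \<delta>" for x r
  proof -
    have "x - r *\<^sub>R a \<in> K0"
      unfolding K0_def using K(2)[OF that(1)] by (intro image_eqI[of _ _ "x - (s + r) *\<^sub>R a"]) (auto simp: algebra_simps)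
    moreover have "norm (r *\<^sub>R a) \<le> e/2"
    proof -
      have "norm (r *\<^sub>R a) \<le> \<delta> * (norm a + 1)" using that(2) \<delta> by (auto intro!: mult_mono)
      also have "\<dots> = e/2"
      proof -
        have "norm a + 1 > 0" by (simp add: add_nonneg_pos)
        then show ?thesis unfolding \<delta>_def by (simp add: field_simps)
      qed
      finally show ?thesis .
    qed
    ultimately show ?thesis unfolding K'_def
      by (intro CollectI exI[of _ "x - r *\<^sub>R a"] exI[of _ "r *\<^sub>R a"]) auto
  qed
  obtain L where L: "L \<ge> 0" "\<And>x y. \<bar>\<psi> x - \<psi> y\<bar> \<le> L * norm (x - y)"
    by (rule test_function_lipschitz[OF t]) blast
  have cpsi: "continuous_on UNIV \<psi>" using test_functionD[OF t] by auto
  have kK': "integrable lebesgue (\<lambda>x. indicator K' x * k x)"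
    using k K' K'U by (auto simp: locally_integrable_on_def set_integrable_def)
  let ?F = "\<lambda>s. LINT x:U|lebesgue. k x * \<psi> (x - s *\<^sub>R a)"
  have int: "set_integrable lebesgue U (\<lambda>x. k x * \<psi> (x - (s + r) *\<^sub>R a))" if "\<bar>r\<bar> \<le> \<delta>" for r
    by (rule integrable_mult_compact_support[OF k K' K'U])
       (use supp that in \<open>auto intro!: continuous_on_compose2[OF cpsi] continuous_intros\<close>)
  define D where "D r x = indicator K' x * k x * ((\<psi> (x - (s + r) *\<^sub>R a) - \<psi> (x - s *\<^sub>R a)) / r)" for r x
  define D0 where "D0 x = indicator K' x * k x * (- (frechet_derivative \<psi> (at (x - s *\<^sub>R a)) a))" for x
  have cont_translate: "(\<lambda>x. \<psi> (x - c)) \<in> borel_measurable lebesgue" for c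
  proof -
    have "(\<lambda>x. \<psi> (x - c)) \<in> borel_measurable borel"
      by (intro borel_measurable_continuous_onI continuous_on_compose2[OF cpsi] continuous_intros) auto
    then show ?thesis by (simp add: measurable_completion)
  qed
  have Dm: "D r \<in> borel_measurable lebesgue" for r
    unfolding D_def[abs_def]
    by (rule borel_measurable_times[OF borel_measurable_integrable[OF kK'] borel_measurable_divide[OF
          borel_measurable_diff[OF cont_translate cont_translate] borel_measurable_const]])
  have der: "(\<psi> has_derivative frechet_derivative \<psi> (at x)) (at x)" for x
    by (rule test_function_has_derivative[OF t])
  have lim: "((\<lambda>r. D r x) \<longlongrightarrow> D0 x) (at 0)" for x
  proof -
    have "((\<lambda>r. x - (s + r) *\<^sub>R a) has_derivative (\<lambda>r. - r *\<^sub>R a)) (at 0)"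
      by (auto intro!: derivative_eq_intros)
    then have "((\<lambda>r. \<psi> (x - (s + r) *\<^sub>R a)) has_derivative (\<lambda>r. frechet_derivative \<psi> (at (x - s *\<^sub>R a)) (- r *\<^sub>R a))) (at 0)"
      using has_derivative_compose[of "\<lambda>r. x - (s + r) *\<^sub>R a" _ 0 UNIV \<psi>] der[of "x - s *\<^sub>R a"] by simp
    moreover have "(\<lambda>r. frechet_derivative \<psi> (at (x - s *\<^sub>R a)) (- r *\<^sub>R a)) = (*) (- frechet_derivative \<psi> (at (x - s *\<^sub>R a)) a)"
    proof
      fix r
      have "linear (frechet_derivative \<psi> (at (x - s *\<^sub>R a)))"
        by (rule has_derivative_linear[OF der])
      from linear_scale[OF this, of "-r" a]
      show "frechet_derivative \<psi> (at (x - s *\<^sub>R a)) (- r *\<^sub>R a) = - frechet_derivative \<psi> (at (x - s *\<^sub>R a)) a * r"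
        by simp
    qed
    ultimately have "((\<lambda>r. \<psi> (x - (s + r) *\<^sub>R a)) has_real_derivative - frechet_derivative \<psi> (at (x - s *\<^sub>R a)) a) (at 0)"
      unfolding has_field_derivative_def by simp
    then show ?thesis
      unfolding D_def D0_def by (intro tendsto_mult tendsto_const) (simp add: DERIV_def)
  qed
  have D0m: "D0 \<in> borel_measurable lebesgue"
  proof (rule borel_measurable_LIMSEQ_metric[where f="\<lambda>n. D (1/real (Suc n))"])
    show "D (1/real (Suc n)) \<in> borel_measurable lebesgue" for n by (rule Dm)
    fix x
    have "filterlim (\<lambda>n. 1/real (Suc n)) (at 0) sequentially"
      using LIMSEQ_inverse_real_of_nat by (auto simp: filterlim_at inverse_eq_divide)
    from filterlim_compose[OF lim this] show "(\<lambda>n. D (1/real (Suc n)) x) \<longlonglongrightarrow> D0 x" .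
  qed
  have "((\<lambda>r. (?F (s + r) - ?F s) / r) \<longlongrightarrow> (\<integral>x. D0 x \<partial>lebesgue)) (at 0)"
    unfolding tendsto_at_iff_sequentially comp_def
  proof (intro allI impI)
    fix X :: "nat \<Rightarrow> real" assume X: "\<forall>i. X i \<in> UNIV - {0}" "X \<longlonglongrightarrow> 0"
    \<comment> \<open>Dominated convergence is applied along an arbitrary null sequence; its first
      \<open>N\<close> terms are dropped so that the supports stay in \<open>K'\<close>.\<close>
    obtain N where N: "\<And>n. n \<ge> N \<Longrightarrow> \<bar>X n\<bar> < \<delta>"
      using X(2) \<delta> unfolding LIMSEQ_def by (force simp: dist_real_def)
    have "(\<lambda>n. \<integral>x. D (X (n + N)) x \<partial>lebesgue) \<longlonglongrightarrow> (\<integral>x. D0 x \<partial>lebesgue)"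
    proof (rule integral_dominated_convergence[where w="\<lambda>x. (L * norm a) * norm (indicator K' x * k x)"])
      show "AE x in lebesgue. (\<lambda>n. D (X (n + N)) x) \<longlonglongrightarrow> D0 x"
      proof (intro AE_I2)
        fix x
        have "filterlim (\<lambda>n. X (n + N)) (at 0) sequentially"
          using X LIMSEQ_ignore_initial_segment[OF X(2), of N] by (auto simp: filterlim_at)
        from filterlim_compose[OF lim this] show "(\<lambda>n. D (X (n + N)) x) \<longlonglongrightarrow> D0 x" .
      qed
      show "AE x in lebesgue. norm (D (X (n + N)) x) \<le> (L * norm a) * norm (indicator K' x * k x)" for n
      proof (intro AE_I2)
        fix x
        let ?r = "X (n + N)"
        have "?r \<noteq> 0" using X by auto
        have "\<bar>\<psi> (x - (s + ?r) *\<^sub>R a) - \<psi> (x - s *\<^sub>R a)\<bar> \<le> L * (\<bar>?r\<bar> * norm a)"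
          using L(2)[of "x - (s + ?r) *\<^sub>R a" "x - s *\<^sub>R a"] by (simp add: algebra_simps)
        then have "\<bar>(\<psi> (x - (s + ?r) *\<^sub>R a) - \<psi> (x - s *\<^sub>R a)) / ?r\<bar> \<le> L * norm a"
          using \<open>?r \<noteq> 0\<close> by (simp add: field_simps)
        then have "norm (indicator K' x * k x) * \<bar>(\<psi> (x - (s + ?r) *\<^sub>R a) - \<psi> (x - s *\<^sub>R a)) / ?r\<bar> \<le> norm (indicator K' x * k x) * (L * norm a)"
          by (rule mult_left_mono) simp
        then show "norm (D ?r x) \<le> (L * norm a) * norm (indicator K' x * k x)"
          unfolding D_def by (simp add: abs_mult mult.commute)
      qed
    qed (use kK' Dm D0m in auto)
    moreover have "(\<integral>x. D (X (n + N)) x \<partial>lebesgue) = (?F (s + X (n + N)) - ?F s) / X (n + N)" for n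
    proof -
      let ?r = "X (n + N)"
      have r: "\<bar>?r\<bar> \<le> \<delta>" using N[of "n + N"] by simp
      have int0: "set_integrable lebesgue U (\<lambda>x. k x * \<psi> (x - s *\<^sub>R a))"
        using int[of 0] \<delta> by simp
      have "?F (s + ?r) - ?F s = (LINT x:U|lebesgue. k x * \<psi> (x - (s + ?r) *\<^sub>R a) - k x * \<psi> (x - s *\<^sub>R a))"
        by (rule set_integral_diff(2)[OF int[OF r] int0, symmetric])
      also have "\<dots> = (\<integral>x. ?r * D ?r x \<partial>lebesgue)"
        unfolding set_lebesgue_integral_def D_def
      proof (rule Bochner_Integration.integral_cong[OF refl])
        fix x
        have r0: "?r \<noteq> 0" using X by auto
        show "indicator U x *\<^sub>R (k x * \<psi> (x - (s + ?r) *\<^sub>R a) - k x * \<psi> (x - s *\<^sub>R a))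
          = ?r * (indicator K' x * k x * ((\<psi> (x - (s + ?r) *\<^sub>R a) - \<psi> (x - s *\<^sub>R a)) / ?r))"
        proof (cases "x \<in> K'")
          case True
          then have "x \<in> U" using K'U by blast
          with True show ?thesis using r0 by (simp add: field_simps)
        next
          case False
          have "\<psi> (x - (s + ?r) *\<^sub>R a) = 0" using supp[OF _ r, of x] False by blast
          moreover have "\<psi> (x - s *\<^sub>R a) = 0" using supp[of x 0] False \<delta> by auto
          ultimately show ?thesis by simp
        qed
      qed
      also have "\<dots> = ?r * (\<integral>x. D ?r x \<partial>lebesgue)" by simp
      finally have "?F (s + ?r) - ?F s = ?r * (\<integral>x. D ?r x \<partial>lebesgue)" .
      moreover have "?r \<noteq> 0" using X by auto
      ultimately show ?thesis by simp
    qed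
    ultimately have "(\<lambda>n. (?F (s + X (n + N)) - ?F s) / X (n + N)) \<longlonglongrightarrow> (\<integral>x. D0 x \<partial>lebesgue)" by simp
    then show "(\<lambda>n. (?F (s + X n) - ?F s) / X n) \<longlonglongrightarrow> (\<integral>x. D0 x \<partial>lebesgue)"
      by (rule LIMSEQ_offset)
  qed
  moreover have "(\<integral>x. D0 x \<partial>lebesgue) = (\<Sum>i\<in>UNIV. a $ i * (LINT x:U|lebesgue. g i x * \<psi> (x - s *\<^sub>R a)))"
  proof -
    let ?p = "\<lambda>i x. frechet_derivative (\<lambda>x. \<psi> (x - s *\<^sub>R a)) (at x) (axis i 1)"
    have tp: "test_function U (?p i)" for i by (rule test_function_partial[OF ts])
    have "D0 x = indicator U x *\<^sub>R (\<Sum>i\<in>UNIV. - a $ i * (k x * ?p i x))" for x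
    proof -
      have lin: "linear (frechet_derivative \<psi> (at (x - s *\<^sub>R a)))"
        using der has_derivative_linear by blast
      have "a = (\<Sum>i\<in>UNIV. a $ i *\<^sub>R axis i 1)"
        using basis_expansion[of a] by (simp add: scalar_mult_eq_scaleR)
      then have "frechet_derivative \<psi> (at (x - s *\<^sub>R a)) a = frechet_derivative \<psi> (at (x - s *\<^sub>R a)) (\<Sum>i\<in>UNIV. a $ i *\<^sub>R axis i 1)"
        by simp
      then have fa: "frechet_derivative \<psi> (at (x - s *\<^sub>R a)) a = (\<Sum>i\<in>UNIV. a $ i * ?p i x)"
        by (simp add: linear_sum[OF lin] linear_scale[OF lin] frechet_derivative_translate[OF t])
      have "?p i x = 0" if "x \<notin> K'" for i
      proof -
        have "((\<lambda>x. 0) has_derivative (\<lambda>h. 0)) (at x)" by simp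
        then have "((\<lambda>x. \<psi> (x - s *\<^sub>R a)) has_derivative (\<lambda>h. 0)) (at x)"
          by (rule has_derivative_transform_within_open[where s="-K'"])
             (use that supp[of _ 0] \<delta> K' in \<open>auto intro: open_Compl compact_imp_closed\<close>)
        then show ?thesis by (simp add: frechet_derivative_at[symmetric])
      qed
      then show ?thesis
        unfolding D0_def fa using K'U
        by (cases "x \<in> K'") (auto simp: indicator_def sum_distrib_left sum_negf[symmetric] mult_ac)
    qed
    then have "(\<integral>x. D0 x \<partial>lebesgue) = (LINT x:U|lebesgue. (\<Sum>i\<in>UNIV. - a $ i * (k x * ?p i x)))"
      by (simp add: set_lebesgue_integral_def)
    also have "\<dots> = (\<Sum>i\<in>UNIV. LINT x:U|lebesgue. - a $ i * (k x * ?p i x))"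
    proof -
      have "integrable lebesgue (\<lambda>x. indicator U x *\<^sub>R (- a $ i * (k x * ?p i x)))" for i
        using set_integrable_mult_right[OF set_integrable_mult_test[OF k tp], of "- a $ i" i]
        by (simp add: set_integrable_def)
      then show ?thesis
        unfolding set_lebesgue_integral_def scaleR_sum_right by (intro Bochner_Integration.integral_sum)
    qed
    also have "\<dots> = (\<Sum>i\<in>UNIV. a $ i * (LINT x:U|lebesgue. g i x * \<psi> (x - s *\<^sub>R a)))"
    proof (rule sum.cong[OF refl])
      fix i
      have "(LINT x:U|lebesgue. k x * ?p i x) = - (LINT x:U|lebesgue. g i x * \<psi> (x - s *\<^sub>R a))"
        using g[of i] ts by (simp add: has_weak_partial_def)
      then show "(LINT x:U|lebesgue. - a $ i * (k x * ?p i x)) = a $ i * (LINT x:U|lebesgue. g i x * \<psi> (x - s *\<^sub>R a))"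
        by (simp only: set_integral_mult_right)
    qed
    finally show ?thesis .
  qed
  ultimately show ?thesis by (simp add: DERIV_def)
qed

lemma set_integrable_continuous_compact_support:
  fixes \<phi> :: "real^'d \<Rightarrow> real"
  assumes "compact K" "K \<subseteq> U" "continuous_on UNIV \<phi>" "\<And>x. \<phi> x \<noteq> 0 \<Longrightarrow> x \<in> K"
  shows "set_integrable lebesgue U \<phi>" "integrable lebesgue \<phi>" "(LINT x:U|lebesgue. \<phi> x) = (\<integral>x. \<phi> x \<partial>lebesgue)"
proof -
  have eq: "indicator U x *\<^sub>R \<phi> x = \<phi> x" for x
    using assms(2) assms(4)[of x] by (auto simp: indicator_def)
  show U: "set_integrable lebesgue U \<phi>"
    using integrable_mult_compact_support[OF locally_integrable_on_const[where c=1 and U=U] assms] by simp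
  show "integrable lebesgue \<phi>" using U unfolding set_integrable_def eq .
  show "(LINT x:U|lebesgue. \<phi> x) = (\<integral>x. \<phi> x \<partial>lebesgue)" unfolding set_lebesgue_integral_def eq ..
qed

lemma abs_integral_mult_le:
  fixes f \<phi> :: "real^'d \<Rightarrow> real"
  assumes f: "locally_integrable_on f U" and B: "AE x in lebesgue. x \<in> U \<longrightarrow> \<bar>f x\<bar> \<le> B"
    and K: "compact K" "K \<subseteq> U" "continuous_on UNIV \<phi>" "\<And>x. \<phi> x \<noteq> 0 \<Longrightarrow> x \<in> K" and pos: "\<And>x. 0 \<le> \<phi> x"
  shows "\<bar>LINT x:U|lebesgue. f x * \<phi> x\<bar> \<le> B * (\<integral>x. \<phi> x \<partial>lebesgue)"
proof -
  have int: "integrable lebesgue (\<lambda>x. indicator U x *\<^sub>R (f x * \<phi> x))"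
    using integrable_mult_compact_support[OF f K] by (simp add: set_integrable_def)
  have "\<bar>LINT x:U|lebesgue. f x * \<phi> x\<bar> \<le> (\<integral>x. \<bar>indicator U x *\<^sub>R (f x * \<phi> x)\<bar> \<partial>lebesgue)"
    unfolding set_lebesgue_integral_def by (rule integral_abs_bound)
  also have "\<dots> \<le> (\<integral>x. B * \<phi> x \<partial>lebesgue)"
  proof (rule integral_mono_AE)
    show "integrable lebesgue (\<lambda>x. \<bar>indicator U x *\<^sub>R (f x * \<phi> x)\<bar>)" using int by (rule integrable_abs)
    show "integrable lebesgue (\<lambda>x. B * \<phi> x)"
      using set_integrable_continuous_compact_support(2)[OF K] by simp
    show "AE x in lebesgue. \<bar>indicator U x *\<^sub>R (f x * \<phi> x)\<bar> \<le> B * \<phi> x"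
      using B
    proof eventually_elim
      case (elim x)
      show ?case
      proof (cases "x \<in> U")
        case True
        then show ?thesis using elim pos[of x] by (simp add: abs_mult mult_right_mono)
      next
        case False
        then have "\<phi> x = 0" using K(2,4) by blast
        then show ?thesis by simp
      qed
    qed
  qed
  also have "\<dots> = B * (\<integral>x. \<phi> x \<partial>lebesgue)" by simp
  finally show ?thesis .
qed

text \<open>Outside \<open>U\<close> the values of \<open>k\<close> are arbitrary; the support of
  \<psi> inside \<open>W\<close> confines both integrals to points whose shifted argument lies in
  \<open>U\<close>.\<close>

lemma integral_shift:
  fixes k :: "real^'d \<Rightarrow> real"
  assumes k: "locally_integrable_on k U" and WU: "\<And>x. x \<in> W \<Longrightarrow> x + b \<in> U"
  shows "locally_integrable_on (\<lambda>x. k (x + b)) W"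
    and "test_function W \<psi> \<Longrightarrow> (LINT x:W|lebesgue. k (x + b) * \<psi> x) = (LINT x:U|lebesgue. k x * \<psi> (x - b))"
proof -
  show "locally_integrable_on (\<lambda>x. k (x + b)) W"
    unfolding locally_integrable_on_def
  proof (intro allI impI)
    fix K assume K: "compact K \<and> K \<subseteq> W"
    define K' where "K' = (\<lambda>x. x + b) ` K"
    have "compact K'" "K' \<subseteq> U"
      unfolding K'_def using K WU by (auto intro!: compact_continuous_image continuous_intros)
    then have "integrable lebesgue (\<lambda>x. indicator K' x * k x)"
      using k by (auto simp: locally_integrable_on_def set_integrable_def)
    then have "integrable lebesgue (\<lambda>x. indicator K' (b + 1 *\<^sub>R x) * k (b + 1 *\<^sub>R x))"
      by (rule integrable_lebesgue_pm_one[rotated]) simp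
    moreover have "indicator K' (b + x) * k (b + x) = indicator K x *\<^sub>R k (x + b)" for x
    proof -
      have "b + x \<in> K' \<longleftrightarrow> x \<in> K" by (auto simp: K'_def add.commute)
      then show ?thesis by (simp add: indicator_def add.commute)
    qed
    ultimately show "set_integrable lebesgue K (\<lambda>x. k (x + b))" by (simp add: set_integrable_def)
  qed
  assume t: "test_function W \<psi>"
  obtain K where K: "compact K" "K \<subseteq> W" "\<And>x. \<psi> x \<noteq> 0 \<Longrightarrow> x \<in> K"
    using test_functionD[OF t] by auto
  have "test_function U (\<lambda>x. \<psi> (x - b))"
    by (rule test_function_translate[OF t K(3,1)]) (use K(2) WU in auto)
  then have int: "integrable lebesgue (\<lambda>x. indicator U x *\<^sub>R (k x * \<psi> (x - b)))"
    using set_integrable_mult_test[OF k] by (simp add: set_integrable_def)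
  have "(LINT x:W|lebesgue. k (x + b) * \<psi> x) = (\<integral>x. indicator U (b + 1 *\<^sub>R x) *\<^sub>R (k (b + 1 *\<^sub>R x) * \<psi> (b + 1 *\<^sub>R x - b)) \<partial>lebesgue)"
    unfolding set_lebesgue_integral_def
  proof (rule Bochner_Integration.integral_cong[OF refl])
    fix x
    show "indicator W x *\<^sub>R (k (x + b) * \<psi> x) = indicator U (b + 1 *\<^sub>R x) *\<^sub>R (k (b + 1 *\<^sub>R x) * \<psi> (b + 1 *\<^sub>R x - b))"
    proof (cases "\<psi> x = 0")
      case False
      then have "x \<in> W" using K(2,3) by blast
      then have "x \<in> W" "b + x \<in> U" using WU[of x] by (auto simp: add.commute)
      then show ?thesis by (simp add: add.commute)
    qed simp
  qed
  also have "\<dots> = (LINT x:U|lebesgue. k x * \<psi> (x - b))"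
    unfolding set_lebesgue_integral_def
    by (rule integral_lebesgue_pm_one[OF _ int]) simp
  finally show "(LINT x:W|lebesgue. k (x + b) * \<psi> x) = (LINT x:U|lebesgue. k x * \<psi> (x - b))" .
qed

lemma locally_integrable_on_sum:
  "(\<And>i. i \<in> I \<Longrightarrow> locally_integrable_on (f i) U) \<Longrightarrow> locally_integrable_on (\<lambda>x. \<Sum>i\<in>I. f i x) U"
  unfolding locally_integrable_on_def set_integrable_def scaleR_sum_right
  by (intro allI impI Bochner_Integration.integrable_sum) auto

text \<open>Both difference bounds are obtained by testing with a nonnegative \<open>\<psi>\<close>: the translates
  \<open>t \<mapsto> \<integral> k(x) \<psi>(x - t a)\<close> are differentiable by the definition of the weak derivative.\<close>

lemma weak_directional_derivative_bound:
  fixes k :: "real^'d \<Rightarrow> real"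
  assumes U: "open U" and g: "\<And>i. has_weak_partial U i k (g i)"
    and B: "AE x in lebesgue. x \<in> U \<longrightarrow> \<bar>\<Sum>i\<in>UNIV. a $ i * g i x\<bar> \<le> B"
    and t: "test_function V \<psi>" and pos: "\<And>x. 0 \<le> \<psi> x" and VU: "\<And>x. x \<in> V \<Longrightarrow> x + s *\<^sub>R a \<in> U"
  defines "D \<equiv> \<lambda>s. \<Sum>i\<in>UNIV. a $ i * (LINT x:U|lebesgue. g i x * \<psi> (x - s *\<^sub>R a))"
  shows "((\<lambda>s. LINT x:U|lebesgue. k x * \<psi> (x - s *\<^sub>R a)) has_real_derivative D s) (at s)"
    and "\<bar>D s\<bar> \<le> B * (\<integral>x. \<psi> x \<partial>lebesgue)"
proof -
  obtain K where K: "compact K" "K \<subseteq> V" "\<And>x. \<psi> x \<noteq> 0 \<Longrightarrow> x \<in> K" "continuous_on UNIV \<psi>"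
    using test_functionD[OF t] by auto
  show "((\<lambda>s. LINT x:U|lebesgue. k x * \<psi> (x - s *\<^sub>R a)) has_real_derivative D s) (at s)"
    unfolding D_def
    by (rule weak_directional_derivative_integral[OF U g t K(1,3)]) (use K VU in auto)
  have "test_function U (\<lambda>x. \<psi> (x - s *\<^sub>R a))"
    by (rule test_function_translate[OF t K(3,1)]) (use K(2) VU in auto)
  from test_functionD[OF this] obtain K' where K': "compact K'" "K' \<subseteq> U" "continuous_on UNIV (\<lambda>x. \<psi> (x - s *\<^sub>R a))"
      "\<And>x. \<psi> (x - s *\<^sub>R a) \<noteq> 0 \<Longrightarrow> x \<in> K'"
    by auto
  have li: "locally_integrable_on (g i) U" for i using g by (simp add: has_weak_partial_def)
  have "(LINT x:U|lebesgue. (\<Sum>i\<in>UNIV. a $ i * g i x) * \<psi> (x - s *\<^sub>R a)) =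
      (LINT x:U|lebesgue. (\<Sum>i\<in>UNIV. a $ i * (g i x * \<psi> (x - s *\<^sub>R a))))"
    by (simp add: sum_distrib_right mult.assoc)
  also have "\<dots> = (\<Sum>i\<in>UNIV. LINT x:U|lebesgue. a $ i * (g i x * \<psi> (x - s *\<^sub>R a)))"
  proof -
    have "integrable lebesgue (\<lambda>x. indicator U x *\<^sub>R (a $ i * (g i x * \<psi> (x - s *\<^sub>R a))))" for i
      using set_integrable_mult_right[OF integrable_mult_compact_support[OF li K'], of "a $ i" i]
      by (simp add: set_integrable_def)
    then show ?thesis
      unfolding set_lebesgue_integral_def scaleR_sum_right by (intro Bochner_Integration.integral_sum)
  qed
  also have "\<dots> = D s" unfolding D_def by (simp only: set_integral_mult_right)
  finally have D: "D s = (LINT x:U|lebesgue. (\<Sum>i\<in>UNIV. a $ i * g i x) * \<psi> (x - s *\<^sub>R a))" ..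
  have "locally_integrable_on (\<lambda>x. \<Sum>i\<in>UNIV. a $ i * g i x) U"
    by (intro locally_integrable_on_sum locally_integrable_on_cmult li)
  then have "\<bar>D s\<bar> \<le> B * (\<integral>x. \<psi> (x - s *\<^sub>R a) \<partial>lebesgue)"
    unfolding D by (rule abs_integral_mult_le[OF _ B K' pos])
  also have "(\<integral>x. \<psi> (x - s *\<^sub>R a) \<partial>lebesgue) = (\<integral>x. \<psi> x \<partial>lebesgue)"
    using integral_lebesgue_pm_one[of 1 \<psi> "- (s *\<^sub>R a)"] set_integrable_continuous_compact_support(2)[OF K(1,2,4,3)]
    by simp
  finally show "\<bar>D s\<bar> \<le> B * (\<integral>x. \<psi> x \<partial>lebesgue)" .
qed

section \<open>First and second differences of Sobolev functions\<close>

lemma convex_line: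
  assumes "convex U" "x + s *\<^sub>R a \<in> U" "x + t *\<^sub>R a \<in> U" "s \<le> r" "r \<le> t"
  shows "x + r *\<^sub>R a \<in> U"
proof (cases "s = t")
  case False
  define u where "u = (r - s) / (t - s)"
  have u: "0 \<le> u" "u \<le> 1" using assms False by (auto simp: u_def field_simps)
  have "(1 - u) *\<^sub>R (x + s *\<^sub>R a) + u *\<^sub>R (x + t *\<^sub>R a) = x + (s + u * (t - s)) *\<^sub>R a"
    by (simp add: algebra_simps)
  also have "s + u * (t - s) = r" using False by (simp add: u_def)
  finally show ?thesis using convexD_alt[OF assms(1-3) u] by simp
qed (use assms in auto)

text \<open>Tested with \<psi>, the difference is F 1 - F 0 for a function \<open>F\<close> of the
  translation parameter, and the mean value theorem bounds it by the derivative of \<open>F\<close>.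
  Convexity keeps all intermediate translates inside \<open>U\<close>. The exceptional null set
  still depends on \<open>a\<close>.\<close>

lemma AE_difference_bound:
  fixes k :: "real^'d \<Rightarrow> real"
  assumes U: "open U" "convex U" and g: "\<And>i. has_weak_partial U i k (g i)"
    and G: "AE x in lebesgue. x \<in> U \<longrightarrow> norm (\<chi> i. g i x) \<le> G"
  shows "AE x in lebesgue. x \<in> U \<and> x + a \<in> U \<longrightarrow> \<bar>k (x + a) - k x\<bar> \<le> G * norm a"
proof -
  define W where "W = {x. x \<in> U \<and> x + a \<in> U}"
  have W: "open W"
  proof -
    have "open ((\<lambda>x. x + a) -` U)" by (intro open_vimage U continuous_intros)
    moreover have "W = U \<inter> (\<lambda>x. x + a) -` U" by (auto simp: W_def)
    ultimately show ?thesis using U by auto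
  qed
  have k: "locally_integrable_on k U" using g by (simp add: has_weak_partial_def)
  have lW: "locally_integrable_on k W" "locally_integrable_on (\<lambda>x. k (x + a)) W"
    using k integral_shift(1)[OF k, of W a] by (auto simp: W_def intro: locally_integrable_on_mono)
  have B: "AE x in lebesgue. x \<in> U \<longrightarrow> \<bar>\<Sum>i\<in>UNIV. a $ i * g i x\<bar> \<le> G * norm a"
    using G
  proof eventually_elim
    case (elim x)
    have "\<bar>a \<bullet> (\<chi> i. g i x)\<bar> \<le> norm a * norm (\<chi> i. g i x)" by (rule Cauchy_Schwarz_ineq2)
    also have "\<dots> \<le> G * norm a" if "x \<in> U"
      using elim that mult_left_mono[of "norm (\<chi> i. g i x)" G "norm a"] by (simp add: mult.commute)
    finally show ?case by (auto simp: inner_vec_def)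
  qed
  have c: "AE x in lebesgue. x \<in> W \<longrightarrow> 0 \<le> G * norm a - c * (k (x + a) - k x)"
    if c: "c = 1 \<or> c = (-1::real)" for c
  proof (rule nonneg_AE_of_test_integrals[OF W])
    show "locally_integrable_on (\<lambda>x. G * norm a - c * (k (x + a) - k x)) W"
      by (intro locally_integrable_on_diff locally_integrable_on_const locally_integrable_on_cmult lW)
    fix \<psi> :: "real^'d \<Rightarrow> real" assume t: "test_function W \<psi>" and pos: "\<And>x. 0 \<le> \<psi> x"
    obtain K where K: "compact K" "K \<subseteq> W" "continuous_on UNIV \<psi>" "\<And>x. \<psi> x \<noteq> 0 \<Longrightarrow> x \<in> K"
      using test_functionD[OF t] by auto
    define F where "F s = (LINT x:U|lebesgue. k x * \<psi> (x - s *\<^sub>R a))" for s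
    define D where "D s = (\<Sum>i\<in>UNIV. a $ i * (LINT x:U|lebesgue. g i x * \<psi> (x - s *\<^sub>R a)))" for s
    have WU: "x + s *\<^sub>R a \<in> U" if "x \<in> W" "0 \<le> s" "s \<le> 1" for x s
      using convex_line[OF U(2), of x 0 a 1 s] that by (simp add: W_def)
    have der: "(F has_real_derivative D s) (at s)" "\<bar>D s\<bar> \<le> G * norm a * (\<integral>x. \<psi> x \<partial>lebesgue)" if "0 \<le> s" "s \<le> 1" for s
      unfolding F_def[abs_def] D_def
      using weak_directional_derivative_bound[OF U(1) g B t pos WU] that by auto
    have "\<exists>z>0. z < 1 \<and> F 1 - F 0 = (1 - 0) * D z" by (rule MVT2) (use der in auto)
    then obtain z where z: "0 < z" "z < 1" "F 1 - F 0 = D z" by auto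
    have I: "integrable lebesgue (\<lambda>x. indicator W x *\<^sub>R \<psi> x)" "(LINT x:W|lebesgue. \<psi> x) = (\<integral>x. \<psi> x \<partial>lebesgue)"
      using set_integrable_continuous_compact_support[OF K] by (auto simp: set_integrable_def)
    have i1: "set_integrable lebesgue W (\<lambda>x. k (x + a) * \<psi> x)" "set_integrable lebesgue W (\<lambda>x. k x * \<psi> x)"
      by (rule set_integrable_mult_test[OF _ t], rule lW)+
    have "(LINT x:W|lebesgue. k (x + a) * \<psi> x) = F 1"
      unfolding F_def using integral_shift(2)[OF k _ t, of a] by (simp add: W_def)
    moreover have "(LINT x:W|lebesgue. k x * \<psi> x) = F 0"
      unfolding F_def using integral_shift(2)[OF k _ t, of 0] by (simp add: W_def)
    ultimately have "(LINT x:W|lebesgue. (G * norm a - c * (k (x + a) - k x)) * \<psi> x)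
        = G * norm a * (\<integral>x. \<psi> x \<partial>lebesgue) - c * (F 1 - F 0)"
      using i1 I by (simp add: set_integrable_def set_lebesgue_integral_def algebra_simps)
    moreover have "c * (F 1 - F 0) \<le> \<bar>D z\<bar>" using c z by auto
    ultimately show "0 \<le> (LINT x:W|lebesgue. (G * norm a - c * (k (x + a) - k x)) * \<psi> x)"
      using der(2)[of z] z by simp
  qed
  have "AE x in lebesgue. x \<in> W \<longrightarrow> 0 \<le> G * norm a - 1 * (k (x + a) - k x)"
    "AE x in lebesgue. x \<in> W \<longrightarrow> 0 \<le> G * norm a - (-1) * (k (x + a) - k x)"
    by (rule c, simp)+
  then show ?thesis
    by eventually_elim (auto simp: W_def abs_le_iff)
qed

text \<open>The norm of a matrix as a nested vector is the Frobenius norm, which dominates the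
  operator norm.\<close>

lemma abs_quadratic_form_le:
  fixes M :: "real^'d^'d"
  shows "\<bar>\<Sum>j\<in>UNIV. a $ j * (\<Sum>i\<in>UNIV. a $ i * M $ i $ j)\<bar> \<le> norm M * (norm a)\<^sup>2"
proof -
  have "(\<Sum>j\<in>UNIV. a $ j * (\<Sum>i\<in>UNIV. a $ i * M $ i $ j)) = a \<bullet> (\<chi> i. M $ i \<bullet> a)"
    by (simp add: inner_vec_def sum_distrib_left, subst sum.swap, simp add: mult_ac)
  also have "\<bar>\<dots>\<bar> \<le> norm a * norm (\<chi> i. M $ i \<bullet> a)" by (rule Cauchy_Schwarz_ineq2)
  also have "\<dots> \<le> norm a * (norm M * norm a)"
  proof (rule mult_left_mono)
    have "norm (\<chi> i. M $ i \<bullet> a) \<le> L2_set (\<lambda>i. norm (M $ i) * norm a) UNIV"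
      unfolding norm_vec_def[of "\<chi> i. M $ i \<bullet> a"]
      by (rule L2_set_mono) (simp_all add: Cauchy_Schwarz_ineq2)
    also have "\<dots> = norm M * norm a"
      unfolding norm_vec_def[of M] by (rule L2_set_left_distrib[symmetric]) simp
    finally show "norm (\<chi> i. M $ i \<bullet> a) \<le> norm M * norm a" .
  qed simp
  finally show ?thesis by (simp add: power2_eq_square mult_ac)
qed

text \<open>The mean value theorem is applied twice, to F s + F (-s) on (0, 1) and then to
  \<open>D\<close> on (-z, z); the tested second difference becomes 2 z E w. The factor 2 is the
  bound of 2 z by 2.\<close>

lemma AE_second_difference_bound:
  fixes k :: "real^'d \<Rightarrow> real"
  assumes U: "open U" "convex U" and g: "\<And>i. has_weak_partial U i k (g i)"
    and h: "\<And>i j. has_weak_partial U i (g j) (h i j)"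
    and G: "AE x in lebesgue. x \<in> U \<longrightarrow> norm (\<chi> i j. h i j x) \<le> B"
  shows "AE x in lebesgue. x \<in> U \<and> x + a \<in> U \<and> x - a \<in> U \<longrightarrow>
     \<bar>k (x + a) + k (x - a) - 2 * k x\<bar> \<le> 2 * B * (norm a)\<^sup>2"
proof -
  define W where "W = {x. x \<in> U \<and> x + a \<in> U \<and> x - a \<in> U}"
  have W: "open W"
  proof -
    have "open ((\<lambda>x. x + a) -` U)" "open ((\<lambda>x. x - a) -` U)" by (intro open_vimage U continuous_intros)+
    moreover have "W = U \<inter> (\<lambda>x. x + a) -` U \<inter> (\<lambda>x. x - a) -` U" by (auto simp: W_def)
    ultimately show ?thesis using U by auto
  qed
  have k: "locally_integrable_on k U" using g by (simp add: has_weak_partial_def)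
  have lW: "locally_integrable_on k W" "locally_integrable_on (\<lambda>x. k (x + a)) W" "locally_integrable_on (\<lambda>x. k (x - a)) W"
    using k integral_shift(1)[OF k, of W a] integral_shift(1)[OF k, of W "-a"] by (auto simp: W_def intro: locally_integrable_on_mono)
  have bd: "AE x in lebesgue. x \<in> U \<longrightarrow> \<bar>\<Sum>i\<in>UNIV. a $ i * (\<Sum>j\<in>UNIV. a $ j * h i j x)\<bar> \<le> B * (norm a)\<^sup>2"
    using G
  proof eventually_elim
    case (elim x)
    have "\<bar>\<Sum>j\<in>UNIV. a $ j * (\<Sum>i\<in>UNIV. a $ i * (\<chi> i j. h i j x) $ i $ j)\<bar> \<le> norm (\<chi> i j. h i j x) * (norm a)\<^sup>2"
      by (rule abs_quadratic_form_le)
    also have "\<dots> \<le> B * (norm a)\<^sup>2" if "x \<in> U"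
      using elim that by (auto intro: mult_right_mono)
    also have "(\<Sum>j\<in>UNIV. a $ j * (\<Sum>i\<in>UNIV. a $ i * (\<chi> i j. h i j x) $ i $ j)) = (\<Sum>i\<in>UNIV. a $ i * (\<Sum>j\<in>UNIV. a $ j * h i j x))"
      by (simp add: sum_distrib_left, subst sum.swap, simp add: mult_ac)
    finally show ?case by auto
  qed
  \<comment> \<open>The directional derivative of \<open>k\<close> along \<open>a\<close> is again
    weakly differentiable, so \<open>weak_directional_derivative_bound\<close> can be applied to
    it.\<close>
  have gsum: "has_weak_partial U i (\<lambda>x. \<Sum>j\<in>UNIV. a $ j * g j x) (\<lambda>x. \<Sum>j\<in>UNIV. a $ j * h i j x)" for i
    unfolding has_weak_partial_def
  proof (intro conjI allI impI)
    have li: "locally_integrable_on (g j) U" "locally_integrable_on (h i j) U" for j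
      using h by (auto simp: has_weak_partial_def)
    show "locally_integrable_on (\<lambda>x. \<Sum>j\<in>UNIV. a $ j * g j x) U" "locally_integrable_on (\<lambda>x. \<Sum>j\<in>UNIV. a $ j * h i j x) U"
      by (intro locally_integrable_on_sum locally_integrable_on_cmult li)+
    fix \<psi> :: "real^'d \<Rightarrow> real" assume t: "test_function U \<psi>"
    have lin: "(LINT x:U|lebesgue. (\<Sum>j\<in>UNIV. a $ j * f j x) * \<phi> x) = (\<Sum>j\<in>UNIV. a $ j * (LINT x:U|lebesgue. f j x * \<phi> x))"
      if f: "\<And>j. locally_integrable_on (f j) U" and \<phi>: "test_function U \<phi>" for f :: "'d \<Rightarrow> real^'d \<Rightarrow> real" and \<phi>
    proof -
      have "integrable lebesgue (\<lambda>x. indicator U x *\<^sub>R (a $ j * (f j x * \<phi> x)))" for j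
        using set_integrable_mult_right[OF set_integrable_mult_test[OF f \<phi>], of "a $ j" j]
        by (simp add: set_integrable_def)
      then have "(LINT x:U|lebesgue. (\<Sum>j\<in>UNIV. a $ j * (f j x * \<phi> x))) = (\<Sum>j\<in>UNIV. LINT x:U|lebesgue. a $ j * (f j x * \<phi> x))"
        unfolding set_lebesgue_integral_def scaleR_sum_right by (intro Bochner_Integration.integral_sum)
      then show ?thesis by (simp add: sum_distrib_right mult.assoc)
    qed
    have "(LINT x:U|lebesgue. g j x * frechet_derivative \<psi> (at x) (axis i 1)) = - (LINT x:U|lebesgue. h i j x * \<psi> x)" for j
      using h t by (simp add: has_weak_partial_def)
    then show "(LINT x:U|lebesgue. (\<Sum>j\<in>UNIV. a $ j * g j x) * frechet_derivative \<psi> (at x) (axis i 1))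
        = - (LINT x:U|lebesgue. (\<Sum>j\<in>UNIV. a $ j * h i j x) * \<psi> x)"
      unfolding lin[OF li(1) test_function_partial[OF t]] lin[OF li(2) t]
      by (simp add: sum_negf[symmetric])
  qed
  have c: "AE x in lebesgue. x \<in> W \<longrightarrow> 0 \<le> 2 * B * (norm a)\<^sup>2 - c * (k (x + a) + k (x - a) - 2 * k x)"
    if c: "c = 1 \<or> c = (-1::real)" for c
  proof (rule nonneg_AE_of_test_integrals[OF W])
    show "locally_integrable_on (\<lambda>x. 2 * B * (norm a)\<^sup>2 - c * (k (x + a) + k (x - a) - 2 * k x)) W"
      using locally_integrable_on_diff[OF locally_integrable_on_const locally_integrable_on_cmult[OF
        locally_integrable_on_diff[OF locally_integrable_on_diff[OF lW(2) locally_integrable_on_cmult[OF lW(3), of "-1"]]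
          locally_integrable_on_cmult[OF lW(1), of 2]], of c], of "2 * B * (norm a)\<^sup>2"]
      by simp
    fix \<psi> :: "real^'d \<Rightarrow> real" assume t: "test_function W \<psi>" and pos: "\<And>x. 0 \<le> \<psi> x"
    obtain K where K: "compact K" "K \<subseteq> W" "continuous_on UNIV \<psi>" "\<And>x. \<psi> x \<noteq> 0 \<Longrightarrow> x \<in> K"
      using test_functionD[OF t] by auto
    define I where "I = (\<integral>x. \<psi> x \<partial>lebesgue)"
    define F where "F s = (LINT x:U|lebesgue. k x * \<psi> (x - s *\<^sub>R a))" for s
    define D where "D s = (LINT x:U|lebesgue. (\<Sum>j\<in>UNIV. a $ j * g j x) * \<psi> (x - s *\<^sub>R a))" for s
    define E where "E s = (\<Sum>i\<in>UNIV. a $ i * (LINT x:U|lebesgue. (\<Sum>j\<in>UNIV. a $ j * h i j x) * \<psi> (x - s *\<^sub>R a)))" for s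
    have WU: "x + s *\<^sub>R a \<in> U" if "x \<in> W" "-1 \<le> s" "s \<le> 1" for x s
      using convex_line[OF U(2), of x "-1" a 1 s] that by (simp add: W_def)
    have li: "locally_integrable_on (g j) U" for j using h by (auto simp: has_weak_partial_def)
    have derF: "(F has_real_derivative D s) (at s)" if s: "-1 \<le> s" "s \<le> 1" for s
    proof -
      have ts: "test_function U (\<lambda>x. \<psi> (x - s *\<^sub>R a))"
        by (rule test_function_translate[OF t K(4,1)]) (use K(2) WU s in auto)
      have "integrable lebesgue (\<lambda>x. indicator U x *\<^sub>R (a $ j * (g j x * \<psi> (x - s *\<^sub>R a))))" for j
        using set_integrable_mult_right[OF set_integrable_mult_test[OF li ts], of "a $ j" j]
        by (simp add: set_integrable_def)
      then have "(LINT x:U|lebesgue. (\<Sum>j\<in>UNIV. a $ j * (g j x * \<psi> (x - s *\<^sub>R a)))) = (\<Sum>j\<in>UNIV. LINT x:U|lebesgue. a $ j * (g j x * \<psi> (x - s *\<^sub>R a)))"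
        unfolding set_lebesgue_integral_def scaleR_sum_right by (intro Bochner_Integration.integral_sum)
      then have "D s = (\<Sum>j\<in>UNIV. a $ j * (LINT x:U|lebesgue. g j x * \<psi> (x - s *\<^sub>R a)))"
        by (simp add: D_def sum_distrib_right mult.assoc)
      then show ?thesis
        unfolding F_def[abs_def]
        using weak_directional_derivative_integral[OF U(1) g t K(1,4), where s=s and a=a] K(2) WU s by auto
    qed
    have derD: "(D has_real_derivative E s) (at s)" "\<bar>E s\<bar> \<le> B * (norm a)\<^sup>2 * I" if "-1 \<le> s" "s \<le> 1" for s
      unfolding D_def[abs_def] E_def I_def
      using weak_directional_derivative_bound[OF U(1) gsum bd t pos WU] that by auto
    have "\<exists>z>0. z < 1 \<and> (\<lambda>s. F s + F (-s)) 1 - (\<lambda>s. F s + F (-s)) 0 = (1 - 0) * (\<lambda>s. D s - D (-s)) z"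
    proof (rule MVT2)
      fix s :: real assume s: "0 \<le> s" "s \<le> 1"
      have "((\<lambda>s. F (-s)) has_real_derivative D (-s) * (-1)) (at s)"
        by (rule DERIV_chain2[OF derF]) (use s in \<open>auto intro!: derivative_eq_intros\<close>)
      from DERIV_add[OF derF this] show "((\<lambda>s. F s + F (-s)) has_real_derivative D s - D (-s)) (at s)"
        using s by simp
    qed simp
    then obtain z where z: "0 < z" "z < 1" "F 1 + F (-1) - 2 * F 0 = D z - D (-z)" by auto
    have "\<exists>w>-z. w < z \<and> D z - D (-z) = (z - (-z)) * E w"
      by (rule MVT2) (use derD z in auto)
    then obtain w where w: "-z < w" "w < z" "D z - D (-z) = (z - (-z)) * E w" by auto
    have Dbound: "\<bar>F 1 + F (-1) - 2 * F 0\<bar> \<le> 2 * B * (norm a)\<^sup>2 * I"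
    proof -
      have "\<bar>F 1 + F (-1) - 2 * F 0\<bar> = 2 * z * \<bar>E w\<bar>" using z w by (simp add: abs_mult)
      also have "\<dots> \<le> 2 * 1 * \<bar>E w\<bar>" using z by (intro mult_right_mono mult_left_mono) auto
      also have "\<dots> \<le> 2 * 1 * (B * (norm a)\<^sup>2 * I)" using derD(2)[of w] w z by auto
      finally show ?thesis by simp
    qed
    have I: "integrable lebesgue (\<lambda>x. indicator W x *\<^sub>R \<psi> x)" "(LINT x:W|lebesgue. \<psi> x) = I"
      using set_integrable_continuous_compact_support[OF K] by (auto simp: set_integrable_def I_def)
    have i1: "set_integrable lebesgue W (\<lambda>x. k (x + a) * \<psi> x)" "set_integrable lebesgue W (\<lambda>x. k (x - a) * \<psi> x)"
        "set_integrable lebesgue W (\<lambda>x. k x * \<psi> x)"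
      by (rule set_integrable_mult_test[OF _ t], rule lW)+
    have "(LINT x:W|lebesgue. k (x + a) * \<psi> x) = F 1"
      unfolding F_def using integral_shift(2)[OF k _ t, of a] by (simp add: W_def)
    moreover have "(LINT x:W|lebesgue. k (x - a) * \<psi> x) = F (-1)"
      unfolding F_def using integral_shift(2)[OF k _ t, of "-a"] by (simp add: W_def)
    moreover have "(LINT x:W|lebesgue. k x * \<psi> x) = F 0"
      unfolding F_def using integral_shift(2)[OF k _ t, of 0] by (simp add: W_def)
    moreover have "(2 * B * (norm a)\<^sup>2 - c * (k (x + a) + k (x - a) - 2 * k x)) * \<psi> x
        = 2 * B * (norm a)\<^sup>2 * \<psi> x - c * (k (x + a) * \<psi> x + k (x - a) * \<psi> x - 2 * (k x * \<psi> x))" for x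
      by (simp add: algebra_simps)
    moreover have "set_integrable lebesgue W \<psi>" using I(1) by (simp add: set_integrable_def)
    ultimately have "(LINT x:W|lebesgue. (2 * B * (norm a)\<^sup>2 - c * (k (x + a) + k (x - a) - 2 * k x)) * \<psi> x)
        = 2 * B * (norm a)\<^sup>2 * I - c * (F 1 + F (-1) - 2 * F 0)"
      using i1 I(2) by (simp only: set_integral_diff set_integral_add set_integral_mult_right set_integrable_mult_right)
    moreover have "c * (F 1 + F (-1) - 2 * F 0) \<le> \<bar>F 1 + F (-1) - 2 * F 0\<bar>" using c by auto
    ultimately show "0 \<le> (LINT x:W|lebesgue. (2 * B * (norm a)\<^sup>2 - c * (k (x + a) + k (x - a) - 2 * k x)) * \<psi> x)"
      using Dbound by simp
  qed
  have "AE x in lebesgue. x \<in> W \<longrightarrow> 0 \<le> 2 * B * (norm a)\<^sup>2 - 1 * (k (x + a) + k (x - a) - 2 * k x)"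
    "AE x in lebesgue. x \<in> W \<longrightarrow> 0 \<le> 2 * B * (norm a)\<^sup>2 - (-1) * (k (x + a) + k (x - a) - 2 * k x)"
    by (rule c, simp)+
  then show ?thesis
    by eventually_elim (auto simp: W_def abs_le_iff)
qed

text \<open>The null set in the hypothesis varies with \<open>a\<close>. Fubini exchanges the
  quantifiers: almost every x satisfies the bound against almost every y. Two such points are
  compared through a third one close to the first, so \<open>k\<close> is Lipschitz on a set dense
  in \<open>U\<close> and extends to the closure.\<close>

lemma lipschitz_representative:
  fixes k :: "real^'d \<Rightarrow> real"
  assumes U: "open U" and k: "k \<in> borel_measurable (lebesgue_on U)" and G: "0 \<le> G"
    and diff: "\<And>a. AE x in lebesgue. x \<in> U \<and> x + a \<in> U \<longrightarrow> \<bar>k (x + a) - k x\<bar> \<le> G * norm a"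
  obtains K where "G-lipschitz_on (closure U) K" "AE x in lebesgue. x \<in> U \<longrightarrow> K x = k x"
proof -
  \<comment> \<open>Fubini asks for a set measurable in the product of Borel measures, so
    \<open>k\<close> is first replaced by a Borel function.\<close>
  have "(\<lambda>x. if x \<in> U then k x else 0) \<in> borel_measurable lebesgue"
    using k U by (subst borel_measurable_if) (auto simp: borel_open)
  then obtain k' where k'[measurable]: "k' \<in> borel_measurable lborel"
    and kk': "AE x in lborel. (if x \<in> U then k x else 0) = k' x"
    using completion_ex_borel_measurable_real by blast
  have kk: "AE x in lebesgue. (if x \<in> U then k x else 0) = k' x"
    using kk' by (rule AE_completion)
  define P where "P x y \<longleftrightarrow> (x \<in> U \<and> y \<in> U \<longrightarrow> \<bar>k' y - k' x\<bar> \<le> G * norm (y - x))" for x y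
  have "AE x in lborel. P x (x + a)" for a
  proof -
    have "AE x in lebesgue. (if a + 1 *\<^sub>R x \<in> U then k (a + 1 *\<^sub>R x) else 0) = k' (a + 1 *\<^sub>R x)"
      by (rule AE_lebesgue_pm_one[OF _ kk]) simp
    with diff[of a] kk have "AE x in lebesgue. P x (x + a)"
      by eventually_elim (auto simp: P_def add.commute)
    then show ?thesis by (simp add: AE_completion_iff)
  qed
  then have "AE a in lborel. AE x in lborel. P x (x + a)" by simp
  moreover have "{x \<in> space (lborel \<Otimes>\<^sub>M lborel). P (snd x) (snd x + fst x)} \<in> sets (lborel \<Otimes>\<^sub>M (lborel :: (real^'d) measure))"
  proof -
    have [measurable]: "U \<in> sets borel" using U by simp
    show ?thesis unfolding P_def by measurable
  qed
  ultimately have "AE x in lborel. AE a in lborel. P x (x + a)"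
    by (subst (asm) lborel_pair.AE_commute[where P="\<lambda>a x. P x (x + a)"]) auto
  then have E: "AE x in lebesgue. AE a in lebesgue. P x (x + a)"
    by (simp add: AE_completion_iff)
  \<comment> \<open>Agreement with \<open>k'\<close> is part of \<open>E\<close>, so that the
    extension restricts to \<open>k\<close> itself and not merely to its Borel version.\<close>
  define E where "E = {x \<in> U. (AE y in lebesgue. P x y) \<and> k x = k' x}"
  have "AE x in lebesgue. x \<in> U \<longrightarrow> x \<in> E"
    using E kk
  proof eventually_elim
    case (elim x)
    have "AE a in lebesgue. P x (x + (-x + 1 *\<^sub>R a))"
      by (rule AE_lebesgue_pm_one[OF _ elim(1)]) simp
    then have "AE y in lebesgue. P x y" by simp
    then show ?case using elim(2) by (auto simp: E_def)
  qed
  have near: "\<exists>x. x \<in> S \<and> x \<in> U \<and> Q x" if "open S" "S \<inter> U \<noteq> {}" "AE x in lebesgue. x \<in> U \<longrightarrow> Q x" for S Q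
  proof (rule ccontr)
    assume no: "\<not> ?thesis"
    have "AE x in lebesgue. x \<notin> S \<inter> U"
      using that(3) by eventually_elim (use no in auto)
    then have "negligible (S \<inter> U)"
      using that(1) U by (simp add: negligible_iff_null_sets AE_iff_null_sets borel_open)
    then show False using open_not_negligible[of "S \<inter> U"] that U by auto
  qed
  have lipE: "G-lipschitz_on E k"
  proof (rule lipschitz_onI[OF _ G])
    fix x y assume xy: "x \<in> E" "y \<in> E"
    have "\<bar>k x - k y\<bar> \<le> G * norm (x - y) + e" if e: "e > 0" for e
    proof -
      have "AE z in lebesgue. P x z" "AE z in lebesgue. P y z" using xy by (auto simp: E_def)
      then have "AE z in lebesgue. z \<in> U \<longrightarrow> P x z \<and> P y z" by eventually_elim auto
      \<comment> \<open>This radius keeps 2 G |z - x| at most e and makes sense also for G =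
        0.\<close>
      moreover have "x \<in> ball x (e / (2 * G + 1)) \<inter> U"
        using xy e G by (auto simp: E_def)
      then have "ball x (e / (2 * G + 1)) \<inter> U \<noteq> {}" by blast
      ultimately obtain z where z: "z \<in> ball x (e / (2 * G + 1))" "z \<in> U" "P x z" "P y z"
        using near[of "ball x (e / (2 * G + 1))" "\<lambda>z. P x z \<and> P y z"] by auto
      have "\<bar>k x - k y\<bar> \<le> G * norm (z - x) + G * norm (z - y)"
        using z(2-4) xy by (auto simp: P_def E_def)
      also have "\<dots> \<le> G * norm (z - x) + G * (norm (z - x) + norm (x - y))"
        using G norm_triangle_ineq[of "z - x" "x - y"] by (intro add_left_mono mult_left_mono) auto
      also have "\<dots> = 2 * G * norm (z - x) + G * norm (x - y)" by (simp add: algebra_simps)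
      also have "2 * G * norm (z - x) \<le> e"
      proof -
        have "2 * G * norm (z - x) \<le> (2 * G + 1) * (e / (2 * G + 1))"
          using z(1) G e by (intro mult_mono) (auto simp: dist_norm norm_minus_commute)
        then show ?thesis using G by simp
      qed
      finally show ?thesis by simp
    qed
    then show "dist (k x) (k y) \<le> G * dist x y"
      by (simp add: dist_real_def dist_norm field_le_epsilon)
  qed
  then obtain K where K: "G-lipschitz_on (closure E) K" "\<And>x. x \<in> E \<Longrightarrow> K x = k x"
    using lipschitz_extend_closure by blast
  have "U \<subseteq> closure E"
  proof
    fix x assume "x \<in> U"
    show "x \<in> closure E"
      unfolding closure_approachable
    proof (intro allI impI)
      fix e :: real assume "e > 0"
      have "x \<in> ball x e \<inter> U" using \<open>x \<in> U\<close> \<open>e > 0\<close> by simp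
      then have "ball x e \<inter> U \<noteq> {}" by blast
      from near[OF open_ball this \<open>AE x in lebesgue. x \<in> U \<longrightarrow> x \<in> E\<close>]
      show "\<exists>y\<in>E. dist y x < e" by (auto simp: dist_commute)
    qed
  qed
  then have "closure U \<subseteq> closure E" by (simp add: closure_minimal)
  show ?thesis
  proof (rule that[of K])
    show "G-lipschitz_on (closure U) K" using K(1) \<open>closure U \<subseteq> closure E\<close> by (rule lipschitz_on_subset)
    show "AE x in lebesgue. x \<in> U \<longrightarrow> K x = k x"
      using \<open>AE x in lebesgue. x \<in> U \<longrightarrow> x \<in> E\<close> by eventually_elim (use K(2) in auto)
  qed
qed

section \<open>Essential suprema and the chosen weak derivatives\<close>

text \<open>Weak derivatives come as locally integrable functions, whereas the essential supremum
  asks for measurability on all of \<open>U\<close>; countably many boxes bridge this.\<close>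

lemma borel_measurable_locally_integrable:
  fixes f :: "real^'d \<Rightarrow> real"
  assumes "open U" "locally_integrable_on f U"
  shows "f \<in> borel_measurable (lebesgue_on U)"
proof -
  obtain D where D: "countable D" "D \<subseteq> Pow U" "\<And>X. X \<in> D \<Longrightarrow> \<exists>a b. X = cbox a b" "\<Union>D = U"
    using open_countable_Union_open_cbox[OF assms(1)] by metis
  show ?thesis
  proof (rule measurable_piecewise_restrict[OF D(1)])
    fix X assume "X \<in> D"
    then obtain a b where X: "X = cbox a b" "X \<subseteq> U" using D by blast
    show "X \<inter> space (lebesgue_on U) \<in> sets (lebesgue_on U)"
      using X by (auto simp: sets_restrict_space)
    have "set_integrable lebesgue X f" using assms(2) X by (auto simp: locally_integrable_on_def)
    then have "f \<in> borel_measurable (lebesgue_on X)"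
      using X by (simp add: absolutely_integrable_measurable)
    moreover have "restrict_space (lebesgue_on U) X = lebesgue_on X"
      using X assms(1) by (subst restrict_restrict_space) (auto simp: inf.absorb2)
    ultimately show "f \<in> borel_measurable (restrict_space (lebesgue_on U) X)" by simp
  qed (use D(4) in auto)
qed

text \<open>The essential supremum is an extended real, and \<open>real_of_ereal\<close> would send
  \<infinity> to 0; finiteness in \<open>in_Linf\<close> rules this out.\<close>

lemma Linf_norm_AE:
  fixes f :: "real^'d \<Rightarrow> 'b::euclidean_space"
  assumes "U \<in> sets lebesgue" "in_Linf U f"
  shows "AE x in lebesgue. x \<in> U \<longrightarrow> norm (f x) \<le> Linf_norm U f"
proof -
  let ?e = "esssup (lebesgue_on U) (\<lambda>x. ereal (norm (f x)))"
  have "?e < \<infinity>" using assms by (simp add: in_Linf_def)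
  have "AE x in lebesgue_on U. ereal (norm (f x)) \<le> ?e" by (rule esssup_AE)
  then have "AE x in lebesgue_on U. norm (f x) \<le> Linf_norm U f"
    by eventually_elim (use \<open>?e < \<infinity>\<close> in \<open>cases ?e; auto simp: Linf_norm_def\<close>)
  then show ?thesis using assms(1) by (simp add: AE_restrict_space_iff)
qed

text \<open>On a null space the essential supremum is -\<infinity>, or \<infinity> if
  \<open>f\<close> is not measurable, and \<open>real_of_ereal\<close> sends both to 0. Otherwise it
  is nonnegative, since a norm cannot lie almost everywhere below a negative number.\<close>

lemma Linf_norm_nonneg:
  fixes f :: "real^'d \<Rightarrow> 'b::euclidean_space"
  shows "0 \<le> Linf_norm U f"
proof (cases "emeasure (lebesgue_on U) (space (lebesgue_on U)) = 0")
  case True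
  show ?thesis
  proof (cases "(\<lambda>x. ereal (norm (f x))) \<in> borel_measurable (lebesgue_on U)")
    case m: True
    have "esssup (lebesgue_on U) (\<lambda>x. ereal (norm (f x))) = - \<infinity>"
      using esssup_zero_space[OF True m] by simp
    then show ?thesis by (simp add: Linf_norm_def)
  qed (simp add: Linf_norm_def esssup_non_measurable top_ereal_def)
next
  case False
  have "0 \<le> esssup (lebesgue_on U) (\<lambda>x. ereal (norm (f x)))"
  proof (rule ccontr)
    assume "\<not> ?thesis"
    moreover have "AE x in lebesgue_on U. ereal (norm (f x)) \<le> esssup (lebesgue_on U) (\<lambda>x. ereal (norm (f x)))"
      by (rule esssup_AE)
    ultimately have "AE x in lebesgue_on U. False"
      by (auto elim!: eventually_mono simp: not_le dest: order.strict_trans1 order_le_less_trans)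
    then show False using False by (simp add: AE_iff_null_sets null_setsI eventually_False ae_filter_eq_bot_iff)
  qed
  then show ?thesis by (simp add: Linf_norm_def real_of_ereal_pos)
qed

lemma in_LinfI:
  fixes f :: "real^'d \<Rightarrow> 'b::euclidean_space"
  assumes "U \<in> sets lebesgue" "f \<in> borel_measurable (lebesgue_on U)" "AE x in lebesgue. x \<in> U \<longrightarrow> norm (f x) \<le> B"
  shows "in_Linf U f"
proof -
  have "AE x in lebesgue_on U. ereal (norm (f x)) \<le> ereal B"
    using assms(1,3) by (simp add: AE_restrict_space_iff)
  then have "esssup (lebesgue_on U) (\<lambda>x. ereal (norm (f x))) \<le> ereal B"
    using assms(2) by (intro esssup_I) auto
  then show ?thesis using assms(2) by (auto simp: in_Linf_def)
qed

lemma weak_partial_in_Linf: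
  assumes U: "open U" and "has_weak_partial U i u g" "in_Linf U g"
  shows "\<exists>B. AE x in lebesgue. x \<in> U \<longrightarrow> \<bar>weak_partial U i u x\<bar> \<le> B"
    and "weak_partial U i u \<in> borel_measurable (lebesgue_on U)"
    and "AE x in lebesgue. x \<in> U \<longrightarrow> g x = weak_partial U i u x"
proof -
  have w: "has_weak_partial U i u (weak_partial U i u)"
    using assms(2) by (rule has_weak_partial_weak_partial)
  show ae: "AE x in lebesgue. x \<in> U \<longrightarrow> g x = weak_partial U i u x"
    by (rule has_weak_partial_unique[OF U assms(2) w])
  have "AE x in lebesgue. x \<in> U \<longrightarrow> norm (g x) \<le> Linf_norm U g"
    using U by (intro Linf_norm_AE assms) (auto simp: borel_open)
  with ae have "AE x in lebesgue. x \<in> U \<longrightarrow> \<bar>weak_partial U i u x\<bar> \<le> Linf_norm U g"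
    by eventually_elim auto
  then show "\<exists>B. AE x in lebesgue. x \<in> U \<longrightarrow> \<bar>weak_partial U i u x\<bar> \<le> B" by blast
  show "weak_partial U i u \<in> borel_measurable (lebesgue_on U)"
    using w by (intro borel_measurable_locally_integrable U) (simp add: has_weak_partial_def)
qed

text \<open>\<open>in_W2inf\<close> provides second derivatives of an unspecified first derivative;
  this moves them to the chosen \<open>weak_partial\<close>, which agrees with it almost
  everywhere.\<close>

lemma has_weak_partial_cong_AE:
  assumes "has_weak_partial U i u g" "locally_integrable_on v U" "AE x in lebesgue. x \<in> U \<longrightarrow> u x = v x"
  shows "has_weak_partial U i v g"
  unfolding has_weak_partial_def
proof (intro conjI allI impI)
  show "locally_integrable_on g U" using assms(1) by (simp add: has_weak_partial_def)
  fix \<psi> :: "real^'a \<Rightarrow> real" assume t: "test_function U \<psi>"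
  have u: "locally_integrable_on u U" using assms(1) by (simp add: has_weak_partial_def)
  let ?d = "\<lambda>x. frechet_derivative \<psi> (at x) (axis i 1)"
  have "(LINT x:U|lebesgue. v x * ?d x) = (LINT x:U|lebesgue. u x * ?d x)"
    unfolding set_lebesgue_integral_def
  proof (rule integral_cong_AE)
    show "(\<lambda>x. indicator U x *\<^sub>R (v x * ?d x)) \<in> borel_measurable lebesgue"
      using set_integrable_mult_test[OF assms(2) test_function_partial[OF t, of i]]
      unfolding set_integrable_def by (rule borel_measurable_integrable)
    show "(\<lambda>x. indicator U x *\<^sub>R (u x * ?d x)) \<in> borel_measurable lebesgue"
      using set_integrable_mult_test[OF u test_function_partial[OF t, of i]]
      unfolding set_integrable_def by (rule borel_measurable_integrable)
    show "AE x in lebesgue. indicator U x *\<^sub>R (v x * ?d x) = indicator U x *\<^sub>R (u x * ?d x)"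
      using assms(3) by eventually_elim (auto simp: indicator_def)
  qed
  also have "\<dots> = - (LINT x:U|lebesgue. g x * \<psi> x)" using assms(1) t by (simp add: has_weak_partial_def)
  finally show "(LINT x:U|lebesgue. v x * ?d x) = - (LINT x:U|lebesgue. g x * \<psi> x)" .
qed (use assms in auto)

lemma in_Linf_vec:
  fixes f :: "real^'d \<Rightarrow> real^'n"
  assumes U: "U \<in> sets lebesgue" and m: "\<And>i. (\<lambda>x. f x $ i) \<in> borel_measurable (lebesgue_on U)"
    and B: "\<And>i. \<exists>B. AE x in lebesgue. x \<in> U \<longrightarrow> \<bar>f x $ i\<bar> \<le> B"
  shows "in_Linf U f" "\<exists>B. AE x in lebesgue. x \<in> U \<longrightarrow> norm (f x) \<le> B"
proof -
  have "\<exists>B. \<forall>i. AE x in lebesgue. x \<in> U \<longrightarrow> \<bar>f x $ i\<bar> \<le> B i" using B by (intro choice allI)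
  then obtain B where B: "\<And>i. AE x in lebesgue. x \<in> U \<longrightarrow> \<bar>f x $ i\<bar> \<le> B i" by blast
  have "AE x in lebesgue. \<forall>i\<in>UNIV. x \<in> U \<longrightarrow> \<bar>f x $ i\<bar> \<le> B i"
    by (subst AE_ball_countable) (use B in auto)
  then have *: "AE x in lebesgue. x \<in> U \<longrightarrow> norm (f x) \<le> (\<Sum>i\<in>UNIV. B i)"
  proof eventually_elim
    case (elim x)
    show ?case
    proof
      assume "x \<in> U"
      have "norm (f x) \<le> (\<Sum>i\<in>UNIV. \<bar>f x $ i\<bar>)" by (rule norm_le_l1_cart)
      also have "\<dots> \<le> (\<Sum>i\<in>UNIV. B i)" using elim \<open>x \<in> U\<close> by (intro sum_mono) auto
      finally show "norm (f x) \<le> (\<Sum>i\<in>UNIV. B i)" .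
    qed
  qed
  show "in_Linf U f"
  proof (rule in_LinfI[OF U _ *])
    have "f x = (\<Sum>i\<in>UNIV. f x $ i *\<^sub>R axis i 1)" for x
      using basis_expansion[of "f x"] by (simp add: scalar_mult_eq_scaleR)
    then have "f = (\<lambda>x. \<Sum>i\<in>UNIV. f x $ i *\<^sub>R axis i 1)" by blast
    also have "\<dots> \<in> borel_measurable (lebesgue_on U)"
      by (intro borel_measurable_sum borel_measurable_scaleR m borel_measurable_const)
    finally show "f \<in> borel_measurable (lebesgue_on U)" .
  qed
  show "\<exists>B. AE x in lebesgue. x \<in> U \<longrightarrow> norm (f x) \<le> B" using * by blast
qed

text \<open>The norms in the theorem are formed from the chosen weak derivatives, whereas
  \<open>in_W2inf\<close> only asserts that suitable ones exist. Boundedness and measurability are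
  carried over componentwise, so that the essential suprema are finite and serve as
  almost-everywhere bounds.\<close>

lemma W2inf_weak_derivatives:
  assumes U: "open U" and k: "in_W2inf U k"
  shows "has_weak_partial U i k (weak_partial U i k)"
    and "has_weak_partial U i (weak_partial U j k) (weak_partial U i (weak_partial U j k))"
    and "AE x in lebesgue. x \<in> U \<longrightarrow> norm (weak_grad U k x) \<le> Linf_norm U (weak_grad U k)"
    and "AE x in lebesgue. x \<in> U \<longrightarrow> norm (weak_hess U k x) \<le> Linf_norm U (weak_hess U k)"
proof -
  have Us: "U \<in> sets lebesgue" using U by (simp add: borel_open)
  have g: "has_weak_partial U i k (weak_partial U i k)" "\<exists>B. AE x in lebesgue. x \<in> U \<longrightarrow> \<bar>weak_partial U i k x\<bar> \<le> B"
    "weak_partial U i k \<in> borel_measurable (lebesgue_on U)" for i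
  proof -
    obtain g where g: "has_weak_partial U i k g" "in_Linf U g"
      using k unfolding in_W2inf_def by blast
    show "has_weak_partial U i k (weak_partial U i k)" by (rule has_weak_partial_weak_partial[OF g(1)])
    show "\<exists>B. AE x in lebesgue. x \<in> U \<longrightarrow> \<bar>weak_partial U i k x\<bar> \<le> B"
      "weak_partial U i k \<in> borel_measurable (lebesgue_on U)"
      by (rule weak_partial_in_Linf[OF U g])+
  qed
  have h: "has_weak_partial U i (weak_partial U j k) (weak_partial U i (weak_partial U j k))"
    "\<exists>B. AE x in lebesgue. x \<in> U \<longrightarrow> \<bar>weak_partial U i (weak_partial U j k) x\<bar> \<le> B"
    "weak_partial U i (weak_partial U j k) \<in> borel_measurable (lebesgue_on U)" for i j
  proof -
    obtain gj g' where g': "has_weak_partial U j k gj" "in_Linf U gj" "has_weak_partial U i gj g'" "in_Linf U g'"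
      using k unfolding in_W2inf_def by blast
    have "has_weak_partial U i (weak_partial U j k) g'"
      using weak_partial_in_Linf(3)[OF U g'(1,2)] g(1)[of j]
      by (intro has_weak_partial_cong_AE[OF g'(3)]) (auto simp: has_weak_partial_def)
    note h = this g'(4)
    show "has_weak_partial U i (weak_partial U j k) (weak_partial U i (weak_partial U j k))"
      by (rule has_weak_partial_weak_partial[OF h(1)])
    show "\<exists>B. AE x in lebesgue. x \<in> U \<longrightarrow> \<bar>weak_partial U i (weak_partial U j k) x\<bar> \<le> B"
      "weak_partial U i (weak_partial U j k) \<in> borel_measurable (lebesgue_on U)"
      by (rule weak_partial_in_Linf[OF U h])+
  qed
  show "has_weak_partial U i k (weak_partial U i k)"
    "has_weak_partial U i (weak_partial U j k) (weak_partial U i (weak_partial U j k))"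
    by (rule g h)+
  have "in_Linf U (weak_grad U k)"
    by (rule in_Linf_vec[OF Us]) (auto simp: weak_grad_def g(2,3))
  then show "AE x in lebesgue. x \<in> U \<longrightarrow> norm (weak_grad U k x) \<le> Linf_norm U (weak_grad U k)"
    by (rule Linf_norm_AE[OF Us])
  have row: "(\<lambda>x. weak_hess U k x $ i) \<in> borel_measurable (lebesgue_on U)"
    "\<exists>B. AE x in lebesgue. x \<in> U \<longrightarrow> norm (weak_hess U k x $ i) \<le> B" for i
  proof -
    have "(\<lambda>x. weak_hess U k x $ i $ j) \<in> borel_measurable (lebesgue_on U)"
      "\<exists>B. AE x in lebesgue. x \<in> U \<longrightarrow> \<bar>weak_hess U k x $ i $ j\<bar> \<le> B" for j
      by (auto simp: weak_hess_def h(2,3))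
    note in_Linf_vec[OF Us this]
    then show "(\<lambda>x. weak_hess U k x $ i) \<in> borel_measurable (lebesgue_on U)"
      "\<exists>B. AE x in lebesgue. x \<in> U \<longrightarrow> norm (weak_hess U k x $ i) \<le> B"
      by (auto simp: in_Linf_def)
  qed
  have "\<exists>B. \<forall>i. AE x in lebesgue. x \<in> U \<longrightarrow> norm (weak_hess U k x $ i) \<le> B i" using row(2) by (intro choice allI)
  then obtain B where B: "\<And>i. AE x in lebesgue. x \<in> U \<longrightarrow> norm (weak_hess U k x $ i) \<le> B i" by blast
  have "AE x in lebesgue. \<forall>i\<in>UNIV. x \<in> U \<longrightarrow> norm (weak_hess U k x $ i) \<le> B i"
    by (subst AE_ball_countable) (use B in auto)
  then have *: "AE x in lebesgue. x \<in> U \<longrightarrow> norm (weak_hess U k x) \<le> (\<Sum>i\<in>UNIV. B i)"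
  proof eventually_elim
    case (elim x)
    show ?case
    proof
      assume "x \<in> U"
      have "norm (weak_hess U k x) \<le> (\<Sum>i\<in>UNIV. norm (weak_hess U k x $ i))"
        unfolding norm_vec_def[of "weak_hess U k x"] by (rule L2_set_le_sum) simp
      also have "\<dots> \<le> (\<Sum>i\<in>UNIV. B i)" using elim \<open>x \<in> U\<close> by (intro sum_mono) auto
      finally show "norm (weak_hess U k x) \<le> (\<Sum>i\<in>UNIV. B i)" .
    qed
  qed
  have "weak_hess U k \<in> borel_measurable (lebesgue_on U)"
  proof -
    have "(\<lambda>x. weak_hess U k x \<bullet> b) \<in> borel_measurable (lebesgue_on U)" if bB: "b \<in> Basis" for b
    proof -
      obtain i u where b: "b = axis i u" using bB by (auto simp: Basis_vec_def)
      have "(\<lambda>x. weak_hess U k x $ i \<bullet> u) \<in> borel_measurable (lebesgue_on U)"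
        by (intro borel_measurable_inner row borel_measurable_const)
      then show ?thesis by (simp add: b inner_axis)
    qed
    then show ?thesis by (subst borel_measurable_euclidean_space) auto
  qed
  from in_LinfI[OF Us this *]
  show "AE x in lebesgue. x \<in> U \<longrightarrow> norm (weak_hess U k x) \<le> Linf_norm U (weak_hess U k)"
    by (rule Linf_norm_AE[OF Us])
qed

section \<open>The continuous representative on a closed macro element\<close>

text \<open>The part of \<open>W\<close> where f < 0 is open, and nonempty open sets have positive
  measure.\<close>

lemma continuous_AE_nonneg:
  fixes f :: "real^'d \<Rightarrow> real"
  assumes "open W" "continuous_on W f" "AE x in lebesgue. x \<in> W \<longrightarrow> 0 \<le> f x" "x \<in> W"
  shows "0 \<le> f x"
proof (rule ccontr)
  assume neg: "\<not> 0 \<le> f x"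
  have "open (W \<inter> f -` {..<0})" using assms(1,2) by (intro continuous_open_preimage) auto
  moreover have "x \<in> W \<inter> f -` {..<0}" using neg assms(4) by auto
  moreover have "AE x in lebesgue. x \<notin> W \<inter> f -` {..<0}"
    using assms(3) by eventually_elim auto
  ultimately show False
    using open_not_negligible[of "W \<inter> f -` {..<0}"]
    by (auto simp: negligible_iff_null_sets AE_iff_null_sets borel_open)
qed

lemma interior_shrink_sequence:
  fixes T :: "'a::euclidean_space set"
  assumes "convex T" "c \<in> interior T" "x \<in> T"
  shows "x - (1 / real (Suc n)) *\<^sub>R (x - c) \<in> interior T"
  by (rule mem_interior_convex_shrink[OF assms]) auto

lemma shrink_tendsto: "(\<lambda>n. x - (1 / real (Suc n)) *\<^sub>R (x - c)) \<longlonglongrightarrow> (x :: 'a::real_normed_vector)"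
proof -
  have "(\<lambda>n. x - (1 / real (Suc n)) *\<^sub>R (x - c)) \<longlonglongrightarrow> x - 0 *\<^sub>R (x - c)"
    using LIMSEQ_inverse_real_of_nat by (intro tendsto_intros) (simp add: inverse_eq_divide)
  then show ?thesis by simp
qed

text \<open>Existence of a Lipschitz representative gives the \<open>SOME\<close> in
  \<open>cont_ext\<close> its meaning. Continuity turns the almost-everywhere bounds for fixed
  \<open>a\<close> into pointwise bounds in the interior, and boundary points are reached by
  shrinking towards an interior point \<open>c\<close>.\<close>

lemma cont_ext_properties:
  fixes T :: "(real^'d) set"
  assumes T: "convex T" "compact T" "interior T \<noteq> {}" and k: "in_W2inf (interior T) k"
  defines "K \<equiv> cont_ext k T"
  shows "continuous_on T K" "AE x in lebesgue. x \<in> interior T \<longrightarrow> K x = k x"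
    and "x \<in> T \<Longrightarrow> y \<in> T \<Longrightarrow> \<bar>K x - K y\<bar> \<le> Linf_norm (interior T) (weak_grad (interior T) k) * norm (x - y)"
    and "m \<in> T \<Longrightarrow> m + a \<in> T \<Longrightarrow> m - a \<in> T \<Longrightarrow>
       \<bar>K (m + a) + K (m - a) - 2 * K m\<bar> \<le> 2 * Linf_norm (interior T) (weak_hess (interior T) k) * (norm a)\<^sup>2"
proof -
  define U where "U = interior T"
  have U: "open U" "convex U" "U \<noteq> {}" "U \<subseteq> T" using T interior_subset by (auto simp: U_def)
  have Us: "U \<in> sets lebesgue" using U by (simp add: borel_open)
  have clU: "closure U = T"
    unfolding U_def using convex_closure_interior[OF T(1,3)] T(2) by (simp add: compact_imp_closed)
  have kU: "in_W2inf U k" using k by (simp add: U_def)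
  let ?G = "Linf_norm U (weak_grad U k)" and ?B = "Linf_norm U (weak_hess U k)"
  have kd: "AE x in lebesgue. x \<in> U \<and> x + a \<in> U \<longrightarrow> \<bar>k (x + a) - k x\<bar> \<le> ?G * norm a" for a
    by (rule AE_difference_bound[OF U(1,2) W2inf_weak_derivatives(1)[OF U(1) kU]])
       (use W2inf_weak_derivatives(3)[OF U(1) kU] in \<open>simp add: weak_grad_def\<close>)
  have kd2: "AE x in lebesgue. x \<in> U \<and> x + a \<in> U \<and> x - a \<in> U \<longrightarrow>
     \<bar>k (x + a) + k (x - a) - 2 * k x\<bar> \<le> 2 * ?B * (norm a)\<^sup>2" for a
    by (rule AE_second_difference_bound[OF U(1,2) W2inf_weak_derivatives(1,2)[OF U(1) kU]])
       (use W2inf_weak_derivatives(4)[OF U(1) kU] in \<open>simp add: weak_hess_def\<close>)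
  have "k \<in> borel_measurable (lebesgue_on U)" using kU by (simp add: in_W2inf_def in_Linf_def)
  then obtain K' where K': "?G-lipschitz_on T K'" "AE x in lebesgue. x \<in> U \<longrightarrow> K' x = k x"
    using lipschitz_representative[OF U(1) _ Linf_norm_nonneg kd] clU by metis
  have "continuous_on T K' \<and> (AE x in lebesgue_on (interior T). K' x = k x)"
    using K' Us lipschitz_on_continuous_on by (auto simp: AE_restrict_space_iff U_def)
  then have "continuous_on T K \<and> (AE x in lebesgue_on (interior T). K x = k x)"
    unfolding K_def cont_ext_def
    by (rule someI[of "\<lambda>g. continuous_on T g \<and> (AE x in lebesgue_on (interior T). g x = k x)"])
  then show cK: "continuous_on T K" and KU: "AE x in lebesgue. x \<in> interior T \<longrightarrow> K x = k x"
    using Us by (auto simp: AE_restrict_space_iff U_def)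
  have KU': "AE x in lebesgue. x \<in> U \<longrightarrow> K x = k x" using KU by (simp add: U_def)
  have Ka: "AE x in lebesgue. x + a \<in> U \<longrightarrow> K (x + a) = k (x + a)" for a
  proof -
    have "AE x in lebesgue. a + 1 *\<^sub>R x \<in> U \<longrightarrow> K (a + 1 *\<^sub>R x) = k (a + 1 *\<^sub>R x)"
      by (rule AE_lebesgue_pm_one[OF _ KU']) simp
    then show ?thesis by (simp add: add.commute)
  qed
  have cU: "continuous_on V (\<lambda>x. K (x + a))" if "\<And>x. x \<in> V \<Longrightarrow> x + a \<in> U" for V a
    using that U(4) by (intro continuous_on_compose2[OF cK] continuous_intros) auto
  have opn: "open {x \<in> U. x + a \<in> U}" for a
  proof -
    have "open ((\<lambda>x. x + a) -` U)" by (intro open_vimage U continuous_intros)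
    moreover have "{x \<in> U. x + a \<in> U} = U \<inter> (\<lambda>x. x + a) -` U" by auto
    ultimately show ?thesis using U by auto
  qed
  have lip: "\<bar>K (x + a) - K x\<bar> \<le> ?G * norm a" if "x \<in> U" "x + a \<in> U" for x a
  proof -
    have "0 \<le> ?G * norm a - \<bar>K (x + a) - K x\<bar>"
    proof (rule continuous_AE_nonneg[OF opn[of a], of "\<lambda>x. ?G * norm a - \<bar>K (x + a) - K x\<bar>"])
      show "AE x in lebesgue. x \<in> {x \<in> U. x + a \<in> U} \<longrightarrow> 0 \<le> ?G * norm a - \<bar>K (x + a) - K x\<bar>"
        using kd[of a] KU' Ka[of a] by eventually_elim auto
      show "continuous_on {x \<in> U. x + a \<in> U} (\<lambda>x. ?G * norm a - \<bar>K (x + a) - K x\<bar>)"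
        using cU[of "{x \<in> U. x + a \<in> U}" a] cU[of "{x \<in> U. x + a \<in> U}" 0] by (auto intro!: continuous_intros)
    qed (use that in auto)
    then show ?thesis by simp
  qed
  have sec: "\<bar>K (x + a) + K (x - a) - 2 * K x\<bar> \<le> 2 * ?B * (norm a)\<^sup>2" if "x \<in> U" "x + a \<in> U" "x - a \<in> U" for x a
  proof -
    let ?V = "{x \<in> U. x + a \<in> U} \<inter> {x \<in> U. x + (-a) \<in> U}"
    have "0 \<le> 2 * ?B * (norm a)\<^sup>2 - \<bar>K (x + a) + K (x + (-a)) - 2 * K (x + 0)\<bar>"
    proof (rule continuous_AE_nonneg[of ?V "\<lambda>x. 2 * ?B * (norm a)\<^sup>2 - \<bar>K (x + a) + K (x + (-a)) - 2 * K (x + 0)\<bar>"])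
      show "open ?V" by (intro open_Int opn)
      show "AE x in lebesgue. x \<in> ?V \<longrightarrow> 0 \<le> 2 * ?B * (norm a)\<^sup>2 - \<bar>K (x + a) + K (x + (-a)) - 2 * K (x + 0)\<bar>"
        using kd2[of a] KU' Ka[of a] Ka[of "-a"] by eventually_elim auto
      show "continuous_on ?V (\<lambda>x. 2 * ?B * (norm a)\<^sup>2 - \<bar>K (x + a) + K (x + (-a)) - 2 * K (x + 0)\<bar>)"
        by (intro continuous_intros cU) auto
    qed (use that in auto)
    then show ?thesis by simp
  qed
  obtain c where c: "c \<in> U" using U by auto
  let ?s = "\<lambda>x n. x - (1 / real (Suc n)) *\<^sub>R (x - c)"
  have sU: "?s x n \<in> U" if "x \<in> T" for x n
    unfolding U_def using interior_shrink_sequence[OF T(1), of c x n] c that by (simp add: U_def)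
  have limK: "(\<lambda>n. K (?s x n)) \<longlonglongrightarrow> K x" if "x \<in> T" for x
    by (rule continuous_on_tendsto_compose[OF cK shrink_tendsto that])
       (intro always_eventually allI subsetD[OF U(4) sU[OF that]])
  show "\<bar>K x - K y\<bar> \<le> Linf_norm (interior T) (weak_grad (interior T) k) * norm (x - y)" if "x \<in> T" "y \<in> T"
  proof (rule tendsto_upperbound)
    show "(\<lambda>n. \<bar>K (?s x n) - K (?s y n)\<bar>) \<longlonglongrightarrow> \<bar>K x - K y\<bar>"
      by (intro tendsto_intros limK that)
    show "\<forall>\<^sub>F n in sequentially. \<bar>K (?s x n) - K (?s y n)\<bar> \<le> Linf_norm (interior T) (weak_grad (interior T) k) * norm (x - y)"
    proof (intro always_eventually allI)
      fix n
      have "\<bar>K (?s x n) - K (?s y n)\<bar> \<le> ?G * norm (?s x n - ?s y n)"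
        using lip[of "?s y n" "?s x n - ?s y n"] sU that by simp
      also have "?s x n - ?s y n = (1 - 1 / real (Suc n)) *\<^sub>R (x - y)" by (simp add: algebra_simps)
      also have "?G * norm ((1 - 1 / real (Suc n)) *\<^sub>R (x - y)) \<le> ?G * norm (x - y)"
        by (intro mult_left_mono Linf_norm_nonneg) (simp add: mult_left_le_one_le)
      finally show "\<bar>K (?s x n) - K (?s y n)\<bar> \<le> Linf_norm (interior T) (weak_grad (interior T) k) * norm (x - y)"
        by (simp add: U_def)
    qed
  qed simp
  show "\<bar>K (m + a) + K (m - a) - 2 * K m\<bar> \<le> 2 * Linf_norm (interior T) (weak_hess (interior T) k) * (norm a)\<^sup>2"
    if "m \<in> T" "m + a \<in> T" "m - a \<in> T"
  proof (rule tendsto_upperbound)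
    show "(\<lambda>n. \<bar>K (?s (m + a) n) + K (?s (m - a) n) - 2 * K (?s m n)\<bar>) \<longlonglongrightarrow> \<bar>K (m + a) + K (m - a) - 2 * K m\<bar>"
      by (intro tendsto_intros limK that)
    show "\<forall>\<^sub>F n in sequentially. \<bar>K (?s (m + a) n) + K (?s (m - a) n) - 2 * K (?s m n)\<bar> \<le> 2 * Linf_norm (interior T) (weak_hess (interior T) k) * (norm a)\<^sup>2"
    proof (intro always_eventually allI)
      fix n
      let ?b = "(1 - 1 / real (Suc n)) *\<^sub>R a"
      \<comment> \<open>Shrinking is affine: a symmetric triple stays symmetric, with its step
        scaled by a factor at most one.\<close>
      have e: "?s (m + a) n = ?s m n + ?b" "?s (m - a) n = ?s m n - ?b" by (simp_all add: algebra_simps)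
      have "\<bar>K (?s m n + ?b) + K (?s m n - ?b) - 2 * K (?s m n)\<bar> \<le> 2 * ?B * (norm ?b)\<^sup>2"
        using sec[OF sU[OF that(1)]] sU[OF that(2), of n] sU[OF that(3), of n] unfolding e by blast
      also have "\<dots> \<le> 2 * ?B * (norm a)\<^sup>2"
        by (intro mult_left_mono power_mono) (auto simp: Linf_norm_nonneg mult_left_le_one_le)
      finally show "\<bar>K (?s (m + a) n) + K (?s (m - a) n) - 2 * K (?s m n)\<bar> \<le> 2 * Linf_norm (interior T) (weak_hess (interior T) k) * (norm a)\<^sup>2"
        unfolding e U_def .
    qed
  qed simp
qed

section \<open>Weak derivatives of locally Lipschitz functions\<close>

lemma set_integrable_continuous_compact:
  fixes v :: "real^'d \<Rightarrow> real"
  assumes "compact K" "continuous_on K v"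
  shows "set_integrable lebesgue K v"
proof -
  have int: "integrable lborel (\<lambda>x. indicator K x *\<^sub>R v x)"
    by (rule borel_integrable_compact[OF assms])
  then have "integrable (completion lborel) (\<lambda>x. indicator K x *\<^sub>R v x)"
    by (subst integrable_completion) auto
  then show ?thesis by (simp add: set_integrable_def)
qed

text \<open>Discrete integration by parts: shifting the variable moves the difference quotient from
  \<psi> to \<open>v\<close>, and both forms converge by dominated convergence. The Lipschitz bound
  is asked along segments in \<open>U\<close> only, because the domain may be nonconvex, and the
  limit only almost everywhere, because finite element functions have kinks.\<close>

lemma has_weak_partial_directional_limit:
  fixes v :: "real^'d \<Rightarrow> real"
  assumes U: "open U" and L: "0 \<le> L"
    and lip: "\<And>x y. closed_segment x y \<subseteq> U \<Longrightarrow> \<bar>v x - v y\<bar> \<le> L * norm (x - y)"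
    and g: "g \<in> borel_measurable lebesgue" "\<And>x. \<bar>g x\<bar> \<le> B"
    and lim: "AE x in lebesgue. x \<in> U \<longrightarrow> ((\<lambda>s. (v (x + s *\<^sub>R axis i 1) - v x) / s) \<longlongrightarrow> g x) (at 0)"
  shows "has_weak_partial U i v g"
proof -
  have cont: "continuous_on U v"
  proof -
    have "isCont v x" if x: "x \<in> U" for x
    proof -
      obtain e where e: "e > 0" "ball x e \<subseteq> U" using U x openE by blast
      have "L-lipschitz_on (ball x e) v"
      proof (rule lipschitz_onI[OF _ L])
        fix y z assume "y \<in> ball x e" "z \<in> ball x e"
        then have "closed_segment y z \<subseteq> ball x e" by (simp add: closed_segment_subset)
        then show "dist (v y) (v z) \<le> L * dist y z" using lip[of y z] e by (auto simp: dist_real_def dist_norm)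
      qed
      then have "continuous_on (ball x e) v" by (rule lipschitz_on_continuous_on)
      then show ?thesis using e by (simp add: continuous_on_eq_continuous_at)
    qed
    then show ?thesis by (simp add: continuous_at_imp_continuous_on)
  qed
  have liv: "locally_integrable_on v U"
    unfolding locally_integrable_on_def
    using cont by (auto intro: set_integrable_continuous_compact continuous_on_subset)
  have lig: "locally_integrable_on g U"
    unfolding locally_integrable_on_def set_integrable_def
  proof (intro allI impI)
    fix K assume K: "compact K \<and> K \<subseteq> U"
    then have Ks: "K \<in> sets lebesgue" by (simp add: lmeasurable_compact fmeasurableD)
    show "integrable lebesgue (\<lambda>x. indicator K x *\<^sub>R g x)"
    proof (rule Bochner_Integration.integrable_bound)
      show "integrable lebesgue (\<lambda>x. indicator K x *\<^sub>R B)"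
        using absolutely_integrable_on_const[of K B] K by (auto simp: set_integrable_def lmeasurable_compact)
      show "(\<lambda>x. indicator K x *\<^sub>R g x) \<in> borel_measurable lebesgue"
        by (intro borel_measurable_scaleR borel_measurable_indicator Ks g)
      show "AE x in lebesgue. norm (indicator K x *\<^sub>R g x) \<le> norm (indicator K x *\<^sub>R B)"
        using g(2) by (intro AE_I2) (auto simp: indicator_def intro: order_trans[OF _ abs_ge_self])
    qed
  qed
  show ?thesis
    unfolding has_weak_partial_def
  proof (intro conjI liv lig allI impI)
    fix \<psi> :: "real^'d \<Rightarrow> real" assume t: "test_function U \<psi>"
    obtain K where K: "compact K" "K \<subseteq> U" "continuous_on UNIV \<psi>" "\<And>x. \<psi> x \<noteq> 0 \<Longrightarrow> x \<in> K" "\<And>m. Ck m \<psi>"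
      using test_functionD[OF t] by auto
    let ?d = "axis i 1 :: real^'d"
    have nd: "norm ?d = 1" by (simp add: norm_axis_1)
    have tK: "test_function K \<psi>" by (rule test_functionI[OF K(5,1)]) (use K in auto)
    obtain e where e: "e > 0" "(\<Union>x\<in>K. ball x e) \<subseteq> U"
      using compact_subset_open_imp_ball_epsilon_subset[OF K(1) U K(2)] by blast
    define h where "h n = e / 2 / real (Suc n)" for n
    have h: "0 < h n" "h n \<le> e / 2" for n using e by (auto simp: h_def field_simps)
    have h0: "h \<longlonglongrightarrow> 0"
      unfolding h_def by (rule LIMSEQ_Suc[OF lim_const_over_n])
    have hat: "filterlim h (at 0) sequentially"
      using h0 h(1) by (auto simp: filterlim_at less_imp_neq[symmetric] intro!: always_eventually)
    define K' where "K' = {x + y |x y. x \<in> K \<and> y \<in> cball 0 (e/2)}"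
    have K': "compact K'" unfolding K'_def using K by (intro compact_sums) auto
    have K'U: "K' \<subseteq> U"
    proof
      fix z assume "z \<in> K'"
      then obtain x y where z: "z = x + y" "x \<in> K" "norm y \<le> e/2" by (auto simp: K'_def)
      then have "z \<in> ball x e" using e by (auto simp: dist_norm)
      then show "z \<in> U" using e(2) \<open>x \<in> K\<close> by blast
    qed
    have KK': "x + s *\<^sub>R ?d \<in> K'" if "x \<in> K" "\<bar>s\<bar> \<le> e/2" for x s
      unfolding K'_def using that nd by (intro CollectI exI[of _ x] exI[of _ "s *\<^sub>R ?d"]) auto
    have Kx: "x \<in> K'" if "x \<in> K" for x using KK'[OF that, of 0] e by simp
    obtain M where M: "M \<ge> 0" "\<And>x y. \<bar>\<psi> x - \<psi> y\<bar> \<le> M * norm (x - y)"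
      using test_function_lipschitz[OF t] by blast
    have psim: "(\<lambda>x. \<psi> (x + c)) \<in> borel_measurable lebesgue" for c
    proof -
      have "(\<lambda>x. \<psi> (x + c)) \<in> borel_measurable borel"
        by (intro borel_measurable_continuous_onI continuous_on_compose2[OF K(3)] continuous_intros) auto
      then show ?thesis by (simp add: measurable_completion)
    qed
    have vK': "integrable lebesgue (\<lambda>x. indicator K' x *\<^sub>R v x)"
      using liv K' K'U by (auto simp: locally_integrable_on_def set_integrable_def)
    have der: "(\<psi> has_derivative frechet_derivative \<psi> (at x)) (at x)" for x
      by (rule test_function_has_derivative[OF t])
    have quot: "(\<lambda>n. (\<psi> (x + h n *\<^sub>R ?d) - \<psi> x) / h n) \<longlonglongrightarrow> frechet_derivative \<psi> (at x) ?d" for x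
    proof -
      have "((\<lambda>r. x + r *\<^sub>R ?d) has_derivative (\<lambda>r. r *\<^sub>R ?d)) (at 0)"
        by (auto intro!: derivative_eq_intros)
      then have "((\<lambda>r. \<psi> (x + r *\<^sub>R ?d)) has_derivative (\<lambda>r. frechet_derivative \<psi> (at x) (r *\<^sub>R ?d))) (at 0)"
        using has_derivative_compose[of "\<lambda>r. x + r *\<^sub>R ?d" _ 0 UNIV \<psi>] der[of x] by simp
      moreover have "(\<lambda>r. frechet_derivative \<psi> (at x) (r *\<^sub>R ?d)) = (*) (frechet_derivative \<psi> (at x) ?d)"
      proof
        fix r
        have "linear (frechet_derivative \<psi> (at x))"
          by (rule has_derivative_linear[OF der])
        from linear_scale[OF this, of r ?d]
        show "frechet_derivative \<psi> (at x) (r *\<^sub>R ?d) = frechet_derivative \<psi> (at x) ?d * r" by simp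
      qed
      ultimately have "((\<lambda>r. \<psi> (x + r *\<^sub>R ?d)) has_real_derivative frechet_derivative \<psi> (at x) ?d) (at 0)"
        unfolding has_field_derivative_def by simp
      then have "((\<lambda>r. (\<psi> (x + r *\<^sub>R ?d) - \<psi> x) / r) \<longlongrightarrow> frechet_derivative \<psi> (at x) ?d) (at 0)"
        by (simp add: DERIV_def)
      from filterlim_compose[OF this hat] show ?thesis .
    qed
    have supp: "x \<in> K'" if "\<psi> (x + h n *\<^sub>R ?d) \<noteq> 0" for x n
      using KK'[OF K(4)[OF that], of "- h n"] h[of n] by simp
    \<comment> \<open>The common value of both forms; its limit is computed first with the quotient
      on \<psi>, then with the quotient on \<open>v\<close>.\<close>
    define A where "A n = (\<integral>x. indicator K' x *\<^sub>R v x * ((\<psi> (x + h n *\<^sub>R ?d) - \<psi> x) / h n) \<partial>lebesgue)" for n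
    have A1: "A \<longlonglongrightarrow> (\<integral>x. indicator K' x *\<^sub>R v x * frechet_derivative \<psi> (at x) ?d \<partial>lebesgue)"
      unfolding A_def
    proof (rule integral_dominated_convergence[where w="\<lambda>x. M * norm (indicator K' x *\<^sub>R v x)"])
      have "(\<lambda>x. frechet_derivative \<psi> (at x) ?d) \<in> borel_measurable borel"
        using test_functionD[OF test_function_partial[OF t, of i]] by (intro borel_measurable_continuous_onI) auto
      then have "(\<lambda>x. frechet_derivative \<psi> (at x) ?d) \<in> borel_measurable lebesgue" by (simp add: measurable_completion)
      then show "(\<lambda>x. indicator K' x *\<^sub>R v x * frechet_derivative \<psi> (at x) ?d) \<in> borel_measurable lebesgue"
        by (rule borel_measurable_times[OF borel_measurable_integrable[OF vK']])
      show "(\<lambda>x. indicator K' x *\<^sub>R v x * ((\<psi> (x + h n *\<^sub>R ?d) - \<psi> x) / h n)) \<in> borel_measurable lebesgue" for n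
        using borel_measurable_times[OF borel_measurable_integrable[OF vK'] borel_measurable_divide[OF
          borel_measurable_diff[OF psim[of "h n *\<^sub>R ?d"] psim[of 0]] borel_measurable_const[of "h n"]]]
        by simp
      show "integrable lebesgue (\<lambda>x. M * norm (indicator K' x *\<^sub>R v x))" using vK' by simp
      show "AE x in lebesgue. (\<lambda>n. indicator K' x *\<^sub>R v x * ((\<psi> (x + h n *\<^sub>R ?d) - \<psi> x) / h n))
          \<longlonglongrightarrow> indicator K' x *\<^sub>R v x * frechet_derivative \<psi> (at x) ?d"
        by (intro AE_I2 tendsto_mult tendsto_const quot)
      show "AE x in lebesgue. norm (indicator K' x *\<^sub>R v x * ((\<psi> (x + h n *\<^sub>R ?d) - \<psi> x) / h n))
          \<le> M * norm (indicator K' x *\<^sub>R v x)" for n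
      proof (intro AE_I2)
        fix x
        have "\<bar>\<psi> (x + h n *\<^sub>R ?d) - \<psi> x\<bar> \<le> M * h n"
          using M(2)[of "x + h n *\<^sub>R ?d" x] h(1)[of n] nd by simp
        then have "\<bar>(\<psi> (x + h n *\<^sub>R ?d) - \<psi> x) / h n\<bar> \<le> M"
          using h(1)[of n] by (simp add: field_simps)
        then have "norm (indicator K' x *\<^sub>R v x) * \<bar>(\<psi> (x + h n *\<^sub>R ?d) - \<psi> x) / h n\<bar> \<le> norm (indicator K' x *\<^sub>R v x) * M"
          by (rule mult_left_mono) simp
        then show "norm (indicator K' x *\<^sub>R v x * ((\<psi> (x + h n *\<^sub>R ?d) - \<psi> x) / h n)) \<le> M * norm (indicator K' x *\<^sub>R v x)"
          by (simp only: real_norm_def abs_mult mult.commute)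
      qed
    qed
    \<comment> \<open>The shift turns the forward quotient of \<psi> into a backward quotient of
      \<open>v\<close>, whose step - h n also tends to 0.\<close>
    have "(\<lambda>n. \<integral>x. indicator K x *\<^sub>R (((v (x + (- h n) *\<^sub>R ?d) - v x) / (- h n)) * - \<psi> x) \<partial>lebesgue)
        \<longlonglongrightarrow> (\<integral>x. indicator K x *\<^sub>R (g x * - \<psi> x) \<partial>lebesgue)"
    proof (rule integral_dominated_convergence[where w="\<lambda>x. indicator K x *\<^sub>R (L * \<bar>\<psi> x\<bar>)"])
      have Ks: "K \<in> sets lebesgue" using K(1) by (simp add: lmeasurable_compact fmeasurableD)
      show "(\<lambda>x. indicator K x *\<^sub>R (g x * - \<psi> x)) \<in> borel_measurable lebesgue"
        using psim[of 0] by (intro borel_measurable_scaleR borel_measurable_indicator Ks borel_measurable_times g borel_measurable_uminus) simp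
      have "continuous_on K (\<lambda>x. L * \<bar>\<psi> x\<bar>)"
        by (intro continuous_intros continuous_on_subset[OF K(3)]) auto
      from set_integrable_continuous_compact[OF K(1) this]
      show "integrable lebesgue (\<lambda>x. indicator K x *\<^sub>R (L * \<bar>\<psi> x\<bar>))" by (simp add: set_integrable_def)
      show "(\<lambda>x. indicator K x *\<^sub>R (((v (x + (- h n) *\<^sub>R ?d) - v x) / (- h n)) * - \<psi> x)) \<in> borel_measurable lebesgue" for n
      proof -
        have "x + (- h n) *\<^sub>R ?d \<in> U" if "x \<in> K" for x
          using KK'[OF that, of "- h n"] K'U h[of n] by auto
        then have "continuous_on K (\<lambda>x. v (x + (- h n) *\<^sub>R ?d))"
          by (intro continuous_on_compose2[OF cont] continuous_intros) auto
        then have "continuous_on K (\<lambda>x. ((v (x + (- h n) *\<^sub>R ?d) - v x) / (- h n)) * - \<psi> x)"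
          using h(1)[of n] by (intro continuous_intros continuous_on_subset[OF K(3)] continuous_on_subset[OF cont K(2)]) auto
        from set_integrable_continuous_compact[OF K(1) this] show ?thesis
          unfolding set_integrable_def by (rule borel_measurable_integrable)
      qed
      show "AE x in lebesgue. (\<lambda>n. indicator K x *\<^sub>R (((v (x + (- h n) *\<^sub>R ?d) - v x) / (- h n)) * - \<psi> x))
         \<longlonglongrightarrow> indicator K x *\<^sub>R (g x * - \<psi> x)"
        using lim
      proof eventually_elim
        case (elim x)
        show ?case
        proof (cases "x \<in> K")
          case True
          have "filterlim (\<lambda>n. - h n) (at 0) sequentially"
            using hat tendsto_minus[OF h0] by (auto simp: filterlim_at)
          from filterlim_compose[OF elim[rule_format] this] show ?thesis
            using True K(2) by (intro tendsto_intros) auto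
        qed simp
      qed
      show "AE x in lebesgue. norm (indicator K x *\<^sub>R (((v (x + (- h n) *\<^sub>R ?d) - v x) / (- h n)) * - \<psi> x)) \<le> indicator K x *\<^sub>R (L * \<bar>\<psi> x\<bar>)" for n
      proof (intro AE_I2)
        fix x
        show "norm (indicator K x *\<^sub>R (((v (x + (- h n) *\<^sub>R ?d) - v x) / (- h n)) * - \<psi> x)) \<le> indicator K x *\<^sub>R (L * \<bar>\<psi> x\<bar>)"
        proof (cases "x \<in> K")
          case True
          have "x + (- h n) *\<^sub>R ?d \<in> ball x e" "x \<in> ball x e"
            using h[of n] e nd by (auto simp: dist_norm)
          then have "closed_segment (x + (- h n) *\<^sub>R ?d) x \<subseteq> ball x e" by (simp add: closed_segment_subset)
          also have "\<dots> \<subseteq> U" using e True by auto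
          finally have "\<bar>v (x + (- h n) *\<^sub>R ?d) - v x\<bar> \<le> L * h n"
            using lip[of "x + (- h n) *\<^sub>R ?d" x] h(1)[of n] nd by simp
          then have "\<bar>(v (x + (- h n) *\<^sub>R ?d) - v x) / (- h n)\<bar> \<le> L"
            using h(1)[of n] by (simp add: field_simps)
          then have "\<bar>(v (x + (- h n) *\<^sub>R ?d) - v x) / (- h n)\<bar> * \<bar>\<psi> x\<bar> \<le> L * \<bar>\<psi> x\<bar>"
            by (rule mult_right_mono) simp
          then have "\<bar>((v (x + (- h n) *\<^sub>R ?d) - v x) / (- h n)) * - \<psi> x\<bar> \<le> L * \<bar>\<psi> x\<bar>"
            by (simp only: abs_mult abs_minus_cancel)
          then show ?thesis using True by simp
        qed simp
      qed
    qed
    moreover have "(\<integral>x. indicator K x *\<^sub>R (((v (x + (- h n) *\<^sub>R ?d) - v x) / (- h n)) * - \<psi> x) \<partial>lebesgue) = A n" for n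
    proof -
      have KU: "x + (- h n) *\<^sub>R ?d \<in> U" if "x \<in> K" for x
        using KK'[OF that, of "- h n"] K'U h[of n] by auto
      have tU: "test_function U (\<lambda>x. \<psi> (x + h n *\<^sub>R ?d))"
        using test_function_translate[OF t K(4,1), of "(- h n) *\<^sub>R ?d"] KU by simp
      have i1: "set_integrable lebesgue K (\<lambda>x. v (x + (- h n) *\<^sub>R ?d) * \<psi> x)" "set_integrable lebesgue K (\<lambda>x. v x * \<psi> x)"
        by (rule set_integrable_mult_test[OF integral_shift(1)[OF liv KU] tK], assumption)
           (rule set_integrable_mult_test[OF locally_integrable_on_mono[OF liv K(2)] tK])
      have i2: "set_integrable lebesgue U (\<lambda>x. v x * \<psi> (x + h n *\<^sub>R ?d))" "set_integrable lebesgue U (\<lambda>x. v x * \<psi> x)"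
        by (rule set_integrable_mult_test[OF liv tU], rule set_integrable_mult_test[OF liv t])
      have e1: "(LINT x:K|lebesgue. v (x + (- h n) *\<^sub>R ?d) * \<psi> x) = (LINT x:U|lebesgue. v x * \<psi> (x + h n *\<^sub>R ?d))"
        using integral_shift(2)[OF liv KU tK] by simp
      have e2: "(LINT x:K|lebesgue. v x * \<psi> x) = (LINT x:U|lebesgue. v x * \<psi> x)"
        using integral_shift(2)[OF liv _ tK, of 0] K(2) by auto
      have "(\<integral>x. indicator K x *\<^sub>R (((v (x + (- h n) *\<^sub>R ?d) - v x) / (- h n)) * - \<psi> x) \<partial>lebesgue)
        = (LINT x:K|lebesgue. (1 / h n) * (v (x + (- h n) *\<^sub>R ?d) * \<psi> x - v x * \<psi> x))"
        unfolding set_lebesgue_integral_def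
        by (rule Bochner_Integration.integral_cong[OF refl]) (use h(1)[of n] in \<open>auto simp: field_simps\<close>)
      also have "\<dots> = (1 / h n) * ((LINT x:U|lebesgue. v x * \<psi> (x + h n *\<^sub>R ?d)) - (LINT x:U|lebesgue. v x * \<psi> x))"
        using i1 e1 e2 by (simp only: set_integral_mult_right set_integral_diff)
      also have "\<dots> = (LINT x:U|lebesgue. (1 / h n) * (v x * \<psi> (x + h n *\<^sub>R ?d) - v x * \<psi> x))"
        using i2 by (simp only: set_integral_mult_right set_integral_diff)
      also have "\<dots> = A n"
        unfolding set_lebesgue_integral_def A_def
      proof (rule Bochner_Integration.integral_cong[OF refl])
        fix x
        show "indicator U x *\<^sub>R ((1 / h n) * (v x * \<psi> (x + h n *\<^sub>R ?d) - v x * \<psi> x))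
          = indicator K' x *\<^sub>R v x * ((\<psi> (x + h n *\<^sub>R ?d) - \<psi> x) / h n)"
        proof (cases "x \<in> K'")
          case True
          then have "x \<in> U" using K'U by blast
          with True show ?thesis by (simp add: field_simps)
        next
          case False
          have "\<psi> (x + h n *\<^sub>R ?d) = 0" using supp[of x n] False by blast
          moreover have "\<psi> x = 0" using K(4)[of x] Kx False by blast
          ultimately show ?thesis by simp
        qed
      qed
      finally show ?thesis .
    qed
    ultimately have "A \<longlonglongrightarrow> (\<integral>x. indicator K x *\<^sub>R (g x * - \<psi> x) \<partial>lebesgue)" by simp
    from LIMSEQ_unique[OF A1 this]
    have eq: "(\<integral>x. indicator K' x *\<^sub>R v x * frechet_derivative \<psi> (at x) ?d \<partial>lebesgue) = (\<integral>x. indicator K x *\<^sub>R (g x * - \<psi> x) \<partial>lebesgue)" .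
    have d0: "frechet_derivative \<psi> (at x) ?d = 0" if "x \<notin> K" for x
    proof -
      have "((\<lambda>x. 0) has_derivative (\<lambda>h. 0)) (at x)" by simp
      then have "(\<psi> has_derivative (\<lambda>h. 0)) (at x)"
        by (rule has_derivative_transform_within_open[where s="-K"])
           (use that K in \<open>auto intro: open_Compl compact_imp_closed\<close>)
      then show ?thesis by (simp add: frechet_derivative_at[symmetric])
    qed
    have "(LINT x:U|lebesgue. v x * frechet_derivative \<psi> (at x) ?d) = (\<integral>x. indicator K' x *\<^sub>R v x * frechet_derivative \<psi> (at x) ?d \<partial>lebesgue)"
      unfolding set_lebesgue_integral_def
    proof (rule Bochner_Integration.integral_cong[OF refl])
      fix x
      show "indicator U x *\<^sub>R (v x * frechet_derivative \<psi> (at x) ?d) = indicator K' x *\<^sub>R v x * frechet_derivative \<psi> (at x) ?d"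
      proof (cases "x \<in> K")
        case True
        then have "x \<in> U" "x \<in> K'" using K(2) Kx by auto
        then show ?thesis by simp
      qed (simp add: d0)
    qed
    also note eq
    also have "(\<integral>x. indicator K x *\<^sub>R (g x * - \<psi> x) \<partial>lebesgue) = - (\<integral>x. indicator U x *\<^sub>R (g x * \<psi> x) \<partial>lebesgue)"
    proof -
      have "indicator K x *\<^sub>R (g x * - \<psi> x) = - (indicator U x *\<^sub>R (g x * \<psi> x))" for x
      proof (cases "\<psi> x = 0")
        case False
        then have "x \<in> K" "x \<in> U" using K by auto
        then show ?thesis by simp
      qed simp
      then show ?thesis by (simp only: Bochner_Integration.integral_minus)
    qed
    finally show "(LINT x:U|lebesgue. v x * frechet_derivative \<psi> (at x) ?d) = - (LINT x:U|lebesgue. g x * \<psi> x)"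
      by (simp add: set_lebesgue_integral_def)
  qed
qed

section \<open>Bey's refinement and Freudenthal--Kuhn paths\<close>

fun kpath :: "'a::monoid_add \<Rightarrow> 'a list \<Rightarrow> 'a list" where
  "kpath y [] = [y]"
| "kpath y (v # vs) = y # kpath (y + v) vs"

text \<open>The vertices of a path are its start plus the sums of steps over these index sets, which
  form a maximal chain of subsets.\<close>

definition prefix_sets :: "'b list \<Rightarrow> 'b set set" where
  "prefix_sets \<pi> = (\<lambda>a. set (take a \<pi>)) ` {..length \<pi>}"

lemma prefix_sets_Cons: "prefix_sets (i # \<pi>) = insert {} (insert i ` prefix_sets \<pi>)"
proof -
  have "{..length (i # \<pi>)} = insert 0 (Suc ` {..length \<pi>})"
    by (simp add: atMost_Suc_eq_insert_0)
  then show ?thesis by (simp add: prefix_sets_def image_image)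
qed

lemma prefix_sets_subset: "A \<in> prefix_sets \<pi> \<Longrightarrow> A \<subseteq> set \<pi>"
  by (auto simp: prefix_sets_def dest: in_set_takeD)

lemma prefix_sets_chain: "A \<in> prefix_sets \<pi> \<Longrightarrow> B \<in> prefix_sets \<pi> \<Longrightarrow> A \<subseteq> B \<or> B \<subseteq> A"
proof -
  assume "A \<in> prefix_sets \<pi>" "B \<in> prefix_sets \<pi>"
  then obtain a b where "A = set (take a \<pi>)" "B = set (take b \<pi>)" by (auto simp: prefix_sets_def)
  then show ?thesis
    using set_take_subset_set_take[of a b \<pi>] set_take_subset_set_take[of b a \<pi>] linear[of a b] by auto
qed

lemma empty_in_prefix_sets: "{} \<in> prefix_sets \<pi>"
  by (cases \<pi>) (auto simp: prefix_sets_Cons prefix_sets_def)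

text \<open>Two consecutive prefixes that differ by \<open>j\<close> are the ends of the path edge
  in direction \<open>j\<close>.\<close>

lemma prefix_sets_insert:
  assumes "distinct \<pi>" "j \<in> set \<pi>"
  obtains A where "A \<in> prefix_sets \<pi>" "insert j A \<in> prefix_sets \<pi>" "j \<notin> A"
proof -
  have "\<exists>A. A \<in> prefix_sets \<pi> \<and> insert j A \<in> prefix_sets \<pi> \<and> j \<notin> A"
    using assms
  proof (induction \<pi>)
    case (Cons i \<pi>)
    show ?case
    proof (cases "i = j")
      case True
      then show ?thesis
        using empty_in_prefix_sets[of \<pi>] by (auto simp: prefix_sets_Cons intro!: exI[of _ "{}"])
    next
      case False
      then obtain A where "A \<in> prefix_sets \<pi>" "insert j A \<in> prefix_sets \<pi>" "j \<notin> A" using Cons by auto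
      then show ?thesis using False by (auto simp: prefix_sets_Cons insert_commute intro!: exI[of _ "insert i A"])
    qed
  qed auto
  then show ?thesis using that by blast
qed

lemma set_kpath:
  fixes c :: "'b \<Rightarrow> 'a::ab_group_add"
  assumes "distinct \<pi>"
  shows "set (kpath y (map c \<pi>)) = (\<lambda>A. y + sum c A) ` prefix_sets \<pi>"
  using assms
proof (induction \<pi> arbitrary: y)
  case Nil
  then show ?case by (simp add: prefix_sets_def)
next
  case (Cons i \<pi>)
  have "sum c (insert i A) = c i + sum c A" if "A \<in> prefix_sets \<pi>" for A
    using prefix_sets_subset[OF that] Cons.prems finite_subset[of A "set \<pi>"] by (subst sum.insert) auto
  then show ?case
    using Cons by (auto simp: prefix_sets_Cons image_image add.assoc image_iff)
qed

lemma length_kpath [simp]: "length (kpath y vs) = Suc (length vs)"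
  by (induction vs arbitrary: y) auto

lemma kpath_snoc: "kpath y (vs @ [v]) = kpath y vs @ [y + sum_list vs + v]"
  for y :: "'a::ab_group_add"
  by (induction vs arbitrary: y) (auto simp: add_ac)

text \<open>Reflection negates every step and reversal negates it again, so the reflected path makes
  the same steps in opposite order, starting at the image of the last vertex.\<close>

lemma rev_kpath_reflect:
  fixes y :: "'a::ab_group_add"
  shows "rev (map (\<lambda>p. w - p) (kpath y vs)) = kpath (w - (y + sum_list vs)) (rev vs)"
  by (induction vs arbitrary: y) (auto simp: kpath_snoc algebra_simps)

text \<open>Coefficients decrease along the path, so with the largest one, \<open>f i\<close>, as
  weight the point is a convex combination of \<open>y\<close> and a point of the remaining path
  with coefficients \<open>f j / f i\<close>.\<close>

lemma kpath_hull:
  fixes c :: "'b \<Rightarrow> 'a::real_vector"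
  assumes "\<And>j. j \<in> set \<pi> \<Longrightarrow> 0 \<le> f j \<and> f j \<le> 1" "sorted_wrt (\<lambda>i j. f j \<le> f i) \<pi>"
  shows "y + (\<Sum>j\<leftarrow>\<pi>. f j *\<^sub>R c j) \<in> convex hull (set (kpath y (map c \<pi>)))"
  using assms
proof (induction \<pi> arbitrary: y f)
  case Nil
  then show ?case by simp
next
  case (Cons i \<pi>)
  let ?S = "set (kpath y (map c (i # \<pi>)))"
  have y: "y \<in> convex hull ?S" by (rule hull_inc) simp
  show ?case
  proof (cases "f i = 0")
    case True
    have "f j = 0" if "j \<in> set \<pi>" for j
      using Cons.prems(1)[of j] Cons.prems(2) that True by auto
    then have "(\<Sum>j\<leftarrow>\<pi>. f j *\<^sub>R c j) = (\<Sum>j\<leftarrow>\<pi>. 0)"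
      by (intro arg_cong[where f=sum_list] map_cong) auto
    then show ?thesis using y True by simp
  next
    case False
    then have fi: "0 < f i" "f i \<le> 1" using Cons.prems(1)[of i] by auto
    define z where "z = (y + c i) + (\<Sum>j\<leftarrow>\<pi>. (f j / f i) *\<^sub>R c j)"
    have "z \<in> convex hull (set (kpath (y + c i) (map c \<pi>)))"
      unfolding z_def
    proof (rule Cons.IH)
      show "0 \<le> f j / f i \<and> f j / f i \<le> 1" if "j \<in> set \<pi>" for j
        using Cons.prems that fi by (auto simp: field_simps)
      show "sorted_wrt (\<lambda>i' j. f j / f i \<le> f i' / f i) \<pi>"
        using Cons.prems(2) fi by (auto simp: divide_le_cancel)
    qed
    moreover have "convex hull (set (kpath (y + c i) (map c \<pi>))) \<subseteq> convex hull ?S"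
      by (rule hull_mono) auto
    ultimately have "z \<in> convex hull ?S" by blast
    then have "(1 - f i) *\<^sub>R y + f i *\<^sub>R z \<in> convex hull ?S"
      using convexD_alt[OF convex_convex_hull y] fi by (meson less_imp_le)
    also have "(1 - f i) *\<^sub>R y + f i *\<^sub>R z = y + (\<Sum>j\<leftarrow>(i # \<pi>). f j *\<^sub>R c j)"
    proof -
      have "f i *\<^sub>R (\<Sum>j\<leftarrow>\<pi>. (f j / f i) *\<^sub>R c j) = (\<Sum>j\<leftarrow>\<pi>. f j *\<^sub>R c j)"
        using fi by (induction \<pi>) (auto simp: scaleR_add_right)
      then show ?thesis by (simp add: z_def algebra_simps)
    qed
    finally show ?thesis .
  qed
qed

lemma affine_nonneg_hull:
  fixes \<alpha> :: "'a::real_inner"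
  assumes "\<And>p. p \<in> S \<Longrightarrow> 0 \<le> \<alpha> \<bullet> p + c" "x \<in> convex hull S"
  shows "0 \<le> \<alpha> \<bullet> x + c"
proof -
  have "convex hull S \<subseteq> {x. \<alpha> \<bullet> x \<ge> - c}"
    by (rule hull_minimal) (use assms(1) in \<open>force simp: convex_halfspace_ge\<close>)+
  then show ?thesis using assms(2) by auto
qed

section \<open>Bey's rule on lattice paths\<close>

lemma refine_kpath2:
  fixes a b y :: "real^'d"
  shows "refine (kpath y [a, b]) =
   [kpath y [(1/2) *\<^sub>R a, (1/2) *\<^sub>R b], kpath (y + (1/2) *\<^sub>R a) [(1/2) *\<^sub>R a, (1/2) *\<^sub>R b],
    kpath (y + ((1/2) *\<^sub>R a + (1/2) *\<^sub>R b)) [(1/2) *\<^sub>R a, (1/2) *\<^sub>R b], kpath (y + (1/2) *\<^sub>R a) [(1/2) *\<^sub>R b, (1/2) *\<^sub>R a]]"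
  by (simp add: Let_def midpoint_def vec_eq_iff field_simps)

text \<open>Each child again makes every half step exactly once. The four corner tetrahedra keep the
  order of the parent; the four parts of the inner octahedron permute it.\<close>

lemma refine_kpath3:
  fixes a b c y :: "real^'d"
  shows "refine (kpath y [a, b, c]) = (let a' = (1/2) *\<^sub>R a; b' = (1/2) *\<^sub>R b; c' = (1/2) *\<^sub>R c in
   [kpath y [a', b', c'], kpath (y + a') [a', b', c'], kpath (y + (a' + b')) [a', b', c'],
    kpath (y + (a' + (b' + c'))) [a', b', c'], kpath (y + a') [b', c', a'], kpath (y + a') [b', a', c'],
    kpath (y + (a' + b')) [c', a', b'], kpath (y + (a' + b')) [a', c', b']])"
  by (simp add: Let_def midpoint_def vec_eq_iff field_simps)

lemma refine_subset_hull:
  assumes "ys \<in> set (refine xs)"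
  shows "set ys \<subseteq> convex hull (set xs)"
proof -
  define H where "H = convex hull (set xs)"
  have mid: "midpoint a b \<in> H" if "a \<in> H" "b \<in> H" for a b
    using closed_segment_subset[OF that] midpoint_in_closed_segment by (auto simp: H_def)
  have H: "x \<in> H" if "x \<in> set xs" for x using that by (simp add: H_def hull_inc)
  have "set ys \<subseteq> H"
    using assms H by (cases xs rule: refine.cases) (auto simp: Let_def intro!: mid)
  then show ?thesis by (simp add: H_def)
qed

definition is_perm :: "nat \<Rightarrow> nat list \<Rightarrow> bool" where
  "is_perm d \<pi> \<longleftrightarrow> distinct \<pi> \<and> set \<pi> = {1..d}"

lemma is_perm_length: "is_perm d \<pi> \<Longrightarrow> length \<pi> = d"
  using distinct_card[of \<pi>] by (simp add: is_perm_def)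

lemma refine_child_form:
  fixes c :: "nat \<Rightarrow> real^'d"
  assumes "d = 2 \<or> d = 3" "is_perm d \<pi>" "ys \<in> set (refine (kpath y (map c \<pi>)))"
  obtains R \<rho> where "R \<subseteq> {1..d}" "is_perm d \<rho>"
    "ys = kpath (y + (\<Sum>j\<in>R. (1/2) *\<^sub>R c j)) (map (\<lambda>j. (1/2) *\<^sub>R c j) \<rho>)"
  using assms(1)
proof
  assume d: "d = 2"
  with is_perm_length[OF assms(2)] obtain p q where \<pi>: "\<pi> = [p, q]"
    by (auto simp: numeral_eq_Suc length_Suc_conv)
  have pq: "p \<noteq> q" "{p, q} = {1..d}" using assms(2) \<pi> by (auto simp: is_perm_def)
  have perm: "is_perm d [p, q]" "is_perm d [q, p]" using pq by (auto simp: is_perm_def)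
  have sub: "{} \<subseteq> {1..d}" "{p} \<subseteq> {1..d}" "{p, q} \<subseteq> {1..d}" using pq by auto
  show thesis
    using assms(3) pq(1) that[OF sub(1) perm(1)] that[OF sub(2) perm(1)] that[OF sub(3) perm(1)]
      that[OF sub(2) perm(2)]
    unfolding \<pi> by (auto simp: refine_kpath2 simp del: kpath.simps refine.simps)
next
  assume d: "d = 3"
  with is_perm_length[OF assms(2)] obtain p q r where \<pi>: "\<pi> = [p, q, r]"
    by (auto simp: numeral_eq_Suc length_Suc_conv)
  have pq: "p \<noteq> q" "p \<noteq> r" "q \<noteq> r" "{p, q, r} = {1..d}" using assms(2) \<pi> by (auto simp: is_perm_def)
  have perm: "is_perm d [p, q, r]" "is_perm d [q, r, p]" "is_perm d [q, p, r]" "is_perm d [r, p, q]" "is_perm d [p, r, q]"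
    using pq by (auto simp: is_perm_def)
  have sub: "{} \<subseteq> {1..d}" "{p} \<subseteq> {1..d}" "{p, q} \<subseteq> {1..d}" "{p, q, r} \<subseteq> {1..d}" using pq by auto
  show thesis
    using assms(3) pq(1-3) that[OF sub(1) perm(1)] that[OF sub(2) perm(1)] that[OF sub(3) perm(1)] that[OF sub(4) perm(1)]
      that[OF sub(2) perm(2)] that[OF sub(2) perm(3)] that[OF sub(3) perm(4)] that[OF sub(3) perm(5)]
    unfolding \<pi> by (auto simp: refine_kpath3 Let_def simp del: kpath.simps refine.simps)
qed

text \<open>Children start at half a prefix sum, so a parent of the child with start set
  \<open>R\<close> must make the steps in \<open>R\<close> first; inside and outside
  \<open>R\<close> it keeps the order of \<rho>.\<close>

lemma refine_child_mem:
  fixes c :: "nat \<Rightarrow> real^'d"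
  assumes "d = 2 \<or> d = 3" "is_perm d \<rho>" "R \<subseteq> {1..d}"
  shows "kpath (y + (\<Sum>j\<in>R. (1/2) *\<^sub>R c j)) (map (\<lambda>j. (1/2) *\<^sub>R c j) \<rho>)
    \<in> set (refine (kpath y (map c (filter (\<lambda>j. j \<in> R) \<rho> @ filter (\<lambda>j. j \<notin> R) \<rho>))))"
  using assms(1)
proof
  assume d: "d = 2"
  with is_perm_length[OF assms(2)] obtain p q where \<rho>: "\<rho> = [p, q]"
    by (auto simp: numeral_eq_Suc length_Suc_conv)
  have pq: "p \<noteq> q" "{1..d} = {p, q}" using assms(2) \<rho> by (auto simp: is_perm_def)
  have "R = (if p \<in> R then {p} else {}) \<union> (if q \<in> R then {q} else {})" using assms(3) pq by auto
  then have "R = {} \<or> R = {p} \<or> R = {q} \<or> R = {p, q}" by (auto split: if_splits)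
  then show ?thesis
    unfolding \<rho> using pq(1)
    by (elim disjE) (simp_all add: refine_kpath2 eq_commute[of q p] del: kpath.simps refine.simps)
next
  assume d: "d = 3"
  with is_perm_length[OF assms(2)] obtain p q r where \<rho>: "\<rho> = [p, q, r]"
    by (auto simp: numeral_eq_Suc length_Suc_conv)
  have pq: "p \<noteq> q" "p \<noteq> r" "q \<noteq> r" "{1..d} = {p, q, r}" using assms(2) \<rho> by (auto simp: is_perm_def)
  have "R = (if p \<in> R then {p} else {}) \<union> (if q \<in> R then {q} else {}) \<union> (if r \<in> R then {r} else {})" using assms(3) pq by auto
  then have "R = {} \<or> R = {p} \<or> R = {q} \<or> R = {r} \<or> R = {p, q} \<or> R = {p, r} \<or> R = {q, r} \<or> R = {p, q, r}"
    by (auto split: if_splits)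
  then show ?thesis
    unfolding \<rho> using pq(1-3)
    by (elim disjE) (simp_all add: refine_kpath3 Let_def eq_commute[of q p] eq_commute[of r p] eq_commute[of r q] del: kpath.simps refine.simps)
qed

text \<open>\<open>e\<close> lists the consecutive edge vectors of an ordered simplex, \<open>b\<close> is the dual basis. In the
  coordinates \<open>\<sigma>\<close> the simplex is \<open>1 = \<sigma> 0 \<ge> \<sigma> 1 \<ge> \<dots> \<ge> \<sigma> d \<ge> \<sigma> (d + 1) = 0\<close>, and Bey's rule
  produces the Freudenthal--Kuhn triangulation of the lattice spanned by the \<open>e j / N\<close>.\<close>

locale kuhn_frame =
  fixes d :: nat and x0 :: "real^'d" and e b :: "nat \<Rightarrow> real^'d"
  assumes d: "d = 2 \<or> d = 3"
    and dual: "\<And>i j. i \<in> {1..d} \<Longrightarrow> j \<in> {1..d} \<Longrightarrow> b i \<bullet> e j = (if i = j then 1 else 0)"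
    and expand: "\<And>x. (\<Sum>j=1..d. (b j \<bullet> x) *\<^sub>R e j) = x"
begin

section \<open>Coordinates, lattices and Kuhn cells\<close>

definition \<sigma> :: "nat \<Rightarrow> real^'d \<Rightarrow> real" where
  "\<sigma> j x = (if j = 0 then 1 else if j \<le> d then b j \<bullet> (x - x0) else 0)"

text \<open>The linear part of the affine coordinate \<open>\<sigma> j\<close>, zero for the two
  constant coordinates.\<close>

definition dir :: "nat \<Rightarrow> real^'d" where "dir j = (if j \<in> {1..d} then b j else 0)"

lemma \<sigma>_diff: "\<sigma> j x - \<sigma> j y = dir j \<bullet> (x - y)"
  by (auto simp: \<sigma>_def dir_def inner_diff_right)

lemma \<sigma>_0 [simp]: "\<sigma> 0 x = 1" and \<sigma>_end [simp]: "\<sigma> (Suc d) x = 0"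
  by (auto simp: \<sigma>_def)

lemma \<sigma>_eq_affine: "\<sigma> j x = dir j \<bullet> x + (\<sigma> j x0 - dir j \<bullet> x0)"
  using \<sigma>_diff[of j x x0] by (simp add: inner_diff_right)

lemma \<sigma>_shift:
  assumes "A \<subseteq> {1..d}"
  shows "\<sigma> j (y + (\<Sum>i\<in>A. t *\<^sub>R e i)) = \<sigma> j y + (if j \<in> A then t else 0)"
proof -
  have fin: "finite A" using assms finite_subset by blast
  have "dir j \<bullet> (\<Sum>i\<in>A. t *\<^sub>R e i) = (\<Sum>i\<in>A. if i = j then t else 0)"
    unfolding inner_sum_right
  proof (rule sum.cong[OF refl])
    fix i assume "i \<in> A"
    then have "i \<in> {1..d}" using assms by blast
    then show "dir j \<bullet> t *\<^sub>R e i = (if i = j then t else 0)" by (auto simp: dir_def dual)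
  qed
  also have "\<dots> = (if j \<in> A then t else 0)" using fin by simp
  finally show ?thesis using \<sigma>_diff[of j "y + (\<Sum>i\<in>A. t *\<^sub>R e i)" y] by simp
qed

lemma \<sigma>_inject: "(\<And>j. j \<in> {1..d} \<Longrightarrow> \<sigma> j x = \<sigma> j y) \<Longrightarrow> x = y"
proof -
  assume a: "\<And>j. j \<in> {1..d} \<Longrightarrow> \<sigma> j x = \<sigma> j y"
  have "b j \<bullet> (x - y) = 0" if "j \<in> {1..d}" for j
    using a[OF that] \<sigma>_diff[of j x y] that by (simp add: dir_def)
  then have "(\<Sum>j=1..d. (b j \<bullet> (x - y)) *\<^sub>R e j) = 0" by (intro sum.neutral) auto
  then show "x = y" unfolding expand by simp
qed

lemma point_expand: "x = y + (\<Sum>j=1..d. (\<sigma> j x - \<sigma> j y) *\<^sub>R e j)"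
proof -
  have "(\<Sum>j=1..d. (\<sigma> j x - \<sigma> j y) *\<^sub>R e j) = (\<Sum>j=1..d. (b j \<bullet> (x - y)) *\<^sub>R e j)"
    by (rule sum.cong) (auto simp: \<sigma>_diff dir_def)
  then show ?thesis unfolding expand by simp
qed

definition lattice :: "nat \<Rightarrow> (real^'d) set" where
  "lattice N = {x. \<forall>j\<in>{1..d}. real N * \<sigma> j x \<in> \<int>}"

definition kuhn :: "nat \<Rightarrow> real^'d \<Rightarrow> nat list \<Rightarrow> (real^'d) list" where
  "kuhn N y \<pi> = kpath y (map (\<lambda>j. (1 / real N) *\<^sub>R e j) \<pi>)"

text \<open>All cells of the Freudenthal--Kuhn triangulation of the whole space at scale 1/N.
  Without reference to \<open>T\<close> this family is closed under the lattice reflections; the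
  cells inside \<open>T\<close> are selected afterwards.\<close>

definition kuhn_lists :: "nat \<Rightarrow> (real^'d) list set" where
  "kuhn_lists N = {kuhn N y \<pi> |y \<pi>. y \<in> lattice N \<and> is_perm d \<pi>}"

definition root :: "(real^'d) list" where "root = kuhn 1 x0 [1..<Suc d]"

definition T :: "(real^'d) set" where "T = convex hull (set root)"

lemma lattice_int: "x \<in> lattice N \<Longrightarrow> real N * \<sigma> j x \<in> \<int>"
  by (cases "j \<in> {1..d}") (auto simp: lattice_def \<sigma>_def)

lemma kuhn_vertexE:
  assumes "is_perm d \<pi>" "p \<in> set (kuhn N y \<pi>)"
  obtains A where "A \<in> prefix_sets \<pi>" "A \<subseteq> {1..d}" "p = y + (\<Sum>i\<in>A. (1 / real N) *\<^sub>R e i)"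
proof -
  have "p \<in> (\<lambda>A. y + (\<Sum>i\<in>A. (1 / real N) *\<^sub>R e i)) ` prefix_sets \<pi>"
    using assms set_kpath[of \<pi> y "\<lambda>j. (1 / real N) *\<^sub>R e j"] by (simp add: kuhn_def is_perm_def)
  then obtain A where A: "A \<in> prefix_sets \<pi>" "p = y + (\<Sum>i\<in>A. (1 / real N) *\<^sub>R e i)" by auto
  show ?thesis using that[OF A(1) _ A(2)] prefix_sets_subset[OF A(1)] assms(1) by (simp add: is_perm_def)
qed

lemma kuhn_vertexI:
  assumes "is_perm d \<pi>" "A \<in> prefix_sets \<pi>"
  shows "y + (\<Sum>i\<in>A. (1 / real N) *\<^sub>R e i) \<in> set (kuhn N y \<pi>)"
  using assms set_kpath[of \<pi> y "\<lambda>j. (1 / real N) *\<^sub>R e j"] by (auto simp: kuhn_def is_perm_def)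

lemma \<sigma>_vertex:
  assumes "N > 0" "A \<subseteq> {1..d}"
  shows "real N * \<sigma> j (y + (\<Sum>i\<in>A. (1 / real N) *\<^sub>R e i)) = real N * \<sigma> j y + of_bool (j \<in> A)"
  using assms by (simp add: \<sigma>_shift distrib_left)

lemma kuhn_vertex_lattice:
  assumes "N > 0" "xs \<in> kuhn_lists N" "p \<in> set xs"
  shows "p \<in> lattice N"
proof -
  obtain y \<pi> where y: "xs = kuhn N y \<pi>" "y \<in> lattice N" "is_perm d \<pi>" using assms by (auto simp: kuhn_lists_def)
  obtain A where A: "A \<subseteq> {1..d}" "p = y + (\<Sum>i\<in>A. (1 / real N) *\<^sub>R e i)"
    using kuhn_vertexE[OF y(3) assms(3)[unfolded y(1)]] by metis
  show ?thesis
    unfolding lattice_def using lattice_int[OF y(2)] by (auto simp: A(2) \<sigma>_vertex[OF assms(1) A(1)])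
qed

text \<open>Prefix sets are nested, so from \<open>q\<close> to \<open>p\<close> all scaled
  coordinates change by 0 or 1 in a common direction, and two such changes differ by at most 1.
  Hence no cell crosses a hyperplane on which N times \<open>\<sigma> i - \<sigma> j\<close> is an
  integer.\<close>

lemma kuhn_diff_bound:
  assumes "N > 0" "xs \<in> kuhn_lists N" "p \<in> set xs" "q \<in> set xs"
  shows "\<bar>real N * (\<sigma> i p - \<sigma> j p) - real N * (\<sigma> i q - \<sigma> j q)\<bar> \<le> 1"
proof -
  obtain y \<pi> where y: "xs = kuhn N y \<pi>" "y \<in> lattice N" "is_perm d \<pi>" using assms by (auto simp: kuhn_lists_def)
  obtain A where A: "A \<in> prefix_sets \<pi>" "A \<subseteq> {1..d}" "p = y + (\<Sum>i\<in>A. (1 / real N) *\<^sub>R e i)"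
    using kuhn_vertexE[OF y(3) assms(3)[unfolded y(1)]] by metis
  obtain B where B: "B \<in> prefix_sets \<pi>" "B \<subseteq> {1..d}" "q = y + (\<Sum>i\<in>B. (1 / real N) *\<^sub>R e i)"
    using kuhn_vertexE[OF y(3) assms(4)[unfolded y(1)]] by metis
  have eq: "real N * (\<sigma> i p - \<sigma> j p) - real N * (\<sigma> i q - \<sigma> j q)
      = (of_bool (i \<in> A) - of_bool (i \<in> B)) - (of_bool (j \<in> A) - of_bool (j \<in> B))"
    unfolding A(3) B(3) right_diff_distrib \<sigma>_vertex[OF assms(1) A(2)] \<sigma>_vertex[OF assms(1) B(2)] by simp
  show ?thesis
    unfolding eq using prefix_sets_chain[OF A(1) B(1)] by (auto simp: of_bool_def)
qed

lemma \<sigma>_diff_nonneg_hull: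
  assumes "\<And>p. p \<in> S \<Longrightarrow> \<sigma> j p + c \<le> \<sigma> i p" "x \<in> convex hull S"
  shows "\<sigma> j x + c \<le> \<sigma> i x"
proof -
  have "0 \<le> (dir i - dir j) \<bullet> x + ((\<sigma> i x0 - dir i \<bullet> x0) - (\<sigma> j x0 - dir j \<bullet> x0) - c)"
  proof (rule affine_nonneg_hull[OF _ assms(2)])
    fix p assume "p \<in> S"
    then show "0 \<le> (dir i - dir j) \<bullet> p + ((\<sigma> i x0 - dir i \<bullet> x0) - (\<sigma> j x0 - dir j \<bullet> x0) - c)"
      using assms(1)[of p] \<sigma>_eq_affine[of i p] \<sigma>_eq_affine[of j p] by (simp add: inner_diff_left)
  qed
  then show ?thesis
    using \<sigma>_eq_affine[of i x] \<sigma>_eq_affine[of j x] by (simp add: inner_diff_left)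
qed

lemma kuhn_hullI:
  assumes N: "N > 0" and \<pi>: "is_perm d \<pi>"
    and f: "\<And>j. j \<in> {1..d} \<Longrightarrow> 0 \<le> real N * (\<sigma> j x - \<sigma> j y) \<and> real N * (\<sigma> j x - \<sigma> j y) \<le> 1"
    and s: "sorted_wrt (\<lambda>i j. real N * (\<sigma> j x - \<sigma> j y) \<le> real N * (\<sigma> i x - \<sigma> i y)) \<pi>"
  shows "x \<in> convex hull (set (kuhn N y \<pi>))"
proof -
  have "y + (\<Sum>j\<leftarrow>\<pi>. (real N * (\<sigma> j x - \<sigma> j y)) *\<^sub>R (1 / real N) *\<^sub>R e j) \<in> convex hull (set (kuhn N y \<pi>))"
    unfolding kuhn_def by (rule kpath_hull) (use f s \<pi> in \<open>auto simp: is_perm_def\<close>)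
  also have "(\<Sum>j\<leftarrow>\<pi>. (real N * (\<sigma> j x - \<sigma> j y)) *\<^sub>R (1 / real N) *\<^sub>R e j) = (\<Sum>j\<leftarrow>\<pi>. (\<sigma> j x - \<sigma> j y) *\<^sub>R e j)"
    using N by simp
  also have "\<dots> = (\<Sum>j=1..d. (\<sigma> j x - \<sigma> j y) *\<^sub>R e j)"
    using \<pi> by (simp add: is_perm_def sum_list_distinct_conv_sum_set)
  also have "y + \<dots> = x" using point_expand[of x y] by simp
  finally show ?thesis .
qed

text \<open>With \<open>kuhn_hullI\<close> this describes a cell by ordered local coordinates. Each
  inequality is affine and is checked at the vertices: a prefix set that contains a later entry of
  \<pi> contains the earlier ones.\<close>

lemma kuhn_hullD:
  assumes N: "N > 0" and \<pi>: "is_perm d \<pi>" and x: "x \<in> convex hull (set (kuhn N y \<pi>))"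
  shows "j \<in> {1..d} \<Longrightarrow> 0 \<le> real N * (\<sigma> j x - \<sigma> j y) \<and> real N * (\<sigma> j x - \<sigma> j y) \<le> 1"
    and "sorted_wrt (\<lambda>i j. real N * (\<sigma> j x - \<sigma> j y) \<le> real N * (\<sigma> i x - \<sigma> i y)) \<pi>"
proof -
  have v: "\<exists>A\<in>prefix_sets \<pi>. \<forall>j. \<sigma> j p = \<sigma> j y + of_bool (j \<in> A) / real N" if p: "p \<in> set (kuhn N y \<pi>)" for p
  proof -
    obtain A where A: "A \<in> prefix_sets \<pi>" "A \<subseteq> {1..d}" "p = y + (\<Sum>i\<in>A. (1 / real N) *\<^sub>R e i)"
      by (rule kuhn_vertexE[OF \<pi> p])
    have "\<sigma> j p = \<sigma> j y + of_bool (j \<in> A) / real N" for j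
      unfolding A(3) using \<sigma>_shift[OF A(2), of j y "1 / real N"] by simp
    then show ?thesis using A(1) by blast
  qed
  show "0 \<le> real N * (\<sigma> j x - \<sigma> j y) \<and> real N * (\<sigma> j x - \<sigma> j y) \<le> 1" if "j \<in> {1..d}"
  proof -
    have "\<sigma> (Suc d) x + \<sigma> j y \<le> \<sigma> j x"
      by (rule \<sigma>_diff_nonneg_hull[OF _ x]) (use v in fastforce)
    moreover have "\<sigma> j x + (1 - \<sigma> j y - 1 / real N) \<le> \<sigma> 0 x"
      by (rule \<sigma>_diff_nonneg_hull[OF _ x]) (use v N in \<open>fastforce simp: of_bool_def\<close>)
    ultimately show ?thesis using N by (simp add: field_simps)
  qed
  show "sorted_wrt (\<lambda>i j. real N * (\<sigma> j x - \<sigma> j y) \<le> real N * (\<sigma> i x - \<sigma> i y)) \<pi>"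
    unfolding sorted_wrt_iff_nth_less
  proof (intro allI impI)
    fix a c assume ac: "a < c" "c < length \<pi>"
    have "\<sigma> (\<pi> ! c) x + (\<sigma> (\<pi> ! a) y - \<sigma> (\<pi> ! c) y) \<le> \<sigma> (\<pi> ! a) x"
    proof (rule \<sigma>_diff_nonneg_hull[OF _ x])
      fix p assume "p \<in> set (kuhn N y \<pi>)"
      then obtain A where A: "A \<in> prefix_sets \<pi>" "\<And>j. \<sigma> j p = \<sigma> j y + of_bool (j \<in> A) / real N" using v by blast
      obtain m where m: "A = set (take m \<pi>)" using A(1) by (auto simp: prefix_sets_def)
      have "\<pi> ! a \<in> A" if c: "\<pi> ! c \<in> A"
      proof -
        obtain c' where c': "c' < m" "c' < length \<pi>" "\<pi> ! c' = \<pi> ! c"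
          using c m by (auto simp: in_set_conv_nth)
        then have "c' = c" using \<pi> ac by (simp add: is_perm_def nth_eq_iff_index_eq)
        then show ?thesis using m c' ac by (auto simp: in_set_conv_nth intro!: exI[of _ a])
      qed
      then show "\<sigma> (\<pi> ! c) p + (\<sigma> (\<pi> ! a) y - \<sigma> (\<pi> ! c) y) \<le> \<sigma> (\<pi> ! a) p"
        using N by (auto simp: A(2) of_bool_def)
    qed
    then show "real N * (\<sigma> (\<pi> ! c) x - \<sigma> (\<pi> ! c) y) \<le> real N * (\<sigma> (\<pi> ! a) x - \<sigma> (\<pi> ! a) y)"
      by (intro mult_left_mono) auto
  qed
qed

lemma perm_upt: "is_perm d [1..<Suc d]"
  by (auto simp: is_perm_def)

text \<open>\<open>T\<close> is the cell of \<open>root\<close>, whose start has all coordinates 0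
  and whose order is the natural one. The outer inequalities i = 0 and i = d compare with the
  constant coordinates 1 and 0.\<close>

lemma T_iff: "x \<in> T \<longleftrightarrow> (\<forall>i\<le>d. \<sigma> (Suc i) x \<le> \<sigma> i x)"
proof
  assume "x \<in> T"
  then have x: "x \<in> convex hull (set (kuhn 1 x0 [1..<Suc d]))" by (simp add: T_def root_def)
  have x0: "\<sigma> j x0 = 0" if "j \<in> {1..d}" for j using that by (simp add: \<sigma>_def)
  note D = kuhn_hullD[OF _ perm_upt x]
  show "\<forall>i\<le>d. \<sigma> (Suc i) x \<le> \<sigma> i x"
  proof (intro allI impI)
    fix i assume "i \<le> d"
    consider "i = 0" | "i = d" "i > 0" | "0 < i" "i < d" using \<open>i \<le> d\<close> by linarith
    then show "\<sigma> (Suc i) x \<le> \<sigma> i x"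
    proof cases
      case 1
      then show ?thesis using D(1)[of 1] d x0[of 1] by auto
    next
      case 2
      then show ?thesis using D(1)[of d] d x0[of d] by auto
    next
      case 3
      have "sorted_wrt (\<lambda>i j. \<sigma> j x - \<sigma> j x0 \<le> \<sigma> i x - \<sigma> i x0) [1..<Suc d]" using D(2) by simp
      then have "\<sigma> ([1..<Suc d] ! i) x - \<sigma> ([1..<Suc d] ! i) x0 \<le> \<sigma> ([1..<Suc d] ! (i - 1)) x - \<sigma> ([1..<Suc d] ! (i - 1)) x0"
        using 3 by (auto simp: sorted_wrt_iff_nth_less)
      moreover have "[1..<Suc d] ! i = Suc i" "[1..<Suc d] ! (i - 1) = i"
        using 3 nth_upt[of 1 i "Suc d"] nth_upt[of 1 "i - 1" "Suc d"] by auto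
      ultimately show ?thesis using x0[of i] x0[of "Suc i"] 3 by simp
    qed
  qed
next
  assume *: "\<forall>i\<le>d. \<sigma> (Suc i) x \<le> \<sigma> i x"
  have mono: "\<sigma> (i + m) x \<le> \<sigma> i x" if "i + m \<le> Suc d" for i m
    using that by (induction m) (use * in \<open>force intro: order_trans\<close>)+
  have x0: "\<sigma> j x0 = 0" if "j \<in> {1..d}" for j using that by (simp add: \<sigma>_def)
  have "x \<in> convex hull (set (kuhn 1 x0 [1..<Suc d]))"
  proof (rule kuhn_hullI[OF _ perm_upt])
    fix j assume j: "j \<in> {1..d}"
    show "0 \<le> real 1 * (\<sigma> j x - \<sigma> j x0) \<and> real 1 * (\<sigma> j x - \<sigma> j x0) \<le> 1"
      using mono[of 0 j] mono[of j "Suc d - j"] j x0[OF j] by auto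
  next
    have "sorted_wrt (\<lambda>i j. \<sigma> j x \<le> \<sigma> i x) [1..<Suc d]"
      unfolding sorted_wrt_iff_nth_less
    proof (intro allI impI)
      fix i j assume "i < j" "j < length [1..<Suc d]"
      then show "\<sigma> ([1..<Suc d] ! j) x \<le> \<sigma> ([1..<Suc d] ! i) x"
        using mono[of "Suc i" "j - i"] nth_upt[of 1 i "Suc d"] nth_upt[of 1 j "Suc d"] by auto
    qed
    then show "sorted_wrt (\<lambda>i j. real 1 * (\<sigma> j x - \<sigma> j x0) \<le> real 1 * (\<sigma> i x - \<sigma> i x0)) [1..<Suc d]"
      by (rule sorted_wrt_mono_rel[rotated]) (use x0 in auto)
  qed simp
  then show "x \<in> T" by (simp add: T_def root_def)
qed

text \<open>A vertex that violates a facet inequality of \<open>T\<close> violates it by a full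
  lattice unit, and the value changes by at most one unit over the cell. The whole cell would lie on
  the wrong side, which \<open>pos\<close> excludes.\<close>

lemma kuhn_subset_T:
  assumes N: "N > 0" and xs: "xs \<in> kuhn_lists N"
    and pos: "\<And>i. i \<le> d \<Longrightarrow> \<exists>x \<in> convex hull (set xs). \<sigma> (Suc i) x < \<sigma> i x"
  shows "set xs \<subseteq> T"
proof
  fix p assume p: "p \<in> set xs"
  show "p \<in> T"
    unfolding T_iff
  proof (intro allI impI, rule ccontr)
    fix i assume i: "i \<le> d" and neg: "\<not> \<sigma> (Suc i) p \<le> \<sigma> i p"
    have int: "real N * (\<sigma> i p - \<sigma> (Suc i) p) \<in> \<int>"
      using lattice_int[OF kuhn_vertex_lattice[OF N xs p]] by (simp add: right_diff_distrib)
    have "real N * (\<sigma> i p - \<sigma> (Suc i) p) < 0" using neg N by (simp add: mult_less_0_iff)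
    then have le: "real N * (\<sigma> i p - \<sigma> (Suc i) p) \<le> -1"
      using int by (auto elim!: Ints_cases)
    have "\<sigma> i q + 0 \<le> \<sigma> (Suc i) q" if "q \<in> set xs" for q
    proof -
      have "real N * (\<sigma> i q - \<sigma> (Suc i) q) \<le> 0"
        using kuhn_diff_bound[OF N xs p that, of i "Suc i"] le by linarith
      then show ?thesis using N by (simp add: mult_le_0_iff)
    qed
    then have "\<sigma> i x + 0 \<le> \<sigma> (Suc i) x" if "x \<in> convex hull (set xs)" for x
      using \<sigma>_diff_nonneg_hull that by blast
    then show False using pos[OF i] by force
  qed
qed

lemma kuhn_vertex_pos:
  assumes N: "N > 0" and xs: "xs \<in> kuhn_lists N" "set xs \<subseteq> T" and i: "i \<le> d"
  shows "\<exists>x \<in> set xs. \<sigma> (Suc i) x < \<sigma> i x"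
proof (rule ccontr)
  assume neg: "\<not> ?thesis"
  then have eq: "\<sigma> (Suc i) x = \<sigma> i x" if "x \<in> set xs" for x
    using that xs(2) i T_iff[of x] by (force simp: not_less)
  obtain y \<pi> where y: "xs = kuhn N y \<pi>" "y \<in> lattice N" "is_perm d \<pi>" using xs by (auto simp: kuhn_lists_def)
  \<comment> \<open>The path has an edge in direction \<open>j\<close>, along which
    \<open>\<sigma> i - \<sigma> (Suc i)\<close> changes. For i = 0 the coordinate
    \<open>\<sigma> 0\<close> is constant, so direction 1 is taken.\<close>
  define j where "j = (if i = 0 then 1 else i)"
  have j: "j \<in> {1..d}" using i d by (auto simp: j_def)
  obtain A where A: "A \<in> prefix_sets \<pi>" "insert j A \<in> prefix_sets \<pi>" "j \<notin> A"
    using prefix_sets_insert[of \<pi> j] y(3) j by (auto simp: is_perm_def)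
  have AD: "A \<subseteq> {1..d}" "insert j A \<subseteq> {1..d}" using prefix_sets_subset[OF A(1)] prefix_sets_subset[OF A(2)] y(3) by (auto simp: is_perm_def)
  have 1: "\<sigma> (Suc i) (y + (\<Sum>i\<in>A. (1 / real N) *\<^sub>R e i)) = \<sigma> i (y + (\<Sum>i\<in>A. (1 / real N) *\<^sub>R e i))"
    by (rule eq) (use kuhn_vertexI[OF y(3) A(1)] y(1) in auto)
  have 2: "\<sigma> (Suc i) (y + (\<Sum>i\<in>insert j A. (1 / real N) *\<^sub>R e i)) = \<sigma> i (y + (\<Sum>i\<in>insert j A. (1 / real N) *\<^sub>R e i))"
    by (rule eq) (use kuhn_vertexI[OF y(3) A(2)] y(1) in auto)
  show False
    using 1 2 A(3) N unfolding \<sigma>_shift[OF AD(1)] \<sigma>_shift[OF AD(2)]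
    by (auto simp: j_def split: if_splits)
qed

end

section \<open>Iterated refinement of the root simplex\<close>

definition descend :: "(real^'d) list \<Rightarrow> nat \<Rightarrow> (real^'d) list set" where
  "descend xs n = ((\<lambda>M. \<Union>xs\<in>M. set (refine xs)) ^^ n) {xs}"

lemma descend_0 [simp]: "descend xs 0 = {xs}"
  and descend_Suc: "descend xs (Suc n) = (\<Union>ys\<in>descend xs n. set (refine ys))"
  by (simp_all add: descend_def)

lemma finite_descend: "finite (descend xs n)"
  by (induction n) (auto simp: descend_Suc)

lemma refined_mesh_eq: "refined_mesh \<T> vord n = (\<Union>T\<in>\<T>. descend (vord T) n)"
proof -
  have "((\<lambda>M. \<Union>xs\<in>M. set (refine xs)) ^^ n) M = (\<Union>xs\<in>M. descend xs n)" for M :: "(real^'a) list set"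
    by (induction n) (auto simp: descend_Suc)
  then show ?thesis by (simp add: refined_mesh_def)
qed

context kuhn_frame
begin

lemma T_mono: "x \<in> T \<Longrightarrow> i \<le> j \<Longrightarrow> j \<le> Suc d \<Longrightarrow> \<sigma> j x \<le> \<sigma> i x"
proof -
  assume x: "x \<in> T"
  have mono: "\<sigma> (i + m) x \<le> \<sigma> i x" if "i + m \<le> Suc d" for i m
    using that
  proof (induction m)
    case (Suc m)
    then have "\<sigma> (Suc (i + m)) x \<le> \<sigma> (i + m) x" using x by (simp add: T_iff)
    with Suc show ?case by simp
  qed simp
  assume "i \<le> j" "j \<le> Suc d"
  then show ?thesis using mono[of i "j - i"] by simp
qed

lemma root_in: "root \<in> kuhn_lists 1" "set root \<subseteq> T"
proof -
  have "x0 \<in> lattice 1" by (auto simp: lattice_def \<sigma>_def)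
  then show "root \<in> kuhn_lists 1" using perm_upt unfolding kuhn_lists_def root_def by blast
  show "set root \<subseteq> T" unfolding T_def by (rule hull_subset)
qed

text \<open>The end of the path has first coordinate one larger than its start but at most 1 in
  \<open>T\<close>; this forces all coordinates of the start to be 0. An inversion in \<pi> would
  give a vertex with increasing coordinates, so the order is the natural one.\<close>

lemma kuhn_lists_1:
  assumes "xs \<in> kuhn_lists 1" "set xs \<subseteq> T"
  shows "xs = root"
proof -
  obtain y \<pi> where y: "xs = kuhn 1 y \<pi>" "is_perm d \<pi>" using assms by (auto simp: kuhn_lists_def)
  have v: "y + (\<Sum>i\<in>A. 1 *\<^sub>R e i) \<in> T" if "A \<in> prefix_sets \<pi>" for A
    using kuhn_vertexI[OF y(2) that, of y 1] assms(2) y(1) by auto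
  have s: "\<sigma> j (y + (\<Sum>i\<in>A. 1 *\<^sub>R e i)) = \<sigma> j y + of_bool (j \<in> A)" if "A \<in> prefix_sets \<pi>" for A j
    using \<sigma>_shift[of A j y 1] prefix_sets_subset[OF that] y(2) by (simp add: is_perm_def)
  have all: "{1..d} \<in> prefix_sets \<pi>"
  proof -
    have "set (take (length \<pi>) \<pi>) \<in> prefix_sets \<pi>" unfolding prefix_sets_def by blast
    then show ?thesis using y(2) by (simp add: is_perm_def)
  qed
  have y0: "\<sigma> j y = 0" if j: "j \<in> {1..d}" for j
  proof -
    have "\<sigma> 1 y + 1 \<le> \<sigma> 0 (y + (\<Sum>i\<in>{1..d}. 1 *\<^sub>R e i))"
      using T_mono[OF v[OF all], of 0 1] s[OF all, of 1] d by auto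
    then have "\<sigma> 1 y \<le> 0" by simp
    moreover have "y \<in> T" using v[OF empty_in_prefix_sets] by simp
    then have "\<sigma> j y \<le> \<sigma> 1 y" "\<sigma> (Suc d) y \<le> \<sigma> j y" using T_mono[of y 1 j] T_mono[of y j "Suc d"] j by auto
    ultimately show ?thesis by simp
  qed
  have "y = x0"
    by (rule \<sigma>_inject) (use y0 in \<open>auto simp: \<sigma>_def\<close>)
  moreover have "\<pi> = [1..<Suc d]"
  proof (rule sorted_distinct_set_unique)
    show "sorted \<pi>"
      unfolding sorted_iff_nth_mono_less
    proof (intro allI impI, rule ccontr)
      fix a c assume ac: "a < c" "c < length \<pi>" and neg: "\<not> \<pi> ! a \<le> \<pi> ! c"
      define A where "A = set (take (Suc a) \<pi>)"
      have A: "A \<in> prefix_sets \<pi>" using ac by (auto simp: A_def prefix_sets_def)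
      have "\<pi> ! a \<in> A" using ac by (auto simp: A_def in_set_conv_nth intro!: exI[of _ a])
      moreover have "\<pi> ! c \<notin> A"
        using y(2) ac by (auto simp: A_def in_set_conv_nth is_perm_def nth_eq_iff_index_eq)
      moreover have in1: "\<pi> ! a \<in> {1..d}" "\<pi> ! c \<in> {1..d}" using y(2) ac nth_mem[of _ \<pi>] by (auto simp: is_perm_def simp del: nth_mem)
      ultimately show False
        using T_mono[OF v[OF A], of "\<pi> ! c" "\<pi> ! a"] s[OF A] neg y0 by auto
    qed
    show "distinct \<pi>" "set \<pi> = set [1..<Suc d]" using y(2) perm_upt unfolding is_perm_def by blast+
  qed (rule sorted_upt distinct_upt)+
  ultimately show ?thesis by (simp only: root_def y(1))
qed

lemma kuhn_lists_refine:
  assumes N: "N > 0" and xs: "xs \<in> kuhn_lists N" "set xs \<subseteq> T" and ys: "ys \<in> set (refine xs)"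
  shows "ys \<in> kuhn_lists (2 * N)" "set ys \<subseteq> T"
proof -
  obtain y \<pi> where y: "xs = kuhn N y \<pi>" "y \<in> lattice N" "is_perm d \<pi>" using xs by (auto simp: kuhn_lists_def)
  obtain R \<rho> where R: "R \<subseteq> {1..d}" "is_perm d \<rho>"
    and ys': "ys = kpath (y + (\<Sum>j\<in>R. (1/2) *\<^sub>R (1 / real N) *\<^sub>R e j)) (map (\<lambda>j. (1/2) *\<^sub>R (1 / real N) *\<^sub>R e j) \<rho>)"
    by (rule refine_child_form[OF d y(3) ys[unfolded y(1) kuhn_def]])
  have sc: "(1/2) *\<^sub>R (1 / real N) *\<^sub>R e j = (1 / real (2 * N)) *\<^sub>R e j" for j by simp
  have "y + (\<Sum>j\<in>R. (1 / real (2 * N)) *\<^sub>R e j) \<in> lattice (2 * N)"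
    unfolding lattice_def
  proof (intro CollectI ballI)
    fix j
    have "real (2 * N) * \<sigma> j (y + (\<Sum>j\<in>R. (1 / real (2 * N)) *\<^sub>R e j)) = 2 * (real N * \<sigma> j y) + of_bool (j \<in> R)"
      using \<sigma>_vertex[of "2 * N" R j y] N R by simp
    then show "real (2 * N) * \<sigma> j (y + (\<Sum>j\<in>R. (1 / real (2 * N)) *\<^sub>R e j)) \<in> \<int>"
      using lattice_int[OF y(2), of j] by simp
  qed
  then show "ys \<in> kuhn_lists (2 * N)"
    unfolding kuhn_lists_def ys' kuhn_def sc using R(2) by blast
  show "set ys \<subseteq> T"
    using refine_subset_hull[OF ys] hull_minimal[OF xs(2), of convex] by (auto simp: T_def)
qed

text \<open>The odd lattice coordinates of the start form \<open>R\<close>: subtracting half steps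
  there gives a coarse lattice point, and \<open>refine_child_mem\<close> supplies the order of the
  parent. The parent stays in \<open>T\<close> because its child has, for each facet of
  \<open>T\<close>, a vertex strictly inside.\<close>

lemma kuhn_lists_parent:
  assumes N: "N > 0" and ys: "ys \<in> kuhn_lists (2 * N)" "set ys \<subseteq> T"
  shows "\<exists>xs\<in>kuhn_lists N. set xs \<subseteq> T \<and> ys \<in> set (refine xs)"
proof -
  obtain y \<rho> where y: "ys = kuhn (2 * N) y \<rho>" "y \<in> lattice (2 * N)" "is_perm d \<rho>" using ys by (auto simp: kuhn_lists_def)
  have "\<forall>j. \<exists>z::int. real (2 * N) * \<sigma> j y = of_int z" using lattice_int[OF y(2)] by (auto elim!: Ints_cases)
  then obtain z :: "nat \<Rightarrow> int" where z: "\<And>j. real (2 * N) * \<sigma> j y = of_int (z j)" by metis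
  define R where "R = {j \<in> {1..d}. odd (z j)}"
  have R: "R \<subseteq> {1..d}" by (auto simp: R_def)
  define y' where "y' = y - (\<Sum>j\<in>R. (1 / real (2 * N)) *\<^sub>R e j)"
  have yy: "y = y' + (\<Sum>j\<in>R. (1 / real (2 * N)) *\<^sub>R e j)" by (simp add: y'_def)
  have y': "y' \<in> lattice N"
    unfolding lattice_def
  proof (intro CollectI ballI)
    fix j assume j: "j \<in> {1..d}"
    have "of_int (z j) = real (2 * N) * \<sigma> j (y' + (\<Sum>j\<in>R. (1 / real (2 * N)) *\<^sub>R e j))"
      using z[of j] by (simp only: yy[symmetric])
    also have "\<dots> = real (2 * N) * \<sigma> j y' + of_bool (j \<in> R)"
      using N by (intro \<sigma>_vertex R) simp
    also have "(of_bool (j \<in> R) :: real) = of_int (z j mod 2)"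
      using j by (auto simp: R_def odd_iff_mod_2_eq_one)
    finally have "real N * \<sigma> j y' = (of_int (z j) - of_int (z j mod 2)) / 2" by simp
    also have "\<dots> = of_int (z j div 2)"
    proof -
      have "of_int (z j) = (of_int (2 * (z j div 2) + z j mod 2) :: real)" by simp
      then show ?thesis by (simp only: of_int_add of_int_mult) simp
    qed
    finally show "real N * \<sigma> j y' \<in> \<int>" by simp
  qed
  define \<pi> where "\<pi> = filter (\<lambda>j. j \<in> R) \<rho> @ filter (\<lambda>j. j \<notin> R) \<rho>"
  have "set \<pi> = set \<rho>" "distinct \<rho> \<Longrightarrow> distinct \<pi>" by (auto simp: \<pi>_def)
  then have \<pi>: "is_perm d \<pi>" using y(3) unfolding is_perm_def by simp
  define xs where "xs = kuhn N y' \<pi>"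
  have xs: "xs \<in> kuhn_lists N" using y' \<pi> by (auto simp: xs_def kuhn_lists_def)
  have sc: "(1/2) *\<^sub>R (1 / real N) *\<^sub>R e j = (1 / real (2 * N)) *\<^sub>R e j" for j by simp
  have mem: "ys \<in> set (refine xs)"
    using refine_child_mem[OF d y(3) R, of y' "\<lambda>j. (1 / real N) *\<^sub>R e j"]
    unfolding xs_def kuhn_def \<pi>_def y(1) sc yy[symmetric] .
  have "set xs \<subseteq> T"
  proof (rule kuhn_subset_T[OF N xs])
    fix i assume "i \<le> d"
    obtain x where "x \<in> set ys" "\<sigma> (Suc i) x < \<sigma> i x"
      using kuhn_vertex_pos[OF _ ys \<open>i \<le> d\<close>] N by auto
    then show "\<exists>x\<in>convex hull (set xs). \<sigma> (Suc i) x < \<sigma> i x"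
      using refine_subset_hull[OF mem] by blast
  qed
  with xs mem show ?thesis by blast
qed

text \<open>This replaces the recursion by a description through the whole-space triangulation, from
  which covering, overlap and reflection can be read off.\<close>

lemma descend_root: "descend root n = {xs \<in> kuhn_lists (2 ^ n). set xs \<subseteq> T}"
proof (induction n)
  case 0
  have "xs = root \<longleftrightarrow> xs \<in> kuhn_lists 1 \<and> set xs \<subseteq> T" for xs using root_in kuhn_lists_1 by blast
  then show ?case unfolding descend_0 power_0 by blast
next
  case (Suc n)
  have N: "(2::nat) ^ n > 0" by simp
  show ?case
  proof (rule set_eqI, rule iffI)
    fix ys assume "ys \<in> descend root (Suc n)"
    then obtain xs where "xs \<in> kuhn_lists (2 ^ n)" "set xs \<subseteq> T" "ys \<in> set (refine xs)"
      unfolding descend_Suc Suc by blast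
    from kuhn_lists_refine[OF N this] show "ys \<in> {xs \<in> kuhn_lists (2 ^ Suc n). set xs \<subseteq> T}"
      unfolding power_Suc by blast
  next
    fix ys assume "ys \<in> {xs \<in> kuhn_lists (2 ^ Suc n). set xs \<subseteq> T}"
    then have "ys \<in> kuhn_lists (2 * 2 ^ n)" "set ys \<subseteq> T" unfolding power_Suc by blast+
    from kuhn_lists_parent[OF N this] show "ys \<in> descend root (Suc n)"
      unfolding descend_Suc Suc by blast
  qed
qed

section \<open>Covering, overlaps, reflections and shape bounds\<close>

text \<open>The linear part of \<open>\<sigma> i - \<sigma> (Suc i)\<close> is nonzero, so the
  interior of the closed half-space containing \<open>T\<close> is the open one.\<close>

lemma interior_T_subset:
  assumes "x \<in> interior T" "i \<le> d"
  shows "\<sigma> (Suc i) x < \<sigma> i x"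
proof -
  define \<alpha> where "\<alpha> = dir i - dir (Suc i)"
  define c where "c = - (\<sigma> i x0 - \<sigma> (Suc i) x0 - \<alpha> \<bullet> x0)"
  have eq: "\<sigma> i z - \<sigma> (Suc i) z = \<alpha> \<bullet> z - c" for z
    using \<sigma>_eq_affine[of i z] \<sigma>_eq_affine[of "Suc i" z] by (simp add: \<alpha>_def c_def inner_diff_left)
  have "\<alpha> \<noteq> 0"
  proof
    assume "\<alpha> = 0"
    define j where "j = (if i = 0 then 1 else i)"
    have j: "j \<in> {1..d}" using assms(2) d by (auto simp: j_def)
    have "\<alpha> \<bullet> e j = dir i \<bullet> e j - dir (Suc i) \<bullet> e j" by (simp add: \<alpha>_def inner_diff_left)
    also have "\<dots> \<noteq> 0" using j by (auto simp: dir_def dual j_def split: if_splits)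
    finally show False using \<open>\<alpha> = 0\<close> by simp
  qed
  have "T \<subseteq> {z. \<alpha> \<bullet> z \<ge> c}"
  proof
    fix z assume "z \<in> T"
    then have "\<sigma> (Suc i) z \<le> \<sigma> i z" using assms(2) by (simp add: T_iff)
    then show "z \<in> {z. \<alpha> \<bullet> z \<ge> c}" using eq[of z] by simp
  qed
  then have "interior T \<subseteq> interior {z. \<alpha> \<bullet> z \<ge> c}" by (rule interior_mono)
  also have "\<dots> = {z. \<alpha> \<bullet> z > c}" using \<open>\<alpha> \<noteq> 0\<close> by (rule interior_halfspace_ge)
  finally show ?thesis using assms(1) eq[of x] by auto
qed

lemma kuhn_interior_subset:
  assumes "N > 0" "xs \<in> kuhn_lists N" "x \<in> convex hull (set xs)" "x \<in> interior T"
  shows "set xs \<subseteq> T"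
  using kuhn_subset_T[OF assms(1,2)] assms(3) interior_T_subset[OF assms(4)] by blast

text \<open>\<open>y\<close> rounds the scaled coordinates of \<open>x\<close> down to integers, and
  \<pi> sorts the fractional parts in decreasing order.\<close>

lemma kuhn_cover_point:
  assumes N: "N > 0"
  shows "\<exists>xs\<in>kuhn_lists N. x \<in> convex hull (set xs)"
proof -
  define y where "y = x0 + (\<Sum>j=1..d. (of_int \<lfloor>real N * \<sigma> j x\<rfloor> / real N) *\<^sub>R e j)"
  have y: "\<sigma> j y = of_int \<lfloor>real N * \<sigma> j x\<rfloor> / real N" if j: "j \<in> {1..d}" for j
  proof -
    have "\<sigma> j y = (\<Sum>i=1..d. (of_int \<lfloor>real N * \<sigma> i x\<rfloor> / real N) * (b j \<bullet> e i))"
      using j by (simp add: \<sigma>_def y_def inner_sum_right)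
    also have "\<dots> = (\<Sum>i=1..d. if i = j then of_int \<lfloor>real N * \<sigma> i x\<rfloor> / real N else 0)"
      by (rule sum.cong) (use dual[OF j] in auto)
    also have "\<dots> = of_int \<lfloor>real N * \<sigma> j x\<rfloor> / real N" using j by simp
    finally show ?thesis .
  qed
  have yl: "y \<in> lattice N" using y N by (auto simp: lattice_def)
  define f where "f j = real N * (\<sigma> j x - \<sigma> j y)" for j
  have f: "f j = frac (real N * \<sigma> j x)" if "j \<in> {1..d}" for j
    using y[OF that] N by (simp add: f_def frac_def right_diff_distrib)
  define \<pi> where "\<pi> = sort_key (\<lambda>j. - f j) [1..<Suc d]"
  have \<pi>: "is_perm d \<pi>" by (auto simp: \<pi>_def is_perm_def)
  have "sorted (map (\<lambda>j. - f j) \<pi>)" by (simp add: \<pi>_def)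
  then have s: "sorted_wrt (\<lambda>i j. f j \<le> f i) \<pi>" by (simp add: sorted_map)
  have "x \<in> convex hull (set (kuhn N y \<pi>))"
    by (rule kuhn_hullI[OF N \<pi>]) (use f s in \<open>auto simp: f_def[symmetric] frac_ge_0 less_imp_le[OF frac_lt_1]\<close>)
  then show ?thesis using yl \<pi> by (auto simp: kuhn_lists_def)
qed

lemma convex_T: "convex T" and compact_T: "compact T"
  by (auto simp: T_def intro: finite_imp_compact_convex_hull)

text \<open>Every interior point lies in some cell of the whole-space triangulation, which then is
  contained in \<open>T\<close>. The finite union of cells is closed, and \<open>T\<close> is the
  closure of its interior.\<close>

lemma kuhn_cover:
  assumes "interior T \<noteq> {}"
  shows "(\<Union>xs\<in>descend root n. convex hull (set xs)) = T"
proof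
  show "(\<Union>xs\<in>descend root n. convex hull (set xs)) \<subseteq> T"
    using convex_T by (auto simp: descend_root dest: hull_minimal[of _ T convex])
  have "interior T \<subseteq> (\<Union>xs\<in>descend root n. convex hull (set xs))"
  proof
    fix x assume x: "x \<in> interior T"
    obtain xs where xs: "xs \<in> kuhn_lists (2 ^ n)" "x \<in> convex hull (set xs)"
      using kuhn_cover_point[of "2 ^ n" x] by auto
    then have "set xs \<subseteq> T" using kuhn_interior_subset[OF _ xs x] by simp
    then show "x \<in> (\<Union>xs\<in>descend root n. convex hull (set xs))" using xs by (auto simp: descend_root)
  qed
  then have "closure (interior T) \<subseteq> (\<Union>xs\<in>descend root n. convex hull (set xs))"
    by (rule closure_minimal)
       (auto intro!: closed_UN finite_descend compact_imp_closed finite_imp_compact_convex_hull)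
  then show "T \<subseteq> (\<Union>xs\<in>descend root n. convex hull (set xs))"
    using convex_closure_interior[OF convex_T assms] compact_imp_closed[OF compact_T] by simp
qed

text \<open>Outside countably many lattice hyperplanes a point determines its cell: the floors of
  the scaled coordinates give the start, and the strict order of the fractional parts gives the
  permutation.\<close>

lemma kuhn_overlap_negligible:
  assumes N: "N > 0" and xs: "xs \<in> kuhn_lists N" "xs' \<in> kuhn_lists N" "xs \<noteq> xs'"
  shows "negligible (convex hull (set xs) \<inter> convex hull (set xs'))"
proof -
  \<comment> \<open>Index pairs with equal linear part, such as 0 and \<open>Suc d\<close>, are left
    out since they do not define a hyperplane.\<close>
  define B where "B = (\<Union>(i, j, c)\<in>{(i, j, c). i \<le> Suc d \<and> j \<le> Suc d \<and> dir i \<noteq> dir j} :: (nat \<times> nat \<times> int) set.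
      {x. real N * (\<sigma> i x - \<sigma> j x) = of_int c})"
  have "negligible B"
    unfolding B_def
  proof (rule negligible_countable_Union[OF countable_image], goal_cases)
    case 1
    show ?case by (rule countableI_type)
  next
    case (2 S)
    then obtain i j c where S: "S = {x. real N * (\<sigma> i x - \<sigma> j x) = of_int c}" "dir i \<noteq> dir j" by auto
    have "S = {x. (dir i - dir j) \<bullet> x = of_int c / real N - (\<sigma> i x0 - dir i \<bullet> x0) + (\<sigma> j x0 - dir j \<bullet> x0)}"
    proof -
      have "real N * (\<sigma> i x - \<sigma> j x) = of_int c \<longleftrightarrow> \<sigma> i x - \<sigma> j x = of_int c / real N" for x
        using N by (simp add: eq_divide_eq mult.commute)
      moreover have "\<sigma> i x - \<sigma> j x = (dir i - dir j) \<bullet> x + ((\<sigma> i x0 - dir i \<bullet> x0) - (\<sigma> j x0 - dir j \<bullet> x0))" for x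
        using \<sigma>_eq_affine[of i x] \<sigma>_eq_affine[of j x] by (simp add: inner_diff_left)
      ultimately have "real N * (\<sigma> i x - \<sigma> j x) = of_int c \<longleftrightarrow>
          (dir i - dir j) \<bullet> x = of_int c / real N - (\<sigma> i x0 - dir i \<bullet> x0) + (\<sigma> j x0 - dir j \<bullet> x0)" for x
        by (simp only:) (rule iffI, linarith, linarith)
      then show ?thesis unfolding S(1) by (rule Collect_cong)
    qed
    then show ?case using S(2) by (simp add: negligible_hyperplane)
  qed
  have dir_ne: "dir i \<noteq> dir j" if "i \<in> {1..d}" "j \<le> Suc d" "i \<noteq> j" for i j
  proof
    assume "dir i = dir j"
    then have "dir i \<bullet> e i = dir j \<bullet> e i" by simp
    then show False using that dual[of _ i] by (auto simp: dir_def split: if_splits)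
  qed
  have "convex hull (set xs) \<inter> convex hull (set xs') \<subseteq> B"
  proof (rule ccontr)
    assume "\<not> ?thesis"
    then obtain x where x: "x \<in> convex hull (set xs)" "x \<in> convex hull (set xs')" "x \<notin> B" by blast
    have nB: "real N * (\<sigma> i x - \<sigma> j x) \<notin> \<int>" if "i \<in> {1..d}" "j \<le> Suc d" "i \<noteq> j" for i j
    proof
      assume "real N * (\<sigma> i x - \<sigma> j x) \<in> \<int>"
      then obtain c :: int where "real N * (\<sigma> i x - \<sigma> j x) = of_int c" by (auto elim: Ints_cases)
      then have "x \<in> B"
        unfolding B_def using that dir_ne[OF that] by (intro UN_I[of "(i, j, c)"]) auto
      then show False using x by simp
    qed
    obtain y \<pi> where y: "xs = kuhn N y \<pi>" "y \<in> lattice N" "is_perm d \<pi>" using xs by (auto simp: kuhn_lists_def)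
    obtain y' \<pi>' where y': "xs' = kuhn N y' \<pi>'" "y' \<in> lattice N" "is_perm d \<pi>'" using xs by (auto simp: kuhn_lists_def)
    have fl: "real N * \<sigma> j y = of_int \<lfloor>real N * \<sigma> j x\<rfloor>"
      if j: "j \<in> {1..d}" and yl: "y \<in> lattice N" and \<pi>: "is_perm d \<pi>"
        and xh: "x \<in> convex hull (set (kuhn N y \<pi>))" for y \<pi> j
    proof -
      obtain z :: int where z: "real N * \<sigma> j y = of_int z" using lattice_int[OF yl] by (auto elim: Ints_cases)
      have "0 \<le> real N * \<sigma> j x - of_int z" "real N * \<sigma> j x - of_int z \<le> 1"
        using kuhn_hullD(1)[OF N \<pi> xh j] by (simp_all add: z[symmetric] right_diff_distrib)
      moreover have "real N * \<sigma> j x \<noteq> of_int (z + 1)"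
      proof
        assume "real N * \<sigma> j x = of_int (z + 1)"
        then have "real N * (\<sigma> j x - \<sigma> (Suc d) x) \<in> \<int>" unfolding \<sigma>_end diff_zero by (metis Ints_of_int)
        then show False using nB[OF j, of "Suc d"] j by auto
      qed
      ultimately have "\<lfloor>real N * \<sigma> j x\<rfloor> = z" by (intro floor_unique) auto
      then show ?thesis using z by simp
    qed
    have yy: "y = y'"
    proof (rule \<sigma>_inject)
      fix j assume j: "j \<in> {1..d}"
      have "real N * \<sigma> j y = real N * \<sigma> j y'"
        using fl[OF j y(2,3)] fl[OF j y'(2,3)] x y(1) y'(1) by simp
      then show "\<sigma> j y = \<sigma> j y'" using N by simp
    qed
    define f where "f j = - (real N * (\<sigma> j x - \<sigma> j y))" for j
    have s: "sorted (map f \<pi>)" "sorted (map f \<pi>')"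
      using kuhn_hullD(2)[OF N y(3)] kuhn_hullD(2)[OF N y'(3)] x y(1) y'(1) yy
      by (auto simp: sorted_map f_def)
    have inj: "inj_on f {1..d}"
    proof (rule inj_onI, rule ccontr)
      fix i j assume ij: "i \<in> {1..d}" "j \<in> {1..d}" "f i = f j" "i \<noteq> j"
      have "real N * (\<sigma> i x - \<sigma> j x) = real N * \<sigma> i y - real N * \<sigma> j y"
        using ij(3) by (simp add: f_def algebra_simps)
      also have "\<dots> \<in> \<int>" using lattice_int[OF y(2)] by simp
      finally show False using nB[of i j] ij by simp
    qed
    have "\<pi> = \<pi>'"
      by (rule map_sorted_distinct_set_unique[of f])
         (use s inj y(3) y'(3) in \<open>auto simp: is_perm_def distinct_map\<close>)
    then show False using xs(3) y(1) y'(1) yy by simp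
  qed
  then show ?thesis using \<open>negligible B\<close> negligible_subset by blast
qed

text \<open>\<open>p\<close> and \<open>q\<close> are lattice points, so the reflection preserves
  the lattice, and by \<open>rev_kpath_reflect\<close> it maps paths to paths.\<close>

lemma kuhn_reflect:
  assumes N: "N > 0" and xs: "xs \<in> kuhn_lists N" and pq: "p \<in> set xs" "q \<in> set xs"
  shows "rev (map (\<lambda>x. p + q - x) xs) \<in> kuhn_lists N"
proof -
  obtain y \<pi> where y: "xs = kuhn N y \<pi>" "y \<in> lattice N" "is_perm d \<pi>" using xs by (auto simp: kuhn_lists_def)
  let ?l = "map (\<lambda>j. (1 / real N) *\<^sub>R e j) \<pi>"
  have "last (kpath y' l) = y' + sum_list l" for y' and l :: "(real^'d) list"
    by (induction l arbitrary: y') (auto simp: add.assoc, metis kpath.simps list.distinct(1) list.exhaust)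
  then have "y + sum_list ?l \<in> set xs"
    unfolding y(1) kuhn_def by (metis last_in_set length_0_conv length_kpath nat.distinct(1))
  note lat = kuhn_vertex_lattice[OF N xs this] kuhn_vertex_lattice[OF N xs pq(1)] kuhn_vertex_lattice[OF N xs pq(2)]
  have "p + q - (y + sum_list ?l) \<in> lattice N"
    unfolding lattice_def
  proof (intro CollectI ballI)
    fix j assume "j \<in> {1..d}"
    have "\<sigma> j (p + q - (y + sum_list ?l)) = \<sigma> j p + \<sigma> j q - \<sigma> j (y + sum_list ?l)"
      using \<open>j \<in> {1..d}\<close> by (simp add: \<sigma>_def inner_diff_right inner_add_right)
    then have "real N * \<sigma> j (p + q - (y + sum_list ?l)) = real N * \<sigma> j p + real N * \<sigma> j q - real N * \<sigma> j (y + sum_list ?l)"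
      by (simp only: distrib_left right_diff_distrib)
    then show "real N * \<sigma> j (p + q - (y + sum_list ?l)) \<in> \<int>"
      using lat[THEN lattice_int, of j] by simp
  qed
  moreover have "is_perm d (rev \<pi>)" using y(3) by (simp add: is_perm_def)
  moreover have "rev (map (\<lambda>x. p + q - x) xs) = kuhn N (p + q - (y + sum_list ?l)) (rev \<pi>)"
    unfolding y(1) kuhn_def rev_kpath_reflect by (simp add: rev_map)
  ultimately show ?thesis by (auto simp: kuhn_lists_def)
qed

text \<open>The reflected cell belongs to the whole-space mesh and still contains the midpoint;
  since the midpoint is interior to \<open>T\<close>, the cell cannot leave
  \<open>T\<close>.\<close>

lemma descend_reflect:
  assumes xs: "xs \<in> descend root n" and pq: "p \<in> set xs" "q \<in> set xs" and mid: "midpoint p q \<in> interior T"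
  shows "rev (map (\<lambda>x. p + q - x) xs) \<in> descend root n"
proof -
  let ?ys = "rev (map (\<lambda>x. p + q - x) xs)"
  have N: "(2::nat) ^ n > 0" by simp
  have ys: "?ys \<in> kuhn_lists (2 ^ n)" using kuhn_reflect[OF N] xs pq by (simp add: descend_root)
  have "p \<in> set ?ys" "q \<in> set ?ys" using pq by (auto simp: image_iff intro: bexI[of _ q] bexI[of _ p])
  then have "midpoint p q \<in> convex hull (set ?ys)"
    by (meson closed_segment_subset_convex_hull hull_inc midpoint_in_closed_segment subsetD)
  then have "set ?ys \<subseteq> T" by (rule kuhn_interior_subset[OF N ys _ mid])
  then show ?thesis using ys by (simp add: descend_root)
qed

text \<open>Each vertex is reached from the start of the path by distinct steps
  \<open>e j / N\<close>; the factor 2 comes from comparing two points through the start.\<close>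

lemma kuhn_diameter:
  assumes N: "N > 0" and xs: "xs \<in> kuhn_lists N" and pq: "p \<in> convex hull (set xs)" "q \<in> convex hull (set xs)"
  shows "norm (p - q) \<le> 2 * (\<Sum>j=1..d. norm (e j)) / real N"
proof -
  obtain y \<pi> where y: "xs = kuhn N y \<pi>" "is_perm d \<pi>" using xs by (auto simp: kuhn_lists_def)
  let ?r = "(\<Sum>j=1..d. norm (e j)) / real N"
  have "set xs \<subseteq> cball y ?r"
  proof
    fix p assume "p \<in> set xs"
    then obtain A where A: "A \<subseteq> {1..d}" "p = y + (\<Sum>i\<in>A. (1 / real N) *\<^sub>R e i)"
      using kuhn_vertexE[OF y(2)] y(1) by metis
    have "norm (p - y) \<le> (\<Sum>i\<in>A. norm ((1 / real N) *\<^sub>R e i))" using norm_sum[of "\<lambda>i. (1 / real N) *\<^sub>R e i" A] by (simp only: A(2) add_diff_cancel_left')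
    also have "\<dots> \<le> (\<Sum>i=1..d. norm ((1 / real N) *\<^sub>R e i))" by (rule sum_mono2) (use A in auto)
    also have "\<dots> = ?r" by (simp add: sum_divide_distrib)
    finally show "p \<in> cball y ?r" by (simp add: dist_norm norm_minus_commute)
  qed
  then have "convex hull (set xs) \<subseteq> cball y ?r" by (rule hull_minimal) simp
  then have "norm (y - p) \<le> ?r" "norm (y - q) \<le> ?r" using pq by (auto simp: dist_norm)
  then have "norm (p - q) \<le> ?r + ?r"
    using norm_triangle_ineq4[of "y - q" "y - p"] by (simp add: norm_minus_commute)
  then show ?thesis by simp
qed

lemma kuhn_edge_difference:
  assumes N: "N > 0" and xs: "xs \<in> kuhn_lists N" and j: "j \<in> {1..d}"
  shows "\<exists>p\<in>set xs. \<exists>q\<in>set xs. p - q = (1 / real N) *\<^sub>R e j"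
proof -
  obtain y \<pi> where y: "xs = kuhn N y \<pi>" "is_perm d \<pi>" using xs by (auto simp: kuhn_lists_def)
  obtain A where A: "A \<in> prefix_sets \<pi>" "insert j A \<in> prefix_sets \<pi>" "j \<notin> A"
    using prefix_sets_insert[of \<pi> j] y(2) j by (auto simp: is_perm_def)
  have "finite A" using prefix_sets_subset[OF A(1)] finite_subset by auto
  then have "y + (\<Sum>i\<in>insert j A. (1 / real N) *\<^sub>R e i) - (y + (\<Sum>i\<in>A. (1 / real N) *\<^sub>R e i)) = (1 / real N) *\<^sub>R e j"
    using A(3) by simp
  then show ?thesis using kuhn_vertexI[OF y(2) A(2), of y N] kuhn_vertexI[OF y(2) A(1), of y N] y(1) by blast
qed

text \<open>The cell has an edge \<open>e j / N\<close> for each \<open>j\<close>, which bounds the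
  products of \<gamma> with the \<open>e j\<close>; the dual basis \<open>b j\<close> reassembles
  \<gamma>. The factor \<open>N\<close> is an inverse mesh size.\<close>

lemma kuhn_gradient_bound:
  assumes N: "N > 0" and xs: "xs \<in> kuhn_lists N"
    and g: "\<And>p q. p \<in> set xs \<Longrightarrow> q \<in> set xs \<Longrightarrow> \<bar>\<gamma> \<bullet> (p - q)\<bar> \<le> c"
  shows "norm \<gamma> \<le> c * real N * (\<Sum>j=1..d. norm (b j))"
proof -
  have ge: "\<bar>\<gamma> \<bullet> e j\<bar> \<le> c * real N" if j: "j \<in> {1..d}" for j
  proof -
    obtain p q where pq: "p \<in> set xs" "q \<in> set xs" "p - q = (1 / real N) *\<^sub>R e j"
      using kuhn_edge_difference[OF N xs j] by blast
    have "\<bar>\<gamma> \<bullet> e j\<bar> / real N \<le> c" using g[OF pq(1,2)] N by (simp add: pq(3) abs_mult)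
    then show ?thesis using N by (simp add: field_simps)
  qed
  have "\<gamma> = (\<Sum>j=1..d. (\<gamma> \<bullet> e j) *\<^sub>R b j)"
  proof (rule vector_eq_rdot[THEN iffD1], rule allI)
    fix z
    have "\<gamma> \<bullet> z = \<gamma> \<bullet> (\<Sum>j=1..d. (b j \<bullet> z) *\<^sub>R e j)" by (simp only: expand)
    then show "\<gamma> \<bullet> z = (\<Sum>j=1..d. (\<gamma> \<bullet> e j) *\<^sub>R b j) \<bullet> z"
      by (simp add: inner_sum_left inner_sum_right mult.commute)
  qed
  then have "norm \<gamma> \<le> (\<Sum>j=1..d. norm ((\<gamma> \<bullet> e j) *\<^sub>R b j))" by (metis norm_sum)
  also have "\<dots> \<le> (\<Sum>j=1..d. (c * real N) * norm (b j))"
    by (rule sum_mono) (use ge in \<open>auto intro!: mult_right_mono\<close>)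
  finally show ?thesis by (simp add: sum_distrib_left)
qed

end

section \<open>Explicit hat functions on the lattice\<close>

lemma nth_kpath:
  fixes y :: "'a::ab_group_add"
  shows "i \<le> length vs \<Longrightarrow> kpath y vs ! i = y + sum_list (take i vs)"
  by (induction vs arbitrary: y i) (auto simp: take_Cons nth_Cons add.assoc split: nat.splits)

lemma finite_total_has_greatest:
  assumes "finite I" "I \<noteq> {}" "\<And>i j. i \<in> I \<Longrightarrow> j \<in> I \<Longrightarrow> R i j \<or> R j i"
    "\<And>i j k. R i j \<Longrightarrow> R j k \<Longrightarrow> R i k"
  shows "\<exists>m\<in>I. \<forall>i\<in>I. R i m"
  using assms(1-3)
proof (induction I rule: finite_ne_induct)
  case (singleton x)
  then show ?case by blast
next
  case (insert x F)
  then obtain m where m: "m \<in> F" "\<forall>i\<in>F. R i m" by blast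
  have xx: "R x x" using insert.prems by blast
  show ?case
  proof (cases "R x m")
    case True
    then show ?thesis using m by blast
  next
    case False
    then have "R m x" using insert.prems m(1) by blast
    then have "\<forall>i\<in>insert x F. R i x" using m(2) assms(4) xx by blast
    then show ?thesis by blast
  qed
qed

text \<open>Of \<open>A\<close> and its complement in a set of at most three elements one has at
  most one element, and the two partial sums have the same absolute value. The summands 1, 1, -1, -1
  show that three is the limit.\<close>

lemma abs_partial_sum_le:
  fixes \<delta> :: "'a \<Rightarrow> real"
  assumes "finite S" "card S \<le> 3" "A \<subseteq> S" "sum \<delta> S = 0" "\<And>i. i \<in> S \<Longrightarrow> \<bar>\<delta> i\<bar> \<le> \<mu>" "0 \<le> \<mu>"
  shows "\<bar>sum \<delta> A\<bar> \<le> \<mu>"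
proof -
  have small: "\<bar>sum \<delta> B\<bar> \<le> \<mu>" if "B \<subseteq> S" "card B \<le> 1" for B
  proof -
    have "finite B" using that assms(1) finite_subset by blast
    then consider "B = {}" | a where "B = {a}" using \<open>card B \<le> 1\<close>
      by (metis One_nat_def card_0_eq card_1_singletonE le_Suc_eq le_zero_eq)
    then show ?thesis using that assms(5,6) by cases auto
  qed
  have fA: "finite A" using assms(1,3) finite_subset by blast
  have "card A + card (S - A) = card S" using assms(1,3) fA by (simp add: card_Diff_subset card_mono)
  then consider "card A \<le> 1" | "card (S - A) \<le> 1" using assms(2) by linarith
  then show ?thesis
  proof cases
    case 1
    then show ?thesis using small assms(3) by blast
  next
    case 2
    have "sum \<delta> S = sum \<delta> (S - A) + sum \<delta> A" by (rule sum.subset_diff[OF assms(3,1)])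
    then have "\<bar>sum \<delta> A\<bar> = \<bar>sum \<delta> (S - A)\<bar>" using assms(4) by linarith
    then show ?thesis using small[of "S - A"] 2 by simp
  qed
qed

lemma nonzero_int_abs_ge_1: "(a :: real) \<in> \<int> \<Longrightarrow> a \<noteq> 0 \<Longrightarrow> 1 \<le> \<bar>a\<bar>"
  by (auto elim!: Ints_cases)

context kuhn_frame
begin

text \<open>The nodal basis function of the lattice point \<open>p\<close>. Since \<open>\<sigma> i - \<sigma> j\<close> is a sum of consecutive
  barycentric coordinates, \<open>osc\<close> depends on the vertex order only through the interior diagonal.\<close>

definition osc :: "nat \<Rightarrow> real^'d \<Rightarrow> real^'d \<Rightarrow> real" where
  "osc N p x = Max ((\<lambda>(i, j). real N * ((\<sigma> i x - \<sigma> j x) - (\<sigma> i p - \<sigma> j p))) ` ({1..Suc d} \<times> {1..Suc d}))"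

definition hat :: "nat \<Rightarrow> real^'d \<Rightarrow> real^'d \<Rightarrow> real" where
  "hat N p x = max 0 (1 - osc N p x)"

lemma osc_ge:
  "i \<in> {1..Suc d} \<Longrightarrow> j \<in> {1..Suc d} \<Longrightarrow> real N * ((\<sigma> i x - \<sigma> j x) - (\<sigma> i p - \<sigma> j p)) \<le> osc N p x"
  unfolding osc_def by (rule Max_ge) (auto intro!: image_eqI[of _ _ "(i, j)"])

lemma osc_le:
  assumes "\<And>i j. i \<in> {1..Suc d} \<Longrightarrow> j \<in> {1..Suc d} \<Longrightarrow> real N * ((\<sigma> i x - \<sigma> j x) - (\<sigma> i p - \<sigma> j p)) \<le> c"
  shows "osc N p x \<le> c"
  unfolding osc_def by (rule Max.boundedI) (use assms in auto)

text \<open>At the vertices of a cell the integers \<open>D i j q\<close> differ by at most one, so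
  no \<open>D i j\<close> changes sign on the cell. The indices of largest and smallest deviation
  from \<open>p\<close> are therefore the same on the entire cell, \<open>osc\<close> is a single
  affine function \<open>D m l\<close>, and the cut at 1 does not pass through the cell.\<close>

lemma hat_affine:
  assumes N: "N > 0" and xs: "xs \<in> kuhn_lists N" and p: "p \<in> lattice N"
  shows "\<exists>\<alpha> c. \<forall>x\<in>convex hull (set xs). hat N p x = \<alpha> \<bullet> x + c"
proof -
  define D where "D i j x = real N * ((\<sigma> i x - \<sigma> j x) - (\<sigma> i p - \<sigma> j p))" for i j x
  have Dint: "D i j q \<in> \<int>" if "q \<in> set xs" for i j q
    using lattice_int[OF kuhn_vertex_lattice[OF N xs that]] lattice_int[OF p]
    by (simp add: D_def right_diff_distrib)
  have Dvar: "\<bar>D i j q - D i j r\<bar> \<le> 1" if "q \<in> set xs" "r \<in> set xs" for i j q r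
    using kuhn_diff_bound[OF N xs that, of i j] by (simp add: D_def right_diff_distrib)
  have one_side: "(\<forall>q\<in>set xs. D i j q \<le> of_int z) \<or> (\<forall>q\<in>set xs. of_int z \<le> D i j q)" for i j z
  proof (rule ccontr)
    assume "\<not> ?thesis"
    then obtain q r where qr: "q \<in> set xs" "r \<in> set xs" "of_int z < D i j q" "D i j r < of_int z" by force
    obtain a where a: "D i j q = of_int a" using Dint[OF qr(1), of i j] Ints_cases by blast
    obtain c where c: "D i j r = of_int c" using Dint[OF qr(2), of i j] Ints_cases by blast
    have "2 \<le> a - c" using qr(3,4) by (simp add: a c)
    then have "of_int 2 \<le> (of_int (a - c) :: real)" by (simp only: of_int_le_iff)
    then show False using Dvar[OF qr(1,2), of i j] by (simp add: a c)
  qed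
  \<comment> \<open>A total preorder of the indices, valid on the whole cell at once; its greatest
    and least elements give \<open>m\<close> and \<open>l\<close>.\<close>
  define R where "R i j \<longleftrightarrow> (\<forall>q\<in>set xs. D i j q \<le> 0)" for i j
  have flip: "D i j q = - D j i q" for i j q by (simp add: D_def algebra_simps)
  have add: "D i k q = D i j q + D j k q" for i j k q by (simp add: D_def algebra_simps)
  have tot: "R i j \<or> R j i" for i j
    using one_side[of i j 0] flip[of j i] unfolding R_def by auto
  have tr: "R i k" if "R i j" "R j k" for i j k
    unfolding R_def
  proof
    fix q assume "q \<in> set xs"
    then have "D i j q \<le> 0" "D j k q \<le> 0" using that by (auto simp: R_def)
    then show "D i k q \<le> 0" using add[of i k q j] by simp
  qed
  have "\<exists>m\<in>{1..Suc d}. \<forall>i\<in>{1..Suc d}. R i m"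
    by (rule finite_total_has_greatest) (use tot tr in \<open>auto\<close>)
  then obtain m where m: "m \<in> {1..Suc d}" "\<And>i. i \<in> {1..Suc d} \<Longrightarrow> R i m" by blast
  have "\<exists>l\<in>{1..Suc d}. \<forall>i\<in>{1..Suc d}. R l i"
    by (rule finite_total_has_greatest[where R="\<lambda>i j. R j i"]) (use tot tr in \<open>auto\<close>)
  then obtain l where l: "l \<in> {1..Suc d}" "\<And>i. i \<in> {1..Suc d} \<Longrightarrow> R l i" by blast
  have Daff: "D i j x = (real N *\<^sub>R (dir i - dir j)) \<bullet> x + (D i j 0)" for i j x
  proof -
    have "\<sigma> i x - \<sigma> i 0 = dir i \<bullet> x" "\<sigma> j x - \<sigma> j 0 = dir j \<bullet> x" using \<sigma>_diff[of _ x 0] by auto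
    then show ?thesis by (simp add: D_def inner_diff_left algebra_simps)
  qed
  have Dhull: "D i j x \<le> z" if "\<And>q. q \<in> set xs \<Longrightarrow> D i j q \<le> z" "x \<in> convex hull (set xs)" for i j z x
  proof -
    have "0 \<le> (real N *\<^sub>R (dir j - dir i)) \<bullet> x + (z - D i j 0)"
    proof (rule affine_nonneg_hull[OF _ that(2)])
      fix q assume "q \<in> set xs"
      then show "0 \<le> (real N *\<^sub>R (dir j - dir i)) \<bullet> q + (z - D i j 0)"
        using that(1)[of q] Daff[of i j q] by (simp add: inner_diff_left algebra_simps)
    qed
    then show ?thesis using Daff[of i j x] by (simp add: inner_diff_left algebra_simps)
  qed
  have osc: "osc N p x = D m l x" if x: "x \<in> convex hull (set xs)" for x
  proof (rule antisym)
    show "D m l x \<le> osc N p x" unfolding D_def by (rule osc_ge[OF m(1) l(1)])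
    show "osc N p x \<le> D m l x"
    proof (rule osc_le)
      fix i j assume ij: "i \<in> {1..Suc d}" "j \<in> {1..Suc d}"
      have "D i m x \<le> 0" "D l j x \<le> 0"
        using m(2)[OF ij(1)] l(2)[OF ij(2)] Dhull[OF _ x] unfolding R_def by blast+
      then show "real N * ((\<sigma> i x - \<sigma> j x) - (\<sigma> i p - \<sigma> j p)) \<le> D m l x"
        using add[of i j x m] add[of m j x l] unfolding D_def[symmetric] by linarith
    qed
  qed
  from one_side[of m l 1] show ?thesis
  proof
    assume "\<forall>q\<in>set xs. D m l q \<le> of_int 1"
    then have "D m l x \<le> 1" if "x \<in> convex hull (set xs)" for x using Dhull[OF _ that] by simp
    then have "hat N p x = 1 - D m l x" if "x \<in> convex hull (set xs)" for x
      using osc[OF that] that by (simp add: hat_def)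
    then have "hat N p x = (- (real N *\<^sub>R (dir m - dir l))) \<bullet> x + (1 - D m l 0)" if "x \<in> convex hull (set xs)" for x
      using Daff[of m l x] that by simp
    then show ?thesis by blast
  next
    assume "\<forall>q\<in>set xs. of_int 1 \<le> D m l q"
    then have "D l m x \<le> -1" if "x \<in> convex hull (set xs)" for x
      using Dhull[OF _ that, of l m "-1"] flip[of l m] by simp
    then have "hat N p x = 0 \<bullet> x + 0" if "x \<in> convex hull (set xs)" for x
      using osc[OF that] flip[of l m x] that by (force simp: hat_def)
    then show ?thesis by blast
  qed
qed

text \<open>Distinct lattice points differ by at least one unit in some coordinate \<open>j\<close>;
  comparing \<open>j\<close> with the constant coordinate \<open>Suc d\<close> shows that
  \<open>osc\<close> is at least 1.\<close>

lemma hat_lattice: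
  assumes N: "N > 0" and pq: "p \<in> lattice N" "q \<in> lattice N"
  shows "hat N p q = (if q = p then 1 else 0)"
proof (cases "q = p")
  case True
  have "osc N p p = 0"
    using osc_ge[of 1 1 N p p] osc_le[of N p p 0] by force
  then show ?thesis using True by (simp add: hat_def)
next
  case False
  then obtain j where j: "j \<in> {1..d}" "\<sigma> j q \<noteq> \<sigma> j p" using \<sigma>_inject[of q p] by blast
  have "1 \<le> \<bar>real N * (\<sigma> j q - \<sigma> j p)\<bar>"
    by (rule nonzero_int_abs_ge_1)
       (use lattice_int[OF pq(1), of j] lattice_int[OF pq(2), of j] j N in \<open>auto simp: right_diff_distrib\<close>)
  moreover have "\<bar>real N * (\<sigma> j q - \<sigma> j p)\<bar> \<le> osc N p q"
    using osc_ge[of j "Suc d" N q p] osc_ge[of "Suc d" j N q p] j(1)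
    by (simp add: abs_le_iff algebra_simps)
  ultimately show ?thesis using False by (simp add: hat_def)
qed

text \<open>The barycentric coordinate of \<open>x\<close> for the vertex
  \<open>root ! i\<close>.\<close>

definition bary :: "nat \<Rightarrow> real^'d \<Rightarrow> real" where
  "bary i x = \<sigma> i x - \<sigma> (Suc i) x"

lemma \<sigma>_eq_sum_bary: "i \<le> j \<Longrightarrow> \<sigma> i x - \<sigma> j x = (\<Sum>m\<in>{i..<j}. bary m x)"
  by (induction j rule: dec_induct) (auto simp: bary_def)

lemma sum_bary: "(\<Sum>m\<in>{0..d}. bary m x) = 1"
  using \<sigma>_eq_sum_bary[of 0 "Suc d" x] by (simp add: atLeastLessThanSuc_atLeastAtMost)

lemma bary_le_osc:
  assumes "i \<le> d"
  shows "real N * \<bar>bary i x - bary i p\<bar> \<le> osc N p x"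
proof (cases "i = 0")
  case True
  \<comment> \<open>The index 0 is outside the range of \<open>osc\<close>; since
    \<open>\<sigma> 0\<close> and \<open>\<sigma> (Suc d)\<close> are both constant, the pair 1 and
    \<open>Suc d\<close> gives the same change.\<close>
  have "real N * \<bar>\<sigma> 1 x - \<sigma> 1 p\<bar> \<le> osc N p x"
    using osc_ge[of 1 "Suc d" N x p] osc_ge[of "Suc d" 1 N x p] by (simp add: abs_if algebra_simps)
  then show ?thesis using True by (simp add: bary_def abs_minus_commute)
next
  case False
  then show ?thesis
    using osc_ge[of i "Suc i" N x p] osc_ge[of "Suc i" i N x p] assms
    by (simp add: bary_def abs_if algebra_simps)
qed

text \<open>Every difference in \<open>osc\<close> is up to sign a partial sum of changes of
  barycentric coordinates, and these changes add up to 0. With at most three of them nonzero, the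
  partial sums are bounded by the largest single change. The right-hand side is symmetric in the
  vertices.\<close>

lemma osc_eq_Max:
  assumes S: "S \<subseteq> {0..d}" "card S \<le> 3" "S \<noteq> {}"
    and eq: "\<And>i. i \<le> d \<Longrightarrow> i \<notin> S \<Longrightarrow> bary i x = bary i p"
  shows "osc N p x = real N * Max ((\<lambda>i. \<bar>bary i x - bary i p\<bar>) ` S)"
proof -
  have fin: "finite S" using S(1) finite_subset by blast
  define \<delta> where "\<delta> i = bary i x - bary i p" for i
  let ?\<mu> = "Max ((\<lambda>i. \<bar>bary i x - bary i p\<bar>) ` S)"
  have ge: "\<bar>\<delta> i\<bar> \<le> ?\<mu>" if "i \<in> S" for i
    unfolding \<delta>_def by (rule Max_ge) (use fin that in auto)
  obtain i0 where "i0 \<in> S" using S(3) by blast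
  then have mu0: "0 \<le> ?\<mu>" using ge[of i0] abs_ge_zero order_trans by blast
  have "sum \<delta> S = sum \<delta> {0..d}"
    by (rule sum.mono_neutral_left) (use S eq in \<open>auto simp: \<delta>_def\<close>)
  also have "\<dots> = 0" by (simp add: \<delta>_def sum_subtractf sum_bary)
  finally have s0: "sum \<delta> S = 0" .
  have int: "\<bar>(\<sigma> i x - \<sigma> j x) - (\<sigma> i p - \<sigma> j p)\<bar> \<le> ?\<mu>" if ij: "i \<le> j" "j \<le> Suc d" for i j
  proof -
    have "(\<sigma> i x - \<sigma> j x) - (\<sigma> i p - \<sigma> j p) = sum \<delta> {i..<j}"
      using \<sigma>_eq_sum_bary[OF ij(1)] by (simp add: \<delta>_def sum_subtractf)
    also have "\<dots> = sum \<delta> ({i..<j} \<inter> S)"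
      by (rule sum.mono_neutral_right) (use eq ij in \<open>auto simp: \<delta>_def\<close>)
    also have "\<bar>\<dots>\<bar> \<le> ?\<mu>"
      by (rule abs_partial_sum_le[OF fin S(2) _ s0 ge mu0]) auto
    finally show ?thesis .
  qed
  show ?thesis
  proof (rule antisym)
    show "osc N p x \<le> real N * ?\<mu>"
    proof (rule osc_le)
      fix i j assume ij: "i \<in> {1..Suc d}" "j \<in> {1..Suc d}"
      have "(\<sigma> i x - \<sigma> j x) - (\<sigma> i p - \<sigma> j p) \<le> ?\<mu>"
      proof (cases "i \<le> j")
        case True
        then show ?thesis using int[of i j] ij by (simp add: abs_le_iff)
      next
        case False
        then show ?thesis using int[of j i] ij by (simp add: abs_le_iff)
      qed
      then show "real N * ((\<sigma> i x - \<sigma> j x) - (\<sigma> i p - \<sigma> j p)) \<le> real N * ?\<mu>" by (rule mult_left_mono) simp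
    qed
    have "?\<mu> \<in> (\<lambda>i. \<bar>bary i x - bary i p\<bar>) ` S" by (rule Max_in) (use fin S in auto)
    then obtain i where i: "i \<in> S" "?\<mu> = \<bar>bary i x - bary i p\<bar>" by blast
    show "real N * ?\<mu> \<le> osc N p x" unfolding i(2) by (rule bary_le_osc) (use i S in auto)
  qed
qed

section \<open>Barycentric coordinates on faces shared by macro elements\<close>

lemma length_root: "length root = Suc d"
  by (simp add: root_def kuhn_def)

lemma in_rootD: "v \<in> set root \<Longrightarrow> \<exists>i\<le>d. v = root ! i"
  by (metis in_set_conv_nth length_root less_Suc_eq_le)

lemma \<sigma>_root: "i \<le> d \<Longrightarrow> j \<le> Suc d \<Longrightarrow> \<sigma> j (root ! i) = of_bool (j \<le> i)"
proof -
  assume i: "i \<le> d" and j: "j \<le> Suc d"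
  have "take i [1..<Suc d] = [1..<1 + i]" by (rule take_upt) (use i in simp)
  then have "root ! i = x0 + sum_list (map (\<lambda>j. (1 / real 1) *\<^sub>R e j) [1..<Suc i])"
    unfolding root_def kuhn_def using i by (subst nth_kpath) (auto simp del: upt_Suc simp: take_map)
  also have "sum_list (map (\<lambda>j. (1 / real 1) *\<^sub>R e j) [1..<Suc i]) = (\<Sum>j\<in>{1..i}. 1 *\<^sub>R e j)"
  proof -
    have "set [1..<Suc i] = {1..i}" by auto
    then show ?thesis
      using sum_list_distinct_conv_sum_set[OF distinct_upt, of "\<lambda>j. (1 / real 1) *\<^sub>R e j" 1 "Suc i"] by simp
  qed
  finally have "\<sigma> j (root ! i) = \<sigma> j x0 + (if j \<in> {1..i} then 1 else 0)"
    using \<sigma>_shift[of "{1..i}" j x0 1] i by simp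
  then show ?thesis using i j by (auto simp: \<sigma>_def)
qed

lemma bary_root: "i \<le> d \<Longrightarrow> j \<le> d \<Longrightarrow> bary j (root ! i) = of_bool (j = i)"
  by (auto simp: bary_def \<sigma>_root)

lemma distinct_root: "distinct root"
  unfolding distinct_conv_nth
proof (intro allI impI)
  fix i j assume "i < length root" "j < length root" "i \<noteq> j"
  then have "bary i (root ! i) \<noteq> bary i (root ! j)" using length_root by (simp add: bary_root)
  then show "root ! i \<noteq> root ! j" by auto
qed

lemma bary_combination:
  assumes W: "W \<subseteq> set root" and u: "sum u W = 1" and i: "i \<le> d"
  shows "bary i (\<Sum>v\<in>W. u v *\<^sub>R v) = (if root ! i \<in> W then u (root ! i) else 0)"
proof -
  have fin: "finite W" using W finite_subset by blast
  have aff: "bary i z = (dir i - dir (Suc i)) \<bullet> z + bary i 0" for z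
    using \<sigma>_diff[of i z 0] \<sigma>_diff[of "Suc i" z 0] by (simp add: bary_def inner_diff_left)
  have "bary i (\<Sum>v\<in>W. u v *\<^sub>R v) = (\<Sum>v\<in>W. u v * ((dir i - dir (Suc i)) \<bullet> v)) + sum u W * bary i 0"
    by (subst aff) (simp add: inner_sum_right u)
  also have "\<dots> = (\<Sum>v\<in>W. u v * bary i v)"
    by (subst (2) aff) (simp add: sum_distrib_right sum.distrib distrib_left)
  also have "\<dots> = (\<Sum>v\<in>W. if v = root ! i then u v else 0)"
  proof (rule sum.cong[OF refl])
    fix v assume "v \<in> W"
    then obtain j where j: "j \<le> d" "v = root ! j" using W in_rootD by blast
    have "v = root ! i \<longleftrightarrow> j = i" using j i distinct_root length_root by (simp add: nth_eq_iff_index_eq)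
    then show "u v * bary i v = (if v = root ! i then u v else 0)" using j i by (simp add: bary_root)
  qed
  also have "\<dots> = (if root ! i \<in> W then u (root ! i) else 0)" using fin by simp
  finally show ?thesis .
qed

text \<open>The formula involves only the weights on the face \<open>W\<close>, so two macro
  elements sharing \<open>W\<close> give the same value whatever their vertex orders.\<close>

lemma hat_face:
  assumes W: "W \<subseteq> set root" "card W \<le> 3" and u: "sum u W = 1" "x = (\<Sum>v\<in>W. u v *\<^sub>R v)"
    and u': "sum u' W = 1" "p = (\<Sum>v\<in>W. u' v *\<^sub>R v)"
  shows "hat N p x = max 0 (1 - real N * Max ((\<lambda>v. \<bar>u v - u' v\<bar>) ` W))"
proof -
  define S where "S = {i. i \<le> d \<and> root ! i \<in> W}"
  have img: "(\<lambda>i. root ! i) ` S = W"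
    using W(1) length_root by (force simp: S_def in_set_conv_nth less_Suc_eq_le)
  have inj: "inj_on (\<lambda>i. root ! i) S"
    using distinct_root length_root by (auto simp: inj_on_def S_def nth_eq_iff_index_eq)
  have "card S \<le> 3" using W(2) card_image[OF inj] img by simp
  moreover have "S \<noteq> {}" using img u(1) by auto
  ultimately have "osc N p x = real N * Max ((\<lambda>i. \<bar>bary i x - bary i p\<bar>) ` S)"
    by (intro osc_eq_Max) (use u u' bary_combination[OF W(1)] in \<open>auto simp: S_def\<close>)
  also have "(\<lambda>i. \<bar>bary i x - bary i p\<bar>) ` S = (\<lambda>v. \<bar>u v - u' v\<bar>) ` ((\<lambda>i. root ! i) ` S)"
    unfolding image_image
  proof (rule image_cong[OF refl])
    fix i assume "i \<in> S"
    then show "\<bar>bary i x - bary i p\<bar> = \<bar>u (root ! i) - u' (root ! i)\<bar>"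
      unfolding u(2) u'(2) using bary_combination[OF W(1) u(1)] bary_combination[OF W(1) u'(1)] by (simp add: S_def)
  qed
  finally show ?thesis by (simp add: hat_def img)
qed

text \<open>Some barycentric coordinate of \<open>p\<close> for a vertex off \<open>W\<close> is
  nonzero, hence at least 1/N in absolute value, while it vanishes at \<open>x\<close>; so
  \<open>osc\<close> is at least 1.\<close>

lemma hat_off_face:
  assumes W: "W \<subseteq> set root" and x: "x \<in> convex hull W" and p: "p \<in> T" "p \<notin> convex hull W"
    and pl: "p \<in> lattice N" and N: "N > 0"
  shows "hat N p x = 0"
proof -
  have finW: "finite W" using W finite_subset by blast
  obtain u where u: "sum u W = 1" "x = (\<Sum>v\<in>W. u v *\<^sub>R v)"
    using x by (auto simp: convex_hull_finite[OF finW])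
  have "p \<in> convex hull (set root)" using p(1) by (simp add: T_def)
  then obtain u' where u': "\<And>v. v \<in> set root \<Longrightarrow> 0 \<le> u' v" "sum u' (set root) = 1" "p = (\<Sum>v\<in>set root. u' v *\<^sub>R v)"
    by (auto simp: convex_hull_finite)
  have "\<exists>v\<in>set root - W. u' v \<noteq> 0"
  proof (rule ccontr)
    assume "\<not> ?thesis"
    then have z: "\<forall>v\<in>set root - W. u' v = 0" by blast
    then have "sum u' W = 1" using u'(2) sum.mono_neutral_right[OF _ W, of u'] by simp
    moreover have "p = (\<Sum>v\<in>W. u' v *\<^sub>R v)"
      using u'(3) z sum.mono_neutral_right[OF _ W, of "\<lambda>v. u' v *\<^sub>R v"] by simp
    ultimately have "p \<in> convex hull W" using u'(1) W by (auto simp: convex_hull_finite[OF finW])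
    then show False using p(2) by simp
  qed
  then obtain i where i: "i \<le> d" "root ! i \<notin> W" "u' (root ! i) \<noteq> 0"
    using length_root by (auto simp: in_set_conv_nth less_Suc_eq_le)
  have "bary i x = 0" using bary_combination[OF W u(1) i(1)] i(2) u(2) by simp
  moreover have "bary i p \<noteq> 0"
    using bary_combination[OF order_refl u'(2) i(1)] i length_root u'(3) by simp
  moreover have "real N * bary i p \<in> \<int>"
    using lattice_int[OF pl] by (simp add: bary_def right_diff_distrib)
  ultimately have "1 \<le> \<bar>real N * bary i p\<bar>" "real N * \<bar>bary i x - bary i p\<bar> = \<bar>real N * bary i p\<bar>"
    using N nonzero_int_abs_ge_1[of "real N * bary i p"] by (simp_all add: abs_mult)
  then show ?thesis using bary_le_osc[OF i(1), of N x p] by (simp add: hat_def)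
qed

text \<open>The criterion reads only barycentric coordinates on the face, so adjacent macro elements
  agree on which of its points are lattice points.\<close>

lemma lattice_iff_face:
  assumes W: "W \<subseteq> set root" and u: "sum u W = 1" "p = (\<Sum>v\<in>W. u v *\<^sub>R v)"
  shows "p \<in> lattice N \<longleftrightarrow> (\<forall>v\<in>W. real N * u v \<in> \<int>)"
proof
  assume p: "p \<in> lattice N"
  show "\<forall>v\<in>W. real N * u v \<in> \<int>"
  proof
    fix v assume "v \<in> W"
    then obtain i where i: "i \<le> d" "v = root ! i" using W in_rootD by blast
    have "real N * bary i p \<in> \<int>" using lattice_int[OF p] by (simp add: bary_def right_diff_distrib)
    then show "real N * u v \<in> \<int>" using bary_combination[OF W u(1) i(1)] i \<open>v \<in> W\<close> u(2) by simp
  qed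
next
  assume a: "\<forall>v\<in>W. real N * u v \<in> \<int>"
  have l: "real N * bary i p \<in> \<int>" if "i \<le> d" for i
    using bary_combination[OF W u(1) that] a u(2) by simp
  show "p \<in> lattice N"
    unfolding lattice_def
  proof (intro CollectI ballI)
    fix j assume j: "j \<in> {1..d}"
    have "\<sigma> j p = (\<Sum>m\<in>{j..<Suc d}. bary m p)" using \<sigma>_eq_sum_bary[of j "Suc d" p] j by simp
    then have "real N * \<sigma> j p = (\<Sum>m\<in>{j..<Suc d}. real N * bary m p)" by (simp only: sum_distrib_left)
    also have "\<dots> \<in> \<int>" by (rule Ints_sum) (use l in auto)
    finally show "real N * \<sigma> j p \<in> \<int>" .
  qed
qed

end

section \<open>The macro mesh and its nodal basis\<close>

lemma kuhn_frame_of_simplex: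
  fixes T :: "(real^'d) set"
  assumes card: "CARD('d) = 2 \<or> CARD('d) = 3" and T: "int CARD('d) simplex T" and vo: "vertex_ordering T xs"
  shows "\<exists>x0 e b. kuhn_frame CARD('d) (e :: nat \<Rightarrow> real^'d) b \<and> kuhn_frame.root CARD('d) x0 e = xs"
    and "T = convex hull (set xs)" "\<not> affine_dependent (set xs)" "card (set xs) = Suc CARD('d)"
proof -
  obtain C where C: "\<not> affine_dependent C" "int (card C) = int CARD('d) + 1" "T = convex hull C"
    using T by (auto simp: simplex_def)
  have ext: "{x. x extreme_point_of T} = C"
    using extreme_point_of_convex_hull_affine_independent[OF C(1)] C(3) by auto
  then have setxs: "set xs = C" "distinct xs" using vo by (auto simp: vertex_ordering_def)
  show "T = convex hull (set xs)" "\<not> affine_dependent (set xs)" "card (set xs) = Suc CARD('d)"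
    using C setxs by auto
  let ?d = "CARD('d)"
  have len: "length xs = Suc ?d" using C(2) setxs distinct_card[OF setxs(2)] by simp
  define a where "a = xs ! 0"
  have aC: "a \<in> C" using len setxs by (auto simp: a_def)
  define Bs where "Bs = (\<lambda>x. - a + x) ` (C - {a})"
  have ind: "independent Bs" using C(1) affine_dependent_iff_dependent2[OF aC] by (simp add: Bs_def)
  define w where "w j = xs ! j - a" for j
  have w0: "w 0 = 0" by (simp add: w_def a_def)
  have Bsw: "Bs = w ` {1..?d}"
  proof -
    have "C - {a} = (\<lambda>j. xs ! j) ` {1..?d}"
    proof (intro equalityI subsetI)
      fix x assume "x \<in> C - {a}"
      then obtain j where j: "j < Suc ?d" "x = xs ! j" "x \<noteq> a" using len setxs(1) by (auto simp: in_set_conv_nth)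
      then have "j \<noteq> 0" by (cases "j = 0") (simp_all add: a_def)
      then show "x \<in> (\<lambda>j. xs ! j) ` {1..?d}" using j by auto
    next
      fix x assume "x \<in> (\<lambda>j. xs ! j) ` {1..?d}"
      then obtain j where j: "j \<in> {1..?d}" "x = xs ! j" by auto
      then have "x \<noteq> a" using setxs(2) len by (auto simp: a_def nth_eq_iff_index_eq)
      then show "x \<in> C - {a}" using j len setxs(1) nth_mem[of j xs] by auto
    qed
    then show ?thesis by (auto simp: Bs_def w_def image_image)
  qed
  have wneq: "w i \<noteq> w j" if "i \<in> {1..?d}" "j \<in> {1..?d}" "i \<noteq> j" for i j
    using that setxs(2) len by (auto simp: w_def nth_eq_iff_index_eq)
  \<comment> \<open>The functional is 1 on \<open>w j\<close> for i \<le> j and 0 before, hence 1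
    exactly on the i-th consecutive step. Independence of the \<open>w j\<close> allows these values
    to be prescribed, and \<open>adjoint\<close> represents the functional by a vector.\<close>
  have "\<exists>c. \<forall>j\<in>{1..?d}. c \<bullet> w j = of_bool (i \<le> j)" for i
  proof -
    obtain g where g: "linear g" "\<forall>x\<in>Bs. g x = (if \<exists>j\<in>{1..?d}. i \<le> j \<and> x = w j then 1 else (0::real))"
      using linear_independent_extend[OF ind, of "\<lambda>x. if \<exists>j\<in>{1..?d}. i \<le> j \<and> x = w j then 1 else (0::real)"] by auto
    show ?thesis
    proof (intro exI ballI)
      fix j assume j: "j \<in> {1..?d}"
      have "adjoint g 1 \<bullet> w j = g (w j)"
        using adjoint_works[OF g(1), of "w j" 1] by (simp add: inner_commute)
      also have "\<dots> = of_bool (i \<le> j)"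
      proof -
        have "(\<exists>j'\<in>{1..?d}. i \<le> j' \<and> w j = w j') \<longleftrightarrow> i \<le> j" using wneq[OF j] j by metis
        moreover have "w j \<in> Bs" using j Bsw by blast
        ultimately show ?thesis using g(2) by simp
      qed
      finally show "adjoint g 1 \<bullet> w j = of_bool (i \<le> j)" .
    qed
  qed
  then have "\<exists>b. \<forall>i. \<forall>j\<in>{1..?d}. b i \<bullet> w j = of_bool (i \<le> j)" by (intro choice allI)
  then obtain b where b: "\<And>i j. j \<in> {1..?d} \<Longrightarrow> b i \<bullet> w j = of_bool (i \<le> j)" by blast
  have b': "b i \<bullet> w j = of_bool (i \<le> j)" if "i \<ge> 1" "j \<le> ?d" for i j
    using b[of j i] that w0 by (cases "j = 0") auto
  define e where "e j = w j - w (j - 1)" for j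
  have dual: "b i \<bullet> e j = (if i = j then 1 else 0)" if "i \<in> {1..?d}" "j \<in> {1..?d}" for i j
    using that b'[of i j] b'[of i "j - 1"] by (auto simp: e_def inner_diff_right)
  have tele: "(\<Sum>i=1..j. e i) = w j" for j
    by (induction j) (auto simp: e_def w0)
  have spanB: "span Bs = UNIV"
  proof -
    have "inj_on w {1..?d}" using wneq by (intro inj_onI) metis
    then have "card Bs = ?d" by (simp add: Bsw card_image)
    then have "UNIV \<subseteq> span Bs" by (intro card_ge_dim_independent ind) auto
    then show ?thesis by auto
  qed
  have expand: "(\<Sum>j=1..?d. (b j \<bullet> x) *\<^sub>R e j) = x" for x
  proof -
    have "linear (\<lambda>x. \<Sum>j=1..?d. (b j \<bullet> x) *\<^sub>R e j)"
      by (rule linearI) (simp_all add: inner_add_right scaleR_left_distrib sum.distrib scaleR_sum_right)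
    moreover have "linear (\<lambda>x. x)" by (rule linear_ident)
    moreover have "(\<Sum>j=1..?d. (b j \<bullet> y) *\<^sub>R e j) = y" if y: "y \<in> Bs" for y
    proof -
      obtain m where m: "m \<in> {1..?d}" "y = w m" using y Bsw by blast
      have "(\<Sum>j=1..?d. (b j \<bullet> y) *\<^sub>R e j) = (\<Sum>j=1..?d. if j \<in> {1..m} then e j else 0)"
        by (rule sum.cong) (use m b in auto)
      also have "\<dots> = (\<Sum>j\<in>{1..?d} \<inter> {1..m}. e j)" by (rule sum.inter_restrict[symmetric]) simp
      also have "{1..?d} \<inter> {1..m} = {1..m}" using m by auto
      finally show ?thesis using tele[of m] m by simp
    qed
    ultimately show ?thesis
      using linear_eq_on_span[of "\<lambda>x. \<Sum>j=1..?d. (b j \<bullet> x) *\<^sub>R e j" "\<lambda>x. x" Bs x] spanB by simp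
  qed
  interpret kuhn_frame ?d a e b
    by unfold_locales (use card dual expand in auto)
  have "root = xs"
  proof (rule nth_equalityI)
    show "length root = length xs" using length_root len by simp
    fix i assume "i < length root"
    then have i: "i \<le> ?d" using length_root by simp
    have "take i [1..<Suc ?d] = [1..<1 + i]" by (rule take_upt) (use i in simp)
    then have "root ! i = a + sum_list (map (\<lambda>j. (1 / real 1) *\<^sub>R e j) [1..<Suc i])"
      unfolding root_def kuhn_def using i by (subst nth_kpath) (auto simp del: upt_Suc simp: take_map)
    also have "sum_list (map (\<lambda>j. (1 / real 1) *\<^sub>R e j) [1..<Suc i]) = (\<Sum>j=1..i. e j)"
    proof -
      have "set [1..<Suc i] = {1..i}" by auto
      then show ?thesis
        using sum_list_distinct_conv_sum_set[OF distinct_upt, of "\<lambda>j. (1 / real 1) *\<^sub>R e j" 1 "Suc i"] by simp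
    qed
    also have "a + \<dots> = xs ! i" unfolding tele by (simp add: w_def)
    finally show "root ! i = xs ! i" .
  qed
  then show "\<exists>x0 e b. kuhn_frame CARD('d) (e :: nat \<Rightarrow> real^'d) b \<and> kuhn_frame.root CARD('d) x0 e = xs"
    using kuhn_frame_axioms by blast
qed

text \<open>A face of a simplex is the hull of a subset of its vertices, and extreme points identify
  the subsets found in the two simplices. A full set of \<open>Suc m\<close> common vertices would
  make the simplices equal.\<close>

lemma simplex_intersection_vertices:
  fixes T T' :: "(real^'d) set"
  assumes "\<not> affine_dependent V" "T = convex hull V" "\<not> affine_dependent V'" "T' = convex hull V'"
    and "(T \<inter> T') face_of T" "(T \<inter> T') face_of T'" "T \<noteq> T'" and card: "card V = Suc m" "card V' = Suc m"
  shows "\<exists>W. W \<subseteq> V \<inter> V' \<and> T \<inter> T' = convex hull W \<and> card W \<le> m"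
proof -
  obtain c where c: "c \<subseteq> V" "T \<inter> T' = convex hull c"
    using face_of_convex_hull_affine_independent[OF assms(1)] assms(2,5) by blast
  obtain c' where c': "c' \<subseteq> V'" "T \<inter> T' = convex hull c'"
    using face_of_convex_hull_affine_independent[OF assms(3)] assms(4,6) by blast
  have "\<not> affine_dependent c" "\<not> affine_dependent c'"
    using c(1) c'(1) assms(1,3) affine_independent_subset by blast+
  then have cc: "c = c'"
    using extreme_point_of_convex_hull_affine_independent[of c] extreme_point_of_convex_hull_affine_independent[of c']
      c(2) c'(2) by (metis subsetI subset_antisym)
  have fin: "finite V" "finite V'" using card by (auto intro: card_ge_0_finite)
  have "card c \<le> m"
  proof (rule ccontr)
    assume "\<not> card c \<le> m"
    then have "Suc m \<le> card c" by simp
    then have "c = V" "c = V'"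
      using card_seteq[OF fin(1) c(1)] card_seteq[OF fin(2) c'(1)] card cc by simp_all
    then show False using assms(2,4,7) by simp
  qed
  then show ?thesis using c c' cc by blast
qed

text \<open>Each macro element has its own frame, unrelated to those of its neighbours;
  \<open>face\<close>, with its bound of three vertices, is what allows the hats to be
  glued.\<close>

locale macro_mesh =
  fixes \<Omega> :: "(real^'d) set" and \<T> :: "(real^'d) set set" and vord :: "(real^'d) set \<Rightarrow> (real^'d) list"
    and X :: "(real^'d) set \<Rightarrow> real^'d" and E B :: "(real^'d) set \<Rightarrow> nat \<Rightarrow> real^'d" and d :: nat
  assumes frame: "\<And>T. T \<in> \<T> \<Longrightarrow> kuhn_frame d (E T) (B T)"
    and frame_root: "\<And>T. T \<in> \<T> \<Longrightarrow> kuhn_frame.root d (X T) (E T) = vord T"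
    and T_hull: "\<And>T. T \<in> \<T> \<Longrightarrow> T = convex hull (set (vord T))"
    and fin: "finite \<T>"
    and \<Omega>: "open \<Omega>" "closure \<Omega> = \<Union>\<T>" "\<Omega> = interior (\<Union>\<T>)"
    and face: "\<And>T T'. T \<in> \<T> \<Longrightarrow> T' \<in> \<T> \<Longrightarrow> T \<noteq> T' \<Longrightarrow>
       \<exists>W. W \<subseteq> set (vord T) \<inter> set (vord T') \<and> T \<inter> T' = convex hull W \<and> card W \<le> 3"
    and overlap: "\<And>T T'. T \<in> \<T> \<Longrightarrow> T' \<in> \<T> \<Longrightarrow> T \<noteq> T' \<Longrightarrow> negligible (T \<inter> T')"
    and int_ne: "\<And>T. T \<in> \<T> \<Longrightarrow> interior T \<noteq> {}"
begin

section \<open>Cells and nodes of the global mesh\<close>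

abbreviation mesh :: "nat \<Rightarrow> (real^'d) list set" where "mesh n \<equiv> refined_mesh \<T> vord n"
abbreviation sub :: "(real^'d) set \<Rightarrow> nat \<Rightarrow> (real^'d) list set" where "sub T n \<equiv> descend (vord T) n"
abbreviation cell :: "(real^'d) list \<Rightarrow> (real^'d) set" where "cell xs \<equiv> convex hull (set xs)"

lemma T_eq: "T \<in> \<T> \<Longrightarrow> kuhn_frame.T d (X T) (E T) = T"
  using kuhn_frame.T_def[OF frame] frame_root T_hull by metis

lemma sub_eq:
  assumes "T \<in> \<T>"
  shows "sub T n = {xs \<in> kuhn_frame.kuhn_lists d (X T) (E T) (B T) (2 ^ n). set xs \<subseteq> T}"
proof -
  interpret F: kuhn_frame d "X T" "E T" "B T" by (rule frame[OF assms])
  show ?thesis using F.descend_root[of n] frame_root[OF assms] T_eq[OF assms] by simp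
qed

lemma finite_mesh: "finite (mesh n)"
  by (simp add: refined_mesh_eq fin finite_descend)

lemma cell_closed: "compact (cell xs)" "closed (cell xs)" "convex (cell xs)" "cell xs \<in> sets lebesgue" "cell xs \<in> lmeasurable"
proof -
  show c: "compact (cell xs)" by (simp add: finite_imp_compact_convex_hull)
  then show "closed (cell xs)" by (rule compact_imp_closed)
  show "cell xs \<in> lmeasurable" using c by (rule lmeasurable_compact)
  then show "cell xs \<in> sets lebesgue" by (rule fmeasurableD)
qed simp

lemma cell_cover: "T \<in> \<T> \<Longrightarrow> (\<Union>xs\<in>sub T n. cell xs) = T"
proof -
  assume T: "T \<in> \<T>"
  interpret F: kuhn_frame d "X T" "E T" "B T" by (rule frame[OF T])
  show ?thesis using F.kuhn_cover[of n] frame_root[OF T] T_eq[OF T] int_ne[OF T] by simp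
qed

lemma cell_subset: "T \<in> \<T> \<Longrightarrow> xs \<in> sub T n \<Longrightarrow> cell xs \<subseteq> T"
  using cell_cover[of T n] by blast

lemma mesh_cover: "(\<Union>xs\<in>mesh n. cell xs) = \<Union>\<T>"
  using cell_cover[of _ n] by (auto simp: refined_mesh_eq)

lemma cell_overlap_same:
  assumes "T \<in> \<T>" "xs \<in> sub T n" "xs' \<in> sub T n" "xs \<noteq> xs'"
  shows "negligible (cell xs \<inter> cell xs')"
  by (rule kuhn_frame.kuhn_overlap_negligible[OF frame[OF assms(1)], of "2 ^ n"])
     (use assms in \<open>auto simp: sub_eq\<close>)

lemma cell_overlap:
  assumes "T \<in> \<T>" "xs \<in> sub T n" "T' \<in> \<T>" "xs' \<in> sub T' n" "(T, xs) \<noteq> (T', xs')"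
  shows "negligible (cell xs \<inter> cell xs')"
proof (cases "T = T'")
  case True
  then show ?thesis using cell_overlap_same assms by blast
next
  case False
  have "cell xs \<inter> cell xs' \<subseteq> T \<inter> T'" using cell_subset assms by blast
  then show ?thesis using overlap[OF assms(1,3) False] negligible_subset by blast
qed

lemma mesh_overlap:
  assumes "xs \<in> mesh n" "xs' \<in> mesh n" "xs \<noteq> xs'"
  shows "negligible (cell xs \<inter> cell xs')"
  using assms cell_overlap[of _ xs n _ xs'] by (auto simp: refined_mesh_eq)

text \<open>A node created by a neighbour and lying in \<open>T\<close> sits on the common face,
  where the two lattices agree by \<open>lattice_iff_face\<close>.\<close>

lemma node_lattice:
  assumes T: "T \<in> \<T>" and p: "p \<in> nodes (mesh n)" "p \<in> T"
  shows "p \<in> kuhn_frame.lattice d (X T) (B T) (2 ^ n)"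
proof -
  obtain T0 xs where T0: "T0 \<in> \<T>" "xs \<in> sub T0 n" "p \<in> set xs" using p(1) by (auto simp: nodes_def refined_mesh_eq)
  interpret F: kuhn_frame d "X T" "E T" "B T" by (rule frame[OF T])
  interpret F0: kuhn_frame d "X T0" "E T0" "B T0" by (rule frame[OF T0(1)])
  have p0: "p \<in> F0.lattice (2 ^ n)" using F0.kuhn_vertex_lattice[of "2 ^ n" xs p] T0 by (auto simp: sub_eq)
  show ?thesis
  proof (cases "T = T0")
    case True
    then show ?thesis using p0 by simp
  next
    case False
    obtain W where W: "W \<subseteq> set (vord T) \<inter> set (vord T0)" "T \<inter> T0 = convex hull W"
      using face[OF T T0(1) False] by blast
    have "p \<in> T0" using T0 sub_eq[OF T0(1)] by auto
    then have "p \<in> convex hull W" using p(2) W(2) by blast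
    moreover have "finite W" using W(1) finite_subset by blast
    ultimately obtain u where u: "sum u W = 1" "p = (\<Sum>v\<in>W. u v *\<^sub>R v)" by (auto simp: convex_hull_finite)
    have "W \<subseteq> set F.root" "W \<subseteq> set F0.root" using W(1) frame_root[OF T] frame_root[OF T0(1)] by auto
    then show ?thesis using p0 F.lattice_iff_face[OF _ u] F0.lattice_iff_face[OF _ u] by blast
  qed
qed

text \<open>Glued from the hats of the macro elements. The element is an arbitrary one containing
  both points; \<open>nodal_hat_eq\<close> shows that the value does not depend on it.\<close>

definition nodal_hat :: "nat \<Rightarrow> real^'d \<Rightarrow> real^'d \<Rightarrow> real" where
  "nodal_hat n p x = (if \<exists>T\<in>\<T>. p \<in> T \<and> x \<in> T then
     (let T = SOME T. T \<in> \<T> \<and> p \<in> T \<and> x \<in> T in kuhn_frame.hat d (X T) (B T) (2 ^ n) p x) else 0)"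

text \<open>If the choice falls on another element, \<open>x\<close> lies on the common face:
  \<open>hat_face\<close> equates the two values when \<open>p\<close> lies there too, and
  \<open>hat_off_face\<close> gives 0 otherwise.\<close>

lemma nodal_hat_eq:
  assumes T: "T \<in> \<T>" "x \<in> T" and p: "p \<in> nodes (mesh n)"
  shows "nodal_hat n p x = (if p \<in> T then kuhn_frame.hat d (X T) (B T) (2 ^ n) p x else 0)"
proof (cases "\<exists>T\<in>\<T>. p \<in> T \<and> x \<in> T")
  case False
  then show ?thesis using T by (auto simp: nodal_hat_def)
next
  case True
  define T0 where "T0 = (SOME T. T \<in> \<T> \<and> p \<in> T \<and> x \<in> T)"
  have T0: "T0 \<in> \<T> \<and> p \<in> T0 \<and> x \<in> T0" unfolding T0_def by (rule someI_ex) (use True in blast)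
  have val: "nodal_hat n p x = kuhn_frame.hat d (X T0) (B T0) (2 ^ n) p x"
    using True by (simp add: nodal_hat_def T0_def Let_def)
  interpret F: kuhn_frame d "X T" "E T" "B T" by (rule frame[OF T(1)])
  interpret F0: kuhn_frame d "X T0" "E T0" "B T0" by (rule frame) (use T0 in blast)
  show ?thesis
  proof (cases "T = T0")
    case True
    then show ?thesis using val T0 by simp
  next
    case False
    obtain W where W: "W \<subseteq> set (vord T) \<inter> set (vord T0)" "T \<inter> T0 = convex hull W" "card W \<le> 3"
      using face[OF T(1) _ False] T0 by blast
    have Wr: "W \<subseteq> set F.root" "W \<subseteq> set F0.root" using W(1) frame_root[OF T(1)] frame_root[of T0] T0 by auto
    have finW: "finite W" using W(1) finite_subset by blast
    have xW: "x \<in> convex hull W" using T T0 W(2) by blast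
    show ?thesis
    proof (cases "p \<in> T")
      case True
      then have "p \<in> convex hull W" using T0 W(2) by blast
      then obtain u' where u': "sum u' W = 1" "p = (\<Sum>v\<in>W. u' v *\<^sub>R v)" using finW by (auto simp: convex_hull_finite)
      obtain u where u: "sum u W = 1" "x = (\<Sum>v\<in>W. u v *\<^sub>R v)" using xW finW by (auto simp: convex_hull_finite)
      show ?thesis
        using True val F.hat_face[OF Wr(1) W(3) u u', of "2 ^ n"] F0.hat_face[OF Wr(2) W(3) u u', of "2 ^ n"] by simp
    next
      case pT: False
      have "p \<notin> convex hull W" using pT W(2) by blast
      moreover have "p \<in> F0.T" using T_eq[of T0] T0 by simp
      moreover have "p \<in> F0.lattice (2 ^ n)" using node_lattice[OF _ p] T0 by blast
      ultimately show ?thesis using pT val F0.hat_off_face[OF Wr(2) xW] by simp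
    qed
  qed
qed

lemma nodal_hat_fe_space:
  assumes p: "p \<in> nodes (mesh n)"
  shows "nodal_hat n p \<in> fe_space \<Omega> (mesh n)" "\<And>q. q \<in> nodes (mesh n) \<Longrightarrow> nodal_hat n p q = (if q = p then 1 else 0)"
proof -
  have aff: "\<exists>g c. \<forall>x\<in>cell xs. nodal_hat n p x = g \<bullet> x + c" if xs: "xs \<in> mesh n" for xs
  proof -
    obtain T where T: "T \<in> \<T>" "xs \<in> sub T n" using xs by (auto simp: refined_mesh_eq)
    interpret F: kuhn_frame d "X T" "E T" "B T" by (rule frame[OF T(1)])
    have x: "nodal_hat n p x = (if p \<in> T then F.hat (2 ^ n) p x else 0)" if "x \<in> cell xs" for x
      using nodal_hat_eq[OF T(1) _ p] that cell_subset[OF T] by blast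
    show ?thesis
    proof (cases "p \<in> T")
      case True
      have "\<exists>\<alpha> c. \<forall>x\<in>cell xs. F.hat (2 ^ n) p x = \<alpha> \<bullet> x + c"
        by (rule F.hat_affine) (use T node_lattice[OF T(1) p True] sub_eq[OF T(1)] in auto)
      then show ?thesis using x True by simp
    next
      case False
      then show ?thesis using x by (intro exI[of _ 0]) simp
    qed
  qed
  have "continuous_on (\<Union>xs\<in>mesh n. cell xs) (nodal_hat n p)"
  proof (rule continuous_on_closed_Union[OF finite_mesh])
    fix xs assume "xs \<in> mesh n"
    then obtain g c where "\<forall>x\<in>cell xs. nodal_hat n p x = g \<bullet> x + c" using aff by blast
    moreover have "continuous_on (cell xs) (\<lambda>x. g \<bullet> x + c)" by (intro continuous_intros)
    ultimately show "continuous_on (cell xs) (nodal_hat n p)" by (simp cong: continuous_on_cong)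
  qed (rule cell_closed)
  then show "nodal_hat n p \<in> fe_space \<Omega> (mesh n)"
    using aff by (auto simp: fe_space_def elements_def \<Omega>(2) mesh_cover)
  fix q assume q: "q \<in> nodes (mesh n)"
  obtain T0 xs where T0: "T0 \<in> \<T>" "xs \<in> sub T0 n" "q \<in> set xs" using q by (auto simp: nodes_def refined_mesh_eq)
  interpret F0: kuhn_frame d "X T0" "E T0" "B T0" by (rule frame[OF T0(1)])
  have qT: "q \<in> T0" using T0 sub_eq[OF T0(1)] by auto
  show "nodal_hat n p q = (if q = p then 1 else 0)"
    using nodal_hat_eq[OF T0(1) qT p] qT F0.hat_lattice[of "2 ^ n" p q] node_lattice[OF T0(1) p] node_lattice[OF T0(1) q qT]
    by auto
qed

text \<open>\<open>nodal_hat\<close> witnesses the \<open>SOME\<close> in the definition; afterwards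
  only these two properties of the chosen function are used.\<close>

lemma nodal_basis:
  assumes p: "p \<in> nodes (mesh n)"
  shows "nodal_basis \<Omega> (mesh n) p \<in> fe_space \<Omega> (mesh n)"
    "q \<in> nodes (mesh n) \<Longrightarrow> nodal_basis \<Omega> (mesh n) p q = (if q = p then 1 else 0)"
proof -
  have "nodal_basis \<Omega> (mesh n) p \<in> fe_space \<Omega> (mesh n) \<and> (\<forall>q\<in>nodes (mesh n). nodal_basis \<Omega> (mesh n) p q = (if q = p then 1 else 0))"
    unfolding nodal_basis_def
    by (rule someI[of "\<lambda>\<phi>. \<phi> \<in> fe_space \<Omega> (mesh n) \<and> (\<forall>q\<in>nodes (mesh n). \<phi> q = (if q = p then 1 else 0))" "nodal_hat n p"])
       (use nodal_hat_fe_space[OF p] in blast)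
  then show "nodal_basis \<Omega> (mesh n) p \<in> fe_space \<Omega> (mesh n)"
    "q \<in> nodes (mesh n) \<Longrightarrow> nodal_basis \<Omega> (mesh n) p q = (if q = p then 1 else 0)" by blast+
qed

end

section \<open>Integrals and gradients cell by cell\<close>

text \<open>Lebesgue measure is complete: subsets of null sets are measurable. This gives
  measurability of integrands containing \<open>weak_grad\<close>, which are known only almost
  everywhere.\<close>

lemma borel_measurable_lebesgue_AE:
  fixes f g :: "'a::euclidean_space \<Rightarrow> real"
  assumes f: "f \<in> borel_measurable lebesgue" and eq: "AE x in lebesgue. f x = g x"
  shows "g \<in> borel_measurable lebesgue"
proof (rule measurableI)
  fix A :: "real set" assume A: "A \<in> sets borel"
  obtain N where N: "N \<in> null_sets lebesgue" "{x. f x \<noteq> g x} \<subseteq> N"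
    using eq unfolding eventually_ae_filter by auto
  have fg: "f x = g x" if "x \<notin> N" for x using N(2) that by blast
  have "g -` A \<inter> N \<in> null_sets lebesgue"
    using N(1) by (rule null_sets_completion_subset[rotated]) auto
  then have "g -` A \<inter> N \<in> sets lebesgue" by (rule null_setsD2)
  then have "(f -` A - N) \<union> (g -` A \<inter> N) \<in> sets lebesgue" if "f -` A - N \<in> sets lebesgue"
    using that by (rule sets.Un[rotated])
  moreover have "f -` A - N \<in> sets lebesgue"
    using measurable_sets[OF f A] N(1) by auto
  moreover have "(f -` A - N) \<union> (g -` A \<inter> N) = g -` A" using fg by auto
  ultimately show "g -` A \<inter> space lebesgue \<in> sets lebesgue" by simp
qed simp

lemma set_integral_AE_eq:
  fixes f g :: "'a::euclidean_space \<Rightarrow> real"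
  assumes f: "set_integrable lebesgue U f" and eq: "AE x in lebesgue. x \<in> U \<longrightarrow> g x = f x"
  shows "set_integrable lebesgue U g" "(LINT x:U|lebesgue. g x) = (LINT x:U|lebesgue. f x)"
proof -
  have ae: "AE x in lebesgue. indicator U x *\<^sub>R f x = indicator U x *\<^sub>R g x"
    using eq by eventually_elim (auto simp: indicator_def)
  have mf: "(\<lambda>x. indicator U x *\<^sub>R f x) \<in> borel_measurable lebesgue"
    using f by (auto simp: set_integrable_def)
  have mg: "(\<lambda>x. indicator U x *\<^sub>R g x) \<in> borel_measurable lebesgue"
    by (rule borel_measurable_lebesgue_AE[OF mf ae])
  show "set_integrable lebesgue U g"
    using f integrable_cong_AE[OF mf mg ae] by (simp add: set_integrable_def)
  show "(LINT x:U|lebesgue. g x) = (LINT x:U|lebesgue. f x)"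
    unfolding set_lebesgue_integral_def by (rule integral_cong_AE[OF mg mf]) (use ae in \<open>auto elim: eventually_mono\<close>)
qed

lemma AE_interior_convex:
  fixes S :: "'a::euclidean_space set"
  assumes "convex S" "closed S"
  shows "AE x in lebesgue. x \<in> S \<longrightarrow> x \<in> interior S"
proof -
  have "negligible (frontier S)" by (rule negligible_convex_frontier[OF assms(1)])
  then have "AE x in lebesgue. x \<notin> frontier S" by (intro AE_not_in) (simp add: negligible_iff_null_sets)
  then show ?thesis
    by eventually_elim (use assms(2) in \<open>auto simp: frontier_def\<close>)
qed

text \<open>The pieces have finitely many closed preimages covering the parameter interval of the
  segment, and on an interval a Lipschitz constant of such pieces carries over to the whole.\<close>

lemma affine_pieces_lipschitz_segment:
  fixes v :: "'a::euclidean_space \<Rightarrow> real"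
  assumes "finite I" "\<And>i. i \<in> I \<Longrightarrow> closed (S i)" "\<And>i x y. i \<in> I \<Longrightarrow> x \<in> S i \<Longrightarrow> y \<in> S i \<Longrightarrow> \<bar>v x - v y\<bar> \<le> L * norm (x - y)"
    and "0 \<le> L" "closed_segment x y \<subseteq> (\<Union>i\<in>I. S i)"
  shows "\<bar>v x - v y\<bar> \<le> L * norm (x - y)"
proof -
  let ?z = "\<lambda>t::real. x + t *\<^sub>R (y - x)"
  have seg: "?z t \<in> closed_segment x y" if "0 \<le> t" "t \<le> 1" for t
    using that by (auto simp: in_segment algebra_simps intro!: exI[of _ t])
  have "(L * norm (y - x))-lipschitz_on {0..1} (\<lambda>t. v (?z t))"
  proof (rule lipschitz_on_closed_Union[where U="\<lambda>i. {0..1} \<inter> ?z -` S i" and I=I])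
    fix i assume i: "i \<in> I"
    show "closed ({0..1} \<inter> ?z -` S i)"
      by (intro closed_Int closed_atLeastAtMost closed_vimage assms(2)[OF i] continuous_intros)
    show "(L * norm (y - x))-lipschitz_on ({0..1} \<inter> ?z -` S i) (\<lambda>t. v (?z t))"
    proof (rule lipschitz_onI)
      fix s t assume "s \<in> {0..1} \<inter> ?z -` S i" "t \<in> {0..1} \<inter> ?z -` S i"
      then have "?z s \<in> S i" "?z t \<in> S i" by auto
      then have "\<bar>v (?z s) - v (?z t)\<bar> \<le> L * norm (?z s - ?z t)" by (rule assms(3)[OF i])
      also have "?z s - ?z t = (s - t) *\<^sub>R (y - x)" by (simp add: algebra_simps)
      finally show "dist (v (?z s)) (v (?z t)) \<le> L * norm (y - x) * dist s t"
        by (simp add: dist_real_def mult_ac)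
    qed (use assms(4) in simp)
  next
    show "{0..1} \<subseteq> (\<Union>i\<in>I. {0..1} \<inter> ?z -` S i)" using assms(5) seg by fastforce
  qed (use assms in auto)
  from lipschitz_onD[OF this, of 1 0] show ?thesis
    by (simp add: dist_real_def norm_minus_commute abs_minus_commute)
qed

context macro_mesh
begin

text \<open>Cells are paired with their macro element because the representative of \<open>k\<close>
  depends on it.\<close>

definition cells :: "nat \<Rightarrow> ((real^'d) set \<times> (real^'d) list) set" where
  "cells n = Sigma \<T> (\<lambda>T. sub T n)"

lemma finite_cells: "finite (cells n)"
  unfolding cells_def using fin finite_descend by blast

lemma cellsD: "(T, xs) \<in> cells n \<Longrightarrow> T \<in> \<T> \<and> xs \<in> sub T n \<and> xs \<in> mesh n"
  by (auto simp: cells_def refined_mesh_eq)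

lemma mesh_cells: "xs \<in> mesh n \<Longrightarrow> \<exists>T. (T, xs) \<in> cells n"
  by (auto simp: cells_def refined_mesh_eq)

lemma integral_cells:
  fixes f :: "real^'d \<Rightarrow> real"
  assumes J: "J \<subseteq> cells n" and f: "\<And>T xs. (T, xs) \<in> J \<Longrightarrow> set_integrable lebesgue (cell xs) f"
  shows "(LINT x:(\<Union>c\<in>J. cell (snd c))|lebesgue. f x) = (\<Sum>c\<in>J. LINT x:cell (snd c)|lebesgue. f x)"
    and "set_integrable lebesgue (\<Union>c\<in>J. cell (snd c)) f"
proof -
  have finJ: "finite J" using J finite_cells finite_subset by blast
  show "(LINT x:(\<Union>c\<in>J. cell (snd c))|lebesgue. f x) = (\<Sum>c\<in>J. LINT x:cell (snd c)|lebesgue. f x)"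
  proof (rule set_integral_finite_UN_AE[OF finJ])
    fix c c' assume c: "c \<in> J" "c' \<in> J"
    show "AE x in lebesgue. (x \<in> cell (snd c) \<and> x \<in> cell (snd c')) \<longrightarrow> c = c'"
    proof (cases "c = c'")
      case False
      obtain T xs where e: "c = (T, xs)" by (cases c)
      obtain T' xs' where e': "c' = (T', xs')" by (cases c')
      have "(T, xs) \<in> cells n" "(T', xs') \<in> cells n" using c J e e' by auto
      from cellsD[OF this(1)] cellsD[OF this(2)] False have "negligible (cell xs \<inter> cell xs')"
        unfolding e e' by (intro cell_overlap[of T xs n T' xs']) auto
      then have "AE x in lebesgue. x \<notin> cell xs \<inter> cell xs'"
        by (intro AE_not_in) (simp add: negligible_iff_null_sets)
      then show ?thesis by eventually_elim (auto simp: e e')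
    qed simp
  qed (use f cell_closed(4) in auto)
  show "set_integrable lebesgue (\<Union>c\<in>J. cell (snd c)) f"
    by (rule set_integrable_UN[OF finJ]) (use f cell_closed(4) in auto)
qed

lemma cells_cover: "(\<Union>c\<in>cells n. cell (snd c)) = \<Union>\<T>"
proof -
  have "(\<Union>c\<in>cells n. cell (snd c)) = (\<Union>T\<in>\<T>. \<Union>xs\<in>sub T n. cell xs)"
  proof (rule set_eqI, rule iffI)
    fix x assume "x \<in> (\<Union>c\<in>cells n. cell (snd c))"
    then obtain c where "c \<in> cells n" "x \<in> cell (snd c)" by blast
    then have "fst c \<in> \<T>" "snd c \<in> sub (fst c) n" "x \<in> cell (snd c)" by (auto simp: cells_def)
    then show "x \<in> (\<Union>T\<in>\<T>. \<Union>xs\<in>sub T n. cell xs)" by blast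
  next
    fix x assume "x \<in> (\<Union>T\<in>\<T>. \<Union>xs\<in>sub T n. cell xs)"
    then obtain T xs where "T \<in> \<T>" "xs \<in> sub T n" "x \<in> cell xs" by blast
    then show "x \<in> (\<Union>c\<in>cells n. cell (snd c))" by (intro UN_I[of "(T, xs)"]) (simp_all add: cells_def)
  qed
  also have "\<dots> = (\<Union>T\<in>\<T>. T)" by (rule SUP_cong[OF refl]) (rule cell_cover)
  finally show ?thesis by simp
qed

lemma T_props: "T \<in> \<T> \<Longrightarrow> convex T" "T \<in> \<T> \<Longrightarrow> compact T" "T \<in> \<T> \<Longrightarrow> interior T \<subseteq> \<Omega>"
proof -
  assume T: "T \<in> \<T>"
  show "convex T" "compact T" using T_hull[OF T] cell_closed(1,3)[of "vord T"] by auto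
  show "interior T \<subseteq> \<Omega>" unfolding \<Omega>(3) using T by (intro interior_mono) auto
qed

text \<open>The boundaries of the macro elements are null sets, and their interiors lie in
  \<Omega>.\<close>

lemma AE_Omega: "AE x in lebesgue. x \<in> \<Omega> \<longleftrightarrow> x \<in> \<Union>\<T>"
proof -
  have "AE x in lebesgue. \<forall>T\<in>\<T>. x \<in> T \<longrightarrow> x \<in> interior T"
    by (subst AE_ball_countable) (use fin T_props in \<open>auto intro!: AE_interior_convex countable_finite compact_imp_closed\<close>)
  then show ?thesis
  proof eventually_elim
    case (elim x)
    have "\<Omega> \<subseteq> \<Union>\<T>" unfolding \<Omega>(3) by (rule interior_subset)
    then show ?case using elim T_props(3) by blast
  qed
qed

lemma Omega_integral:
  fixes f :: "real^'d \<Rightarrow> real"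
  assumes f: "\<And>T xs. (T, xs) \<in> cells n \<Longrightarrow> set_integrable lebesgue (cell xs) f"
  shows "(LINT x:\<Omega>|lebesgue. f x) = (\<Sum>c\<in>cells n. LINT x:cell (snd c)|lebesgue. f x)"
proof -
  have i: "set_integrable lebesgue (\<Union>\<T>) f"
    using integral_cells(2)[OF order_refl f] cells_cover by simp
  have "(LINT x:\<Omega>|lebesgue. f x) = (LINT x:\<Union>\<T>|lebesgue. f x)"
    unfolding set_lebesgue_integral_def
  proof (rule integral_cong_AE)
    have m: "(\<lambda>x. indicator (\<Union>\<T>) x *\<^sub>R f x) \<in> borel_measurable lebesgue" using i by (auto simp: set_integrable_def)
    then show "(\<lambda>x. indicator (\<Union>\<T>) x *\<^sub>R f x) \<in> borel_measurable lebesgue" .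
    have ae: "AE x in lebesgue. indicator (\<Union>\<T>) x *\<^sub>R f x = indicator \<Omega> x *\<^sub>R f x"
      using AE_Omega by eventually_elim (auto simp: indicator_def)
    show "(\<lambda>x. indicator \<Omega> x *\<^sub>R f x) \<in> borel_measurable lebesgue"
      by (rule borel_measurable_lebesgue_AE[OF m ae])
    show "AE x in lebesgue. indicator \<Omega> x *\<^sub>R f x = indicator (\<Union>\<T>) x *\<^sub>R f x"
      using ae by eventually_elim (rule sym)
  qed
  also have "\<dots> = (\<Sum>c\<in>cells n. LINT x:cell (snd c)|lebesgue. f x)"
    using integral_cells(1)[OF order_refl f] cells_cover by simp
  finally show ?thesis .
qed

definition grad :: "(real^'d \<Rightarrow> real) \<Rightarrow> (real^'d) list \<Rightarrow> real^'d" where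
  "grad v xs = (SOME g. \<exists>c. \<forall>x\<in>cell xs. v x = g \<bullet> x + c)"

lemma grad_affine:
  assumes "v \<in> fe_space \<Omega> (mesh n)" "xs \<in> mesh n"
  shows "\<exists>c. \<forall>x\<in>cell xs. v x = grad v xs \<bullet> x + c"
proof -
  have "\<exists>g c. \<forall>x\<in>cell xs. v x = g \<bullet> x + c"
    using assms by (auto simp: fe_space_def elements_def)
  then show ?thesis unfolding grad_def by (rule someI_ex)
qed

lemma grad_diff:
  assumes "v \<in> fe_space \<Omega> (mesh n)" "xs \<in> mesh n" "p \<in> cell xs" "q \<in> cell xs"
  shows "v p - v q = grad v xs \<bullet> (p - q)"
proof -
  obtain c where "\<forall>x\<in>cell xs. v x = grad v xs \<bullet> x + c" using grad_affine[OF assms(1,2)] by blast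
  then show ?thesis using assms(3,4) by (simp add: inner_diff_right)
qed

text \<open>The piecewise constant gradient is almost everywhere the limit of difference quotients,
  hence a weak derivative, and uniqueness identifies it with the chosen one.\<close>

lemma weak_grad_cell:
  assumes v: "v \<in> fe_space \<Omega> (mesh n)"
  shows "AE x in lebesgue. \<forall>xs\<in>mesh n. x \<in> cell xs \<longrightarrow> weak_grad \<Omega> v x = grad v xs"
proof -
  define L where "L = (\<Sum>xs\<in>mesh n. norm (grad v xs))"
  have L: "norm (grad v xs) \<le> L" if "xs \<in> mesh n" for xs
    unfolding L_def using finite_mesh that by (intro member_le_sum) auto
  have L0: "0 \<le> L" by (simp add: L_def sum_nonneg)
  have interior_cell: "interior (cell xs) \<subseteq> \<Omega>" if "xs \<in> mesh n" for xs
  proof -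
    obtain T where T: "T \<in> \<T>" "xs \<in> sub T n" using \<open>xs \<in> mesh n\<close> by (auto simp: refined_mesh_eq)
    then have "interior (cell xs) \<subseteq> interior T" using cell_subset by (intro interior_mono) blast
    then show ?thesis using T_props(3)[OF T(1)] by blast
  qed
  have disj: "xs = xs'" if xs: "xs \<in> mesh n" "xs' \<in> mesh n" and x: "x \<in> interior (cell xs)" "x \<in> interior (cell xs')" for xs xs' x
  proof (rule ccontr)
    assume "xs \<noteq> xs'"
    have "negligible (cell xs \<inter> cell xs')" by (rule mesh_overlap[OF xs \<open>xs \<noteq> xs'\<close>])
    then have "negligible (interior (cell xs) \<inter> interior (cell xs'))"
      by (rule negligible_subset) (use interior_subset in blast)
    moreover have "open (interior (cell xs) \<inter> interior (cell xs'))" by auto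
    ultimately show False using open_not_negligible x by blast
  qed
  have AEint: "AE x in lebesgue. \<forall>xs\<in>mesh n. x \<in> cell xs \<longrightarrow> x \<in> interior (cell xs)"
    by (subst AE_ball_countable)
       (use finite_mesh cell_closed in \<open>auto intro!: AE_interior_convex countable_finite\<close>)
  have comp: "AE x in lebesgue. \<forall>xs\<in>mesh n. x \<in> interior (cell xs) \<longrightarrow> weak_partial \<Omega> i v x = grad v xs $ i" for i
  proof -
    \<comment> \<open>Interiors of different cells are disjoint, so at most one summand is nonzero;
      the remaining points of the cells form a null set.\<close>
    define g where "g x = (\<Sum>xs\<in>mesh n. indicator (interior (cell xs)) x * grad v xs $ i)" for x
    have g_eq: "g x = grad v xs $ i" if "xs \<in> mesh n" "x \<in> interior (cell xs)" for x xs
    proof -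
      have "g x = (\<Sum>xs'\<in>mesh n. if xs' = xs then grad v xs $ i else 0)"
        unfolding g_def by (rule sum.cong[OF refl]) (use disj that in \<open>auto simp: indicator_def\<close>)
      then show ?thesis using finite_mesh that by simp
    qed
    have "has_weak_partial \<Omega> i v g"
    proof (rule has_weak_partial_directional_limit[OF \<Omega>(1) L0])
      fix x y assume "closed_segment x y \<subseteq> \<Omega>"
      also have "\<Omega> \<subseteq> \<Union>\<T>" unfolding \<Omega>(3) by (rule interior_subset)
      finally have seg: "closed_segment x y \<subseteq> (\<Union>xs\<in>mesh n. cell xs)" by (simp add: mesh_cover)
      show "\<bar>v x - v y\<bar> \<le> L * norm (x - y)"
      proof (rule affine_pieces_lipschitz_segment[OF finite_mesh cell_closed(2) _ L0 seg])
        fix xs x y assume xs: "xs \<in> mesh n" "x \<in> cell xs" "y \<in> cell xs"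
        have "\<bar>v x - v y\<bar> = \<bar>grad v xs \<bullet> (x - y)\<bar>" by (simp add: grad_diff[OF v xs])
        also have "\<dots> \<le> norm (grad v xs) * norm (x - y)" by (rule Cauchy_Schwarz_ineq2)
        also have "\<dots> \<le> L * norm (x - y)" using L[OF xs(1)] by (intro mult_right_mono) auto
        finally show "\<bar>v x - v y\<bar> \<le> L * norm (x - y)" .
      qed
    next
      have "interior (cell xs) \<in> sets lebesgue" for xs by (simp add: borel_open)
      then show "g \<in> borel_measurable lebesgue"
        unfolding g_def[abs_def] by (intro borel_measurable_sum borel_measurable_times borel_measurable_indicator) auto
      show "\<bar>g x\<bar> \<le> L" for x
      proof -
        have "\<bar>g x\<bar> \<le> (\<Sum>xs\<in>mesh n. \<bar>indicator (interior (cell xs)) x * grad v xs $ i\<bar>)" unfolding g_def by (rule sum_abs)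
        also have "\<dots> \<le> L" unfolding L_def
          by (rule sum_mono) (auto simp: indicator_def component_le_norm_cart)
        finally show ?thesis .
      qed
      show "AE x in lebesgue. x \<in> \<Omega> \<longrightarrow> ((\<lambda>s. (v (x + s *\<^sub>R axis i 1) - v x) / s) \<longlongrightarrow> g x) (at 0)"
        using AEint
      proof eventually_elim
        case (elim x)
        show ?case
        proof
          assume "x \<in> \<Omega>"
          also have "\<Omega> \<subseteq> \<Union>\<T>" unfolding \<Omega>(3) by (rule interior_subset)
          finally obtain xs where xs: "xs \<in> mesh n" "x \<in> cell xs" using mesh_cover[of n] by auto
          then have xi: "x \<in> interior (cell xs)" using elim by blast
          have "open ((\<lambda>s. x + s *\<^sub>R axis i 1) -` interior (cell xs))"
            by (intro open_vimage open_interior continuous_intros)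
          moreover have "0 \<in> (\<lambda>s. x + s *\<^sub>R axis i 1) -` interior (cell xs)" using xi by simp
          ultimately have "\<forall>\<^sub>F s in nhds 0. s \<in> (\<lambda>s. x + s *\<^sub>R axis i 1) -` interior (cell xs)"
            by (rule eventually_nhds_in_open)
          then have ev: "\<forall>\<^sub>F s in at 0. x + s *\<^sub>R axis i 1 \<in> cell xs \<and> s \<noteq> (0::real)"
            unfolding eventually_at_filter by eventually_elim (use interior_subset in auto)
          have "\<forall>\<^sub>F s in at 0. g x = (v (x + s *\<^sub>R axis i 1) - v x) / s"
            using ev
          proof eventually_elim
            case (elim s)
            have "v (x + s *\<^sub>R axis i 1) - v x = grad v xs \<bullet> (s *\<^sub>R axis i 1)"
              using grad_diff[OF v xs(1) conjunct1[OF elim] xs(2)] by simp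
            then show ?case using elim g_eq[OF xs(1) xi] by (simp add: inner_axis)
          qed
          then show "((\<lambda>s. (v (x + s *\<^sub>R axis i 1) - v x) / s) \<longlongrightarrow> g x) (at 0)"
            by (rule Lim_transform_eventually[OF tendsto_const])
        qed
      qed
    qed
    from has_weak_partial_unique[OF \<Omega>(1) this has_weak_partial_weak_partial[OF this]]
    show ?thesis
    proof eventually_elim
      case (elim x)
      show ?case using elim g_eq interior_cell by force
    qed
  qed
  have "AE x in lebesgue. \<forall>i\<in>UNIV. \<forall>xs\<in>mesh n. x \<in> interior (cell xs) \<longrightarrow> weak_partial \<Omega> i v x = grad v xs $ i"
    by (subst AE_ball_countable) (use comp in auto)
  with AEint show ?thesis
    by eventually_elim (auto simp: weak_grad_def vec_eq_iff)
qed

definition vol :: "(real^'d) list \<Rightarrow> real" where "vol xs = measure lebesgue (cell xs)"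

lemma vol_nonneg: "0 \<le> vol xs" by (simp add: vol_def)

lemma cell_const: "set_integrable lebesgue (cell xs) (\<lambda>x. c :: real)" "(LINT x:cell xs|lebesgue. (c::real)) = vol xs * c"
proof -
  show "set_integrable lebesgue (cell xs) (\<lambda>x. c :: real)"
    by (rule absolutely_integrable_on_const[OF cell_closed(5)])
  have "emeasure lebesgue (cell xs) \<noteq> \<infinity>" using fmeasurableD2[OF cell_closed(5)] by simp
  then show "(LINT x:cell xs|lebesgue. (c::real)) = vol xs * c"
    using cell_closed(4)[of xs] by (simp add: set_integral_const vol_def)
qed

lemma weak_grad_cell_AE:
  assumes "v \<in> fe_space \<Omega> (mesh n)" "(T, xs) \<in> cells n"
  shows "AE x in lebesgue. x \<in> cell xs \<longrightarrow> weak_grad \<Omega> v x = grad v xs"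
  using weak_grad_cell[OF assms(1)] by eventually_elim (use cellsD[OF assms(2)] in blast)

lemma norm_sq_cell:
  assumes "v \<in> fe_space \<Omega> (mesh n)" "(T, xs) \<in> cells n"
  shows "set_integrable lebesgue (cell xs) (\<lambda>x. (norm (weak_grad \<Omega> v x))\<^sup>2)"
    "(LINT x:cell xs|lebesgue. (norm (weak_grad \<Omega> v x))\<^sup>2) = vol xs * (norm (grad v xs))\<^sup>2"
proof -
  have ae: "AE x in lebesgue. x \<in> cell xs \<longrightarrow> (norm (weak_grad \<Omega> v x))\<^sup>2 = (norm (grad v xs))\<^sup>2"
    using weak_grad_cell_AE[OF assms] by eventually_elim simp
  show "set_integrable lebesgue (cell xs) (\<lambda>x. (norm (weak_grad \<Omega> v x))\<^sup>2)"
    by (rule set_integral_AE_eq(1)[OF cell_const(1) ae])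
  show "(LINT x:cell xs|lebesgue. (norm (weak_grad \<Omega> v x))\<^sup>2) = vol xs * (norm (grad v xs))\<^sup>2"
    using set_integral_AE_eq(2)[OF cell_const(1) ae] cell_const(2) by simp
qed

lemma L2_norm_cells:
  assumes "v \<in> fe_space \<Omega> (mesh n)" "J \<subseteq> cells n"
  shows "L2_norm_on (\<Union>c\<in>J. cell (snd c)) (weak_grad \<Omega> v) = sqrt (\<Sum>c\<in>J. vol (snd c) * (norm (grad v (snd c)))\<^sup>2)"
proof -
  have "(LINT x:(\<Union>c\<in>J. cell (snd c))|lebesgue. (norm (weak_grad \<Omega> v x))\<^sup>2) = (\<Sum>c\<in>J. LINT x:cell (snd c)|lebesgue. (norm (weak_grad \<Omega> v x))\<^sup>2)"
    by (rule integral_cells(1)[OF assms(2)]) (use norm_sq_cell(1)[OF assms(1)] assms(2) in blast)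
  also have "\<dots> = (\<Sum>c\<in>J. vol (snd c) * (norm (grad v (snd c)))\<^sup>2)"
    by (rule sum.cong[OF refl]) (use norm_sq_cell(2)[OF assms(1)] assms(2) in \<open>force\<close>)
  finally show ?thesis by (simp add: L2_norm_on_def)
qed

lemma L2_norm_Omega:
  assumes "v \<in> fe_space \<Omega> (mesh n)"
  shows "L2_norm_on \<Omega> (weak_grad \<Omega> v) = sqrt (\<Sum>c\<in>cells n. vol (snd c) * (norm (grad v (snd c)))\<^sup>2)"
proof -
  have "(LINT x:\<Omega>|lebesgue. (norm (weak_grad \<Omega> v x))\<^sup>2) = (\<Sum>c\<in>cells n. LINT x:cell (snd c)|lebesgue. (norm (weak_grad \<Omega> v x))\<^sup>2)"
    by (rule Omega_integral) (use norm_sq_cell(1)[OF assms(1)] in blast)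
  also have "\<dots> = (\<Sum>c\<in>cells n. vol (snd c) * (norm (grad v (snd c)))\<^sup>2)"
    by (rule sum.cong[OF refl]) (use norm_sq_cell(2)[OF assms(1)] in \<open>force\<close>)
  finally show ?thesis by (simp add: L2_norm_on_def)
qed

text \<open>The macro boundaries are null sets, so \<open>k\<close> may be replaced by its
  continuous representative on each cell.\<close>

lemma bilin_a_cells:
  assumes v: "v \<in> fe_space \<Omega> (mesh n)" and w: "w \<in> fe_space \<Omega> (mesh n)"
    and K: "\<And>T. T \<in> \<T> \<Longrightarrow> continuous_on T (K T)"
    and Kk: "\<And>T. T \<in> \<T> \<Longrightarrow> AE x in lebesgue. x \<in> interior T \<longrightarrow> K T x = k x"
  shows "bilin_a \<Omega> k v w = (\<Sum>c\<in>cells n. (LINT x:cell (snd c)|lebesgue. K (fst c) x) * (grad v (snd c) \<bullet> grad w (snd c)))"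
proof -
  have c: "set_integrable lebesgue (cell xs) (\<lambda>x. k x * (weak_grad \<Omega> v x \<bullet> weak_grad \<Omega> w x))"
    "(LINT x:cell xs|lebesgue. k x * (weak_grad \<Omega> v x \<bullet> weak_grad \<Omega> w x)) = (LINT x:cell xs|lebesgue. K T x) * (grad v xs \<bullet> grad w xs)"
    if c: "(T, xs) \<in> cells n" for T xs
  proof -
    have T: "T \<in> \<T>" "cell xs \<subseteq> T" using cellsD[OF c] cell_subset by auto
    have "AE x in lebesgue. x \<in> T \<longrightarrow> x \<in> interior T"
      using T_props(1,2)[OF T(1)] by (intro AE_interior_convex compact_imp_closed)
    with weak_grad_cell_AE[OF v c] weak_grad_cell_AE[OF w c] Kk[OF T(1)]
    have ae: "AE x in lebesgue. x \<in> cell xs \<longrightarrow> k x * (weak_grad \<Omega> v x \<bullet> weak_grad \<Omega> w x) = K T x * (grad v xs \<bullet> grad w xs)"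
      by eventually_elim (use T(2) in auto)
    have "continuous_on (cell xs) (\<lambda>x. K T x * (grad v xs \<bullet> grad w xs))"
      by (intro continuous_intros continuous_on_subset[OF K[OF T(1)] T(2)])
    then have i: "set_integrable lebesgue (cell xs) (\<lambda>x. K T x * (grad v xs \<bullet> grad w xs))"
      by (rule set_integrable_continuous_compact[OF cell_closed(1)])
    show "set_integrable lebesgue (cell xs) (\<lambda>x. k x * (weak_grad \<Omega> v x \<bullet> weak_grad \<Omega> w x))"
      by (rule set_integral_AE_eq(1)[OF i ae])
    show "(LINT x:cell xs|lebesgue. k x * (weak_grad \<Omega> v x \<bullet> weak_grad \<Omega> w x)) = (LINT x:cell xs|lebesgue. K T x) * (grad v xs \<bullet> grad w xs)"
      using set_integral_AE_eq(2)[OF i ae] by simp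
  qed
  have "bilin_a \<Omega> k v w = (\<Sum>c\<in>cells n. LINT x:cell (snd c)|lebesgue. k x * (weak_grad \<Omega> v x \<bullet> weak_grad \<Omega> w x))"
    unfolding bilin_a_def by (rule Omega_integral) (rule c(1))
  also have "\<dots> = (\<Sum>c\<in>cells n. (LINT x:cell (snd c)|lebesgue. K (fst c) x) * (grad v (snd c) \<bullet> grad w (snd c)))"
    by (rule sum.cong[OF refl]) (use c(2) in force)
  finally show ?thesis .
qed

lemma macro_integral:
  assumes T: "T \<in> \<T>" and v: "v \<in> fe_space \<Omega> (mesh n)" and w: "w \<in> fe_space \<Omega> (mesh n)"
  shows "(LINT x:T|lebesgue. weak_grad \<Omega> v x \<bullet> weak_grad \<Omega> w x) = (\<Sum>xs\<in>sub T n. vol xs * (grad v xs \<bullet> grad w xs))"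
proof -
  let ?J = "(\<lambda>xs. (T, xs)) ` sub T n"
  have J: "?J \<subseteq> cells n" using T by (auto simp: cells_def)
  have c: "set_integrable lebesgue (cell xs) (\<lambda>x. weak_grad \<Omega> v x \<bullet> weak_grad \<Omega> w x)"
    "(LINT x:cell xs|lebesgue. weak_grad \<Omega> v x \<bullet> weak_grad \<Omega> w x) = vol xs * (grad v xs \<bullet> grad w xs)"
    if c: "(T, xs) \<in> cells n" for T xs
  proof -
    have ae: "AE x in lebesgue. x \<in> cell xs \<longrightarrow> weak_grad \<Omega> v x \<bullet> weak_grad \<Omega> w x = grad v xs \<bullet> grad w xs"
      using weak_grad_cell_AE[OF v c] weak_grad_cell_AE[OF w c] by eventually_elim auto
    show "set_integrable lebesgue (cell xs) (\<lambda>x. weak_grad \<Omega> v x \<bullet> weak_grad \<Omega> w x)"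
      by (rule set_integral_AE_eq(1)[OF cell_const(1) ae])
    show "(LINT x:cell xs|lebesgue. weak_grad \<Omega> v x \<bullet> weak_grad \<Omega> w x) = vol xs * (grad v xs \<bullet> grad w xs)"
      using set_integral_AE_eq(2)[OF cell_const(1) ae] cell_const(2) by simp
  qed
  have "(\<Union>c\<in>?J. cell (snd c)) = T" using cell_cover[OF T, of n] by simp
  moreover have "(LINT x:(\<Union>c\<in>?J. cell (snd c))|lebesgue. weak_grad \<Omega> v x \<bullet> weak_grad \<Omega> w x) = (\<Sum>c\<in>?J. LINT x:cell (snd c)|lebesgue. weak_grad \<Omega> v x \<bullet> weak_grad \<Omega> w x)"
    by (rule integral_cells(1)[OF J]) (use c(1) J in blast)
  moreover have "(\<Sum>c\<in>?J. LINT x:cell (snd c)|lebesgue. weak_grad \<Omega> v x \<bullet> weak_grad \<Omega> w x) = (\<Sum>xs\<in>sub T n. vol xs * (grad v xs \<bullet> grad w xs))"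
    by (subst sum.reindex) (use c(2) J in \<open>auto simp: inj_on_def intro!: sum.cong\<close>)
  ultimately show ?thesis by simp
qed

end

section \<open>The consistency error\<close>

text \<open>After expansion the terms with \<open>a i * c i\<close> or \<open>a j * c j\<close>
  vanish because the \<gamma> sum to 0, and the two mixed terms coincide by symmetry. With basis
  gradients for \<gamma> this writes the energy of a cell in the edge form of
  \<open>bilin_ah\<close>.\<close>

lemma edge_energy_identity:
  fixes \<gamma> :: "'b \<Rightarrow> 'a::real_inner"
  assumes z: "(\<Sum>i\<in>V. \<gamma> i) = 0"
  shows "(\<Sum>i\<in>V. \<Sum>j\<in>V. (a i - a j) * (c j - c i) * (\<gamma> i \<bullet> \<gamma> j)) = 2 * ((\<Sum>i\<in>V. a i *\<^sub>R \<gamma> i) \<bullet> (\<Sum>j\<in>V. c j *\<^sub>R \<gamma> j))"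
proof -
  have z1: "(\<Sum>j\<in>V. \<gamma> i \<bullet> \<gamma> j) = 0" for i using z by (simp add: inner_sum_right[symmetric])
  have z2: "(\<Sum>i\<in>V. \<gamma> i \<bullet> \<gamma> j) = 0" for j using z by (simp add: inner_sum_left[symmetric])
  have "(a i - a j) * (c j - c i) * (\<gamma> i \<bullet> \<gamma> j) =
      a i * c j * (\<gamma> i \<bullet> \<gamma> j) - (a i * c i) * (\<gamma> i \<bullet> \<gamma> j) - (a j * c j) * (\<gamma> i \<bullet> \<gamma> j) + a j * c i * (\<gamma> j \<bullet> \<gamma> i)" for i j
    by (simp add: algebra_simps inner_commute)
  then have "(\<Sum>i\<in>V. \<Sum>j\<in>V. (a i - a j) * (c j - c i) * (\<gamma> i \<bullet> \<gamma> j)) =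
      (\<Sum>i\<in>V. \<Sum>j\<in>V. a i * c j * (\<gamma> i \<bullet> \<gamma> j)) - (\<Sum>i\<in>V. \<Sum>j\<in>V. (a i * c i) * (\<gamma> i \<bullet> \<gamma> j))
      - (\<Sum>i\<in>V. \<Sum>j\<in>V. (a j * c j) * (\<gamma> i \<bullet> \<gamma> j)) + (\<Sum>i\<in>V. \<Sum>j\<in>V. a j * c i * (\<gamma> j \<bullet> \<gamma> i))"
    by (simp add: sum.distrib sum_subtractf)
  also have "(\<Sum>i\<in>V. \<Sum>j\<in>V. (a i * c i) * (\<gamma> i \<bullet> \<gamma> j)) = 0"
    by (simp add: sum_distrib_left[symmetric] z1)
  also have "(\<Sum>i\<in>V. \<Sum>j\<in>V. (a j * c j) * (\<gamma> i \<bullet> \<gamma> j)) = 0"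
    by (subst sum.swap) (simp add: sum_distrib_left[symmetric] z2)
  also have "(\<Sum>i\<in>V. \<Sum>j\<in>V. a j * c i * (\<gamma> j \<bullet> \<gamma> i)) = (\<Sum>i\<in>V. \<Sum>j\<in>V. a i * c j * (\<gamma> i \<bullet> \<gamma> j))"
    by (rule sum.swap)
  also have "(\<Sum>i\<in>V. \<Sum>j\<in>V. a i * c j * (\<gamma> i \<bullet> \<gamma> j)) = (\<Sum>i\<in>V. a i *\<^sub>R \<gamma> i) \<bullet> (\<Sum>j\<in>V. c j *\<^sub>R \<gamma> j)"
    by (simp add: inner_sum_left inner_sum_right mult.assoc sum_distrib_left mult.left_commute) (rule sum.swap)
  finally show ?thesis by simp
qed

context macro_mesh
begin

section \<open>Reduction of both forms to edges of cells\<close>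

definition basis_grad :: "nat \<Rightarrow> real^'d \<Rightarrow> (real^'d) list \<Rightarrow> real^'d" where
  "basis_grad n i xs = grad (nodal_basis \<Omega> (mesh n) i) xs"

lemma mesh_nodes: "xs \<in> mesh n \<Longrightarrow> p \<in> set xs \<Longrightarrow> p \<in> nodes (mesh n)"
  by (auto simp: nodes_def)

lemma basis_grad_diff:
  assumes "i \<in> nodes (mesh n)" "xs \<in> mesh n" "p \<in> set xs" "q \<in> set xs"
  shows "basis_grad n i xs \<bullet> (p - q) = of_bool (p = i) - of_bool (q = i)"
proof -
  have "basis_grad n i xs \<bullet> (p - q) = nodal_basis \<Omega> (mesh n) i p - nodal_basis \<Omega> (mesh n) i q"
    unfolding basis_grad_def
    by (rule grad_diff[OF nodal_basis(1)[OF assms(1)] assms(2), symmetric]) (use assms(3,4) in \<open>simp_all add: hull_inc\<close>)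
  then show ?thesis
    using nodal_basis(2)[OF assms(1) mesh_nodes[OF assms(2,3)]] nodal_basis(2)[OF assms(1) mesh_nodes[OF assms(2,4)]]
    by (simp add: of_bool_def)
qed

lemma cell_kuhn:
  assumes "(T, xs) \<in> cells n"
  shows "xs \<in> kuhn_frame.kuhn_lists d (X T) (E T) (B T) (2 ^ n)" "T \<in> \<T>" "set xs \<subseteq> T" "xs \<in> mesh n" "cell xs \<subseteq> T"
  using cellsD[OF assms] sub_eq[of T n] cell_subset[of T xs n] by auto

lemma gradient_bound:
  assumes c: "(T, xs) \<in> cells n" and g: "\<And>p q. p \<in> set xs \<Longrightarrow> q \<in> set xs \<Longrightarrow> \<bar>\<gamma> \<bullet> (p - q)\<bar> \<le> a"
  shows "norm \<gamma> \<le> a * 2 ^ n * (\<Sum>j=1..d. norm (B T j))"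
proof -
  interpret F: kuhn_frame d "X T" "E T" "B T" by (rule frame[OF cell_kuhn(2)[OF c]])
  show ?thesis using F.kuhn_gradient_bound[OF _ cell_kuhn(1)[OF c] g] by simp
qed

text \<open>\<open>gradient_bound\<close> with a = 0 forces the difference of the two gradients to
  vanish.\<close>

lemma vertices_separate:
  assumes "xs \<in> mesh n" and g: "\<And>p q. p \<in> set xs \<Longrightarrow> q \<in> set xs \<Longrightarrow> \<gamma> \<bullet> (p - q) = \<gamma>' \<bullet> (p - q)"
  shows "\<gamma> = \<gamma>'"
proof -
  obtain T where T: "(T, xs) \<in> cells n" using mesh_cells[OF assms(1)] by blast
  have "norm (\<gamma> - \<gamma>') \<le> 0 * 2 ^ n * (\<Sum>j=1..d. norm (B T j))"
    by (rule gradient_bound[OF T]) (simp add: inner_diff_left g)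
  then show ?thesis by simp
qed

lemma basis_grad_zero:
  assumes "i \<in> nodes (mesh n)" "xs \<in> mesh n" "i \<notin> set xs"
  shows "basis_grad n i xs = 0"
  by (rule vertices_separate[OF assms(2)]) (use basis_grad_diff[OF assms(1,2)] assms(3) in auto)

lemma grad_expand:
  assumes v: "v \<in> fe_space \<Omega> (mesh n)" and xs: "xs \<in> mesh n"
  shows "grad v xs = (\<Sum>i\<in>set xs. v i *\<^sub>R basis_grad n i xs)" "(\<Sum>i\<in>set xs. basis_grad n i xs) = 0"
proof -
  \<comment> \<open>The combination reproduces nodal differences. Constant nodal values 1 then give
    the second claim, which is the gradient of the partition of unity.\<close>
  have key: "(\<Sum>i\<in>set xs. a i *\<^sub>R basis_grad n i xs) \<bullet> (p - q) = a p - a q" if pq: "p \<in> set xs" "q \<in> set xs" for a :: "real^'d \<Rightarrow> real" and p q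
  proof -
    have "(\<Sum>i\<in>set xs. a i *\<^sub>R basis_grad n i xs) \<bullet> (p - q) = (\<Sum>i\<in>set xs. a i * (basis_grad n i xs \<bullet> (p - q)))"
      by (simp add: inner_sum_left)
    also have "\<dots> = (\<Sum>i\<in>set xs. (if i = p then a i else 0) - (if i = q then a i else 0))"
      by (rule sum.cong[OF refl]) (use basis_grad_diff[OF mesh_nodes[OF xs] xs pq] in auto)
    also have "\<dots> = a p - a q" using pq by (simp add: sum_subtractf)
    finally show ?thesis .
  qed
  show "grad v xs = (\<Sum>i\<in>set xs. v i *\<^sub>R basis_grad n i xs)"
  proof (rule vertices_separate[OF xs])
    fix p q assume pq: "p \<in> set xs" "q \<in> set xs"
    show "grad v xs \<bullet> (p - q) = (\<Sum>i\<in>set xs. v i *\<^sub>R basis_grad n i xs) \<bullet> (p - q)"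
      using key[OF pq] grad_diff[OF v xs, of p q] pq by (simp add: hull_inc)
  qed
  show "(\<Sum>i\<in>set xs. basis_grad n i xs) = 0"
  proof (rule vertices_separate[OF xs])
    fix p q assume pq: "p \<in> set xs" "q \<in> set xs"
    show "(\<Sum>i\<in>set xs. basis_grad n i xs) \<bullet> (p - q) = 0 \<bullet> (p - q)"
      using key[OF pq, of "\<lambda>_. 1"] by simp
  qed
qed

lemma energy_edges:
  assumes v: "v \<in> fe_space \<Omega> (mesh n)" and w: "w \<in> fe_space \<Omega> (mesh n)" and xs: "xs \<in> mesh n"
  shows "(\<Sum>i\<in>set xs. \<Sum>j\<in>set xs. (v i - v j) * (w j - w i) * (basis_grad n i xs \<bullet> basis_grad n j xs)) = 2 * (grad v xs \<bullet> grad w xs)"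
  unfolding grad_expand(1)[OF v xs] grad_expand(1)[OF w xs]
  by (rule edge_energy_identity[OF grad_expand(2)[OF v xs]])

text \<open>Basis gradients vanish on cells that do not contain the node, so the double sum over all
  nodes shrinks to the vertices of each cell. This also removes the values of
  \<open>cont_ext\<close> outside its macro element.\<close>

lemma bilin_ah_cells:
  assumes v: "v \<in> fe_space \<Omega> (mesh n)" and w: "w \<in> fe_space \<Omega> (mesh n)"
  shows "bilin_ah \<Omega> \<T> (mesh n) k v w = 1/4 * (\<Sum>c\<in>cells n. \<Sum>i\<in>set (snd c). \<Sum>j\<in>set (snd c).
     (cont_ext k (fst c) i + cont_ext k (fst c) j) * (v i - v j) * (w j - w i) * (vol (snd c) * (basis_grad n i (snd c) \<bullet> basis_grad n j (snd c))))"
proof -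
  let ?N = "nodes (mesh n)"
  have finN: "finite ?N" using finite_mesh by (auto simp: nodes_def)
  define a where "a T i j = (cont_ext k T i + cont_ext k T j) * (v i - v j) * (w j - w i)" for T i j
  define b where "b xs i j = vol xs * (basis_grad n i xs \<bullet> basis_grad n j xs)" for xs i j
  have "(\<Sum>i\<in>?N. \<Sum>j\<in>?N. a T i j * (LINT x:T|lebesgue. weak_grad \<Omega> (nodal_basis \<Omega> (mesh n) i) x \<bullet> weak_grad \<Omega> (nodal_basis \<Omega> (mesh n) j) x))
     = (\<Sum>xs\<in>sub T n. \<Sum>i\<in>set xs. \<Sum>j\<in>set xs. a T i j * b xs i j)" if T: "T \<in> \<T>" for T
  proof -
    have "(\<Sum>i\<in>?N. \<Sum>j\<in>?N. a T i j * (LINT x:T|lebesgue. weak_grad \<Omega> (nodal_basis \<Omega> (mesh n) i) x \<bullet> weak_grad \<Omega> (nodal_basis \<Omega> (mesh n) j) x))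
      = (\<Sum>i\<in>?N. \<Sum>j\<in>?N. \<Sum>xs\<in>sub T n. a T i j * b xs i j)"
      by (intro sum.cong refl) (simp add: macro_integral[OF T nodal_basis(1) nodal_basis(1)] sum_distrib_left b_def basis_grad_def)
    also have "\<dots> = (\<Sum>i\<in>?N. \<Sum>xs\<in>sub T n. \<Sum>j\<in>?N. a T i j * b xs i j)"
      by (intro sum.cong refl sum.swap)
    also have "\<dots> = (\<Sum>xs\<in>sub T n. \<Sum>i\<in>?N. \<Sum>j\<in>?N. a T i j * b xs i j)"
      by (rule sum.swap)
    also have "\<dots> = (\<Sum>xs\<in>sub T n. \<Sum>i\<in>set xs. \<Sum>j\<in>set xs. a T i j * b xs i j)"
    proof (rule sum.cong[OF refl])
      fix xs assume "xs \<in> sub T n"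
      then have xs: "xs \<in> mesh n" using T by (auto simp: refined_mesh_eq)
      have sub: "set xs \<subseteq> ?N" using mesh_nodes[OF xs] by blast
      have z: "b xs i j = 0" if "i \<in> ?N" "j \<in> ?N" "i \<notin> set xs \<or> j \<notin> set xs" for i j
        using that basis_grad_zero[OF _ xs] by (auto simp: b_def)
      have "(\<Sum>i\<in>?N. \<Sum>j\<in>?N. a T i j * b xs i j) = (\<Sum>i\<in>set xs. \<Sum>j\<in>?N. a T i j * b xs i j)"
        by (rule sum.mono_neutral_right[OF finN sub]) (auto intro!: sum.neutral simp: z)
      also have "\<dots> = (\<Sum>i\<in>set xs. \<Sum>j\<in>set xs. a T i j * b xs i j)"
        by (rule sum.cong[OF refl], rule sum.mono_neutral_right[OF finN sub]) (use sub in \<open>auto simp: z subset_iff\<close>)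
      finally show "(\<Sum>i\<in>?N. \<Sum>j\<in>?N. a T i j * b xs i j) = (\<Sum>i\<in>set xs. \<Sum>j\<in>set xs. a T i j * b xs i j)" .
    qed
    finally show ?thesis .
  qed
  then have "bilin_ah \<Omega> \<T> (mesh n) k v w = 1/4 * (\<Sum>T\<in>\<T>. \<Sum>xs\<in>sub T n. \<Sum>i\<in>set xs. \<Sum>j\<in>set xs. a T i j * b xs i j)"
    unfolding bilin_ah_def a_def[symmetric] by (intro arg_cong2[where f="(*)"] refl sum.cong) auto
  also have "(\<Sum>T\<in>\<T>. \<Sum>xs\<in>sub T n. \<Sum>i\<in>set xs. \<Sum>j\<in>set xs. a T i j * b xs i j)
     = (\<Sum>c\<in>cells n. \<Sum>i\<in>set (snd c). \<Sum>j\<in>set (snd c). a (fst c) i j * b (snd c) i j)"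
    unfolding cells_def by (subst sum.Sigma) (auto simp: fin finite_descend case_prod_unfold)
  finally show ?thesis by (simp add: a_def b_def)
qed

text \<open>The factor 1/2 is that of \<open>energy_edges\<close>, since each edge occurs in both
  orders. The last factor is the error of the two-point average as a quadrature for the integral of
  \<open>K T\<close> over the cell.\<close>

definition edge_error :: "nat \<Rightarrow> ((real^'d) set \<Rightarrow> real^'d \<Rightarrow> real) \<Rightarrow> (real^'d \<Rightarrow> real) \<Rightarrow> (real^'d \<Rightarrow> real) \<Rightarrow>
    (real^'d) set \<Rightarrow> (real^'d) list \<Rightarrow> real^'d \<Rightarrow> real^'d \<Rightarrow> real" where
  "edge_error n K v w T xs i j = 1/2 * ((v i - v j) * (w j - w i)) * (basis_grad n i xs \<bullet> basis_grad n j xs)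
     * ((LINT x:cell xs|lebesgue. K T x) - vol xs * ((K T i + K T j) / 2))"

lemma error_edges:
  assumes v: "v \<in> fe_space \<Omega> (mesh n)" and w: "w \<in> fe_space \<Omega> (mesh n)"
    and K: "\<And>T. T \<in> \<T> \<Longrightarrow> continuous_on T (cont_ext k T)"
    and Kk: "\<And>T. T \<in> \<T> \<Longrightarrow> AE x in lebesgue. x \<in> interior T \<longrightarrow> cont_ext k T x = k x"
  shows "bilin_a \<Omega> k v w - bilin_ah \<Omega> \<T> (mesh n) k v w =
     (\<Sum>c\<in>cells n. \<Sum>i\<in>set (snd c). \<Sum>j\<in>set (snd c). edge_error n (cont_ext k) v w (fst c) (snd c) i j)"
proof -
  let ?K = "cont_ext k"
  define I where "I c = (LINT x:cell (snd c)|lebesgue. ?K (fst c) x)" for c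
  define s where "s c i j = (v i - v j) * (w j - w i) * (basis_grad n i (snd c) \<bullet> basis_grad n j (snd c))" for c :: "(real^'d) set \<times> (real^'d) list" and i j
  have "bilin_a \<Omega> k v w = (\<Sum>c\<in>cells n. I c * (grad v (snd c) \<bullet> grad w (snd c)))"
    unfolding I_def by (rule bilin_a_cells[OF v w K Kk])
  also have "\<dots> = (\<Sum>c\<in>cells n. \<Sum>i\<in>set (snd c). \<Sum>j\<in>set (snd c). 1/2 * I c * s c i j)"
  proof (rule sum.cong[OF refl])
    fix c assume "c \<in> cells n"
    then have xs: "snd c \<in> mesh n" using cellsD[of "fst c" "snd c"] by simp
    have "(\<Sum>i\<in>set (snd c). \<Sum>j\<in>set (snd c). 1/2 * I c * s c i j) = 1/2 * I c * (\<Sum>i\<in>set (snd c). \<Sum>j\<in>set (snd c). s c i j)"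
      by (simp only: sum_distrib_left)
    also have "\<dots> = I c * (grad v (snd c) \<bullet> grad w (snd c))"
      unfolding s_def energy_edges[OF v w xs] by simp
    finally show "I c * (grad v (snd c) \<bullet> grad w (snd c)) = (\<Sum>i\<in>set (snd c). \<Sum>j\<in>set (snd c). 1/2 * I c * s c i j)" ..
  qed
  finally have a: "bilin_a \<Omega> k v w = (\<Sum>c\<in>cells n. \<Sum>i\<in>set (snd c). \<Sum>j\<in>set (snd c). 1/2 * I c * s c i j)" .
  have ah: "bilin_ah \<Omega> \<T> (mesh n) k v w = (\<Sum>c\<in>cells n. \<Sum>i\<in>set (snd c). \<Sum>j\<in>set (snd c).
      1/4 * ((?K (fst c) i + ?K (fst c) j) * (v i - v j) * (w j - w i) * (vol (snd c) * (basis_grad n i (snd c) \<bullet> basis_grad n j (snd c)))))"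
    unfolding bilin_ah_cells[OF v w] by (simp only: sum_distrib_left)
  show ?thesis
    unfolding a ah sum_subtractf[symmetric]
    by (intro sum.cong refl) (simp add: edge_error_def s_def I_def field_simps)
qed

lemma cell_integral_bound:
  assumes "continuous_on (cell xs) f" "\<And>x. x \<in> cell xs \<Longrightarrow> \<bar>f x\<bar> \<le> M"
  shows "\<bar>LINT x:cell xs|lebesgue. f x\<bar> \<le> vol xs * M"
proof -
  have i: "set_integrable lebesgue (cell xs) f" by (rule set_integrable_continuous_compact[OF cell_closed(1) assms(1)])
  have "\<bar>LINT x:cell xs|lebesgue. f x\<bar> \<le> (LINT x:cell xs|lebesgue. \<bar>f x\<bar>)"
    using set_integral_norm_bound[OF i] by simp
  also have "\<dots> \<le> (LINT x:cell xs|lebesgue. M)"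
    by (rule set_integral_mono) (use i cell_const(1) assms(2) set_integrable_abs in auto)
  finally show ?thesis by (simp add: cell_const(2))
qed

lemma cell_integral_diff:
  assumes "continuous_on (cell xs) f"
  shows "(LINT x:cell xs|lebesgue. f x - \<kappa>) = (LINT x:cell xs|lebesgue. f x) - vol xs * \<kappa>"
  using set_integral_diff(2)[OF set_integrable_continuous_compact[OF cell_closed(1) assms] cell_const(1)[of xs \<kappa>]]
  by (simp add: cell_const(2))

text \<open>Reflection carries the cell to another cell of the same macro element and exchanges
  \<open>p\<close> with \<open>q\<close>. It reverses gradients and swaps their nodes, so the
  product of the two basis gradients is unchanged.\<close>

lemma reflected_cell:
  fixes f :: "real^'d \<Rightarrow> real"
  assumes c: "(T, xs) \<in> cells n" and pq: "p \<in> set xs" "q \<in> set xs" and mid: "midpoint p q \<in> interior T"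
  defines "ys \<equiv> rev (map (\<lambda>x. p + q - x) xs)"
  shows "(T, ys) \<in> cells n" "p \<in> set ys" "q \<in> set ys" "x \<in> cell ys \<longleftrightarrow> p + q - x \<in> cell xs" "vol ys = vol xs"
    "basis_grad n p ys = - basis_grad n q xs" "basis_grad n q ys = - basis_grad n p xs"
    "continuous_on (cell ys) f \<Longrightarrow> (LINT x:cell ys|lebesgue. f x) = (LINT x:cell xs|lebesgue. f (p + q - x))"
proof -
  have T: "T \<in> \<T>" by (rule cell_kuhn(2)[OF c])
  interpret F: kuhn_frame d "X T" "E T" "B T" by (rule frame[OF T])
  have "ys \<in> sub T n"
    using F.descend_reflect[of xs n p q] c pq mid frame_root[OF T] T_eq[OF T] by (simp add: ys_def cells_def)
  then show ys: "(T, ys) \<in> cells n" using T by (simp add: cells_def)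
  have xsM: "xs \<in> mesh n" and ysM: "ys \<in> mesh n" using cell_kuhn(4)[OF c] cell_kuhn(4)[OF ys] by auto
  have set_ys: "set ys = (\<lambda>x. p + q - x) ` set xs" by (simp add: ys_def)
  show py: "p \<in> set ys" and qy: "q \<in> set ys" unfolding set_ys using pq by (auto intro: image_eqI[of _ _ q] image_eqI[of _ _ p])
  have hull: "cell ys = (\<lambda>x. p + q - x) ` cell xs"
  proof -
    have "(\<lambda>x. (p + q) + x) ` ((\<lambda>x. (-1) *\<^sub>R x) ` (cell xs)) = convex hull ((\<lambda>x. (p + q) + x) ` ((\<lambda>x. (-1) *\<^sub>R x) ` set xs))"
      by (simp only: convex_hull_translation convex_hull_scaling)
    then show ?thesis by (simp add: set_ys image_image)
  qed
  show mem: "x \<in> cell ys \<longleftrightarrow> p + q - x \<in> cell xs" for x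
    unfolding hull by (auto intro: image_eqI[of _ _ "p + q - x"])
  have refl_int: "(LINT x:cell ys|lebesgue. f x) = (LINT x:cell xs|lebesgue. f (p + q - x))" if f: "continuous_on (cell ys) f" for f :: "real^'d \<Rightarrow> real"
  proof -
    have i: "integrable lebesgue (\<lambda>x. indicator (cell ys) x *\<^sub>R f x)"
      using set_integrable_continuous_compact[OF cell_closed(1) f] by (simp add: set_integrable_def)
    have 1: "(\<integral>x. indicator (cell ys) (p + q + (-1) *\<^sub>R x) *\<^sub>R f (p + q + (-1) *\<^sub>R x) \<partial>lebesgue) = (\<integral>x. indicator (cell ys) x *\<^sub>R f x \<partial>lebesgue)"
      by (rule integral_lebesgue_pm_one[OF _ i]) simp
    have eq: "indicator (cell ys) (p + q + (-1) *\<^sub>R x) *\<^sub>R f (p + q + (-1) *\<^sub>R x) = indicator (cell xs) x *\<^sub>R f (p + q - x)" for x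
      using mem[of "p + q - x"] by (simp add: indicator_def)
    show ?thesis using 1 unfolding set_lebesgue_integral_def eq by (rule sym)
  qed
  then show "continuous_on (cell ys) f \<Longrightarrow> (LINT x:cell ys|lebesgue. f x) = (LINT x:cell xs|lebesgue. f (p + q - x))" .
  show "vol ys = vol xs"
    using refl_int[of "\<lambda>_. 1"] by (simp add: cell_const(2))
  \<comment> \<open>The vector a - b is the difference of the reflected vertices taken in opposite
    order, which accounts for the sign.\<close>
  have bg: "basis_grad n p' ys = - basis_grad n q' xs" if pq': "p' \<in> set xs" "q' \<in> set xs" "p' + q' = p + q" for p' q'
  proof (rule vertices_separate[OF xsM])
    fix a b assume ab: "a \<in> set xs" "b \<in> set xs"
    have q'y: "p' \<in> set ys" unfolding set_ys using pq' by (auto intro!: image_eqI[of _ _ q'] simp: algebra_simps)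
    have "basis_grad n p' ys \<bullet> ((p + q - b) - (p + q - a)) = of_bool (p + q - b = p') - of_bool (p + q - a = p')"
    proof (rule basis_grad_diff[OF mesh_nodes[OF ysM q'y] ysM])
      show "p + q - b \<in> set ys" unfolding set_ys by (rule imageI[OF ab(2)])
      show "p + q - a \<in> set ys" unfolding set_ys by (rule imageI[OF ab(1)])
    qed
    also have "\<dots> = of_bool (b = q') - of_bool (a = q')"
    proof -
      have "p + q - z = p' \<longleftrightarrow> z = q'" for z
        unfolding pq'(3)[symmetric] diff_eq_eq add_left_cancel by (rule eq_commute)
      then show ?thesis by simp
    qed
    also have "\<dots> = - basis_grad n q' xs \<bullet> (a - b)"
      using basis_grad_diff[OF mesh_nodes[OF xsM pq'(2)] xsM ab] by simp
    finally show "basis_grad n p' ys \<bullet> (a - b) = - basis_grad n q' xs \<bullet> (a - b)" by simp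
  qed
  show "basis_grad n p ys = - basis_grad n q xs" by (rule bg[OF pq refl])
  show "basis_grad n q ys = - basis_grad n p xs" by (rule bg[OF pq(2,1) add.commute])
qed

end

lemma abs_diff_mean_le: "\<bar>x - a\<bar> \<le> D \<Longrightarrow> \<bar>x - b\<bar> \<le> D \<Longrightarrow> \<bar>x - (a + b) / 2\<bar> \<le> D"
  for x a b D :: real
  by (simp add: abs_le_iff field_simps)

lemma interior_simplex_nonempty:
  fixes T :: "(real^'d) set"
  assumes "int CARD('d) simplex T"
  shows "interior T \<noteq> {}"
proof -
  have c: "convex T" using assms by (rule convex_simplex)
  have ad: "aff_dim T = int DIM(real^'d)" using aff_dim_simplex[OF assms] by simp
  then have "affine hull T = UNIV" using aff_dim_eq_full by blast
  then have "rel_interior T = interior T" by (rule rel_interior_interior)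
  moreover have "T \<noteq> {}" using ad by auto
  ultimately show ?thesis using rel_interior_eq_empty[OF c] by simp
qed

lemma negligible_hull_small:
  fixes W :: "(real^'d) set"
  assumes "finite W" "card W \<le> CARD('d)"
  shows "negligible (convex hull W)"
proof -
  have "aff_dim (convex hull W) \<le> int (card W) - 1" using aff_dim_le_card[OF assms(1)] by (simp add: aff_dim_convex_hull)
  then have "aff_dim (convex hull W) \<noteq> int DIM(real^'d)" using assms(2) by simp
  then have "interior (convex hull W) = {}" using aff_dim_nonempty_interior by blast
  then show ?thesis using negligible_convex_interior convex_convex_hull by blast
qed

context macro_mesh
begin

section \<open>Counting vertex pairs and summing cell energies\<close>

text \<open>A cell has at most four vertices, hence at most 16 ordered pairs; this is the origin of
  the number 16 in the estimates.\<close>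

lemma card_cell: "(T, xs) \<in> cells n \<Longrightarrow> card (set xs \<times> set xs) \<le> 16"
proof -
  assume c: "(T, xs) \<in> cells n"
  interpret F: kuhn_frame d "X T" "E T" "B T" by (rule frame[OF cell_kuhn(2)[OF c]])
  obtain y \<pi> where "xs = F.kuhn (2 ^ n) y \<pi>" "is_perm d \<pi>" using cell_kuhn(1)[OF c] by (auto simp: F.kuhn_lists_def)
  then have "length xs = Suc d" by (simp add: F.kuhn_def is_perm_length)
  then have "card (set xs) \<le> 4" using card_length[of xs] F.d by auto
  then have "card (set xs) * card (set xs) \<le> 4 * 4" by (intro mult_mono) auto
  then show ?thesis by (simp add: card_cartesian_product)
qed

lemma sum_pairs_le:
  assumes "(T, xs) \<in> cells n" "A \<subseteq> set xs \<times> set xs" "0 \<le> (a::real)"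
  shows "(\<Sum>z\<in>A. a) \<le> 16 * a"
proof -
  have "card A \<le> 16" using card_cell[OF assms(1)] card_mono[OF _ assms(2)] by simp
  then show ?thesis using assms(3) by (simp add: mult_right_mono)
qed

definition energy :: "(real^'d \<Rightarrow> real) \<Rightarrow> (real^'d \<Rightarrow> real) \<Rightarrow> (real^'d) list \<Rightarrow> real" where
  "energy v w xs = vol xs * (norm (grad v xs) * norm (grad w xs))"

lemma energy_nonneg: "0 \<le> energy v w xs"
  by (simp add: energy_def vol_nonneg)

text \<open>The weight \<open>vol\<close> is split into square roots, one for each factor, before
  the discrete Cauchy-Schwarz inequality.\<close>

lemma energy_cauchy_schwarz:
  assumes "finite J"
  shows "(\<Sum>c\<in>J. energy v w (snd c)) \<le> sqrt (\<Sum>c\<in>J. vol (snd c) * (norm (grad v (snd c)))\<^sup>2) * sqrt (\<Sum>c\<in>J. vol (snd c) * (norm (grad w (snd c)))\<^sup>2)"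
proof -
  have "(\<Sum>c\<in>J. energy v w (snd c)) = (\<Sum>c\<in>J. \<bar>sqrt (vol (snd c)) * norm (grad v (snd c))\<bar> * \<bar>sqrt (vol (snd c)) * norm (grad w (snd c))\<bar>)"
  proof (rule sum.cong[OF refl])
    fix c
    have "sqrt (vol (snd c)) * sqrt (vol (snd c)) = vol (snd c)" using vol_nonneg by simp
    then show "energy v w (snd c) = \<bar>sqrt (vol (snd c)) * norm (grad v (snd c))\<bar> * \<bar>sqrt (vol (snd c)) * norm (grad w (snd c))\<bar>"
      by (simp add: energy_def abs_mult vol_nonneg)
  qed
  also have "\<dots> \<le> L2_set (\<lambda>c. sqrt (vol (snd c)) * norm (grad v (snd c))) J * L2_set (\<lambda>c. sqrt (vol (snd c)) * norm (grad w (snd c))) J"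
    by (rule L2_set_mult_ineq)
  finally show ?thesis
    by (simp add: L2_set_def power_mult_distrib vol_nonneg)
qed

text \<open>Pairing each cell of the layer with a macro element lets norms over the layer be split
  like those over \<Omega>.\<close>

lemma boundary_layer_cells:
  "boundary_layer \<T> (mesh n) = (\<Union>c\<in>{c \<in> cells n. \<exists>T\<in>\<T>. frontier (cell (snd c)) \<inter> frontier T \<noteq> {}}. cell (snd c))"
proof (rule set_eqI, rule iffI)
  fix x assume "x \<in> boundary_layer \<T> (mesh n)"
  then obtain T xs where "T \<in> \<T>" "xs \<in> mesh n" "frontier (cell xs) \<inter> frontier T \<noteq> {}" "x \<in> cell xs"
    unfolding boundary_layer_def elements_def by blast
  moreover obtain T' where "(T', xs) \<in> cells n" using mesh_cells[OF \<open>xs \<in> mesh n\<close>] by blast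
  ultimately show "x \<in> (\<Union>c\<in>{c \<in> cells n. \<exists>T\<in>\<T>. frontier (cell (snd c)) \<inter> frontier T \<noteq> {}}. cell (snd c))"
    by (intro UN_I[of "(T', xs)"]) auto
next
  fix x assume "x \<in> (\<Union>c\<in>{c \<in> cells n. \<exists>T\<in>\<T>. frontier (cell (snd c)) \<inter> frontier T \<noteq> {}}. cell (snd c))"
  then obtain c T where c: "c \<in> cells n" "T \<in> \<T>" "frontier (cell (snd c)) \<inter> frontier T \<noteq> {}" "x \<in> cell (snd c)" by blast
  have "snd c \<in> mesh n" using cellsD[of "fst c" "snd c" n] c(1) by simp
  then show "x \<in> boundary_layer \<T> (mesh n)"
    unfolding boundary_layer_def elements_def using c by blast
qed

section \<open>Estimates on a fixed refinement level\<close>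

context
  fixes n :: nat and K :: "(real^'d) set \<Rightarrow> real^'d \<Rightarrow> real" and G S c \<beta> :: real and v w :: "real^'d \<Rightarrow> real"
  assumes K: "\<And>T. T \<in> \<T> \<Longrightarrow> continuous_on T (K T)"
    and K_lip: "\<And>T x y. T \<in> \<T> \<Longrightarrow> x \<in> T \<Longrightarrow> y \<in> T \<Longrightarrow> \<bar>K T x - K T y\<bar> \<le> G * norm (x - y)"
    and K_second: "\<And>T m a. T \<in> \<T> \<Longrightarrow> m \<in> T \<Longrightarrow> m + a \<in> T \<Longrightarrow> m - a \<in> T \<Longrightarrow> \<bar>K T (m + a) + K T (m - a) - 2 * K T m\<bar> \<le> 2 * S * (norm a)\<^sup>2"
    and pos: "0 \<le> G" "0 \<le> S" "0 \<le> c" "0 \<le> \<beta>"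
    and c: "\<And>T. T \<in> \<T> \<Longrightarrow> 2 * (\<Sum>j=1..d. norm (E T j)) \<le> c"
    and \<beta>: "\<And>T. T \<in> \<T> \<Longrightarrow> (\<Sum>j=1..d. norm (B T j)) \<le> \<beta>"
    and v: "v \<in> fe_space \<Omega> (mesh n)" and w: "w \<in> fe_space \<Omega> (mesh n)"
begin

abbreviation "N \<equiv> (2::real) ^ n"

lemma diameter:
  assumes "(T, xs) \<in> cells n" "p \<in> cell xs" "q \<in> cell xs"
  shows "norm (p - q) \<le> c / N"
proof -
  have T: "T \<in> \<T>" by (rule cell_kuhn(2)[OF assms(1)])
  interpret F: kuhn_frame d "X T" "E T" "B T" by (rule frame[OF T])
  have "norm (p - q) \<le> 2 * (\<Sum>j=1..d. norm (E T j)) / N"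
    using F.kuhn_diameter[OF _ cell_kuhn(1)[OF assms(1)] assms(2,3)] by simp
  also have "\<dots> \<le> c / N" using c[OF T] by (rule divide_right_mono) simp
  finally show ?thesis .
qed

lemma basis_grad_bound:
  assumes "(T, xs) \<in> cells n" "i \<in> set xs"
  shows "norm (basis_grad n i xs) \<le> N * \<beta>"
proof -
  have T: "T \<in> \<T>" and xs: "xs \<in> mesh n" using cell_kuhn[OF assms(1)] by auto
  have "norm (basis_grad n i xs) \<le> 1 * N * (\<Sum>j=1..d. norm (B T j))"
    by (rule gradient_bound[OF assms(1)]) (use basis_grad_diff[OF mesh_nodes[OF xs assms(2)] xs] in \<open>auto simp: of_bool_def\<close>)
  also have "\<dots> \<le> 1 * N * \<beta>" using \<beta>[OF T] by (intro mult_left_mono) auto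
  finally show ?thesis by simp
qed

text \<open>The two nodal differences contribute (c / N)^2 and the two basis gradients (N
  \<beta>)^2, so \<open>N\<close> cancels and all smallness has to come from the quadrature
  error.\<close>

lemma edge_factor_bound:
  assumes cl: "(T, xs) \<in> cells n" and ij: "i \<in> set xs" "j \<in> set xs"
  shows "\<bar>(v i - v j) * (w j - w i) * (basis_grad n i xs \<bullet> basis_grad n j xs)\<bar>
    \<le> c\<^sup>2 * \<beta>\<^sup>2 * (norm (grad v xs) * norm (grad w xs))"
proof -
  have xs: "xs \<in> mesh n" by (rule cell_kuhn(4)[OF cl])
  have diff: "\<bar>u p - u q\<bar> \<le> norm (grad u xs) * (c / N)"
    if u: "u \<in> fe_space \<Omega> (mesh n)" and pq: "p \<in> set xs" "q \<in> set xs" for u p q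
  proof -
    have pq': "p \<in> cell xs" "q \<in> cell xs" using pq by (simp_all add: hull_inc)
    have "\<bar>u p - u q\<bar> \<le> norm (grad u xs) * norm (p - q)"
      unfolding grad_diff[OF u xs pq'] by (rule Cauchy_Schwarz_ineq2)
    also have "\<dots> \<le> norm (grad u xs) * (c / N)" by (intro mult_left_mono diameter[OF cl pq']) simp
    finally show ?thesis .
  qed
  have g: "\<bar>basis_grad n i xs \<bullet> basis_grad n j xs\<bar> \<le> (N * \<beta>) * (N * \<beta>)"
    by (rule order_trans[OF Cauchy_Schwarz_ineq2]) (intro mult_mono basis_grad_bound[OF cl] ij, use pos in auto)
  have "\<bar>v i - v j\<bar> * \<bar>w j - w i\<bar> * \<bar>basis_grad n i xs \<bullet> basis_grad n j xs\<bar>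
     \<le> (norm (grad v xs) * (c / N)) * (norm (grad w xs) * (c / N)) * ((N * \<beta>) * (N * \<beta>))"
    by (intro mult_mono diff[OF v] diff[OF w] g ij) (use pos in auto)
  also have "\<dots> = c\<^sup>2 * \<beta>\<^sup>2 * (norm (grad v xs) * norm (grad w xs))"
    by (simp add: power2_eq_square)
  finally show ?thesis by (simp only: abs_mult)
qed

text \<open>One further factor c / N comes from the oscillation of \<open>K T\<close> over the cell,
  which is at most G c / N.\<close>

lemma edge_error_bound:
  assumes cl: "(T, xs) \<in> cells n" and ij: "i \<in> set xs" "j \<in> set xs"
  shows "\<bar>edge_error n K v w T xs i j\<bar> \<le> 1/2 * c ^ 3 * \<beta>\<^sup>2 * G / N * energy v w xs"
proof -
  have T: "T \<in> \<T>" "cell xs \<subseteq> T" using cell_kuhn[OF cl] by auto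
  have cont: "continuous_on (cell xs) (K T)" using continuous_on_subset[OF K[OF T(1)] T(2)] .
  have ij': "i \<in> cell xs" "j \<in> cell xs" using ij by (simp_all add: hull_inc)
  have "\<bar>(LINT x:cell xs|lebesgue. K T x) - vol xs * ((K T i + K T j) / 2)\<bar> \<le> vol xs * (G * (c / N))"
    unfolding cell_integral_diff[OF cont, symmetric]
  proof (rule cell_integral_bound)
    fix x assume x: "x \<in> cell xs"
    have *: "\<bar>K T x - K T p\<bar> \<le> G * (c / N)" if p: "p \<in> cell xs" for p
      using K_lip[OF T(1), of x p] x p T(2) mult_left_mono[OF diameter[OF cl x p] pos(1)] by force
    show "\<bar>K T x - (K T i + K T j) / 2\<bar> \<le> G * (c / N)"
      by (rule abs_diff_mean_le[OF *[OF ij'(1)] *[OF ij'(2)]])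
  qed (intro continuous_intros cont)
  then have "1/2 * \<bar>(v i - v j) * (w j - w i) * (basis_grad n i xs \<bullet> basis_grad n j xs)\<bar>
      * \<bar>(LINT x:cell xs|lebesgue. K T x) - vol xs * ((K T i + K T j) / 2)\<bar>
    \<le> 1/2 * (c\<^sup>2 * \<beta>\<^sup>2 * (norm (grad v xs) * norm (grad w xs))) * (vol xs * (G * (c / N)))"
    by (intro mult_mono edge_factor_bound[OF cl ij]) (use pos in auto)
  also have "\<dots> = 1/2 * c ^ 3 * \<beta>\<^sup>2 * G / N * energy v w xs"
    by (simp add: energy_def power3_eq_cube power2_eq_square)
  finally show ?thesis by (simp add: edge_error_def abs_mult)
qed

text \<open>Point reflection at the midpoint of an interior edge maps the mesh of the macro element to
  itself, so that the first-order parts of the two errors cancel.\<close>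

lemma edge_error_reflected:
  assumes cl: "(T, xs) \<in> cells n" and ij: "i \<in> set xs" "j \<in> set xs" and mid: "midpoint i j \<in> interior T"
  shows "\<bar>edge_error n K v w T xs i j + edge_error n K v w T (rev (map (\<lambda>x. i + j - x) xs)) j i\<bar>
    \<le> 2 * c ^ 4 * \<beta>\<^sup>2 * S / N\<^sup>2 * energy v w xs"
proof -
  define ys where "ys = rev (map (\<lambda>x. i + j - x) xs)"
  note r = reflected_cell[OF cl ij mid, folded ys_def]
  have T: "T \<in> \<T>" "cell xs \<subseteq> T" using cell_kuhn[OF cl] by auto
  have Ty: "cell ys \<subseteq> T" using cell_kuhn[OF r(1)] by auto
  have cont: "continuous_on (cell xs) (K T)" using continuous_on_subset[OF K[OF T(1)] T(2)] .
  have conty: "continuous_on (cell ys) (K T)" using continuous_on_subset[OF K[OF T(1)] Ty] .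
  have cont': "continuous_on (cell xs) (\<lambda>x. K T (i + j - x))"
  proof (rule continuous_on_compose2[OF conty])
    show "continuous_on (cell xs) (\<lambda>x. i + j - x)" by (intro continuous_intros)
    show "(\<lambda>x. i + j - x) ` cell xs \<subseteq> cell ys"
    proof (rule image_subsetI)
      fix x assume "x \<in> cell xs"
      then show "i + j - x \<in> cell ys" unfolding r(4) by simp
    qed
  qed
  have ij': "i \<in> cell xs" "j \<in> cell xs" using ij by (simp_all add: hull_inc)
  define m where "m = midpoint i j"
  have m: "m \<in> cell xs"
    using closed_segment_subset_convex_hull[OF ij'] midpoint_in_closed_segment by (auto simp: m_def)
  have mm: "i + j = m + m" by (simp add: m_def midpoint_def scaleR_right_distrib[symmetric] scaleR_2[symmetric])
  have sec: "\<bar>K T x + K T (i + j - x) - 2 * K T m\<bar> \<le> 2 * S * (c / N)\<^sup>2" if x: "x \<in> cell xs" for x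
  proof -
    have "i + j - x \<in> cell ys" using r(4)[of "i + j - x"] x by simp
    then have "\<bar>K T (m + (x - m)) + K T (m - (x - m)) - 2 * K T m\<bar> \<le> 2 * S * (norm (x - m))\<^sup>2"
      using x m T Ty by (intro K_second[OF T(1)]) (auto simp: mm algebra_simps)
    also have "\<dots> \<le> 2 * S * (c / N)\<^sup>2"
      using pos by (intro mult_left_mono power_mono diameter[OF cl x m]) auto
    finally show ?thesis by (simp add: mm algebra_simps)
  qed
  \<comment> \<open>Both K x + K (i + j - x) and K i + K j are compared with 2 K m, where
    \<open>m\<close> is the midpoint; this doubles the constant 2 S.\<close>
  have "\<bar>LINT x:cell xs|lebesgue. (K T x + K T (i + j - x)) - (K T i + K T j)\<bar> \<le> vol xs * (4 * S * (c / N)\<^sup>2)"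
  proof (rule cell_integral_bound)
    fix x assume x: "x \<in> cell xs"
    show "\<bar>(K T x + K T (i + j - x)) - (K T i + K T j)\<bar> \<le> 4 * S * (c / N)\<^sup>2"
    proof -
      have "i + j - i = j" by simp
      then show ?thesis using sec[OF x] sec[OF ij'(1)] by (simp only:)
    qed
  qed (intro continuous_intros cont cont')
  also have "(LINT x:cell xs|lebesgue. (K T x + K T (i + j - x)) - (K T i + K T j))
     = (LINT x:cell xs|lebesgue. K T x) + (LINT x:cell ys|lebesgue. K T x) - vol xs * (K T i + K T j)"
    unfolding cell_integral_diff[OF continuous_on_add[OF cont cont']] r(8)[OF conty]
    using set_integral_add(2)[OF set_integrable_continuous_compact[OF cell_closed(1) cont] set_integrable_continuous_compact[OF cell_closed(1) cont']]
    by simp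
  finally have D: "\<bar>(LINT x:cell xs|lebesgue. K T x) + (LINT x:cell ys|lebesgue. K T x) - vol xs * (K T i + K T j)\<bar> \<le> vol xs * (4 * S * (c / N)\<^sup>2)" .
  \<comment> \<open>Volume, nodal differences and product of gradients agree for both cells, so they
    factor out of the sum of the two quadrature errors.\<close>
  have "edge_error n K v w T xs i j + edge_error n K v w T ys j i =
    1/2 * ((v i - v j) * (w j - w i) * (basis_grad n i xs \<bullet> basis_grad n j xs))
     * ((LINT x:cell xs|lebesgue. K T x) + (LINT x:cell ys|lebesgue. K T x) - vol xs * (K T i + K T j))"
    unfolding edge_error_def r(5-7) by (simp add: inner_commute[of "basis_grad n j xs"] field_simps)
  also have "\<bar>\<dots>\<bar> = 1/2 * \<bar>(v i - v j) * (w j - w i) * (basis_grad n i xs \<bullet> basis_grad n j xs)\<bar>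
     * \<bar>(LINT x:cell xs|lebesgue. K T x) + (LINT x:cell ys|lebesgue. K T x) - vol xs * (K T i + K T j)\<bar>"
    by (simp add: abs_mult)
  also have "\<dots> \<le> 1/2 * (c\<^sup>2 * \<beta>\<^sup>2 * (norm (grad v xs) * norm (grad w xs))) * (vol xs * (4 * S * (c / N)\<^sup>2))"
    by (intro mult_mono edge_factor_bound[OF cl ij] D) (use pos in auto)
  also have "\<dots> = 2 * c ^ 4 * \<beta>\<^sup>2 * S / N\<^sup>2 * energy v w xs"
    by (simp add: energy_def power4_eq_xxxx power2_eq_square)
  finally show ?thesis unfolding ys_def .
qed

definition edges :: "(real^'d) set \<Rightarrow> ((real^'d) list \<times> (real^'d) \<times> (real^'d)) set" where
  "edges T = Sigma (sub T n) (\<lambda>xs. set xs \<times> set xs)"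

lemma sum_edges:
  "(\<Sum>cl\<in>cells n. \<Sum>i\<in>set (snd cl). \<Sum>j\<in>set (snd cl). f (fst cl) (snd cl) i j) =
   (\<Sum>T\<in>\<T>. \<Sum>(xs, i, j)\<in>edges T. f T xs i j)" for f :: "_ \<Rightarrow> _ \<Rightarrow> _ \<Rightarrow> _ \<Rightarrow> real"
proof -
  have "(\<Sum>cl\<in>cells n. \<Sum>i\<in>set (snd cl). \<Sum>j\<in>set (snd cl). f (fst cl) (snd cl) i j)
    = (\<Sum>T\<in>\<T>. \<Sum>xs\<in>sub T n. \<Sum>i\<in>set xs. \<Sum>j\<in>set xs. f T xs i j)"
    unfolding cells_def by (subst sum.Sigma) (auto simp: fin finite_descend case_prod_unfold)
  also have "\<dots> = (\<Sum>T\<in>\<T>. \<Sum>xs\<in>sub T n. \<Sum>z\<in>set xs \<times> set xs. f T xs (fst z) (snd z))"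
    by (simp add: sum.cartesian_product case_prod_unfold)
  also have "\<dots> = (\<Sum>T\<in>\<T>. \<Sum>(xs, z)\<in>edges T. f T xs (fst z) (snd z))"
    unfolding edges_def by (intro sum.cong refl, subst sum.Sigma) (auto simp: finite_descend)
  finally show ?thesis by (simp add: case_prod_unfold)
qed

lemma finite_edges: "finite (edges T)"
  unfolding edges_def by (intro finite_SigmaI finite_descend) auto

text \<open>The bound depends on the cell only, so each cell of \<open>J\<close> is counted at most
  16 times.\<close>

lemma sum_edges_le:
  assumes T: "T \<in> \<T>" and A: "A \<subseteq> edges T" and J: "\<And>z. z \<in> A \<Longrightarrow> fst z \<in> J" "J \<subseteq> sub T n" and a: "0 \<le> a"
  shows "(\<Sum>z\<in>A. a * energy v w (fst z)) \<le> 16 * a * (\<Sum>xs\<in>J. energy v w xs)"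
proof -
  have finJ: "finite J" using J(2) finite_descend finite_subset by blast
  have A': "A \<subseteq> Sigma J (\<lambda>xs. set xs \<times> set xs)" using A J(1) by (force simp: edges_def)
  have "(\<Sum>z\<in>A. a * energy v w (fst z)) \<le> (\<Sum>z\<in>Sigma J (\<lambda>xs. set xs \<times> set xs). a * energy v w (fst z))"
    by (rule sum_mono2[OF _ A']) (use finJ a energy_nonneg in auto)
  also have "\<dots> = (\<Sum>xs\<in>J. \<Sum>z\<in>set xs \<times> set xs. a * energy v w xs)"
    by (subst sum.Sigma) (auto simp: finJ case_prod_unfold)
  also have "\<dots> \<le> (\<Sum>xs\<in>J. 16 * (a * energy v w xs))"
    by (rule sum_mono, rule sum_pairs_le[of T _ n]) (use J(2) T a energy_nonneg in \<open>auto simp: cells_def\<close>)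
  finally show ?thesis by (simp add: sum_distrib_left mult.assoc)
qed

lemma edges_cell: "T \<in> \<T> \<Longrightarrow> (xs, i, j) \<in> edges T \<Longrightarrow> (T, xs) \<in> cells n \<and> i \<in> set xs \<and> j \<in> set xs"
  by (auto simp: edges_def cells_def)

text \<open>Reflection at the midpoint, with the two ends exchanged, is an involution of
  \<open>Q\<close>. Twice the sum therefore pairs every error with its reflected one, and
  \<open>edge_error_reflected\<close> applies to each pair.\<close>

lemma interior_edges_bound:
  assumes T: "T \<in> \<T>"
  defines "Q \<equiv> {(xs, i, j) \<in> edges T. midpoint i j \<in> interior T}"
  shows "\<bar>\<Sum>(xs, i, j)\<in>Q. edge_error n K v w T xs i j\<bar> \<le> 16 * (c ^ 4 * \<beta>\<^sup>2 * S / N\<^sup>2) * (\<Sum>xs\<in>sub T n. energy v w xs)"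
proof -
  let ?\<rho> = "\<lambda>(xs, i, j). (rev (map (\<lambda>x. i + j - x) xs), j, i) :: (real^'d) list \<times> (real^'d) \<times> (real^'d)"
  let ?f = "\<lambda>(xs, i, j). edge_error n K v w T xs i j"
  have \<rho>Q: "?\<rho> z \<in> Q" if "z \<in> Q" for z
  proof -
    obtain xs i j where z: "z = (xs, i, j)" by (cases z)
    have zz: "(T, xs) \<in> cells n" "i \<in> set xs" "j \<in> set xs" "midpoint i j \<in> interior T"
      using that edges_cell[OF T, of xs i j] by (auto simp: Q_def z)
    note r = reflected_cell(1-3)[OF zz]
    show ?thesis
      using r zz(4) by (simp add: z Q_def edges_def cells_def midpoint_sym)
  qed
  have \<rho>\<rho>: "?\<rho> (?\<rho> z) = z" for z
    by (cases z) (simp add: rev_map[symmetric] o_def add.commute)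
  have bij: "bij_betw ?\<rho> Q Q"
    by (rule bij_betw_byWitness[where f'="?\<rho>"]) (use \<rho>Q \<rho>\<rho> in blast)+
  have finQ: "finite Q" using finite_edges by (rule finite_subset[rotated]) (auto simp: Q_def)
  have "(\<Sum>z\<in>Q. ?f z) = (\<Sum>z\<in>Q. ?f (?\<rho> z))" by (rule sum.reindex_bij_betw[OF bij, symmetric])
  then have eq: "2 * (\<Sum>z\<in>Q. ?f z) = (\<Sum>z\<in>Q. ?f z + ?f (?\<rho> z))" unfolding sum.distrib by linarith
  have "\<bar>2 * (\<Sum>z\<in>Q. ?f z)\<bar> \<le> (\<Sum>z\<in>Q. \<bar>?f z + ?f (?\<rho> z)\<bar>)" unfolding eq by (rule sum_abs)
  also have "\<dots> \<le> (\<Sum>z\<in>Q. (2 * c ^ 4 * \<beta>\<^sup>2 * S / N\<^sup>2) * energy v w (fst z))"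
  proof (rule sum_mono)
    fix z assume "z \<in> Q"
    obtain xs i j where z: "z = (xs, i, j)" by (cases z)
    have zz: "(T, xs) \<in> cells n" "i \<in> set xs" "j \<in> set xs" "midpoint i j \<in> interior T"
      using \<open>z \<in> Q\<close> edges_cell[OF T, of xs i j] by (auto simp: Q_def z)
    show "\<bar>?f z + ?f (?\<rho> z)\<bar> \<le> (2 * c ^ 4 * \<beta>\<^sup>2 * S / N\<^sup>2) * energy v w (fst z)"
      using edge_error_reflected[OF zz] by (simp add: z)
  qed
  also have "\<dots> \<le> 16 * (2 * c ^ 4 * \<beta>\<^sup>2 * S / N\<^sup>2) * (\<Sum>xs\<in>sub T n. energy v w xs)"
    by (rule sum_edges_le[OF T]) (use pos in \<open>auto simp: Q_def edges_def\<close>)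
  finally show ?thesis by (simp add: abs_mult)
qed

lemma edges_bound:
  assumes T: "T \<in> \<T>" and A: "A \<subseteq> edges T" "\<And>z. z \<in> A \<Longrightarrow> fst z \<in> J" "J \<subseteq> sub T n"
  shows "\<bar>\<Sum>(xs, i, j)\<in>A. edge_error n K v w T xs i j\<bar> \<le> 8 * (c ^ 3 * \<beta>\<^sup>2 * G / N) * (\<Sum>xs\<in>J. energy v w xs)"
proof -
  let ?f = "\<lambda>(xs, i, j). edge_error n K v w T xs i j"
  have "\<bar>\<Sum>z\<in>A. ?f z\<bar> \<le> (\<Sum>z\<in>A. \<bar>?f z\<bar>)" by (rule sum_abs)
  also have "\<dots> \<le> (\<Sum>z\<in>A. (1/2 * c ^ 3 * \<beta>\<^sup>2 * G / N) * energy v w (fst z))"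
  proof (rule sum_mono)
    fix z assume "z \<in> A"
    obtain xs i j where z: "z = (xs, i, j)" by (cases z)
    have zz: "(T, xs) \<in> cells n" "i \<in> set xs" "j \<in> set xs"
      using \<open>z \<in> A\<close> edges_cell[OF T, of xs i j] A(1) by (auto simp: z)
    show "\<bar>?f z\<bar> \<le> (1/2 * c ^ 3 * \<beta>\<^sup>2 * G / N) * energy v w (fst z)"
      using edge_error_bound[OF zz] by (simp add: z)
  qed
  also have "\<dots> \<le> 16 * (1/2 * c ^ 3 * \<beta>\<^sup>2 * G / N) * (\<Sum>xs\<in>J. energy v w xs)"
    by (rule sum_edges_le[OF T A]) (use pos in auto)
  finally show ?thesis by (simp add: mult_ac)
qed

lemma total_first_order:
  "\<bar>\<Sum>cl\<in>cells n. \<Sum>i\<in>set (snd cl). \<Sum>j\<in>set (snd cl). edge_error n K v w (fst cl) (snd cl) i j\<bar>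
   \<le> 8 * (c ^ 3 * \<beta>\<^sup>2 * G / N) * (\<Sum>cl\<in>cells n. energy v w (snd cl))"
proof -
  have "\<bar>\<Sum>T\<in>\<T>. \<Sum>(xs, i, j)\<in>edges T. edge_error n K v w T xs i j\<bar> \<le> (\<Sum>T\<in>\<T>. \<bar>\<Sum>(xs, i, j)\<in>edges T. edge_error n K v w T xs i j\<bar>)"
    by (rule sum_abs)
  also have "\<dots> \<le> (\<Sum>T\<in>\<T>. 8 * (c ^ 3 * \<beta>\<^sup>2 * G / N) * (\<Sum>xs\<in>sub T n. energy v w xs))"
    by (rule sum_mono, rule edges_bound) (auto simp: edges_def)
  also have "\<dots> = 8 * (c ^ 3 * \<beta>\<^sup>2 * G / N) * (\<Sum>T\<in>\<T>. \<Sum>xs\<in>sub T n. energy v w xs)"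
    by (simp only: sum_distrib_left)
  also have "(\<Sum>T\<in>\<T>. \<Sum>xs\<in>sub T n. energy v w xs) = (\<Sum>cl\<in>cells n. energy v w (snd cl))"
    unfolding cells_def by (subst sum.Sigma) (auto simp: fin finite_descend case_prod_unfold)
  finally show ?thesis unfolding sum_edges .
qed

lemma total_second_order:
  defines "J \<equiv> {cl \<in> cells n. \<exists>T\<in>\<T>. frontier (cell (snd cl)) \<inter> frontier T \<noteq> {}}"
  shows "\<bar>\<Sum>cl\<in>cells n. \<Sum>i\<in>set (snd cl). \<Sum>j\<in>set (snd cl). edge_error n K v w (fst cl) (snd cl) i j\<bar>
   \<le> 16 * (c ^ 4 * \<beta>\<^sup>2 * S / N\<^sup>2) * (\<Sum>cl\<in>cells n. energy v w (snd cl))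
    + 8 * (c ^ 3 * \<beta>\<^sup>2 * G / N) * (\<Sum>cl\<in>J. energy v w (snd cl))"
proof -
  let ?f = "\<lambda>T. \<lambda>(xs, i, j). edge_error n K v w T xs i j"
  define Q where "Q T = {(xs, i, j) \<in> edges T. midpoint i j \<in> interior T}" for T
  define JT where "JT T = {xs \<in> sub T n. \<exists>T'\<in>\<T>. frontier (cell xs) \<inter> frontier T' \<noteq> {}}" for T
  have b: "\<bar>\<Sum>z\<in>edges T. ?f T z\<bar> \<le> 16 * (c ^ 4 * \<beta>\<^sup>2 * S / N\<^sup>2) * (\<Sum>xs\<in>sub T n. energy v w xs)
      + 8 * (c ^ 3 * \<beta>\<^sup>2 * G / N) * (\<Sum>xs\<in>JT T. energy v w xs)" if T: "T \<in> \<T>" for T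
  proof -
    have "(\<Sum>z\<in>edges T. ?f T z) = (\<Sum>z\<in>edges T - Q T. ?f T z) + (\<Sum>z\<in>Q T. ?f T z)"
      by (rule sum.subset_diff[OF _ finite_edges]) (auto simp: Q_def)
    moreover have "\<bar>\<Sum>z\<in>Q T. ?f T z\<bar> \<le> 16 * (c ^ 4 * \<beta>\<^sup>2 * S / N\<^sup>2) * (\<Sum>xs\<in>sub T n. energy v w xs)"
      unfolding Q_def by (rule interior_edges_bound[OF T])
    moreover have "\<bar>\<Sum>z\<in>edges T - Q T. ?f T z\<bar> \<le> 8 * (c ^ 3 * \<beta>\<^sup>2 * G / N) * (\<Sum>xs\<in>JT T. energy v w xs)"
    proof (rule edges_bound[OF T])
      fix z assume z: "z \<in> edges T - Q T"
      obtain xs i j where zz: "z = (xs, i, j)" by (cases z)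
      have cl: "(T, xs) \<in> cells n" "i \<in> set xs" "j \<in> set xs" "midpoint i j \<notin> interior T"
        using z edges_cell[OF T, of xs i j] by (auto simp: zz Q_def)
      have "i \<in> cell xs" "j \<in> cell xs" using cl by (simp_all add: hull_inc)
      then have m: "midpoint i j \<in> cell xs"
        using closed_segment_subset_convex_hull midpoint_in_closed_segment by blast
      have sub: "cell xs \<subseteq> T" by (rule cell_kuhn(5)[OF cl(1)])
      \<comment> \<open>The midpoint lies in the cell but is not interior to \<open>T\<close>, hence
        it is on both boundaries, and the cell meets the condition defining the boundary
        layer.\<close>
      have "midpoint i j \<in> frontier T"
        using m sub cl(4) closure_subset by (auto simp: frontier_def)
      moreover have "midpoint i j \<in> frontier (cell xs)"
        using m cl(4) interior_mono[OF sub] closure_subset by (auto simp: frontier_def)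
      ultimately show "fst z \<in> JT T" using T cl(1) by (auto simp: JT_def zz cells_def)
    qed (auto simp: JT_def)
    ultimately show ?thesis by linarith
  qed
  have "\<bar>\<Sum>T\<in>\<T>. \<Sum>z\<in>edges T. ?f T z\<bar> \<le> (\<Sum>T\<in>\<T>. \<bar>\<Sum>z\<in>edges T. ?f T z\<bar>)" by (rule sum_abs)
  also have "\<dots> \<le> (\<Sum>T\<in>\<T>. 16 * (c ^ 4 * \<beta>\<^sup>2 * S / N\<^sup>2) * (\<Sum>xs\<in>sub T n. energy v w xs)
      + 8 * (c ^ 3 * \<beta>\<^sup>2 * G / N) * (\<Sum>xs\<in>JT T. energy v w xs))"
    by (rule sum_mono) (rule b)
  also have "\<dots> = 16 * (c ^ 4 * \<beta>\<^sup>2 * S / N\<^sup>2) * (\<Sum>T\<in>\<T>. \<Sum>xs\<in>sub T n. energy v w xs)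
      + 8 * (c ^ 3 * \<beta>\<^sup>2 * G / N) * (\<Sum>T\<in>\<T>. \<Sum>xs\<in>JT T. energy v w xs)"
    by (simp only: sum_distrib_left sum.distrib)
  also have "(\<Sum>T\<in>\<T>. \<Sum>xs\<in>sub T n. energy v w xs) = (\<Sum>cl\<in>cells n. energy v w (snd cl))"
    unfolding cells_def by (subst sum.Sigma) (auto simp: fin finite_descend case_prod_unfold)
  also have "(\<Sum>T\<in>\<T>. \<Sum>xs\<in>JT T. energy v w xs) = (\<Sum>cl\<in>J. energy v w (snd cl))"
  proof -
    have "(T, xs) \<in> J \<longleftrightarrow> T \<in> \<T> \<and> xs \<in> JT T" for T xs
      by (simp add: J_def JT_def cells_def)
    then have "J = Sigma \<T> JT" by (intro set_eqI) (auto simp del: mem_Sigma_iff simp: mem_Sigma_iff)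
    then show ?thesis by (simp, subst sum.Sigma) (auto simp: fin finite_descend case_prod_unfold JT_def)
  qed
  finally show ?thesis unfolding sum_edges .
qed

end

end

section \<open>Conclusion for the given triangulation\<close>

lemma macro_mesh_exists:
  fixes \<Omega> :: "(real^'d) set"
  assumes card: "CARD('d) = 2 \<or> CARD('d) = 3" and "polyhedral_domain \<Omega>" "conforming_triangulation \<T> \<Omega>"
    and vo: "\<forall>T\<in>\<T>. vertex_ordering T (vord T)"
  shows "\<exists>X E B. macro_mesh \<Omega> \<T> vord X E B CARD('d)"
proof -
  have tri: "triangulation \<T>" and simp: "\<And>T. T \<in> \<T> \<Longrightarrow> int CARD('d) simplex T" and cover: "\<Union>\<T> = closure \<Omega>"
    using assms(3) by (auto simp: conforming_triangulation_def)
  have fin: "finite \<T>" and faces: "\<And>T T'. T \<in> \<T> \<Longrightarrow> T' \<in> \<T> \<Longrightarrow> (T \<inter> T') face_of T"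
    using tri by (auto simp: triangulation_def)
  have "\<forall>T\<in>\<T>. \<exists>F. kuhn_frame CARD('d) (fst (snd F)) (snd (snd F)) \<and> kuhn_frame.root CARD('d) (fst F) (fst (snd F)) = vord T"
  proof
    fix T assume T: "T \<in> \<T>"
    obtain x0 e b where "kuhn_frame CARD('d) (e :: nat \<Rightarrow> real^'d) b" "kuhn_frame.root CARD('d) x0 e = vord T"
      using kuhn_frame_of_simplex(1)[OF card simp[OF T]] vo T by blast
    then show "\<exists>F. kuhn_frame CARD('d) (fst (snd F)) (snd (snd F)) \<and> kuhn_frame.root CARD('d) (fst F) (fst (snd F)) = vord T"
      by (intro exI[of _ "(x0, e, b)"]) simp
  qed
  from bchoice[OF this] obtain F where F: "\<And>T. T \<in> \<T> \<Longrightarrow> kuhn_frame CARD('d) (fst (snd (F T))) (snd (snd (F T)))"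
    "\<And>T. T \<in> \<T> \<Longrightarrow> kuhn_frame.root CARD('d) (fst (F T)) (fst (snd (F T))) = vord T" by blast
  have hull: "T = convex hull (set (vord T))" "\<not> affine_dependent (set (vord T))" "card (set (vord T)) = Suc CARD('d)" if "T \<in> \<T>" for T
    using kuhn_frame_of_simplex(2-4)[OF card simp[OF that]] vo that by blast+
  have face: "\<exists>W. W \<subseteq> set (vord T) \<inter> set (vord T') \<and> T \<inter> T' = convex hull W \<and> card W \<le> CARD('d)"
    if T: "T \<in> \<T>" "T' \<in> \<T>" "T \<noteq> T'" for T T'
    by (rule simplex_intersection_vertices[OF hull(2)[OF T(1)] hull(1)[OF T(1)] hull(2)[OF T(2)] hull(1)[OF T(2)]])
       (use faces[OF T(1,2)] faces[OF T(2,1)] T(3) hull(3)[OF T(1)] hull(3)[OF T(2)] in \<open>simp_all add: Int_commute\<close>)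
  have op: "open \<Omega>" using assms(2) by (simp add: polyhedral_domain_def)
  \<comment> \<open>A finite union of polytopes is closed, so the domain equals the interior of its
    closure, that is of the union of the macro elements.\<close>
  have int: "\<Omega> = interior (\<Union>\<T>)"
  proof -
    obtain P where P: "finite P" "\<forall>p\<in>P. polytope p" "\<Omega> = interior (\<Union>P)"
      using assms(2) by (auto simp: polyhedral_domain_def)
    have "closed (\<Union>P)" using P(1,2) by (intro closed_Union) (auto intro: polytope_imp_closed)
    then have "closure \<Omega> \<subseteq> \<Union>P" unfolding P(3) by (intro closure_minimal interior_subset)
    then have "interior (closure \<Omega>) \<subseteq> \<Omega>" unfolding P(3) by (rule interior_mono)
    moreover have "\<Omega> \<subseteq> interior (closure \<Omega>)" by (rule interior_maximal[OF closure_subset op])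
    ultimately show ?thesis unfolding cover by blast
  qed
  have "macro_mesh \<Omega> \<T> vord (\<lambda>T. fst (F T)) (\<lambda>T. fst (snd (F T))) (\<lambda>T. snd (snd (F T))) CARD('d)"
  proof (rule macro_mesh.intro)
    fix T T' assume T: "T \<in> \<T>" "T' \<in> \<T>" "T \<noteq> T'"
    obtain W where W: "W \<subseteq> set (vord T) \<inter> set (vord T')" "T \<inter> T' = convex hull W" "card W \<le> CARD('d)"
      using face[OF T] by blast
    then show "\<exists>W. W \<subseteq> set (vord T) \<inter> set (vord T') \<and> T \<inter> T' = convex hull W \<and> card W \<le> 3"
      using card by (intro exI[of _ W]) auto
    have "finite W" using W(1) finite_subset by blast
    then show "negligible (T \<inter> T')" unfolding W(2) by (rule negligible_hull_small[OF _ W(3)])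
  next
    fix T assume T: "T \<in> \<T>"
    show "kuhn_frame CARD('d) (fst (snd (F T))) (snd (snd (F T)))" by (rule F(1)[OF T])
    show "kuhn_frame.root CARD('d) (fst (F T)) (fst (snd (F T))) = vord T" by (rule F(2)[OF T])
    show "T = convex hull (set (vord T))" by (rule hull(1)[OF T])
    show "interior T \<noteq> {}" by (rule interior_simplex_nonempty[OF simp[OF T]])
  next
    show "finite \<T>" by (rule fin)
    show "open \<Omega>" by (rule op)
    show "closure \<Omega> = \<Union>\<T>" by (rule cover[symmetric])
    show "\<Omega> = interior (\<Union>\<T>)" by (rule int)
  qed
  then show ?thesis by blast
qed

theorem lemma3p4:
  fixes \<Omega> :: "(real^'d) set"
    and \<T>\<^sub>H :: "(real^'d) set set"
    and vord :: "(real^'d) set \<Rightarrow> (real^'d) list"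
    and H :: real
  assumes "CARD('d) = 2 \<or> CARD('d) = 3"
    and "polyhedral_domain \<Omega>"
    and "conforming_triangulation \<T>\<^sub>H \<Omega>"
    and "\<forall>T\<in>\<T>\<^sub>H. vertex_ordering T (vord T)"
    and "H > 0"
  shows "\<exists>C :: real \<Rightarrow> real.
    \<forall>k. admissible_coefficient \<Omega> \<T>\<^sub>H k \<longrightarrow>
    (\<forall>n\<ge>1. let h = H / 2 ^ n; M = refined_mesh \<T>\<^sub>H vord n; S = boundary_layer \<T>\<^sub>H M in
      \<forall>v\<in>fe_space \<Omega> M. \<forall>w\<in>fe_space \<Omega> M.
        \<bar>bilin_a \<Omega> k v w - bilin_ah \<Omega> \<T>\<^sub>H M k v w\<bar>
          \<le> C (contrast \<Omega> k) *
            (h * broken_grad_norm \<T>\<^sub>H k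
               * L2_norm_on \<Omega> (weak_grad \<Omega> v) * L2_norm_on \<Omega> (weak_grad \<Omega> w)) \<and>
        \<bar>bilin_a \<Omega> k v w - bilin_ah \<Omega> \<T>\<^sub>H M k v w\<bar>
          \<le> C (contrast \<Omega> k) *
            (h\<^sup>2 * broken_hess_norm \<T>\<^sub>H k
               * L2_norm_on \<Omega> (weak_grad \<Omega> v) * L2_norm_on \<Omega> (weak_grad \<Omega> w)
             + h * broken_grad_norm \<T>\<^sub>H k
               * L2_norm_on S (weak_grad \<Omega> v) * L2_norm_on S (weak_grad \<Omega> w)))"
proof -
  obtain X E B where "macro_mesh \<Omega> \<T>\<^sub>H vord X E B CARD('d)"
    using macro_mesh_exists[OF assms(1-4)] by blast
  then interpret macro_mesh \<Omega> "\<T>\<^sub>H" vord X E B "CARD('d)" .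
  define c where "c = (\<Sum>T\<in>\<T>\<^sub>H. 2 * (\<Sum>j=1..CARD('d). norm (E T j)))"
  define \<beta> where "\<beta> = (\<Sum>T\<in>\<T>\<^sub>H. \<Sum>j=1..CARD('d). norm (B T j))"
  have c: "2 * (\<Sum>j=1..CARD('d). norm (E T j)) \<le> c" if "T \<in> \<T>\<^sub>H" for T
    unfolding c_def using fin that by (intro member_le_sum) (auto intro: sum_nonneg)
  have \<beta>: "(\<Sum>j=1..CARD('d). norm (B T j)) \<le> \<beta>" if "T \<in> \<T>\<^sub>H" for T
    unfolding \<beta>_def using fin that by (intro member_le_sum) (auto intro: sum_nonneg)
  have c0: "0 \<le> c" "0 \<le> \<beta>" by (auto simp: c_def \<beta>_def intro!: sum_nonneg)
  \<comment> \<open>The level factor 1 / 2^n equals h / H, which explains the divisions by H and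
    H^2.\<close>
  define A1 where "A1 = 8 * (c ^ 3 * \<beta>\<^sup>2) / H"
  define A2 where "A2 = 16 * (c ^ 4 * \<beta>\<^sup>2) / H\<^sup>2"
  have A0: "0 \<le> A1" "0 \<le> A2" using c0 assms(5) by (auto simp: A1_def A2_def)
  show ?thesis
  \<comment> \<open>\<open>A1\<close> and \<open>A2\<close> are built from the macro mesh and H, so
    a constant function of the contrast serves; their sum covers both estimates.\<close>
  proof (intro exI[of _ "\<lambda>_. A1 + A2"] allI impI)
    fix k :: "real^'d \<Rightarrow> real" and n :: nat
    assume k: "admissible_coefficient \<Omega> \<T>\<^sub>H k"
    define G where "G = broken_grad_norm \<T>\<^sub>H k"
    define S where "S = broken_hess_norm \<T>\<^sub>H k"
    define h where "h = H / 2 ^ n"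
    have h: "0 < h" using assms(5) by (simp add: h_def)
    have GT: "Linf_norm (interior T) (weak_grad (interior T) k) \<le> G" if "T \<in> \<T>\<^sub>H" for T
      unfolding G_def broken_grad_norm_def using fin that by (intro cSUP_upper) auto
    have ST: "Linf_norm (interior T) (weak_hess (interior T) k) \<le> S" if "T \<in> \<T>\<^sub>H" for T
      unfolding S_def broken_hess_norm_def using fin that by (intro cSUP_upper) auto
    have "\<T>\<^sub>H \<noteq> {}" using \<Omega>(2) assms(2) by (auto simp: polyhedral_domain_def)
    then obtain T0 where T0: "T0 \<in> \<T>\<^sub>H" by blast
    have GS: "0 \<le> G" "0 \<le> S"
      using GT[OF T0] ST[OF T0] Linf_norm_nonneg order_trans by blast+
    let ?K = "cont_ext k"
    have W: "in_W2inf (interior T) k" if "T \<in> \<T>\<^sub>H" for T using k that by (simp add: admissible_coefficient_def)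
    have Kc: "continuous_on T (?K T)" and Kk: "AE x in lebesgue. x \<in> interior T \<longrightarrow> ?K T x = k x" if T: "T \<in> \<T>\<^sub>H" for T
      using cont_ext_properties(1,2)[OF T_props(1,2)[OF T] int_ne[OF T] W[OF T]] by blast+
    have Klip: "\<bar>?K T x - ?K T y\<bar> \<le> G * norm (x - y)" if T: "T \<in> \<T>\<^sub>H" and "x \<in> T" "y \<in> T" for T x y
      by (rule order_trans[OF cont_ext_properties(3)[OF T_props(1,2)[OF T] int_ne[OF T] W[OF T] that(2,3)]])
         (rule mult_right_mono[OF GT[OF T]], simp)
    have Ksec: "\<bar>?K T (m + a) + ?K T (m - a) - 2 * ?K T m\<bar> \<le> 2 * S * (norm a)\<^sup>2"
      if T: "T \<in> \<T>\<^sub>H" and "m \<in> T" "m + a \<in> T" "m - a \<in> T" for T m a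
      by (rule order_trans[OF cont_ext_properties(4)[OF T_props(1,2)[OF T] int_ne[OF T] W[OF T] that(2-4)]])
         (intro mult_right_mono mult_left_mono ST[OF T], simp_all)
    show "let h = H / 2 ^ n; M = mesh n; S = boundary_layer \<T>\<^sub>H M in
      \<forall>v\<in>fe_space \<Omega> M. \<forall>w\<in>fe_space \<Omega> M.
        \<bar>bilin_a \<Omega> k v w - bilin_ah \<Omega> \<T>\<^sub>H M k v w\<bar>
          \<le> (A1 + A2) *
            (h * broken_grad_norm \<T>\<^sub>H k
               * L2_norm_on \<Omega> (weak_grad \<Omega> v) * L2_norm_on \<Omega> (weak_grad \<Omega> w)) \<and>
        \<bar>bilin_a \<Omega> k v w - bilin_ah \<Omega> \<T>\<^sub>H M k v w\<bar>
          \<le> (A1 + A2) *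
            (h\<^sup>2 * broken_hess_norm \<T>\<^sub>H k
               * L2_norm_on \<Omega> (weak_grad \<Omega> v) * L2_norm_on \<Omega> (weak_grad \<Omega> w)
             + h * broken_grad_norm \<T>\<^sub>H k
               * L2_norm_on S (weak_grad \<Omega> v) * L2_norm_on S (weak_grad \<Omega> w))"
      unfolding Let_def h_def[symmetric] G_def[symmetric] S_def[symmetric]
    proof (intro ballI)
      fix v w assume v: "v \<in> fe_space \<Omega> (mesh n)" and w: "w \<in> fe_space \<Omega> (mesh n)"
      define J where "J = {cl \<in> cells n. \<exists>T\<in>\<T>\<^sub>H. frontier (cell (snd cl)) \<inter> frontier T \<noteq> {}}"
      define e where "e = bilin_a \<Omega> k v w - bilin_ah \<Omega> \<T>\<^sub>H (mesh n) k v w"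
      define P where "P = L2_norm_on \<Omega> (weak_grad \<Omega> v) * L2_norm_on \<Omega> (weak_grad \<Omega> w)"
      define PS where "PS = L2_norm_on (boundary_layer \<T>\<^sub>H (mesh n)) (weak_grad \<Omega> v) * L2_norm_on (boundary_layer \<T>\<^sub>H (mesh n)) (weak_grad \<Omega> w)"
      have J: "J \<subseteq> cells n" "finite J" using finite_cells finite_subset by (auto simp: J_def)
      have bl: "boundary_layer \<T>\<^sub>H (mesh n) = (\<Union>cl\<in>J. cell (snd cl))"
        unfolding J_def by (rule boundary_layer_cells)
      have eP: "(\<Sum>cl\<in>cells n. energy v w (snd cl)) \<le> P"
        unfolding P_def L2_norm_Omega[OF v] L2_norm_Omega[OF w] by (rule energy_cauchy_schwarz[OF finite_cells])
      have ePS: "(\<Sum>cl\<in>J. energy v w (snd cl)) \<le> PS"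
        unfolding PS_def bl L2_norm_cells[OF v J(1)] L2_norm_cells[OF w J(1)] by (rule energy_cauchy_schwarz[OF J(2)])
      have P0: "0 \<le> P" "0 \<le> PS"
        using eP ePS sum_nonneg[of "cells n" "\<lambda>cl. energy v w (snd cl)"] sum_nonneg[of J "\<lambda>cl. energy v w (snd cl)"] energy_nonneg
        by (meson order_trans)+
      have err: "e = (\<Sum>cl\<in>cells n. \<Sum>i\<in>set (snd cl). \<Sum>j\<in>set (snd cl). edge_error n ?K v w (fst cl) (snd cl) i j)"
        unfolding e_def by (rule error_edges[OF v w Kc Kk])
      have B1: "8 * (c ^ 3 * \<beta>\<^sup>2 * G / 2 ^ n) = A1 * (h * G)"
        using assms(5) by (simp add: A1_def h_def)
      have B2: "16 * (c ^ 4 * \<beta>\<^sup>2 * S / (2 ^ n)\<^sup>2) = A2 * (h\<^sup>2 * S)"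
        using assms(5) by (simp add: A2_def h_def power_divide)
      have "\<bar>e\<bar> \<le> 8 * (c ^ 3 * \<beta>\<^sup>2 * G / 2 ^ n) * (\<Sum>cl\<in>cells n. energy v w (snd cl))"
        unfolding err by (rule total_first_order[OF Kc Klip Ksec GS c0 c \<beta> v w])
      also have "\<dots> \<le> A1 * (h * G) * P"
        unfolding B1 using A0 h GS by (intro mult_left_mono eP mult_nonneg_nonneg) auto
      also have "\<dots> \<le> (A1 + A2) * (h * G) * P"
        using A0 h GS P0 by (intro mult_right_mono) auto
      finally have 1: "\<bar>e\<bar> \<le> (A1 + A2) * (h * G) * P" .
      have "\<bar>e\<bar> \<le> 16 * (c ^ 4 * \<beta>\<^sup>2 * S / (2 ^ n)\<^sup>2) * (\<Sum>cl\<in>cells n. energy v w (snd cl))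
          + 8 * (c ^ 3 * \<beta>\<^sup>2 * G / 2 ^ n) * (\<Sum>cl\<in>J. energy v w (snd cl))"
        unfolding err J_def by (rule total_second_order[OF Kc Klip Ksec GS c0 c \<beta> v w])
      also have "\<dots> \<le> A2 * (h\<^sup>2 * S) * P + A1 * (h * G) * PS"
        unfolding B1 B2 using A0 h GS by (intro add_mono mult_left_mono eP ePS mult_nonneg_nonneg) auto
      also have "\<dots> \<le> (A1 + A2) * (h\<^sup>2 * S) * P + (A1 + A2) * (h * G) * PS"
        using A0 h GS P0 by (intro add_mono mult_right_mono) auto
      finally have 2: "\<bar>e\<bar> \<le> (A1 + A2) * (h\<^sup>2 * S) * P + (A1 + A2) * (h * G) * PS" .
      show "\<bar>bilin_a \<Omega> k v w - bilin_ah \<Omega> \<T>\<^sub>H (mesh n) k v w\<bar>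
          \<le> (A1 + A2) * (h * G * L2_norm_on \<Omega> (weak_grad \<Omega> v) * L2_norm_on \<Omega> (weak_grad \<Omega> w)) \<and>
        \<bar>bilin_a \<Omega> k v w - bilin_ah \<Omega> \<T>\<^sub>H (mesh n) k v w\<bar>
          \<le> (A1 + A2) * (h\<^sup>2 * S * L2_norm_on \<Omega> (weak_grad \<Omega> v) * L2_norm_on \<Omega> (weak_grad \<Omega> w)
             + h * G * L2_norm_on (boundary_layer \<T>\<^sub>H (mesh n)) (weak_grad \<Omega> v) * L2_norm_on (boundary_layer \<T>\<^sub>H (mesh n)) (weak_grad \<Omega> w))"
        using 1 2 unfolding e_def P_def PS_def by (simp only: distrib_left mult.assoc)
    qed
  qed
qed

end
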